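(* Let $\varphi\in C^2(\mathbb{C}^n)$ be real valued with $\mathrm{Hess}_{\mathbb R}\varphi\simeq \mathrm{E}$, and let $f\in L^\infty(\mathbb{C}^n)$. Then $$\lim_{t\to0}\left\|T^{(t)}_fT^{(t)}_g-T^{(t)}_{fg}\right\|_{F^2_t(\varphi)\to F^2_t(\varphi)}=0\quad\text{for all } g\in L^\infty(\mathbb{C}^n)$$ if and only if $f\in\overline{\mathrm{VDA}_*}$ (that is, $\bar f\in \mathrm{VDA}_*$).
   Context: $v$ is Lebesgue measure on $\mathbb{C}^n=\mathbb{R}^{2n}$; $H(\Omega)$ is the set of holomorphic functions on $\Omega$; $B(z,r)=\{w\in\mathbb{C}^n:|w-z|<r\}$. $\mathrm{Hess}_{\mathbb R}\varphi\simeq\mathrm{E}$ means there are constants $m,M>0$ such that $m\mathrm{E}\le\left(\frac{\partial^2\varphi(x)}{\partial x_j\partial x_k}\right)_{j,k=1}^{2n}\le M\mathrm{E}$ for all $x\in\mathbb{R}^{2n}$, where $\mathrm E$ is the $2n\times 2n$ identity matrix and $A\le B$ means that $B-A$ is positive semi-definite. For $t>0$, $d\mu_t(z)=\frac1{t^n}\exp\{-2\varphi(z/\sqrt t)\}dv(z)$, $L^2_t(\varphi)=L^2(\mathbb{C}^n,d\mu_t)$, $F^2_t(\varphi)=L^2_t(\varphi)\cap H(\mathbb{C}^n)$, $P^{(t)}$ is the orthogonal projection of $L^2_t(\varphi)$ onto $F^2_t(\varphi)$, and for $f\in L^\infty$ the Toeplitz operator is $T^{(t)}_f g=P^{(t)}(fg)$,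 $g\in F^2_t(\varphi)$. The limit is taken over $t>0$. For $f\in L^2_{\mathrm{loc}}$, $G_{2,r}(f)(z)=\inf_{h\in H(B(z,r))}\left(\frac1{|B(z,r)|}\int_{B(z,r)}|f-h|^2dv\right)^{1/2}$. $\mathrm{BDA}_*$ is the set of $f\in L^2_{\mathrm{loc}}$ with $\sup_{z\in\mathbb{C}^n,\,r>0}G_{2,r}(f)(z)<\infty$, and $\mathrm{VDA}_*$ is the set of $f\in\mathrm{BDA}_*$ with $\lim_{r\to0}\sup_{z\in\mathbb{C}^n}G_{2,r}(f)(z)=0$. For a family $X$ of functions, $\overline X=\{\bar f:f\in X\}$. *)

theory Defs
  imports "HOL-Analysis.Analysis"
begin

text \<open>
  Meaningful for open \<open>S\<close>. Only the values on \<open>S\<close> matter. The Frechet derivative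
  is required to be complex linear; \<open>has_derivative\<close> alone gives real linearity.
\<close>

definition holo :: "(complex ^ 'n) set \<Rightarrow> (complex ^ 'n \<Rightarrow> complex) set" where
  "holo S = {h. \<forall>z\<in>S. \<exists>D. (h has_derivative D) (at z) \<and> (\<forall>c v. D (c *s v) = c * D v)}"

text \<open>
  The canonical basis of \<^typ>\<open>complex ^ 'n\<close> as a real Euclidean space consists of the
  \<open>2n\<close> vectors \<open>axis i 1\<close> and \<open>axis i \<i>\<close>, so \<open>Basis\<close> indexes the real coordinates and
  \<open>Basis \<times> Basis\<close> the entries of the Hessian.
\<close>

definition partial :: "'a \<Rightarrow> ('a::euclidean_space \<Rightarrow> real) \<Rightarrow> 'a \<Rightarrow> real" where
  "partial b f x = deriv (\<lambda>s. f (x + s *\<^sub>R b)) 0"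

definition has_partial :: "'a \<Rightarrow> ('a::euclidean_space \<Rightarrow> real) \<Rightarrow> bool" where
  "has_partial b f \<longleftrightarrow> (\<forall>x. (\<lambda>s::real. f (x + s *\<^sub>R b)) differentiable (at 0))"

definition C2 :: "('a::euclidean_space \<Rightarrow> real) \<Rightarrow> bool" where
  "C2 f \<longleftrightarrow> continuous_on UNIV f \<and>
     (\<forall>b\<in>Basis. has_partial b f \<and> continuous_on UNIV (partial b f) \<and>
       (\<forall>c\<in>Basis. has_partial c (partial b f) \<and> continuous_on UNIV (partial c (partial b f))))"

definition hess :: "('a::euclidean_space \<Rightarrow> real) \<Rightarrow> 'a \<Rightarrow> 'a \<Rightarrow> 'a \<Rightarrow> real" where
  "hess f x b c = partial b (partial c f) x"

definition id_matrix :: "'a::euclidean_space \<Rightarrow> 'a \<Rightarrow> real" where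
  "id_matrix b c = (if b = c then 1 else 0)"

definition psd :: "('a::euclidean_space \<Rightarrow> 'a \<Rightarrow> real) \<Rightarrow> bool" where
  "psd A \<longleftrightarrow> (\<forall>b\<in>Basis. \<forall>c\<in>Basis. A b c = A c b) \<and>
     (\<forall>v. 0 \<le> (\<Sum>b\<in>Basis. \<Sum>c\<in>Basis. A b c * v b * v c))"

definition matrix_le :: "('a::euclidean_space \<Rightarrow> 'a \<Rightarrow> real) \<Rightarrow> ('a \<Rightarrow> 'a \<Rightarrow> real) \<Rightarrow> bool" where
  "matrix_le A B \<longleftrightarrow> psd (\<lambda>b c. B b c - A b c)"

definition hess_equiv_id :: "('a::euclidean_space \<Rightarrow> real) \<Rightarrow> bool" where
  "hess_equiv_id f \<longleftrightarrow> (\<exists>m>0. \<exists>M>0. \<forall>x.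
     matrix_le (\<lambda>b c. m * id_matrix b c) (hess f x) \<and>
     matrix_le (hess f x) (\<lambda>b c. M * id_matrix b c))"

text \<open>
  Elements of \<open>L\<^sup>2\<close> and \<open>L\<^sup>\<infinity>\<close> are represented by functions; they are not quotiented by
  almost everywhere equality. Norms and mean values are extended nonnegative reals, so
  that non-integrable functions get the value \<open>\<infinity>\<close>.
\<close>

definition Linf :: "(complex ^ 'n \<Rightarrow> complex) set" where
  "Linf = {f \<in> borel_measurable lebesgue. \<exists>C::real. AE z in lebesgue. norm (f z) \<le> C}"

definition ennsqrt :: "ennreal \<Rightarrow> ennreal" where
  "ennsqrt x = (if x = \<infinity> then \<infinity> else ennreal (sqrt (enn2real x)))"

definition L2norm :: "'a measure \<Rightarrow> ('a \<Rightarrow> complex) \<Rightarrow> ennreal" where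
  "L2norm M u = ennsqrt (\<integral>\<^sup>+z. ennreal ((norm (u z))\<^sup>2) \<partial>M)"

definition L2 :: "'a measure \<Rightarrow> ('a \<Rightarrow> complex) set" where
  "L2 M = {u \<in> borel_measurable M. L2norm M u < \<infinity>}"

definition L2loc :: "(complex ^ 'n \<Rightarrow> complex) set" where
  "L2loc = {f \<in> borel_measurable lebesgue.
     \<forall>K. compact K \<longrightarrow> (\<integral>\<^sup>+z\<in>K. ennreal ((norm (f z))\<^sup>2) \<partial>lebesgue) < \<infinity>}"

definition mu :: "(complex ^ 'n \<Rightarrow> real) \<Rightarrow> real \<Rightarrow> (complex ^ 'n) measure" where
  "mu \<phi> t = density lebesgue
     (\<lambda>z. ennreal (1 / t ^ CARD('n) * exp (- 2 * \<phi> (z /\<^sub>R sqrt t))))"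

definition F2 :: "(complex ^ 'n \<Rightarrow> real) \<Rightarrow> real \<Rightarrow> (complex ^ 'n \<Rightarrow> complex) set" where
  "F2 \<phi> t = L2 (mu \<phi> t) \<inter> holo UNIV"

text \<open>
  The orthogonal projection of \<open>u \<in> L2 M\<close> onto a subspace \<open>F\<close>: the element \<open>h\<close> of \<open>F\<close> with
  \<open>u - h\<close> orthogonal to \<open>F\<close>. For \<open>F2\<close> it is unique as a function, since its members are
  continuous and \<open>mu\<close> has a positive density.
\<close>

definition orth_proj ::
    "'a measure \<Rightarrow> ('a \<Rightarrow> complex) set \<Rightarrow> ('a \<Rightarrow> complex) \<Rightarrow> ('a \<Rightarrow> complex)" where
  "orth_proj M F u = (THE h. h \<in> F \<and> (\<forall>k\<in>F. (\<integral>z. (u z - h z) * cnj (k z) \<partial>M) = 0))"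

definition toeplitz :: "(complex ^ 'n \<Rightarrow> real) \<Rightarrow> real \<Rightarrow> (complex ^ 'n \<Rightarrow> complex) \<Rightarrow>
    (complex ^ 'n \<Rightarrow> complex) \<Rightarrow> (complex ^ 'n \<Rightarrow> complex)" where
  "toeplitz \<phi> t f u = orth_proj (mu \<phi> t) (F2 \<phi> t) (\<lambda>z. f z * u z)"

definition F2_opnorm :: "(complex ^ 'n \<Rightarrow> real) \<Rightarrow> real \<Rightarrow>
    ((complex ^ 'n \<Rightarrow> complex) \<Rightarrow> (complex ^ 'n \<Rightarrow> complex)) \<Rightarrow> ennreal" where
  "F2_opnorm \<phi> t A = (SUP u \<in> {u \<in> F2 \<phi> t. L2norm (mu \<phi> t) u \<le> 1}. L2norm (mu \<phi> t) (A u))"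

definition G2 :: "real \<Rightarrow> (complex ^ 'n \<Rightarrow> complex) \<Rightarrow> complex ^ 'n \<Rightarrow> ennreal" where
  "G2 r f z = (INF h \<in> holo (ball z r).
     ennsqrt ((\<integral>\<^sup>+w\<in>ball z r. ennreal ((norm (f w - h w))\<^sup>2) \<partial>lebesgue)
              / emeasure lebesgue (ball z r)))"

definition BDA_star :: "(complex ^ 'n \<Rightarrow> complex) set" where
  "BDA_star = {f \<in> L2loc. (SUP z. SUP r\<in>{0<..}. G2 r f z) < \<infinity>}"

definition VDA_star :: "(complex ^ 'n \<Rightarrow> complex) set" where
  "VDA_star = {f \<in> BDA_star. ((\<lambda>r. SUP z. G2 r f z) \<longlongrightarrow> 0) (at_right 0)}"

definition conj_family :: "('a \<Rightarrow> complex) set \<Rightarrow> ('a \<Rightarrow> complex) set" where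
  "conj_family X = (\<lambda>f z. cnj (f z)) ` X"

end

theory Submission
  imports Defs "HOL-Complex_Analysis.Cauchy_Integral_Formula"
begin

text \<open>
  The reason for the equivalence is the identity
  \<open>T\<^sub>f T\<^sub>g - T\<^sub>f\<^sub>g = - P f (I - P) g\<close>, which makes the semicommutator equal to minus the
  product of the adjoint of the Hankel operator \<open>(I - P) (cnj f)\<close> with the Hankel operator
  \<open>(I - P) g\<close>. Its norm is at most \<open>\<parallel>g\<parallel>\<close> times the norm of the first one, and for
  \<open>g = cnj f\<close> the two factors coincide, so the semicommutators vanish in the limit for all bounded
  \<open>g\<close> iff the Hankel operators with symbol \<open>cnj f\<close> do (\<open>semicommutator_bound\<close>, \<open>hankel_bound\<close>).
  It remains to compare the norm of the Hankel operator at scale \<open>t\<close> with the distance of the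
  symbol to holomorphic functions on balls of radius comparable to \<open>sqrt t\<close>. The dilation
  \<open>z \<mapsto> sqrt t z\<close> turns the weight into the fixed weight \<open>\<phi>\<close> and these radii into fixed ones, and
  the estimates of functions are made at that scale, with constants that depend only on \<open>\<phi>\<close>.

  The Hessian enters only through uniform convexity: with \<open>p\<close> the complex form of the gradient,
  \<open>\<phi> y\<close> lies between \<open>\<phi> x + Re \<langle>p x, y - x\<rangle> + m \<bar>y - x\<bar>\<^sup>2\<close> and the same expression with \<open>M\<close>
  (\<open>hessian_convex_weight\<close>).

  A small Hankel operator forces small oscillation (\<open>G2_from_hankel\<close>) because the entire functions
  \<open>\<kappa> x = exp (\<phi> b + \<langle>p b, x - b\<rangle>)\<close> satisfy \<open>\<bar>\<kappa> x\<bar>\<^sup>2 exp (- 2 \<phi> x) \<le> exp (- 2 m \<bar>x - b\<bar>\<^sup>2)\<close>, hence have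
  norms bounded independently of \<open>b\<close>, while this weighted size is bounded below on the unit ball
  around \<open>b\<close>. Since \<open>\<kappa>\<close> has no zeros, \<open>P (f \<kappa>) / \<kappa>\<close> is a holomorphic competitor for \<open>f\<close> on that ball.

  Conversely let \<open>F\<close> be a bounded symbol that is close to holomorphic functions in mean square on all
  balls of radius \<open>3\<close> (\<open>hankel_small\<close>, \<open>hankel_approximation\<close>). Convolution with a radial bump \<open>rho\<close>
  reproduces holomorphic functions (\<open>holo_rho_mean\<close>); applied to \<open>F\<close> it gives a smooth \<open>F1\<close> for which
  both \<open>F - F1\<close>, in local mean square, and \<open>dbar F1\<close>, uniformly, are small. Multiplication by
  \<open>F - F1\<close> on entire functions is then small by a sub-mean-value property
  (\<open>local_L2_mult_bound\<close>). For \<open>F1 G\<close> with \<open>G\<close> entire, an entire function close to it is found by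
  solving the d-bar equation with \<open>L\<^sup>2\<close> bounds (\<open>dbar_solution\<close>).

  The d-bar estimate is proved by an explicit integral formula (\<open>weighted_L2_solution\<close>) in the
  style of Berndtsson and Andersson. For a map \<open>q\<close> close to the gradient the kernels
  \<open>exp (- \<langle>q x, x - z\<rangle> - s \<bar>x - z\<bar>\<^sup>2) det (dbar q x + s I)\<close> are holomorphic in \<open>z\<close> at \<open>s = 0\<close>
  and form an approximate identity as \<open>s \<rightarrow> \<infinity>\<close>. Their \<open>s\<close>-derivative is a d-bar divergence
  (\<open>divergence_flux\<close>), so \<open>u\<close> minus a holomorphic function is an integral operator applied to
  \<open>dbar u\<close>. Uniform convexity gives \<open>Re \<langle>q x, x - z\<rangle> \<ge> \<phi> x - \<phi> z + c \<bar>x - z\<bar>\<^sup>2 - C\<close> (\<open>growth\<close>),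
  which makes this operator, conjugated with the weight, dominated by a convolution with an
  integrable kernel, hence bounded on \<open>L\<^sup>2\<close>.
\<close>

section \<open>Cofactors and the Piola identity\<close>

text \<open>
  Row \<open>k\<close> is replaced by a unit vector instead of deleting a row and a column, so
  that all matrices keep the same index type and the sign is built in.
\<close>

definition cof :: "'a::comm_ring_1^'n^'n \<Rightarrow> 'n \<Rightarrow> 'n \<Rightarrow> 'a" where
  "cof A k j = det (\<chi> i. if i = k then axis j 1 else A $ i)"

text \<open>
  Laplace expansion along row \<open>k\<close>, in the form of linearity of the determinant in
  that row.
\<close>

lemma det_row_expand:
  fixes A :: "'a::comm_ring_1^'n^'n"
  shows "det (\<chi> i. if i = k then v else A $ i) = (\<Sum>j\<in>UNIV. v $ j * cof A k j)"
proof -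
  have "v = (\<Sum>j\<in>UNIV. v $ j *s axis j 1)"
    by (simp add: basis_expansion)
  then have "det (\<chi> i. if i = k then v else A $ i)
      = det (\<chi> i. if i = k then (\<Sum>j\<in>UNIV. v $ j *s axis j 1) else A $ i)"
    by (rule arg_cong)
  also have "\<dots> = (\<Sum>j\<in>UNIV. det (\<chi> i. if i = k then v $ j *s axis j 1 else A $ i))"
    by (rule det_linear_row_sum) simp
  also have "\<dots> = (\<Sum>j\<in>UNIV. v $ j * cof A k j)"
    by (simp add: det_row_mul cof_def)
  finally show ?thesis .
qed

lemma sum_row_cof:
  fixes A :: "'a::field^'n^'n"
  shows "(\<Sum>j\<in>UNIV. A $ l $ j * cof A k j) = (if l = k then det A else 0)"
proof -
  have "(\<Sum>j\<in>UNIV. A $ l $ j * cof A k j) = det (\<chi> i. if i = k then A $ l else A $ i)"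
    by (simp add: det_row_expand)
  also have "\<dots> = (if l = k then det A else 0)"
  proof (cases "l = k")
    case True
    have "(\<chi> i. if i = k then A $ k else A $ i) = A" by (simp add: vec_eq_iff)
    then show ?thesis using True by (simp only: simp_thms if_True)
  next
    case False
    show ?thesis using False
      by (auto intro!: det_identical_rows[of l k] simp: row_def vec_eq_iff)
  qed
  finally show ?thesis .
qed

text \<open>
  Jacobi's formula: the determinant is linear in each row, so its derivative is the sum over the
  rows of the determinants with that row differentiated.
\<close>

lemma has_derivative_det:
  fixes X :: "'b::real_normed_vector \<Rightarrow> complex^'n^'n"
  assumes "\<And>i j. ((\<lambda>x. X x $ i $ j) has_derivative X' i j) (at x)"
  shows "((\<lambda>x. det (X x)) has_derivative (\<lambda>v. \<Sum>k\<in>UNIV. \<Sum>j\<in>UNIV. X' k j v * cof (X x) k j)) (at x)"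
proof -
  have 1: "((\<lambda>x. det (X x)) has_derivative (\<lambda>v. \<Sum>p | p permutes (UNIV::'n set).
      of_int (sign p) * (\<Sum>k\<in>UNIV. X' k (p k) v * (\<Prod>i\<in>UNIV - {k}. X x $ i $ p i)))) (at x)"
    unfolding det_def
    by (intro has_derivative_sum has_derivative_mult_right has_derivative_prod assms)
  have 2: "(\<Sum>p | p permutes (UNIV::'n set).
      of_int (sign p) * (\<Sum>k\<in>UNIV. X' k (p k) v * (\<Prod>i\<in>UNIV - {k}. X x $ i $ p i)))
      = (\<Sum>k\<in>UNIV. \<Sum>j\<in>UNIV. X' k j v * cof (X x) k j)" for v
  proof -
    have "(\<Sum>j\<in>UNIV. X' k j v * cof (X x) k j) = (\<Sum>p | p permutes (UNIV::'n set).
      of_int (sign p) * (X' k (p k) v * (\<Prod>i\<in>UNIV - {k}. X x $ i $ p i)))" for k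
    proof -
      have "(\<Sum>j\<in>UNIV. X' k j v * cof (X x) k j)
         = det (\<chi> i. if i = k then (\<chi> j. X' k j v) else X x $ i)"
        by (simp add: det_row_expand)
      also have "\<dots> = (\<Sum>p | p permutes (UNIV::'n set).
        of_int (sign p) * (X' k (p k) v * (\<Prod>i\<in>UNIV - {k}. X x $ i $ p i)))"
        unfolding det_def
        by (intro sum.cong refl arg_cong2[where f="(*)"], subst prod.remove[of UNIV k]) auto
      finally show ?thesis .
    qed
    then show ?thesis by (simp add: sum_distrib_left) (rule sum.swap)
  qed
  show ?thesis using 1 by (simp add: 2)
qed

text \<open>
  The second cofactors, which are the partial derivatives of the entries of the cofactor matrix.
\<close>

definition cof2 :: "'a::comm_ring_1^'n^'n \<Rightarrow> 'n \<Rightarrow> 'n \<Rightarrow> 'n \<Rightarrow> 'n \<Rightarrow> 'a" where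
  "cof2 A k j l m = det (\<chi> i. if i = l then axis m 1 else if i = k then axis j 1 else A $ i)"

text \<open>
  Exchanging \<open>j\<close> and \<open>m\<close> exchanges two rows of the determinant. The
  proof polarises the vanishing of a determinant with two equal rows.
\<close>

lemma cof2_antisym:
  fixes A :: "complex^'n^'n"
  assumes "l \<noteq> k"
  shows "cof2 A k j l m = - cof2 A k m l j"
proof -
  let ?D = "\<lambda>u v. det (\<chi> i. if i = l then u else if i = k then v else A $ i)"
  have z: "?D u u = 0" for u
    using assms by (auto intro!: det_identical_rows[of l k] simp: row_def vec_eq_iff)
  have a: "?D (u + u') v = ?D u v + ?D u' v" for u u' v
    using det_row_add[of l "\<lambda>_. u" "\<lambda>_. u'" "\<lambda>i. if i = k then v else A $ i"] by simp
  have b: "?D u (v + v') = ?D u v + ?D u v'" for u v v'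
  proof -
    have eq: "(\<chi> i. if i = l then u else if i = k then w else A $ i) =
       (\<chi> i. if i = k then w else if i = l then u else A $ i)" for w
      using assms by (auto simp: vec_eq_iff)
    show ?thesis unfolding eq
      using det_row_add[of k "\<lambda>_. v" "\<lambda>_. v'" "\<lambda>i. if i = l then u else A $ i"] by simp
  qed
  have "?D (axis m 1 + axis j 1) (axis m 1 + axis j 1) = 0" by (rule z)
  then have "?D (axis m 1) (axis j 1) + ?D (axis j 1) (axis m 1) = 0"
    by (simp only: a b z) simp
  then show ?thesis by (simp add: cof2_def eq_neg_iff_add_eq_0)
qed

lemma has_derivative_cof:
  fixes X :: "'b::real_normed_vector \<Rightarrow> complex^'n^'n"
  assumes "\<And>i j. ((\<lambda>x. X x $ i $ j) has_derivative X' i j) (at x)"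
  shows "((\<lambda>x. cof (X x) k j) has_derivative
    (\<lambda>v. \<Sum>l\<in>UNIV - {k}. \<Sum>m\<in>UNIV. X' l m v * cof2 (X x) k j l m)) (at x)"
proof -
  let ?Y = "\<lambda>x. (\<chi> i. if i = k then axis j 1 else X x $ i)"
  have d: "((\<lambda>x. ?Y x $ a $ b) has_derivative (if a = k then (\<lambda>v. 0) else X' a b)) (at x)" for a b
    using assms[of a b] by (cases "a = k") auto
  have c: "cof (?Y x) l m = cof2 (X x) k j l m" for l m
    by (simp add: cof_def cof2_def if_distrib cong: if_cong)
  have "(\<Sum>l\<in>UNIV. \<Sum>m\<in>UNIV. (if l = k then (\<lambda>v. 0) else X' l m) v * cof (?Y x) l m)
     = (\<Sum>l\<in>UNIV - {k}. \<Sum>m\<in>UNIV. X' l m v * cof2 (X x) k j l m)" for v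
    unfolding c
    by (subst sum.remove[of UNIV k]) (auto intro!: sum.cong)
  then show ?thesis
    using has_derivative_det[of ?Y "\<lambda>a b. if a = k then (\<lambda>v. 0) else X' a b" x, OF d]
    by (simp add: cof_def)
qed

text \<open>
  The algebraic core of the Piola identity (cofactor matrices of Jacobians are divergence free):
  symmetric second derivatives are contracted with antisymmetric second cofactors.
\<close>

lemma piola_sum_zero:
  fixes A :: "complex^'n^'n"
  assumes sym: "\<And>l m j. H l m j = H l j m"
  shows "(\<Sum>j\<in>UNIV. \<Sum>l\<in>UNIV - {k}. \<Sum>m\<in>UNIV. H l m j * cof2 A k j l m) = 0"
proof -
  have "(\<Sum>j\<in>UNIV. \<Sum>m\<in>UNIV. H l m j * cof2 A k j l m) = 0" if "l \<noteq> k" for l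
  proof -
    let ?S = "\<Sum>j\<in>UNIV. \<Sum>m\<in>UNIV. H l m j * cof2 A k j l m"
    have "?S = (\<Sum>m\<in>UNIV. \<Sum>j\<in>UNIV. H l m j * cof2 A k j l m)" by (rule sum.swap)
    also have "\<dots> = (\<Sum>m\<in>UNIV. \<Sum>j\<in>UNIV. - (H l j m * cof2 A k m l j))"
      by (intro sum.cong refl) (metis cof2_antisym[OF that] sym mult_minus_right)
    also have "\<dots> = - ?S" by (simp add: sum_negf)
    finally show ?thesis by simp
  qed
  then have "(\<Sum>l\<in>UNIV - {k}. \<Sum>j\<in>UNIV. \<Sum>m\<in>UNIV. H l m j * cof2 A k j l m) = 0" by simp
  then show ?thesis by (subst sum.swap)
qed

text \<open>
  The crude bound from the permutation expansion, with \<open>fact CARD('n)\<close> terms.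
\<close>

lemma norm_det_le:
  fixes A :: "complex^'n^'n"
  assumes "\<And>i j. norm (A $ i $ j) \<le> b i" "\<And>i. 0 \<le> b i"
  shows "norm (det A) \<le> fact CARD('n) * (\<Prod>i\<in>UNIV. b i)"
proof -
  have "norm (det A) \<le> (\<Sum>p | p permutes (UNIV::'n set). norm (of_int (sign p) * (\<Prod>i\<in>UNIV. A $ i $ p i)))"
    unfolding det_def by (rule norm_sum)
  also have "\<dots> \<le> (\<Sum>p | p permutes (UNIV::'n set). (\<Prod>i\<in>UNIV. b i))"
  proof (rule sum_mono)
    fix p :: "'n \<Rightarrow> 'n"
    have "norm (of_int (sign p) :: complex) = 1" by (simp add: sign_def)
    then show "norm (of_int (sign p) * (\<Prod>i\<in>UNIV. A $ i $ p i)) \<le> (\<Prod>i\<in>UNIV. b i)"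
      by (auto simp: norm_mult prod_norm[symmetric] intro!: prod_mono assms)
  qed
  also have "\<dots> = fact CARD('n) * (\<Prod>i\<in>UNIV. b i)"
    by (simp add: card_permutations)
  finally show ?thesis .
qed

lemma norm_cof_le:
  fixes A :: "complex^'n^'n"
  assumes "\<And>i j. norm (A $ i $ j) \<le> b" "0 \<le> b"
  shows "norm (cof A k j) \<le> fact CARD('n) * b ^ (CARD('n) - 1)"
proof -
  have "norm (cof A k j) \<le> fact CARD('n) * (\<Prod>i\<in>UNIV. if i = k then 1 else b)"
    unfolding cof_def
    by (rule norm_det_le) (use assms in \<open>auto simp: axis_def\<close>)
  also have "(\<Prod>i\<in>UNIV. if i = k then 1 else b) = b ^ (CARD('n) - 1)"
    by (subst prod.remove[of _ k]) (auto simp: card_Diff_singleton)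
  finally show ?thesis .
qed

section \<open>Lebesgue integrals: translation, Gaussians, convolution\<close>

lemma has_derivative_imp_continuous_on:
  "(\<And>x. x \<in> S \<Longrightarrow> (f has_derivative f' x) (at x)) \<Longrightarrow> continuous_on S f"
  by (intro continuous_at_imp_continuous_on ballI has_derivative_continuous)

lemma continuous_on_bounded_cball:
  fixes f :: "'a::euclidean_space \<Rightarrow> 'b::real_normed_vector"
  assumes "continuous_on UNIV f"
  obtains D where "0 \<le> D" "\<And>x. norm x \<le> R \<Longrightarrow> norm (f x) \<le> D"
proof -
  have "compact (f ` cball 0 R)"
    by (intro compact_continuous_image continuous_on_subset[OF assms]) auto
  then obtain D where "\<And>x. norm x \<le> R \<Longrightarrow> norm (f x) \<le> D"
    by (meson bounded_iff compact_imp_bounded imageI mem_cball_0)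
  then show ?thesis using that[of "max 0 D"] by (meson max.coboundedI2 max.cobounded1)
qed

lemma nn_integral_lborel_affine:
  fixes f :: "'a::euclidean_space \<Rightarrow> ennreal"
  assumes [measurable]: "f \<in> borel_measurable borel" and "c \<noteq> 0"
  shows "(\<integral>\<^sup>+x. f x \<partial>lborel) = ennreal (\<bar>c\<bar> ^ DIM('a)) * (\<integral>\<^sup>+x. f (t + c *\<^sub>R x) \<partial>lborel)"
  by (subst lborel_affine[OF assms(2), of t])
     (simp add: nn_integral_density nn_integral_distr nn_integral_cmult)

lemma lborel_integral_affine:
  fixes f :: "'a::euclidean_space \<Rightarrow> 'b::{banach, second_countable_topology}"
  assumes [measurable]: "f \<in> borel_measurable borel" and "c \<noteq> 0"
  shows "(\<integral>x. f x \<partial>lborel) = (\<bar>c\<bar> ^ DIM('a)) *\<^sub>R (\<integral>x. f (t + c *\<^sub>R x) \<partial>lborel)"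
  by (subst lborel_affine[OF assms(2), of t])
     (simp add: integral_density integral_distr)

text \<open>
  The difference quotients of a compactly supported function integrate to zero by translation
  invariance and converge boundedly to the derivative. This is the only form of Stokes' theorem
  that is used.
\<close>

lemma integral_directional_derivative_zero:
  fixes F :: "'a::euclidean_space \<Rightarrow> 'b::{banach, second_countable_topology}"
  assumes der: "\<And>x. (F has_derivative F' x) (at x)"
    and cont: "continuous_on UNIV (\<lambda>x. F' x b)"
    and supp: "\<And>x. norm x > R \<Longrightarrow> F x = 0"
  shows "(\<integral>x. F' x b \<partial>lborel) = 0"
proof -
  define S where "S = cball (0::'a) (R + norm b)"
  have contF: "continuous_on UNIV F"
    using der has_derivative_continuous continuous_at_imp_continuous_on by blast
  then have [measurable]: "F \<in> borel_measurable borel" by (rule borel_measurable_continuous_onI)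
  have [measurable]: "(\<lambda>x. F' x b) \<in> borel_measurable borel" by (rule borel_measurable_continuous_onI[OF cont])
  obtain L where "\<And>x. norm x \<le> R + 2 * norm b \<Longrightarrow> norm (F' x b) \<le> L"
    using continuous_on_bounded_cball[OF cont] by blast
  then have L: "\<And>x. x \<in> cball 0 (R + 2 * norm b) \<Longrightarrow> norm (F' x b) \<le> L" by simp
  define h where "h k = inverse (real (Suc k))" for k
  have h: "0 < h k" "h k \<le> 1" for k by (auto simp: h_def field_simps)
  have h0: "h \<longlonglongrightarrow> 0" unfolding h_def by (rule LIMSEQ_inverse_real_of_nat)
  have line: "((\<lambda>s. F (x + s *\<^sub>R b)) has_derivative (\<lambda>s. s *\<^sub>R F' (x + r *\<^sub>R b) b)) (at r within A)" for x r A
  proof -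
    have "((\<lambda>s. F (x + s *\<^sub>R b)) has_derivative (\<lambda>s. F' (x + r *\<^sub>R b) (s *\<^sub>R b))) (at r within A)"
      by (rule has_derivative_compose[OF _ der]) (auto intro!: derivative_eq_intros)
    moreover have "linear (F' (x + r *\<^sub>R b))" using der has_derivative_linear by blast
    ultimately show ?thesis by (simp add: linear_scale)
  qed
  let ?q = "\<lambda>k x. (1 / h k) *\<^sub>R (F (x + h k *\<^sub>R b) - F x)"
  have F_int: "integrable lborel F"
  proof -
    have "F = (\<lambda>x. indicator (cball 0 R) x *\<^sub>R F x)"
      using supp by (auto simp: fun_eq_iff indicator_def not_le)
    then show ?thesis
      using borel_integrable_compact[of "cball 0 R" F] contF continuous_on_subset by (metis compact_cball subset_UNIV)
  qed
  have bound: "norm (?q k x) \<le> indicator S x * L" for k x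
  proof (cases "x \<in> S")
    case True
    have "norm (F (x + h k *\<^sub>R b) - F (x + 0 *\<^sub>R b)) \<le> L * norm (h k - 0)"
    proof (rule differentiable_bound[where f' = "\<lambda>r s. s *\<^sub>R F' (x + r *\<^sub>R b) b" and S = "{0..h k}"])
      fix r assume r: "r \<in> {0..h k}"
      show "((\<lambda>s. F (x + s *\<^sub>R b)) has_derivative (\<lambda>s. s *\<^sub>R F' (x + r *\<^sub>R b) b)) (at r within {0..h k})"
        by (rule line)
      have "norm (x + r *\<^sub>R b) \<le> norm x + r * norm b" using r
        by (metis norm_triangle_ineq norm_scaleR abs_of_nonneg atLeastAtMost_iff)
      also have "\<dots> \<le> (R + norm b) + 1 * norm b"
        using True r h[of k] by (intro add_mono mult_right_mono) (auto simp: S_def)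
      finally have "norm (F' (x + r *\<^sub>R b) b) \<le> L" by (intro L) simp
      then show "onorm (\<lambda>s. s *\<^sub>R F' (x + r *\<^sub>R b) b) \<le> L"
        by (auto simp: onorm_scaleR_left_lemma intro!: onorm_le)
          (metis mult.commute mult_left_mono abs_ge_zero)
    qed (use h[of k] in auto)
    moreover have "norm (?q k x) = norm (F (x + h k *\<^sub>R b) - F x) / h k"
      using h[of k] by (simp only: norm_scaleR) simp
    ultimately show ?thesis using True h[of k] by (simp add: pos_divide_le_eq)
  next
    case False
    then have "norm x > R + norm b" by (simp add: S_def)
    moreover have "norm x \<le> norm (x + h k *\<^sub>R b) + h k * norm b"
      using norm_triangle_ineq4[of "x + h k *\<^sub>R b" "h k *\<^sub>R b"] h[of k] by simp
    moreover have "h k * norm b \<le> norm b" using h[of k] by (simp add: mult_left_le_one_le)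
    ultimately have "norm (x + h k *\<^sub>R b) > R" "norm x > R" using norm_ge_zero[of b] by linarith+
    then show ?thesis using supp False by simp
  qed
  have lim: "(\<lambda>k. ?q k x) \<longlonglongrightarrow> F' x b" for x
  proof -
    have "((\<lambda>s. F (x + s *\<^sub>R b)) has_vector_derivative F' x b) (at 0)"
      using line[of x 0 UNIV] by (simp add: has_vector_derivative_def)
    then have "((\<lambda>y. norm (F (x + y *\<^sub>R b) - F x - y *\<^sub>R F' x b) / \<bar>y\<bar>) \<longlongrightarrow> 0) (at 0)"
      by (simp add: has_vector_derivative_def has_derivative_iff_norm)
    moreover have "norm (F (x + y *\<^sub>R b) - F x - y *\<^sub>R F' x b) / \<bar>y\<bar> = norm ((F (x + y *\<^sub>R b) - F x) /\<^sub>R y - F' x b)"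
      if "y \<noteq> 0" for y
    proof -
      have "(F (x + y *\<^sub>R b) - F x) /\<^sub>R y - F' x b = (F (x + y *\<^sub>R b) - F x - y *\<^sub>R F' x b) /\<^sub>R y"
        using that by (simp add: scaleR_diff_right)
      then show ?thesis by (simp only: norm_scaleR) (simp add: divide_inverse mult.commute)
    qed
    ultimately have "((\<lambda>y. norm ((F (x + y *\<^sub>R b) - F x) /\<^sub>R y - F' x b)) \<longlongrightarrow> 0) (at 0)"
      by (smt (verit, best) LIM_equal)
    then have "((\<lambda>y. (F (x + y *\<^sub>R b) - F x) /\<^sub>R y) \<longlongrightarrow> F' x b) (at 0)"
      by (simp only: tendsto_norm_zero_iff Lim_null[symmetric])
    then have "((\<lambda>k. (F (x + h k *\<^sub>R b) - F x) /\<^sub>R (h k)) \<longlonglongrightarrow> F' x b)"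
      by (rule filterlim_compose) (use h0 less_imp_neq[OF h(1)] in \<open>auto simp: filterlim_at intro!: always_eventually\<close>)
    then show ?thesis by (simp add: divide_inverse)
  qed
  have "(\<lambda>k. \<integral>x. ?q k x \<partial>lborel) \<longlonglongrightarrow> (\<integral>x. F' x b \<partial>lborel)"
  proof (rule integral_dominated_convergence[where w = "\<lambda>x. indicator S x * L"])
    show "integrable lborel (\<lambda>x. indicator S x * L)"
      unfolding S_def by (intro integrable_mult_left integrable_real_indicator emeasure_compact_finite) auto
  qed (use lim bound in auto)
  moreover have "(\<integral>x. ?q k x \<partial>lborel) = 0" for k
  proof -
    have i: "integrable lborel (\<lambda>x. F (x + h k *\<^sub>R b))"
      using F_int integrable_distr[of "(+) (h k *\<^sub>R b)" lborel borel F]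
      by (simp add: lborel_distr_plus add.commute)
    have "(\<integral>x. F (x + h k *\<^sub>R b) \<partial>lborel) = (\<integral>x. F x \<partial>lborel)"
      using lborel_integral_affine[of F 1 "h k *\<^sub>R b"] by (simp add: add.commute)
    then show ?thesis using i F_int by simp
  qed
  ultimately show ?thesis by (simp only: LIMSEQ_const_iff)
qed

text \<open>
  Comparison with the derivative of arctan.
\<close>

lemma nn_integral_gauss_real_finite:
  fixes c :: real assumes "0 < c"
  shows "(\<integral>\<^sup>+x. ennreal (exp (- c * x\<^sup>2)) \<partial>lborel) < \<infinity>"
proof -
  have h: "(\<integral>\<^sup>+x. ennreal (1 / (1 + x\<^sup>2)) * indicator {0..} x \<partial>lborel) = ennreal (pi / 2 - arctan 0)"
    by (rule nn_integral_FTC_atLeast[where F = arctan])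
       (auto intro!: tendsto_arctan_at_top derivative_eq_intros simp: field_simps add_nonneg_eq_0_iff)
  have h2: "(\<integral>\<^sup>+x. ennreal (1 / (1 + x\<^sup>2)) * indicator {..0} x \<partial>lborel) =
     (\<integral>\<^sup>+x. ennreal (1 / (1 + x\<^sup>2)) * indicator {0..} x \<partial>(lborel::real measure))"
    by (subst nn_integral_real_affine[where c = "-1" and t = 0]) (auto simp: indicator_def intro!: nn_integral_cong)
  have "(\<integral>\<^sup>+x. ennreal (exp (- c * x\<^sup>2)) \<partial>lborel) \<le>
    (\<integral>\<^sup>+x. ennreal (1 + 1 / c) * (ennreal (1 / (1 + x\<^sup>2)) * indicator {0..} x + ennreal (1 / (1 + x\<^sup>2)) * indicator {..0} x) \<partial>lborel)"
  proof (rule nn_integral_mono)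
    fix x :: real
    have "(1 + x\<^sup>2) \<le> (1 + 1/c) * (1 + c * x\<^sup>2)" using assms by (simp add: field_simps)
    also have "\<dots> \<le> (1 + 1/c) * exp (c * x\<^sup>2)"
      using assms by (intro mult_left_mono exp_ge_add_one_self) (auto simp: add_nonneg_nonneg)
    finally have "exp (- (c * x\<^sup>2)) \<le> (1 + 1/c) * (1 / (1 + x\<^sup>2))"
      by (simp add: exp_minus field_simps add_pos_nonneg)
    then have "ennreal (exp (- c * x\<^sup>2)) \<le> ennreal ((1 + 1 / c) * (1 / (1 + x\<^sup>2)))"
      by (intro ennreal_leI) simp
    also have "\<dots> = ennreal (1 + 1 / c) * ennreal (1 / (1 + x\<^sup>2))"
      using assms by (intro ennreal_mult) auto
    also have "\<dots> \<le> ennreal (1 + 1 / c) * (ennreal (1 / (1 + x\<^sup>2)) * indicator {0..} x + ennreal (1 / (1 + x\<^sup>2)) * indicator {..0} x)"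
      by (intro mult_left_mono) (auto simp: indicator_def)
    finally show "ennreal (exp (- c * x\<^sup>2)) \<le> ennreal (1 + 1 / c) *
      (ennreal (1 / (1 + x\<^sup>2)) * indicator {0..} x + ennreal (1 / (1 + x\<^sup>2)) * indicator {..0} x)" .
  qed
  also have "\<dots> < \<infinity>"
    by (simp add: nn_integral_cmult nn_integral_add h h2 ennreal_mult_less_top)
  finally show ?thesis .
qed

lemma nn_integral_gauss_finite:
  assumes "0 < c"
  shows "(\<integral>\<^sup>+x. ennreal (exp (- c * (norm x)\<^sup>2)) \<partial>(lborel :: 'a::euclidean_space measure)) < \<infinity>"
proof -
  have "(\<integral>\<^sup>+x. ennreal (exp (- c * (norm x)\<^sup>2)) \<partial>(lborel :: 'a measure))
      = (\<integral>\<^sup>+x. (\<Prod>b\<in>Basis. ennreal (exp (- c * (x \<bullet> b)\<^sup>2))) \<partial>(lborel :: 'a measure))"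
  proof (rule nn_integral_cong)
    fix x :: 'a
    have "(norm x)\<^sup>2 = (\<Sum>b\<in>Basis. (x \<bullet> b)\<^sup>2)"
      unfolding power2_norm_eq_inner by (subst euclidean_inner) (simp add: power2_eq_square)
    then show "ennreal (exp (- c * (norm x)\<^sup>2)) = (\<Prod>b\<in>Basis. ennreal (exp (- c * (x \<bullet> b)\<^sup>2)))"
      by (simp add: prod_ennreal exp_sum[symmetric] sum_distrib_left sum_negf)
  qed
  also have "\<dots> = (\<Prod>b\<in>(Basis::'a set). (\<integral>\<^sup>+x. ennreal (exp (- c * x\<^sup>2)) \<partial>lborel))"
    by (rule nn_integral_lborel_prod) auto
  also have "\<dots> < \<infinity>" using nn_integral_gauss_real_finite[OF assms]
    by (simp add: less_top[symmetric] power_eq_top_ennreal)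
  finally show ?thesis .
qed

lemma nn_integral_norm_gauss_finite:
  shows "(\<integral>\<^sup>+x. ennreal (norm x * exp (- (norm x)\<^sup>2)) \<partial>(lborel :: 'a::euclidean_space measure)) < \<infinity>"
proof -
  have "norm x * exp (- (norm x)\<^sup>2) \<le> exp (- (1/2) * (norm x)\<^sup>2)" for x :: 'a
  proof -
    \<comment> \<open>Half of the Gaussian absorbs the factor \<open>norm x\<close>.\<close>
    have "norm x \<le> 1 + (norm x)\<^sup>2 / 2"
      using zero_le_power2[of "norm x - 1"] by (simp add: power2_diff)
    also have "\<dots> \<le> exp ((norm x)\<^sup>2 / 2)" by (rule exp_ge_add_one_self)
    finally have "norm x * exp (- (norm x)\<^sup>2) \<le> exp ((norm x)\<^sup>2 / 2) * exp (- (norm x)\<^sup>2)"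
      by (intro mult_right_mono) auto
    then show ?thesis by (simp add: exp_add[symmetric] field_simps)
  qed
  then have "(\<integral>\<^sup>+x. ennreal (norm x * exp (- (norm x)\<^sup>2)) \<partial>(lborel :: 'a measure))
     \<le> (\<integral>\<^sup>+x. ennreal (exp (- (1/2) * (norm x)\<^sup>2)) \<partial>(lborel :: 'a measure))"
    by (intro nn_integral_mono ennreal_leI) auto
  also have "\<dots> < \<infinity>" by (rule nn_integral_gauss_finite) simp
  finally show ?thesis .
qed

text \<open>
  Substituting \<open>x / sqrt a\<close>: the power of \<open>a\<close> gained here pays for the
  powers of the homotopy parameter in the kernel.
\<close>

lemma nn_integral_norm_gauss_scale:
  assumes "0 < a"
  shows "(\<integral>\<^sup>+x. ennreal (norm x * exp (- a * (norm x)\<^sup>2)) \<partial>(lborel :: 'a::euclidean_space measure))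
    = ennreal ((1 / sqrt a) ^ (DIM('a) + 1)) *
      (\<integral>\<^sup>+x. ennreal (norm x * exp (- (norm x)\<^sup>2)) \<partial>(lborel :: 'a::euclidean_space measure))"
proof -
  let ?c = "1 / sqrt a"
  have c: "?c > 0" using assms by simp
  have [measurable]: "(\<lambda>x::'a. ennreal (norm x * exp (- a * (norm x)\<^sup>2))) \<in> borel_measurable borel" by measurable
  have eq: "ennreal (norm (?c *\<^sub>R x) * exp (- a * (norm (?c *\<^sub>R x))\<^sup>2)) =
      ennreal ?c * ennreal (norm x * exp (- (norm x)\<^sup>2))" for x :: 'a
    using assms by (simp add: ennreal_mult[symmetric] power_mult_distrib power_divide)
  show ?thesis
  proof -
    have "(\<integral>\<^sup>+x. ennreal (norm x * exp (- a * (norm x)\<^sup>2)) \<partial>(lborel :: 'a measure))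
      = ennreal (\<bar>?c\<bar> ^ DIM('a)) * (ennreal ?c * (\<integral>\<^sup>+x. ennreal (norm x * exp (- (norm x)\<^sup>2)) \<partial>(lborel :: 'a measure)))"
      using nn_integral_lborel_affine[of "\<lambda>x::'a. ennreal (norm x * exp (- a * (norm x)\<^sup>2))" ?c 0] c
      unfolding add_0 eq by (subst nn_integral_cmult[symmetric]) auto
    also have "\<dots> = ennreal (?c ^ (DIM('a) + 1)) * (\<integral>\<^sup>+x. ennreal (norm x * exp (- (norm x)\<^sup>2)) \<partial>(lborel :: 'a measure))"
      unfolding mult.assoc[symmetric] using c
      by (subst ennreal_mult[symmetric]) (auto simp: mult.commute)
    finally show ?thesis .
  qed
qed

text \<open>
  The integrand decays like \<open>s powr (-3/2)\<close>. With \<open>n\<close> one less than the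
  complex dimension, \<open>2 n + 3\<close> is the real dimension plus one, the exponent of
  \<open>1 / sqrt a\<close> in \<open>nn_integral_norm_gauss_scale\<close>.
\<close>

lemma nn_integral_power_gain_finite:
  assumes "0 < a"
  shows "(\<integral>\<^sup>+s. ennreal ((1 + s) ^ n * (1 / sqrt (s + a)) ^ (2 * n + 3)) * indicator {0..} s \<partial>lborel) < \<infinity>"
proof -
  \<comment> \<open>This \<open>b\<close> satisfies \<open>b (1 + s) \<le> s + a\<close>, which reduces the integral to \<open>a = 1\<close>.\<close>
  define b where "b = min a 1"
  have b: "0 < b" "b \<le> 1" "b \<le> a" using assms by (auto simp: b_def)
  have le: "(1 + s) ^ n * (1 / sqrt (s + a)) ^ (2 * n + 3) \<le> (1 / sqrt b) ^ (2*n+3) * (1 / (sqrt (1 + s))^3)"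
    if "0 \<le> s" for s
  proof -
    have "b * (1 + s) \<le> s + a"
      using b that mult_right_mono[of b 1 s] by (simp add: algebra_simps)
    then have "1 / sqrt (s + a) \<le> 1 / sqrt (b * (1 + s))"
      using b that by (intro divide_left_mono) (auto simp: zero_less_mult_iff)
    then have "(1 / sqrt (s + a)) ^ (2 * n + 3) \<le> (1 / sqrt (b * (1 + s))) ^ (2 * n + 3)"
      using that assms by (intro power_mono) auto
    also have "\<dots> = (1 / sqrt b) ^ (2*n+3) * (1 / sqrt (1 + s)) ^ (2 * n + 3)"
      by (simp add: real_sqrt_mult power_mult_distrib power_divide)
    finally have "(1 + s) ^ n * (1 / sqrt (s + a)) ^ (2 * n + 3) \<le>
       (1 + s) ^ n * ((1 / sqrt b) ^ (2*n+3) * (1 / sqrt (1 + s)) ^ (2 * n + 3))"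
      using that by (intro mult_left_mono) auto
    also have "\<dots> = (sqrt (1 + s)) ^ (2 * n) * ((1 / sqrt b) ^ (2*n+3) * (1 / sqrt (1 + s)) ^ (2 * n + 3))"
      using that by (simp add: power_mult)
    also have "(sqrt (1 + s)) ^ (2 * n) * ((1 / sqrt b) ^ (2*n+3) * (1 / sqrt (1 + s)) ^ (2 * n + 3))
       = (1 / sqrt b) ^ (2*n+3) * (1 / (sqrt (1 + s))^3)"
      using that by (simp add: power_add power_divide)
    finally show ?thesis .
  qed
  have fin: "(\<integral>\<^sup>+s. ennreal (1 / (sqrt (1 + s))^3) * indicator {0..} s \<partial>lborel) = ennreal (0 - (- 2 / sqrt (1 + 0)))"
  proof (rule nn_integral_FTC_atLeast[where F = "\<lambda>s. - 2 / sqrt (1 + s)"])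
    fix s :: real assume "0 \<le> s"
    then show "((\<lambda>s. - 2 / sqrt (1 + s)) has_real_derivative 1 / (sqrt (1 + s))^3) (at s)"
      by (auto intro!: derivative_eq_intros simp: field_simps power3_eq_cube)
  next
    show "((\<lambda>s. - 2 / sqrt (1 + s)) \<longlongrightarrow> 0) at_top"
      by real_asymp
  qed auto
  have "(\<integral>\<^sup>+s. ennreal ((1 + s) ^ n * (1 / sqrt (s + a)) ^ (2 * n + 3)) * indicator {0..} s \<partial>lborel)
    \<le> (\<integral>\<^sup>+s. ennreal ((1 / sqrt b) ^ (2*n+3)) * (ennreal (1 / (sqrt (1 + s))^3) * indicator {0..} s) \<partial>lborel)"
    using le b by (intro nn_integral_mono) (auto simp: ennreal_mult[symmetric] indicator_def)
  also have "\<dots> < \<infinity>" by (simp add: nn_integral_cmult fin ennreal_mult_less_top)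
  finally show ?thesis .
qed

text \<open>
  Young's inequality for a nonnegative convolution kernel, by Cauchy-Schwarz with respect to the
  measure with density \<open>N (w - z)\<close> and Tonelli's theorem.
\<close>

lemma nn_integral_convolution_square_le:
  fixes N f :: "'a::euclidean_space \<Rightarrow> ennreal"
  assumes [measurable]: "N \<in> borel_measurable borel" "f \<in> borel_measurable borel"
  shows "(\<integral>\<^sup>+z. (\<integral>\<^sup>+w. N (w - z) * f w \<partial>lborel)\<^sup>2 \<partial>lborel)
     \<le> (\<integral>\<^sup>+w. N w \<partial>lborel)\<^sup>2 * (\<integral>\<^sup>+w. (f w)\<^sup>2 \<partial>lborel)"
proof -
  let ?I = "\<integral>\<^sup>+w. N w \<partial>lborel"
  have I: "(\<integral>\<^sup>+w. N (w - z) \<partial>lborel) = ?I" for z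
    using nn_integral_lborel_affine[of N 1 "-z"] by (simp add: )
  have I': "(\<integral>\<^sup>+z. N (w - z) \<partial>lborel) = ?I" for w
    using nn_integral_lborel_affine[of N "-1" w] by (simp add: )
  have "(\<integral>\<^sup>+w. N (w - z) * f w \<partial>lborel)\<^sup>2 \<le> ?I * (\<integral>\<^sup>+w. N (w - z) * (f w)\<^sup>2 \<partial>lborel)" for z
    using Cauchy_Schwarz_nn_integral[of "\<lambda>_. 1" "density lborel (\<lambda>w. N (w - z))" f]
    by (simp add: nn_integral_density I emeasure_density mult_ac)
  then have "(\<integral>\<^sup>+z. (\<integral>\<^sup>+w. N (w - z) * f w \<partial>lborel)\<^sup>2 \<partial>lborel)
     \<le> (\<integral>\<^sup>+z. ?I * (\<integral>\<^sup>+w. N (w - z) * (f w)\<^sup>2 \<partial>lborel) \<partial>lborel)"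
    by (intro nn_integral_mono)
  also have "\<dots> = ?I * (\<integral>\<^sup>+z. (\<integral>\<^sup>+w. N (w - z) * (f w)\<^sup>2 \<partial>lborel) \<partial>lborel)"
    by (rule nn_integral_cmult) measurable
  also have "(\<integral>\<^sup>+z. (\<integral>\<^sup>+w. N (w - z) * (f w)\<^sup>2 \<partial>lborel) \<partial>lborel)
     = (\<integral>\<^sup>+w. (\<integral>\<^sup>+z. N (w - z) * (f w)\<^sup>2 \<partial>lborel) \<partial>lborel)"
    by (rule lborel_pair.Fubini') measurable
  also have "\<dots> = ?I * (\<integral>\<^sup>+w. (f w)\<^sup>2 \<partial>lborel)"
    by (simp add: nn_integral_multc I' nn_integral_cmult)
  finally show ?thesis by (simp add: power2_eq_square mult.assoc)
qed

section \<open>The d-bar homotopy of exponential kernels\<close>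

text \<open>
  The antilinear part of a real-linear functional in direction \<open>j\<close>. Applied to a
  Frechet derivative it is the Wirtinger derivative with respect to the conjugate of the
  \<open>j\<close>-th coordinate.
\<close>

definition dbar :: "(complex^'n \<Rightarrow> complex) \<Rightarrow> 'n \<Rightarrow> complex" where
  "dbar D j = (D (axis j 1) + \<i> * D (axis j \<i>)) / 2"

text \<open>
  The complex bilinear pairing, without conjugation, so that it is holomorphic in
  \<open>w\<close>.
\<close>

definition cdot :: "complex^'n \<Rightarrow> complex^'n \<Rightarrow> complex" where
  "cdot q w = (\<Sum>k\<in>UNIV. q $ k * w $ k)"

lemma dbar_add: "dbar (\<lambda>v. D v + D' v) j = dbar D j + dbar D' j"
  by (simp add: dbar_def field_simps)
lemma dbar_minus: "dbar (\<lambda>v. - D v) j = - dbar D j"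
  by (simp add: dbar_def field_simps)
lemma dbar_cmult: "dbar (\<lambda>v. c * D v) j = c * dbar D j"
  by (simp add: dbar_def field_simps)
lemma dbar_multc: "dbar (\<lambda>v. D v * c) j = dbar D j * c"
  by (simp add: dbar_def field_simps)
lemma dbar_sum: "dbar (\<lambda>v. \<Sum>i\<in>I. D i v) j = (\<Sum>i\<in>I. dbar (D i) j)"
  by (simp add: dbar_def sum_distrib_left sum.distrib[symmetric] sum_divide_distrib)
lemma dbar_coord: "dbar (\<lambda>v. v $ k) j = 0"
  by (simp add: dbar_def axis_def)
lemma dbar_cnj_coord: "dbar (\<lambda>v. cnj (v $ k)) j = (if k = j then 1 else 0)"
  by (simp add: dbar_def axis_def)
lemma inner_axis_complex: "(w :: complex^'n) \<bullet> axis j c = w $ j \<bullet> c"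
  by (simp add: inner_axis)
text \<open>
  This is the antilinear part of the differential \<open>2 (w \<bullet> v)\<close> of the squared
  norm.
\<close>

lemma dbar_inner: "dbar (\<lambda>v. of_real (2 * (w \<bullet> v))) j = w $ j"
  by (simp add: dbar_def inner_axis_complex inner_complex_def complex_eq_iff)
lemma dbar_complex_linear:
  assumes "\<And>c v. D (c *s v) = c * D v"
  shows "dbar D j = 0"
proof -
  have "D (axis j \<i>) = \<i> * D (axis j 1)"
    using assms[of \<i> "axis j 1"] by (simp add: vector_scalar_mult_def axis_def if_distrib cong: if_cong)
  then show ?thesis by (simp add: dbar_def)
qed

lemma norm_dbar_le:
  assumes "\<And>c. norm c = 1 \<Longrightarrow> norm (D (axis j c)) \<le> B"
  shows "norm (dbar D j) \<le> B"
proof -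
  have "norm (dbar D j) \<le> (norm (D (axis j 1)) + norm (D (axis j \<i>))) / 2"
    unfolding dbar_def norm_divide
    using norm_triangle_ineq[of "D (axis j 1)" "\<i> * D (axis j \<i>)"] by (simp add: norm_mult)
  also have "\<dots> \<le> B" using assms[of 1] assms[of \<i>] by simp
  finally show ?thesis .
qed

lemma continuous_on_det:
  assumes "\<And>i j. continuous_on S (\<lambda>x. (X x :: complex^'n^'n) $ i $ j)"
  shows "continuous_on S (\<lambda>x. det (X x))"
  unfolding det_def by (intro continuous_intros assms)

lemma continuous_on_cof:
  assumes "\<And>i j. continuous_on S (\<lambda>x. (X x :: complex^'n^'n) $ i $ j)"
  shows "continuous_on S (\<lambda>x. cof (X x) k l)"
  unfolding cof_def
proof (rule continuous_on_det)
  fix i j show "continuous_on S (\<lambda>x. (\<chi> i. if i = k then axis l 1 else X x $ i) $ i $ j)"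
    using assms[of i j] by (cases "i = k") auto
qed

lemma continuous_on_cof2:
  assumes "\<And>i j. continuous_on S (\<lambda>x. (X x :: complex^'n^'n) $ i $ j)"
  shows "continuous_on S (\<lambda>x. cof2 (X x) k j l m)"
  unfolding cof2_def
proof (rule continuous_on_det)
  fix a b show "continuous_on S (\<lambda>x. (\<chi> i. if i = l then axis m 1 else if i = k then axis j 1 else X x $ i) $ a $ b)"
    using assms[of a b] by (cases "a = k"; cases "a = l") auto
qed

text \<open>
  A twice continuously differentiable map \<open>q\<close> with its derivatives given explicitly:
  \<open>Q1 k x\<close> is the differential of the \<open>k\<close>-th component at
  \<open>x\<close>, and \<open>Q2 k x v\<close> that of \<open>Q1 k _ v\<close>.
\<close>

locale koppelman =
  fixes q :: "complex^'n \<Rightarrow> complex^'n"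
    and Q1 :: "'n \<Rightarrow> complex^'n \<Rightarrow> complex^'n \<Rightarrow> complex"
    and Q2 :: "'n \<Rightarrow> complex^'n \<Rightarrow> complex^'n \<Rightarrow> complex^'n \<Rightarrow> complex"
  assumes q1: "\<And>k x. ((\<lambda>x. q x $ k) has_derivative Q1 k x) (at x)"
    and q2: "\<And>k v x. ((\<lambda>x. Q1 k x v) has_derivative Q2 k x v) (at x)"
    and q2_sym: "\<And>k x u v. Q2 k x u v = Q2 k x v u"
    and q2_cont: "\<And>k u v. continuous_on UNIV (\<lambda>x. Q2 k x u v)"
begin

text \<open>
  The d-bar Jacobian of \<open>q x + s cnj (x - z)\<close>.
\<close>

definition jac :: "real \<Rightarrow> complex^'n \<Rightarrow> complex^'n^'n" where
  "jac s x = (\<chi> k j. dbar (Q1 k x) j + (if k = j then of_real s else 0))"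

definition expker :: "complex^'n \<Rightarrow> real \<Rightarrow> complex^'n \<Rightarrow> complex" where
  "expker z s x = exp (- (cdot (q x) (x - z) + of_real (s * (norm (x - z))\<^sup>2)))"

text \<open>
  The coefficient of the volume form in the Berndtsson-Andersson kernel for the section \<open>q x
  + s cnj (x - z)\<close>.
\<close>

definition form :: "complex^'n \<Rightarrow> real \<Rightarrow> complex^'n \<Rightarrow> complex" where
  "form z s x = expker z s x * det (jac s x)"

text \<open>
  The derivative of \<open>form\<close> with respect to \<open>s\<close>.
\<close>

definition form' :: "complex^'n \<Rightarrow> real \<Rightarrow> complex^'n \<Rightarrow> complex" where
  "form' z s x = expker z s x * ((\<Sum>k\<in>UNIV. cof (jac s x) k k) - of_real ((norm (x - z))\<^sup>2) * det (jac s x))"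

text \<open>
  The vector field whose d-bar divergence is \<open>form'\<close>: it contracts the
  \<open>s\<close>-derivative \<open>cnj (x - z)\<close> of the section with the cofactors of its
  d-bar Jacobian.
\<close>

definition flux :: "complex^'n \<Rightarrow> real \<Rightarrow> 'n \<Rightarrow> complex^'n \<Rightarrow> complex" where
  "flux z s j x = expker z s x * (\<Sum>k\<in>UNIV. cnj ((x - z) $ k) * cof (jac s x) k j)"

definition expker' :: "complex^'n \<Rightarrow> real \<Rightarrow> complex^'n \<Rightarrow> complex^'n \<Rightarrow> complex" where
  "expker' z s x v = expker z s x * - ((\<Sum>l\<in>UNIV. Q1 l x v * (x - z) $ l + q x $ l * v $ l) + of_real s * of_real (2 * ((x - z) \<bullet> v)))"

definition jac' :: "'n \<Rightarrow> 'n \<Rightarrow> complex^'n \<Rightarrow> complex^'n \<Rightarrow> complex" where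
  "jac' k j x v = dbar (\<lambda>u. Q2 k x u v) j"

definition cof' :: "real \<Rightarrow> 'n \<Rightarrow> 'n \<Rightarrow> complex^'n \<Rightarrow> complex^'n \<Rightarrow> complex" where
  "cof' s k j x v = (\<Sum>l\<in>UNIV - {k}. \<Sum>m\<in>UNIV. jac' l m x v * cof2 (jac s x) k j l m)"

definition flux' :: "complex^'n \<Rightarrow> real \<Rightarrow> 'n \<Rightarrow> complex^'n \<Rightarrow> complex^'n \<Rightarrow> complex" where
  "flux' z s j x v = expker z s x * (\<Sum>k\<in>UNIV. cnj ((x - z) $ k) * cof' s k j x v + cnj (v $ k) * cof (jac s x) k j)
     + expker' z s x v * (\<Sum>k\<in>UNIV. cnj ((x - z) $ k) * cof (jac s x) k j)"

lemma jac_deriv: "((\<lambda>x. jac s x $ k $ j) has_derivative jac' k j x) (at x)"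
  unfolding jac_def jac'_def[abs_def] dbar_def
  by (auto intro!: derivative_eq_intros q2 simp: fun_eq_iff)

lemma expker_deriv: "((\<lambda>x. expker z s x) has_derivative expker' z s x) (at x)"
proof -
  have "((\<lambda>x. (norm (x - z))\<^sup>2) has_derivative (\<lambda>v. 2 * ((x - z) \<bullet> v))) (at x)"
    unfolding power2_norm_eq_inner
    by (auto intro!: derivative_eq_intros simp: inner_commute)
  then have n: "((\<lambda>x. of_real (s * (norm (x - z))\<^sup>2) :: complex) has_derivative (\<lambda>v. of_real s * of_real (2 * ((x - z) \<bullet> v)))) (at x)"
  proof -
    assume n: "((\<lambda>x. (norm (x - z))\<^sup>2) has_derivative (\<lambda>v. 2 * ((x - z) \<bullet> v))) (at x)"
    show ?thesis
      using has_derivative_of_real[OF has_derivative_mult_right[OF n, of s]] by (simp only: of_real_mult)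
  qed
  have c: "((\<lambda>x. cdot (q x) (x - z)) has_derivative (\<lambda>v. \<Sum>l\<in>UNIV. Q1 l x v * (x - z) $ l + q x $ l * v $ l)) (at x)"
    unfolding cdot_def
    by (auto intro!: derivative_eq_intros q1 bounded_linear.has_derivative[OF bounded_linear_vec_nth] simp: fun_eq_iff algebra_simps)
  show ?thesis
    unfolding expker_def[abs_def] expker'_def[abs_def]
    by (rule has_derivative_compose[OF has_derivative_minus[OF has_derivative_add[OF c n]] DERIV_exp[unfolded has_field_derivative_def]])
qed

lemma cof_deriv: "((\<lambda>x. cof (jac s x) k j) has_derivative cof' s k j x) (at x)"
  unfolding cof'_def[abs_def] by (rule has_derivative_cof) (rule jac_deriv)

lemma flux_deriv: "((\<lambda>x. flux z s j x) has_derivative flux' z s j x) (at x)"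
proof -
  have w: "((\<lambda>x. cnj ((x - z) $ k)) has_derivative (\<lambda>v. cnj (v $ k))) (at x)" for k
    by (auto intro!: derivative_eq_intros bounded_linear.has_derivative[OF bounded_linear_cnj]
      bounded_linear.has_derivative[OF bounded_linear_vec_nth])
  show ?thesis
    unfolding flux_def[abs_def] flux'_def[abs_def]
    by (rule has_derivative_mult[OF expker_deriv has_derivative_sum[OF has_derivative_mult[OF w cof_deriv]]])
qed

text \<open>
  The factor \<open>x - z\<close> is holomorphic in \<open>x\<close>, so only the section \<open>q
  x + s cnj (x - z)\<close> is differentiated.
\<close>

lemma dbar_expker': "dbar (expker' z s x) j = - expker z s x * (\<Sum>l\<in>UNIV. (x - z) $ l * jac s x $ l $ j)"
proof -
  have "(\<Sum>l\<in>UNIV. (x - z) $ l * jac s x $ l $ j) = (\<Sum>l\<in>UNIV. dbar (Q1 l x) j * (x - z) $ l) + of_real s * (x - z) $ j"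
  proof -
    have "(\<Sum>l\<in>UNIV. (x - z) $ l * jac s x $ l $ j)
      = (\<Sum>l\<in>UNIV. dbar (Q1 l x) j * (x - z) $ l + (if l = j then of_real s * (x - z) $ l else 0))"
      by (intro sum.cong) (auto simp: jac_def algebra_simps simp del: vector_minus_component)
    then show ?thesis by (simp add: sum.distrib del: vector_minus_component)
  qed
  then show ?thesis
    unfolding expker'_def[abs_def] dbar_cmult dbar_minus dbar_add dbar_sum dbar_multc dbar_coord dbar_inner dbar_cmult
      sum.distrib by (simp only: mult_zero_right sum.neutral_const add_0_right mult_minus_left mult_minus_right)
qed

text \<open>
  The homotopy identity. Three terms arise in the divergence: derivatives of the cofactors cancel
  by the Piola identity, derivatives of \<open>cnj (x - z)\<close> give the trace of the cofactor
  matrix, and derivatives of the exponential give \<open>(x - z) \<cdot> jac \<cdot> cof\<close>,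
  which is \<open>det jac\<close> times the squared norm.
\<close>

lemma divergence_flux: "(\<Sum>j\<in>UNIV. dbar (flux' z s j x) j) = form' z s x"
proof -
  let ?w = "x - z"
  let ?A = "jac s x"
  have piola: "(\<Sum>j\<in>UNIV. dbar (cof' s k j x) j) = 0" for k
  proof -
    have "dbar (cof' s k j x) j = (\<Sum>l\<in>UNIV - {k}. \<Sum>m\<in>UNIV. dbar (jac' l m x) j * cof2 ?A k j l m)" for j
      unfolding cof'_def[abs_def] by (simp only: dbar_sum dbar_multc)
    moreover have "dbar (jac' l m x) j = dbar (jac' l j x) m" for l m j
      unfolding jac'_def[abs_def] dbar_def
      by (simp add: q2_sym[of l x "axis j 1" "axis m 1"] q2_sym[of l x "axis j \<i>" "axis m 1"]
         q2_sym[of l x "axis j 1" "axis m \<i>"] q2_sym[of l x "axis j \<i>" "axis m \<i>"] field_simps)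
    ultimately show ?thesis
      using piola_sum_zero[where H = "\<lambda>l m j. dbar (jac' l m x) j" and k = k and A = ?A] by simp
  qed
  have "(\<Sum>j\<in>UNIV. dbar (flux' z s j x) j)
     = (\<Sum>j\<in>UNIV. expker z s x * (\<Sum>k\<in>UNIV. cnj (?w $ k) * dbar (cof' s k j x) j + (if k = j then 1 else 0) * cof ?A k j)
       + dbar (expker' z s x) j * (\<Sum>k\<in>UNIV. cnj (?w $ k) * cof ?A k j))"
    unfolding flux'_def[abs_def] by (simp only: dbar_add dbar_sum dbar_multc dbar_cmult dbar_cnj_coord)
  also have "\<dots> = expker z s x * (\<Sum>k\<in>UNIV. cnj (?w $ k) * (\<Sum>j\<in>UNIV. dbar (cof' s k j x) j))
      + expker z s x * (\<Sum>j\<in>UNIV. \<Sum>k\<in>UNIV. (if k = j then 1 else 0) * cof ?A k j)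
      - expker z s x * (\<Sum>j\<in>UNIV. (\<Sum>l\<in>UNIV. ?w $ l * ?A $ l $ j) * (\<Sum>k\<in>UNIV. cnj (?w $ k) * cof ?A k j))"
  proof -
    have "(\<Sum>j\<in>UNIV. \<Sum>k\<in>UNIV. cnj (?w $ k) * dbar (cof' s k j x) j) = (\<Sum>k\<in>UNIV. cnj (?w $ k) * (\<Sum>j\<in>UNIV. dbar (cof' s k j x) j))"
      by (subst sum.swap) (simp only: sum_distrib_left)
    then show ?thesis
      unfolding dbar_expker' mult.assoc mult_minus_left sum.distrib distrib_left sum_negf
      by (simp only: sum_distrib_left[symmetric] diff_conv_add_uminus)
  qed
  also have "(\<Sum>j\<in>UNIV. (\<Sum>l\<in>UNIV. ?w $ l * ?A $ l $ j) * (\<Sum>k\<in>UNIV. cnj (?w $ k) * cof ?A k j))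
     = (\<Sum>l\<in>UNIV. \<Sum>k\<in>UNIV. ?w $ l * cnj (?w $ k) * (\<Sum>j\<in>UNIV. ?A $ l $ j * cof ?A k j))"
  proof -
    have "(\<Sum>j\<in>UNIV. (\<Sum>l\<in>UNIV. ?w $ l * ?A $ l $ j) * (\<Sum>k\<in>UNIV. cnj (?w $ k) * cof ?A k j))
      = (\<Sum>j\<in>UNIV. \<Sum>l\<in>UNIV. \<Sum>k\<in>UNIV. ?w $ l * cnj (?w $ k) * (?A $ l $ j * cof ?A k j))"
    proof (intro sum.cong refl)
      fix j
      show "(\<Sum>l\<in>UNIV. ?w $ l * ?A $ l $ j) * (\<Sum>k\<in>UNIV. cnj (?w $ k) * cof ?A k j)
        = (\<Sum>l\<in>UNIV. \<Sum>k\<in>UNIV. ?w $ l * cnj (?w $ k) * (?A $ l $ j * cof ?A k j))"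
        unfolding sum_product by (intro sum.cong refl) (simp only: mult_ac)
    qed
    also have "\<dots> = (\<Sum>l\<in>UNIV. \<Sum>j\<in>UNIV. \<Sum>k\<in>UNIV. ?w $ l * cnj (?w $ k) * (?A $ l $ j * cof ?A k j))"
      by (rule sum.swap)
    also have "\<dots> = (\<Sum>l\<in>UNIV. \<Sum>k\<in>UNIV. \<Sum>j\<in>UNIV. ?w $ l * cnj (?w $ k) * (?A $ l $ j * cof ?A k j))"
      by (intro sum.cong refl sum.swap)
    finally show ?thesis by (simp only: sum_distrib_left)
  qed
  also have "\<dots> = (\<Sum>l\<in>UNIV. ?w $ l * cnj (?w $ l)) * det ?A"
  proof -
    have "(\<Sum>k\<in>UNIV. ?w $ l * cnj (?w $ k) * (if l = k then det ?A else 0)) = ?w $ l * cnj (?w $ l) * det ?A" for l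
    proof -
      have "(\<Sum>k\<in>UNIV. ?w $ l * cnj (?w $ k) * (if l = k then det ?A else 0))
        = (\<Sum>k\<in>UNIV. if l = k then ?w $ l * cnj (?w $ k) * det ?A else 0)"
        by (intro sum.cong) auto
      then show ?thesis by simp
    qed
    then show ?thesis unfolding sum_row_cof by (simp only: sum_distrib_right)
  qed
  also have "(\<Sum>l\<in>UNIV. ?w $ l * cnj (?w $ l)) = of_real ((norm ?w)\<^sup>2)"
    by (simp add: norm_vec_def L2_set_def sum_nonneg complex_norm_square[symmetric] del: vector_minus_component)
  also have "(\<Sum>j\<in>UNIV. \<Sum>k\<in>UNIV. (if k = j then 1 else 0) * cof ?A k j) = (\<Sum>k\<in>UNIV. cof ?A k k)"
  proof -
    have "(\<Sum>j\<in>UNIV. \<Sum>k\<in>UNIV. (if k = j then 1 else 0) * cof ?A k j) = (\<Sum>j\<in>UNIV. \<Sum>k\<in>UNIV. if k = j then cof ?A k j else 0)"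
      by (intro sum.cong) auto
    then show ?thesis by simp
  qed
  finally show ?thesis unfolding piola form'_def by (simp only: mult_zero_right sum.neutral_const add_0_left right_diff_distrib mult.assoc)
qed

lemma form_deriv: "((\<lambda>s. form z s x) has_vector_derivative form' z s x) (at s)"
proof -
  have d: "((\<lambda>s. det (jac s x)) has_derivative (\<lambda>v. \<Sum>k\<in>UNIV. \<Sum>j\<in>UNIV. (if k = j then of_real v else 0) * cof (jac s x) k j)) (at s)"
  proof (rule has_derivative_det)
    fix i j show "((\<lambda>s. jac s x $ i $ j) has_derivative (\<lambda>v. if i = j then of_real v else 0)) (at s)"
      unfolding jac_def by (cases "i = j") (auto intro!: derivative_eq_intros)
  qed
  have e: "((\<lambda>s. expker z s x) has_derivative (\<lambda>v. expker z s x * - of_real (v * (norm (x - z))\<^sup>2))) (at s)"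
  proof -
    have "((\<lambda>s. - (cdot (q x) (x - z) + of_real (s * (norm (x - z))\<^sup>2)) :: complex) has_derivative
        (\<lambda>v. - of_real (v * (norm (x - z))\<^sup>2))) (at s)"
      by (auto intro!: derivative_eq_intros)
    from has_derivative_compose[OF this DERIV_exp[unfolded has_field_derivative_def]] show ?thesis unfolding expker_def .
  qed
  have s: "(\<Sum>k\<in>UNIV. \<Sum>j\<in>UNIV. (if k = j then of_real v else 0) * cof (jac s x) k j) = of_real v * (\<Sum>k\<in>UNIV. cof (jac s x) k k)" for v
    by (simp add: if_distrib sum_distrib_left if_distribR cong: if_cong)
  show ?thesis
    unfolding has_vector_derivative_def form_def
    by (rule has_derivative_eq_rhs[OF has_derivative_mult[OF e d]])
       (simp add: fun_eq_iff form'_def s algebra_simps scaleR_conv_of_real)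
qed

lemma q_cont: "continuous_on UNIV (\<lambda>x. q x $ k)"
  by (intro has_derivative_imp_continuous_on[OF q1])

lemma Q1_cont: "continuous_on UNIV (\<lambda>x. Q1 k x v)"
  by (intro has_derivative_imp_continuous_on[OF q2])

lemma joint_cont:
  "continuous_on UNIV (\<lambda>(s, x). form' z s x)" "continuous_on UNIV (\<lambda>(s, x). form z s x)"
  "continuous_on UNIV (\<lambda>(s, x). flux z s j x)"
proof -
  have s: "continuous_on UNIV (\<lambda>p::real \<times> (complex^'n). snd p)"
    by (intro continuous_intros)
  have q: "continuous_on UNIV (\<lambda>p::real \<times> (complex^'n). q (snd p) $ k)" for k
    by (rule continuous_on_compose2[OF q_cont s]) auto
  have Q: "continuous_on UNIV (\<lambda>p::real \<times> (complex^'n). Q1 k (snd p) v)" for k v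
    by (rule continuous_on_compose2[OF Q1_cont s]) auto
  have a: "continuous_on UNIV (\<lambda>p. jac (fst p) (snd p) $ i $ j)" for i j
    unfolding jac_def dbar_def by (cases "i = j") (simp_all, (intro continuous_intros Q; simp)+)
  have e: "continuous_on UNIV (\<lambda>p. expker z (fst p) (snd p))"
    unfolding expker_def cdot_def by (intro continuous_intros q)
  have w: "continuous_on UNIV (\<lambda>p::real \<times> (complex^'n). cnj ((snd p - z) $ k))" for k
    by (intro continuous_intros)
  have n: "continuous_on UNIV (\<lambda>p::real \<times> (complex^'n). of_real ((norm (snd p - z))\<^sup>2) :: complex)"
    by (intro continuous_intros)
  note rules = continuous_on_mult continuous_on_diff continuous_on_sum e n w
    continuous_on_det[OF a] continuous_on_cof[OF a]
  show "continuous_on UNIV (\<lambda>(s, x). form' z s x)"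
    unfolding form'_def split_beta by (intro rules)
  show "continuous_on UNIV (\<lambda>(s, x). form z s x)"
    unfolding form_def split_beta by (intro rules)
  show "continuous_on UNIV (\<lambda>(s, x). flux z s j x)"
    unfolding flux_def split_beta by (intro rules)
qed

lemma form'_cont: "continuous_on UNIV (form' z s)" and form_cont: "continuous_on UNIV (form z s)"
  and flux_cont: "continuous_on UNIV (flux z s j)"
proof -
  have p: "continuous_on UNIV (\<lambda>x. (s, x))" by (intro continuous_intros)
  show "continuous_on UNIV (form' z s)" "continuous_on UNIV (form z s)" "continuous_on UNIV (flux z s j)"
    using continuous_on_compose2[OF joint_cont(1)[of z] p] continuous_on_compose2[OF joint_cont(2)[of z] p]
      continuous_on_compose2[OF joint_cont(3)[of z j] p] by simp_all
qed

lemma flux'_cont: "continuous_on UNIV (\<lambda>x. flux' z s j x v)"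
proof -
  have a: "continuous_on UNIV (\<lambda>p. jac s p $ i $ j)" for i j
    by (intro has_derivative_imp_continuous_on[OF jac_deriv])
  have e: "continuous_on UNIV (expker z s)"
    by (intro has_derivative_imp_continuous_on[OF expker_deriv])
  have c2: "continuous_on UNIV (\<lambda>x. dbar (\<lambda>u. Q2 l x u v) m)" for l m
    unfolding dbar_def by (rule continuous_on_divide continuous_on_add continuous_on_mult continuous_on_const q2_cont | simp)+
  have w: "continuous_on UNIV (\<lambda>x. (x - z) $ k)" "continuous_on UNIV (\<lambda>x. cnj ((x - z) $ k))" for k
    by (intro continuous_intros)+
  have n: "continuous_on UNIV (\<lambda>x. complex_of_real (2 * ((x - z) \<bullet> v)))"
    by (intro continuous_intros)
  show ?thesis unfolding flux'_def expker'_def cof'_def jac'_def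
    by (intro continuous_on_mult continuous_on_add continuous_on_sum continuous_on_minus continuous_on_const
       e n w c2 q_cont Q1_cont continuous_on_cof[OF a] continuous_on_cof2[OF a])
qed

end

section \<open>The weighted estimate for the d-bar equation\<close>

text \<open>
  Differentiation under the integral sign when the linearisation error of the integrand is
  quadratic with an integrable constant. The error is integrated directly, without a limit
  theorem.
\<close>

lemma has_derivative_integral_quadratic:
  fixes T :: "'a::euclidean_space \<Rightarrow> 'x \<Rightarrow> 'b::{banach, second_countable_topology}"
  assumes "0 < \<delta>"
    and T: "\<And>y. integrable M (T y)" and T': "\<And>v. integrable M (\<lambda>x. T' x v)"
    and lin: "\<And>x. linear (T' x)"
    and G: "integrable M G"
    and bd: "\<And>x v. norm v \<le> \<delta> \<Longrightarrow> norm (T (y + v) x - T y x - T' x v) \<le> G x * (norm v)\<^sup>2"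
  shows "((\<lambda>y. \<integral>x. T y x \<partial>M) has_derivative (\<lambda>v. \<integral>x. T' x v \<partial>M)) (at y)"
proof (rule has_derivativeI_sandwich[where e = \<delta> and H = "\<lambda>z. (\<integral>x. G x \<partial>M) * norm (z - y)"])
  have "linear (\<lambda>v. \<integral>x. T' x v \<partial>M)"
    using lin T' by (intro linearI) (simp_all add: linear_add linear_scale)
  then show "bounded_linear (\<lambda>v. \<integral>x. T' x v \<partial>M)"
    by (simp add: linear_conv_bounded_linear)
next
  fix z assume z: "z \<noteq> y" "dist z y < \<delta>"
  let ?v = "z - y"
  have "(\<integral>x. T z x \<partial>M) - (\<integral>x. T y x \<partial>M) - (\<integral>x. T' x ?v \<partial>M) = (\<integral>x. T z x - T y x - T' x ?v \<partial>M)"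
    using T T' by simp
  also have "norm \<dots> \<le> (\<integral>x. G x * (norm ?v)\<^sup>2 \<partial>M)"
    using bd[of ?v] z
    by (intro order_trans[OF integral_norm_bound] integral_mono) (auto intro!: T T' G integrable_norm Bochner_Integration.integrable_diff simp: dist_norm)
  also have "\<dots> = (\<integral>x. G x \<partial>M) * (norm ?v)\<^sup>2" by simp
  finally show "norm ((\<integral>x. T z x \<partial>M) - (\<integral>x. T y x \<partial>M) - (\<integral>x. T' x ?v \<partial>M)) / norm ?v \<le> (\<integral>x. G x \<partial>M) * norm ?v"
    using z by (simp add: divide_le_eq power2_eq_square mult.assoc)
next
  show "((\<lambda>z. (\<integral>x. G x \<partial>M) * norm (z - y)) \<longlongrightarrow> 0) (at y)"
    by (auto intro!: tendsto_eq_intros)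
qed (use \<open>0 < \<delta>\<close> in auto)

lemma integrable_continuous_bounded_support:
  fixes F :: "'a::euclidean_space \<Rightarrow> 'b::{banach, second_countable_topology}"
  assumes "continuous_on UNIV F" "\<And>x. norm x > R \<Longrightarrow> F x = 0"
  shows "integrable lborel F"
proof -
  have "F = (\<lambda>x. indicator (cball 0 R) x *\<^sub>R F x)"
    using assms(2) by (auto simp: fun_eq_iff indicator_def not_le)
  then show ?thesis
    using borel_integrable_compact[of "cball 0 R" F] assms(1) continuous_on_subset by (metis compact_cball subset_UNIV)
qed

lemma bounded_continuous_bounded_support:
  fixes F :: "'a::euclidean_space \<Rightarrow> 'b::real_normed_vector"
  assumes "continuous_on UNIV F" "\<And>x. norm x > R \<Longrightarrow> F x = 0"
  obtains D where "0 \<le> D" "\<And>x. norm (F x) \<le> D"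
proof -
  obtain D where D: "0 \<le> D" "\<And>x. norm x \<le> R \<Longrightarrow> norm (F x) \<le> D"
    using continuous_on_bounded_cball[OF assms(1)] by blast
  have "norm (F x) \<le> D" for x
    using D(2)[of x] D(1) assms(2)[of x] by (cases "norm x \<le> R") auto
  then show ?thesis using that[of D] D(1) by auto
qed

lemma lborel_integral_eq_cbox:
  fixes F :: "'a::euclidean_space \<Rightarrow> complex"
  assumes "continuous_on UNIV F" "\<And>x. norm x > R \<Longrightarrow> F x = 0" "cball 0 R \<subseteq> cbox a b"
  shows "(\<integral>x. F x \<partial>lborel) = integral (cbox a b) F"
proof -
  have int: "integrable lborel F"
    by (rule integrable_continuous_bounded_support[OF assms(1,2)])
  have "F x = 0" if "x \<notin> cbox a b" for x
  proof -
    have "norm x > R" using assms(3) that by force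
    then show ?thesis by (simp add: assms(2))
  qed
  then have "F = (\<lambda>x. if x \<in> cbox a b then F x else 0)" by auto
  then show ?thesis using integral_restrict_UNIV[of "cbox a b" F] integral_lborel[OF int] by simp
qed

lemma norm_exp_minus_1_minus_le:
  fixes a :: complex
  assumes "norm a \<le> 1"
  shows "norm (exp a - 1 - a) \<le> 3 * (norm a)\<^sup>2"
proof -
  have "norm (exp a - (\<Sum>i\<le>1. a ^ i / fact i)) \<le> exp (norm a) * (norm a ^ Suc 1) / fact 1"
    by (rule Taylor_exp_field)
  also have "\<dots> \<le> 3 * (norm a)\<^sup>2"
  proof -
    have "exp (norm a) \<le> exp 1" using assms by simp
    also have "exp (1::real) \<le> 3" by (rule exp_le)
    finally show ?thesis by (simp add: power2_eq_square mult_right_mono)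
  qed
  finally show ?thesis by (simp add: algebra_simps)
qed

lemma cdot_add: "cdot q (v + w) = cdot q v + cdot q w"
  and cdot_diff: "cdot q (v - w) = cdot q v - cdot q w"
  and cdot_smult: "cdot q (c *s v) = c * cdot q v"
  and cdot_scaleR: "cdot q (r *\<^sub>R v) = r *\<^sub>R cdot q v"
  and cdot_0: "cdot q 0 = 0"
  by (simp_all add: cdot_def algebra_simps sum.distrib sum_subtractf sum_distrib_left scaleR_sum_right)

lemma norm_cdot_le: "norm (cdot q v) \<le> (\<Sum>k\<in>UNIV. norm (q $ k)) * norm v"
  unfolding cdot_def sum_distrib_right
  by (rule order_trans[OF norm_sum]) (auto intro!: sum_mono mult_left_mono simp: norm_mult Finite_Cartesian_Product.norm_nth_le)

text \<open>
  The kernel is holomorphic in \<open>z\<close>, and \<open>c\<close> has compact support.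
\<close>

lemma holo_compact_exp_integral:
  fixes c :: "complex^'n \<Rightarrow> complex" and q :: "complex^'n \<Rightarrow> complex^'n"
  assumes c: "continuous_on UNIV c" and supp: "\<And>x. norm x > R \<Longrightarrow> c x = 0"
    and q: "\<And>k. continuous_on UNIV (\<lambda>x. q x $ k)"
  shows "(\<lambda>z. \<integral>x. c x * exp (cdot (q x) (z - x)) \<partial>lborel) \<in> holo UNIV"
proof -
  define S where "S x = (\<Sum>k\<in>UNIV. norm (q x $ k))" for x
  have Sc: "continuous_on UNIV S" unfolding S_def by (intro continuous_intros q)
  have cd: "continuous_on UNIV (\<lambda>x. cdot (q x) (g x))" if "continuous_on UNIV g" for g
    unfolding cdot_def by (intro continuous_intros q that)
  have S0: "0 \<le> S x" for x unfolding S_def by (intro sum_nonneg) auto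
  obtain D where "0 \<le> D" "\<And>x. norm x \<le> R \<Longrightarrow> norm (S x) \<le> D"
    using continuous_on_bounded_cball[OF Sc] by blast
  then have D: "0 \<le> D" "\<And>x. norm x \<le> R \<Longrightarrow> S x \<le> D" using S0 by auto
  have "((\<lambda>z. \<integral>x. c x * exp (cdot (q x) (z - x)) \<partial>lborel) has_derivative
      (\<lambda>v. \<integral>x. c x * exp (cdot (q x) (z - x)) * cdot (q x) v \<partial>lborel)) (at z)" for z
  proof (rule has_derivative_integral_quadratic[where \<delta> = "1 / (D + 1)" and G = "\<lambda>x. norm (c x * exp (cdot (q x) (z - x))) * (3 * D\<^sup>2)"])
    show "0 < 1 / (D + 1)" using D by simp
    show "integrable lborel (\<lambda>x. c x * exp (cdot (q x) (y - x)))" for y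
      by (rule integrable_continuous_bounded_support[where R = R]) (auto intro!: continuous_intros c cd simp: supp)
    show "integrable lborel (\<lambda>x. c x * exp (cdot (q x) (z - x)) * cdot (q x) v)" for v
      by (rule integrable_continuous_bounded_support[where R = R]) (auto intro!: continuous_intros c cd simp: supp)
    show "integrable lborel (\<lambda>x. norm (c x * exp (cdot (q x) (z - x))) * (3 * D\<^sup>2))"
      by (rule integrable_continuous_bounded_support[where R = R]) (auto intro!: continuous_intros c cd simp: supp)
    show "linear (\<lambda>v. c x * exp (cdot (q x) (z - x)) * cdot (q x) v)" for x
      by (intro linearI) (auto simp: cdot_add cdot_scaleR algebra_simps)
    fix x v :: "complex^'n" assume v: "norm v \<le> 1 / (D + 1)"
    let ?a = "cdot (q x) v"
    show "norm (c x * exp (cdot (q x) (z + v - x)) - c x * exp (cdot (q x) (z - x)) - c x * exp (cdot (q x) (z - x)) * cdot (q x) v)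
       \<le> norm (c x * exp (cdot (q x) (z - x))) * (3 * D\<^sup>2) * (norm v)\<^sup>2"
    proof (cases "norm x \<le> R")
      case True
      have a: "norm ?a \<le> D * norm v"
        using norm_cdot_le[of "q x" v] mult_right_mono[OF D(2)[OF True], of "norm v"] by (simp add: S_def)
      also have "\<dots> \<le> D * (1 / (D + 1))" using v D by (intro mult_left_mono) auto
      also have "\<dots> \<le> 1" using D by (simp add: field_simps)
      finally have a1: "norm ?a \<le> 1" .
      have e: "exp (cdot (q x) (z + v - x)) = exp (cdot (q x) (z - x)) * exp ?a"
        by (simp add: exp_add[symmetric] cdot_add cdot_diff algebra_simps)
      have "c x * exp (cdot (q x) (z + v - x)) - c x * exp (cdot (q x) (z - x)) - c x * exp (cdot (q x) (z - x)) * cdot (q x) v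
        = c x * exp (cdot (q x) (z - x)) * (exp ?a - 1 - ?a)"
        unfolding e by (simp add: algebra_simps)
      also have "norm \<dots> \<le> norm (c x * exp (cdot (q x) (z - x))) * (3 * (norm ?a)\<^sup>2)"
        unfolding norm_mult[of _ "exp ?a - 1 - ?a"] by (intro mult_left_mono norm_exp_minus_1_minus_le a1) auto
      also have "\<dots> \<le> norm (c x * exp (cdot (q x) (z - x))) * (3 * (D * norm v)\<^sup>2)"
        using a by (intro mult_left_mono power_mono) auto
      finally show ?thesis by (simp add: power_mult_distrib mult_ac)
    qed (simp add: supp)
  qed
  moreover have "(\<integral>x. c x * exp (cdot (q x) (z - x)) * cdot (q x) (a *s v) \<partial>lborel)
     = a * (\<integral>x. c x * exp (cdot (q x) (z - x)) * cdot (q x) v \<partial>lborel)" for z a v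
  proof -
    have "(\<lambda>x. c x * exp (cdot (q x) (z - x)) * cdot (q x) (a *s v)) = (\<lambda>x. a * (c x * exp (cdot (q x) (z - x)) * cdot (q x) v))"
      by (simp add: cdot_smult mult_ac fun_eq_iff)
    then show ?thesis by simp
  qed
  ultimately show ?thesis unfolding holo_def by blast
qed

text \<open>
  Equal to \<open>pi ^ CARD('n)\<close>.
\<close>

definition gaussK :: "'n::finite itself \<Rightarrow> real" where
  "gaussK _ = (\<integral>v. exp (- (norm (v :: complex^'n))\<^sup>2) \<partial>lborel)"

lemma integrable_gauss: "integrable lborel (\<lambda>v :: 'a::euclidean_space. exp (- (norm v)\<^sup>2))"
  using nn_integral_gauss_finite[of 1] by (intro integrableI_nonneg) auto

lemma gaussK_pos: "0 < gaussK TYPE('n::finite)"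
proof -
  have "gaussK TYPE('n) \<noteq> 0"
  proof
    assume "gaussK TYPE('n) = 0"
    then have "AE v in lborel. exp (- (norm (v :: complex^'n))\<^sup>2) = 0"
      unfolding gaussK_def by (subst (asm) integral_nonneg_eq_0_iff_AE) (auto intro: integrable_gauss)
    then have "ae_filter (lborel :: (complex^'n) measure) = bot" by (simp add: trivial_limit_def)
    then show False by (simp add: ae_filter_eq_bot_iff)
  qed
  moreover have "0 \<le> gaussK TYPE('n)" unfolding gaussK_def by (intro Bochner_Integration.integral_nonneg) auto
  ultimately show ?thesis by simp
qed

text \<open>
  The inequality \<open>growth\<close> says that up to the additive constant \<open>C0\<close> the
  map \<open>q\<close> behaves like the gradient of a uniformly convex function, so that the
  kernel at \<open>(x, z)\<close> is bounded by \<open>exp (\<phi> z - \<phi> x)\<close> times a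
  Gaussian in \<open>x - z\<close>.
\<close>

locale koppelman_estimate = koppelman q Q1 Q2
  for q :: "complex^'n \<Rightarrow> complex^'n" and Q1 Q2 +
  fixes \<phi> :: "complex^'n \<Rightarrow> real" and m B C0 :: real
  assumes m: "0 < m" and B: "0 \<le> B"
    and phi_cont: "continuous_on UNIV \<phi>"
    and growth: "\<And>x z. Re (cdot (q x) (x - z)) \<ge> \<phi> x - \<phi> z + m * (norm (x - z))\<^sup>2 - C0"
    and dbarQ: "\<And>k j x. norm (dbar (Q1 k x) j) \<le> B"
begin

lemma norm_jac_le: "0 \<le> s \<Longrightarrow> norm (jac s x $ k $ j) \<le> (B + 1) * (1 + s)"
proof -
  assume s: "0 \<le> s"
  have "norm (jac s x $ k $ j) \<le> B + s"
    unfolding jac_def using dbarQ[of k x j] s norm_triangle_ineq[of "dbar (Q1 k x) j" "of_real s"] by auto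
  also have "\<dots> \<le> (B + 1) * (1 + s)" using B s by (simp add: algebra_simps)
  finally show ?thesis .
qed

lemma norm_expker_le: "norm (expker z s x) \<le> exp (\<phi> z - \<phi> x + C0) * exp (- (m + s) * (norm (x - z))\<^sup>2)"
  using growth[of x z] by (simp add: expker_def norm_exp_eq_Re exp_add[symmetric] algebra_simps)

definition flux_const :: real where
  "flux_const = exp C0 * (CARD('n) * (fact CARD('n) * (B + 1) ^ (CARD('n) - 1)))"

lemma norm_flux_le:
  assumes "0 \<le> s"
  shows "norm (flux z s j x) \<le> flux_const * exp (\<phi> z - \<phi> x) * ((1 + s) ^ (CARD('n) - 1) * (norm (x - z) * exp (- (m + s) * (norm (x - z))\<^sup>2)))"
proof -
  let ?c = "fact CARD('n) * ((B + 1) * (1 + s)) ^ (CARD('n) - 1)"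
  have "norm (\<Sum>k\<in>UNIV. cnj ((x - z) $ k) * cof (jac s x) k j) \<le> (\<Sum>k\<in>(UNIV :: 'n set). norm (x - z) * ?c)"
    by (rule order_trans[OF norm_sum], intro sum_mono, unfold norm_mult complex_mod_cnj,
        intro mult_mono norm_cof_le norm_jac_le Finite_Cartesian_Product.norm_nth_le) (use assms B in auto)
  then have "norm (flux z s j x) \<le> (exp (\<phi> z - \<phi> x + C0) * exp (- (m + s) * (norm (x - z))\<^sup>2)) * (CARD('n) * (norm (x - z) * ?c))"
    unfolding flux_def norm_mult by (intro mult_mono norm_expker_le) auto
  also have "\<dots> = flux_const * exp (\<phi> z - \<phi> x) * ((1 + s) ^ (CARD('n) - 1) * (norm (x - z) * exp (- (m + s) * (norm (x - z))\<^sup>2)))"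
    by (simp add: flux_const_def exp_add power_mult_distrib mult_ac)
  finally show ?thesis .
qed

text \<open>
  The translation invariant majorant of the flux, integrated over the homotopy parameter, with the
  weight factor \<open>exp (\<phi> z - \<phi> x)\<close> removed.
\<close>

definition schur :: "complex^'n \<Rightarrow> ennreal" where
  "schur w = (\<integral>\<^sup>+s. ennreal (flux_const * ((1 + s) ^ (CARD('n) - 1) * (norm w * exp (- (m + s) * (norm w)\<^sup>2)))) * indicator {0..} s \<partial>lborel)"

lemma schur_measurable[measurable]: "schur \<in> borel_measurable borel"
  unfolding schur_def by measurable

lemma flux_const_nonneg: "0 \<le> flux_const" using B by (simp add: flux_const_def)

text \<open>
  For fixed \<open>s\<close> the Gaussian integral gives \<open>(m + s) powr (- (2 n + 1) /
  2)\<close> with \<open>n\<close> the complex dimension, against \<open>n - 1\<close> powers of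
  \<open>1 + s\<close> from the cofactors.
\<close>

lemma schur_finite: "(\<integral>\<^sup>+w. schur w \<partial>lborel) < \<infinity>"
proof -
  let ?n = "CARD('n) - 1"
  let ?G = "\<integral>\<^sup>+x. ennreal (norm x * exp (- (norm x)\<^sup>2)) \<partial>(lborel :: (complex^'n) measure)"
  have dim: "DIM(complex^'n) + 1 = 2 * ?n + 3"
    using zero_less_card_finite[where 'a='n] by (cases "CARD('n)") (simp_all add: DIM_cart)
  have "(\<integral>\<^sup>+w. schur w \<partial>lborel) = (\<integral>\<^sup>+s. (\<integral>\<^sup>+w. ennreal (flux_const * ((1 + s) ^ ?n * (norm (w::complex^'n) * exp (- (m + s) * (norm w)\<^sup>2)))) * indicator {0..} s \<partial>lborel) \<partial>lborel)"
    unfolding schur_def by (rule lborel_pair.Fubini') measurable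
  also have "\<dots> = (\<integral>\<^sup>+s. (ennreal flux_const * ?G) * (ennreal ((1 + s) ^ ?n * (1 / sqrt (s + m)) ^ (2 * ?n + 3)) * indicator {0..} s) \<partial>lborel)"
  proof (rule nn_integral_cong)
    fix s :: real
    show "(\<integral>\<^sup>+w. ennreal (flux_const * ((1 + s) ^ ?n * (norm (w::complex^'n) * exp (- (m + s) * (norm w)\<^sup>2)))) * indicator {0..} s \<partial>lborel)
      = (ennreal flux_const * ?G) * (ennreal ((1 + s) ^ ?n * (1 / sqrt (s + m)) ^ (2 * ?n + 3)) * indicator {0..} s)"
    proof (cases "0 \<le> s")
      case True
      have "(\<integral>\<^sup>+w. ennreal (flux_const * ((1 + s) ^ ?n * (norm (w::complex^'n) * exp (- (m + s) * (norm w)\<^sup>2)))) \<partial>lborel)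
        = (\<integral>\<^sup>+w. ennreal (flux_const * (1 + s) ^ ?n) * ennreal (norm (w::complex^'n) * exp (- (m + s) * (norm w)\<^sup>2)) \<partial>lborel)"
        using True flux_const_nonneg by (intro nn_integral_cong) (subst ennreal_mult[symmetric], auto simp: mult_ac)
      also have "\<dots> = ennreal (flux_const * (1 + s) ^ ?n) * (ennreal ((1 / sqrt (m + s)) ^ (2 * ?n + 3)) * ?G)"
        using True m
        by (subst nn_integral_cmult, simp, subst nn_integral_norm_gauss_scale, simp, subst dim) (rule refl)
      also have "\<dots> = (ennreal flux_const * ?G) * ennreal ((1 + s) ^ ?n * (1 / sqrt (s + m)) ^ (2 * ?n + 3))"
        using True flux_const_nonneg m by (simp add: ennreal_mult add.commute mult_ac)
      finally show ?thesis using True by simp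
    qed simp
  qed
  also have "\<dots> = (ennreal flux_const * ?G) * (\<integral>\<^sup>+s. (ennreal ((1 + s) ^ ?n * (1 / sqrt (s + m)) ^ (2 * ?n + 3)) * indicator {0..} s) \<partial>lborel)"
    by (rule nn_integral_cmult) measurable
  also have "\<dots> < \<infinity>"
    using nn_integral_power_gain_finite[OF m, of ?n] nn_integral_norm_gauss_finite[where 'a="complex^'n"]
    by (simp add: ennreal_mult_less_top)
  finally show ?thesis .
qed

context
  fixes u :: "complex^'n \<Rightarrow> complex" and U' :: "complex^'n \<Rightarrow> complex^'n \<Rightarrow> complex" and R :: real
  assumes u: "\<And>x. (u has_derivative U' x) (at x)"
    and U'_cont: "\<And>v. continuous_on UNIV (\<lambda>x. U' x v)"
    and supp: "\<And>x. norm x > R \<Longrightarrow> u x = 0"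
begin

lemma u_cont: "continuous_on UNIV u"
  by (intro has_derivative_imp_continuous_on[OF u])

lemma supp': "norm x > R \<Longrightarrow> U' x v = 0"
proof -
  assume x: "norm x > R"
  have "open {x::complex^'n. norm x > R}" by (intro open_Collect_less continuous_intros)
  then have "((\<lambda>x. 0) has_derivative U' x) (at x)"
    using has_derivative_transform_within_open[OF u[of x], of "{x. norm x > R}" "\<lambda>_. 0"] x supp by auto
  then have "U' x = (\<lambda>_. 0)" using has_derivative_unique has_derivative_const by blast
  then show ?thesis by simp
qed

text \<open>
  The integral operators that connect a holomorphic function at \<open>s = 0\<close> with a
  multiple of \<open>u\<close> as \<open>s \<rightarrow> \<infinity>\<close>.
\<close>

definition avg :: "complex^'n \<Rightarrow> real \<Rightarrow> complex" where
  "avg z s = (\<integral>x. u x * form z s x \<partial>lborel)"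

text \<open>
  Integration by parts in the homotopy identity; \<open>u\<close> has compact support.
\<close>

lemma integral_form'_eq:
  "(\<integral>x. u x * form' z s x \<partial>lborel) = - (\<integral>x. (\<Sum>j\<in>UNIV. dbar (U' x) j * flux z s j x) \<partial>lborel)"
proof -
  have d: "((\<lambda>x. u x * flux z s j x) has_derivative (\<lambda>v. u x * flux' z s j x v + U' x v * flux z s j x)) (at x)" for j x
    by (rule has_derivative_mult[OF u flux_deriv])
  have c: "continuous_on UNIV (\<lambda>x. u x * flux' z s j x v + U' x v * flux z s j x)" for j v
    by (intro continuous_intros u_cont flux'_cont U'_cont flux_cont)
  have int: "integrable lborel (\<lambda>x. u x * flux' z s j x v + U' x v * flux z s j x)" for j v
    by (rule integrable_continuous_bounded_support[OF c, of R]) (simp add: supp supp')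
  have z: "(\<integral>x. u x * flux' z s j x v + U' x v * flux z s j x \<partial>lborel) = 0" for j v
    by (rule integral_directional_derivative_zero[OF d c, of R]) (simp add: supp)
  have "(\<integral>x. (\<Sum>j\<in>UNIV. dbar (\<lambda>v. u x * flux' z s j x v + U' x v * flux z s j x) j) \<partial>lborel) = 0"
    unfolding dbar_def using int z by simp
  also have "(\<lambda>x. \<Sum>j\<in>UNIV. dbar (\<lambda>v. u x * flux' z s j x v + U' x v * flux z s j x) j)
     = (\<lambda>x. u x * form' z s x + (\<Sum>j\<in>UNIV. dbar (U' x) j * flux z s j x))"
    unfolding divergence_flux[symmetric]
    by (simp add: fun_eq_iff dbar_add dbar_cmult dbar_multc sum.distrib sum_distrib_left)
  finally have "(\<integral>x. u x * form' z s x + (\<Sum>j\<in>UNIV. dbar (U' x) j * flux z s j x) \<partial>lborel) = 0" .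
  moreover have "integrable lborel (\<lambda>x. u x * form' z s x)"
    by (rule integrable_continuous_bounded_support[where R = R]) (auto intro!: continuous_intros u_cont form'_cont simp: supp)
  moreover have "integrable lborel (\<lambda>x. (\<Sum>j\<in>UNIV. dbar (U' x) j * flux z s j x))"
    unfolding dbar_def
    by (rule integrable_continuous_bounded_support[where R = R]) (auto intro!: continuous_intros U'_cont flux_cont simp: supp')
  ultimately show ?thesis by (simp add: eq_neg_iff_add_eq_0)
qed

lemma avg_deriv: "((\<lambda>s. avg z s) has_vector_derivative (\<integral>x. u x * form' z s x \<partial>lborel)) (at s within T)"
  and avg'_cont: "continuous_on UNIV (\<lambda>s. \<integral>x. u x * form' z s x \<partial>lborel)"
proof -
  obtain a b :: "complex^'n" where ab: "cball 0 R \<subseteq> cbox a b"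
    using bounded_subset_cbox_symmetric[OF bounded_cball] by metis
  have eq: "(\<integral>x. u x * F x \<partial>lborel) = integral (cbox a b) (\<lambda>x. u x * F x)" if F: "continuous_on UNIV F" for F
    by (rule lborel_integral_eq_cbox[OF _ _ ab]) (auto intro!: continuous_intros u_cont F simp: supp)
  have cu: "continuous_on UNIV (\<lambda>p::real \<times> (complex^'n). u (snd p))"
    by (rule continuous_on_compose2[OF u_cont]) (auto intro: continuous_intros)
  have cj: "continuous_on UNIV (\<lambda>(s, x). u x * form' z s x)"
    using continuous_on_mult[OF cu joint_cont(1)[of z, unfolded split_beta]] by (simp add: split_beta)
  have "((\<lambda>s. integral (cbox a b) (\<lambda>x. u x * form z s x)) has_vector_derivative
     integral (cbox a b) (\<lambda>x. u x * form' z s x)) (at s within UNIV)"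
  proof (rule leibniz_rule_vector_derivative)
    fix r x
    show "((\<lambda>s. u x * form z s x) has_vector_derivative u x * form' z r x) (at r within UNIV)"
      using has_vector_derivative_mult_right[OF form_deriv] by simp
    show "(\<lambda>x. u x * form z r x) integrable_on cbox a b"
      by (intro integrable_continuous continuous_intros continuous_on_subset[OF u_cont] continuous_on_subset[OF form_cont]) auto
    show "continuous_on (UNIV \<times> cbox a b) (\<lambda>(s, x). u x * form' z s x)"
      by (rule continuous_on_subset[OF cj]) auto
  qed auto
  then show "((\<lambda>s. avg z s) has_vector_derivative (\<integral>x. u x * form' z s x \<partial>lborel)) (at s within T)"
    unfolding avg_def eq[OF form_cont] eq[OF form'_cont] by (rule has_vector_derivative_at_within)
  show "continuous_on UNIV (\<lambda>s. \<integral>x. u x * form' z s x \<partial>lborel)"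
    unfolding eq[OF form'_cont]
    by (rule integral_continuous_on_param, rule continuous_on_subset[OF cj]) auto
qed

definition dbar_abs :: "complex^'n \<Rightarrow> real" where
  "dbar_abs x = (\<Sum>j\<in>UNIV. norm (dbar (U' x) j))"

lemma dbar_abs_cont: "continuous_on UNIV dbar_abs"
  unfolding dbar_abs_def dbar_def by (auto intro!: continuous_intros U'_cont)

lemma dbar_abs_nonneg: "0 \<le> dbar_abs x" unfolding dbar_abs_def by (intro sum_nonneg) auto

text \<open>
  The right-hand side does not depend on \<open>S\<close>, so the bound survives the limit
  \<open>S \<rightarrow> \<infinity>\<close>.
\<close>

lemma norm_avg_diff_le:
  assumes "0 \<le> S"
  shows "ennreal (norm (avg z S - avg z 0)) \<le>
    ennreal (exp (\<phi> z)) * (\<integral>\<^sup>+x. schur (x - z) * ennreal (dbar_abs x * exp (- \<phi> x)) \<partial>lborel)"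
proof -
  have [measurable]: "dbar_abs \<in> borel_measurable borel" "\<phi> \<in> borel_measurable borel"
    by (auto intro!: borel_measurable_continuous_onI dbar_abs_cont phi_cont)
  let ?D = "\<lambda>s. \<integral>x. u x * form' z s x \<partial>lborel"
  let ?F = "\<lambda>s x. flux_const * ((1 + s) ^ (CARD('n) - 1) * (norm (x - z) * exp (- (m + s) * (norm (x - z))\<^sup>2)))"
  have "has_bochner_integral lborel (\<lambda>s. indicator {0..S} s *\<^sub>R ?D s) (avg z S - avg z 0)"
    by (rule has_bochner_integral_FTC_Icc[OF assms]) (auto intro!: avg_deriv continuous_on_subset[OF avg'_cont])
  from has_bochner_integral_norm_bound[OF this]
  have "ennreal (norm (avg z S - avg z 0)) \<le> (\<integral>\<^sup>+s. ennreal (norm (indicator {0..S} s *\<^sub>R ?D s)) \<partial>lborel)" by simp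
  also have "\<dots> \<le> (\<integral>\<^sup>+s. (\<integral>\<^sup>+x. ennreal (exp (\<phi> z)) * (ennreal (?F s x) * indicator {0..} s * ennreal (dbar_abs x * exp (- \<phi> x))) \<partial>lborel) \<partial>lborel)"
  proof (rule nn_integral_mono)
    fix s :: real
    show "ennreal (norm (indicator {0..S} s *\<^sub>R ?D s)) \<le>
       (\<integral>\<^sup>+x. ennreal (exp (\<phi> z)) * (ennreal (?F s x) * indicator {0..} s * ennreal (dbar_abs x * exp (- \<phi> x))) \<partial>lborel)"
    proof (cases "s \<in> {0..S}")
      case True
      then have s: "0 \<le> s" by simp
      have int: "integrable lborel (\<lambda>x. (\<Sum>j\<in>UNIV. dbar (U' x) j * flux z s j x))"
        unfolding dbar_def
        by (rule integrable_continuous_bounded_support[where R = R]) (auto intro!: continuous_intros U'_cont flux_cont simp: supp')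
      have "ennreal (norm (?D s)) \<le> (\<integral>\<^sup>+x. ennreal (norm (\<Sum>j\<in>UNIV. dbar (U' x) j * flux z s j x)) \<partial>lborel)"
        unfolding integral_form'_eq norm_minus_cancel by (rule integral_norm_bound_ennreal[OF int])
      also have "\<dots> \<le> (\<integral>\<^sup>+x. ennreal (exp (\<phi> z)) * (ennreal (?F s x) * indicator {0..} s * ennreal (dbar_abs x * exp (- \<phi> x))) \<partial>lborel)"
      proof (rule nn_integral_mono)
        fix x
        have "norm (\<Sum>j\<in>UNIV. dbar (U' x) j * flux z s j x) \<le> (\<Sum>j\<in>UNIV. norm (dbar (U' x) j) * (exp (\<phi> z - \<phi> x) * ?F s x))"
          by (rule order_trans[OF norm_sum], intro sum_mono, unfold norm_mult, intro mult_left_mono order_trans[OF norm_flux_le[OF s]])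
            (auto simp: mult_ac)
        also have "\<dots> = exp (\<phi> z) * (?F s x * (dbar_abs x * exp (- \<phi> x)))"
        proof -
          have "exp (\<phi> z - \<phi> x) = exp (\<phi> z) * exp (- \<phi> x)" by (simp add: exp_add[symmetric])
          then show ?thesis unfolding dbar_abs_def sum_distrib_right[symmetric] by (simp only: mult_ac)
        qed
        finally have "ennreal (norm (\<Sum>j\<in>UNIV. dbar (U' x) j * flux z s j x)) \<le> ennreal (exp (\<phi> z) * (?F s x * (dbar_abs x * exp (- \<phi> x))))"
          by (rule ennreal_leI)
        also have "\<dots> = ennreal (exp (\<phi> z)) * (ennreal (?F s x) * indicator {0..} s * ennreal (dbar_abs x * exp (- \<phi> x)))"
          using s flux_const_nonneg dbar_abs_nonneg[of x] by (simp add: ennreal_mult)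
        finally show "ennreal (norm (\<Sum>j\<in>UNIV. dbar (U' x) j * flux z s j x)) \<le>
           ennreal (exp (\<phi> z)) * (ennreal (?F s x) * indicator {0..} s * ennreal (dbar_abs x * exp (- \<phi> x)))" .
      qed
      finally show ?thesis using True by simp
    qed simp
  qed
  also have "\<dots> = (\<integral>\<^sup>+x. (\<integral>\<^sup>+s. ennreal (exp (\<phi> z)) * (ennreal (?F s x) * indicator {0..} s * ennreal (dbar_abs x * exp (- \<phi> x))) \<partial>lborel) \<partial>lborel)"
    by (rule lborel_pair.Fubini') measurable
  also have "\<dots> = (\<integral>\<^sup>+x. ennreal (exp (\<phi> z)) * (schur (x - z) * ennreal (dbar_abs x * exp (- \<phi> x))) \<partial>lborel)"
    unfolding schur_def by (intro nn_integral_cong) (simp add: nn_integral_cmult nn_integral_multc)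
  also have "\<dots> = ennreal (exp (\<phi> z)) * (\<integral>\<^sup>+x. schur (x - z) * ennreal (dbar_abs x * exp (- \<phi> x)) \<partial>lborel)"
    by (rule nn_integral_cmult) measurable
  finally show ?thesis .
qed

text \<open>
  After the substitution \<open>x = z + v / sqrt s\<close> the factor \<open>s ^ CARD('n)\<close>
  in the determinant cancels the Jacobian, and the kernel converges to a Gaussian. The parameter
  runs through squares so that \<open>sqrt s\<close> is an integer.
\<close>

lemma avg_limit: "(\<lambda>k. avg z ((real (Suc k))\<^sup>2)) \<longlonglongrightarrow> of_real (gaussK TYPE('n)) * u z"
proof -
  define l where "l k = 1 / real (Suc k)" for k
  have l: "0 < l k" "l k \<le> 1" for k by (auto simp: l_def)
  have l0: "l \<longlonglongrightarrow> 0" unfolding l_def using LIMSEQ_inverse_real_of_nat by (simp add: inverse_eq_divide)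
  let ?S = "\<lambda>k. (real (Suc k))\<^sup>2"
  \<comment> \<open>The Jacobian matrix \<open>jac\<close> divided by \<open>s\<close> at the rescaled point; it tends to the unit matrix.\<close>
  let ?M = "\<lambda>k v. (\<chi> i j. of_real ((l k)\<^sup>2) * dbar (Q1 i (z + l k *\<^sub>R v)) j + (if i = j then 1 else 0)) :: complex^'n^'n"
  \<comment> \<open>The rescaled integrand, in the form in which its pointwise limit and a dominating function are visible.\<close>
  let ?H = "\<lambda>k v. u (z + l k *\<^sub>R v) * exp (- (cdot (q (z + l k *\<^sub>R v)) (l k *\<^sub>R v))) * of_real (exp (- (norm v)\<^sup>2)) * det (?M k v)"
  have H_eq: "?H k v = of_real ((l k)\<^sup>2) ^ CARD('n) * (u (z + l k *\<^sub>R v) * form z (?S k) (z + l k *\<^sub>R v))" for k v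
  proof -
    have ls: "(l k)\<^sup>2 * ?S k = 1" using l[of k] by (simp add: l_def power_divide)
    have "?M k v = (\<chi> i. of_real ((l k)\<^sup>2) *s jac (?S k) (z + l k *\<^sub>R v) $ i)"
    proof -
      have "of_real ((l k)\<^sup>2) * of_real (?S k) = (1::complex)"
        using ls by (simp only: of_real_mult[symmetric]) simp
      then show ?thesis by (simp add: vec_eq_iff jac_def algebra_simps del: of_nat_Suc of_real_power)
    qed
    then have d: "det (?M k v) = of_real ((l k)\<^sup>2) ^ CARD('n) * det (jac (?S k) (z + l k *\<^sub>R v))"
      using det_rows_mul[of "\<lambda>_. of_real ((l k)\<^sup>2)" "\<lambda>i. jac (?S k) (z + l k *\<^sub>R v) $ i"] by simp
    have n: "?S k * (norm (l k *\<^sub>R v))\<^sup>2 = (norm v)\<^sup>2"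
      using ls by (simp add: power_mult_distrib) (metis mult.assoc mult.commute mult_1)
    have e: "expker z (?S k) (z + l k *\<^sub>R v) = exp (- (cdot (q (z + l k *\<^sub>R v)) (l k *\<^sub>R v))) * of_real (exp (- (norm v)\<^sup>2))"
      unfolding expker_def add_diff_cancel_left' n by (simp add: exp_add[symmetric] exp_of_real[symmetric])
    show ?thesis unfolding form_def d e by (simp only: mult_ac)
  qed
  have uJ_cont: "continuous_on UNIV (\<lambda>x. u x * form z (?S k) x)" for k
    by (intro continuous_intros u_cont form_cont)
  have avg_eq: "avg z (?S k) = (\<integral>v. ?H k v \<partial>lborel)" for k
  proof -
    have meas: "(\<lambda>x. u x * form z (?S k) x) \<in> borel_measurable borel"
      by (intro borel_measurable_continuous_onI continuous_intros u_cont form_cont)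
    have "avg z (?S k) = (\<bar>l k\<bar> ^ DIM(complex^'n)) *\<^sub>R (\<integral>v. u (z + l k *\<^sub>R v) * form z (?S k) (z + l k *\<^sub>R v) \<partial>lborel)"
      unfolding avg_def using l[of k] by (intro lborel_integral_affine[OF meas]) auto
    also have "\<dots> = (\<integral>v. of_real ((l k)\<^sup>2) ^ CARD('n) * (u (z + l k *\<^sub>R v) * form z (?S k) (z + l k *\<^sub>R v)) \<partial>lborel)"
      using l[of k] by (simp add: scaleR_conv_of_real power_mult[symmetric] mult.commute)
    finally show ?thesis unfolding H_eq .
  qed
  have cE: "continuous_on UNIV (\<lambda>x. u x * exp (- cdot (q x) (x - z)))"
    unfolding cdot_def by (intro continuous_intros u_cont q_cont)
  obtain D where D: "0 \<le> D" "\<And>x. norm (u x * exp (- cdot (q x) (x - z))) \<le> D"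
    by (rule bounded_continuous_bounded_support[OF cE, of R]) (auto simp: supp)
  have lim_x: "(\<lambda>k. z + l k *\<^sub>R v) \<longlonglongrightarrow> z" for v :: "complex^'n"
    using tendsto_add[OF tendsto_const[of z] tendsto_scaleR[OF l0 tendsto_const[of v]]] by simp
  have cont_lim: "(\<lambda>k. F (z + l k *\<^sub>R v)) \<longlonglongrightarrow> F z" if "continuous_on UNIV F" for F :: "complex^'n \<Rightarrow> complex" and v
    using continuous_on_tendsto_compose[OF that lim_x] by simp
  have M_lim: "(\<lambda>k. det (?M k v)) \<longlonglongrightarrow> 1" for v
  proof -
    have e: "(\<lambda>k. ?M k v $ i $ j) \<longlonglongrightarrow> mat 1 $ i $ j" for i j
    proof -
      have "(\<lambda>k. of_real ((l k)\<^sup>2) * dbar (Q1 i (z + l k *\<^sub>R v)) j + (if i = j then 1 else 0)) \<longlonglongrightarrow> of_real (0\<^sup>2) * dbar (Q1 i z) j + (if i = j then 1 else (0::complex))"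
        unfolding dbar_def by (intro tendsto_intros l0 cont_lim Q1_cont) simp
      then show ?thesis by (simp add: mat_def)
    qed
    have "(\<lambda>k. det (?M k v)) \<longlonglongrightarrow> det (mat 1 :: complex^'n^'n)"
      unfolding det_def by (intro tendsto_intros e)
    then show ?thesis by simp
  qed
  have H_lim: "(\<lambda>k. ?H k v) \<longlonglongrightarrow> u z * of_real (exp (- (norm v)\<^sup>2))" for v
  proof -
    have "(\<lambda>k. cdot (q (z + l k *\<^sub>R v)) (l k *\<^sub>R v)) \<longlonglongrightarrow> (\<Sum>i\<in>UNIV. q z $ i * (0 *\<^sub>R v) $ i)"
      unfolding cdot_def by (intro tendsto_intros l0 cont_lim q_cont)
    then have "(\<lambda>k. ?H k v) \<longlonglongrightarrow> u z * exp (- (\<Sum>i\<in>UNIV. q z $ i * (0 *\<^sub>R v) $ i)) * of_real (exp (- (norm v)\<^sup>2)) * 1"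
      by (intro tendsto_intros M_lim cont_lim u_cont)
    then show ?thesis by simp
  qed
  have "(\<lambda>k. \<integral>v. ?H k v \<partial>lborel) \<longlonglongrightarrow> (\<integral>v. u z * of_real (exp (- (norm v)\<^sup>2)) \<partial>(lborel :: (complex^'n) measure))"
  proof (rule integral_dominated_convergence[where w = "\<lambda>v. D * (fact CARD('n) * (B + 1) ^ CARD('n)) * exp (- (norm v)\<^sup>2)"])
    show "integrable lborel (\<lambda>v::complex^'n. D * (fact CARD('n) * (B + 1) ^ CARD('n)) * exp (- (norm v)\<^sup>2))"
      by (intro integrable_mult_right integrable_gauss)
    show "(\<lambda>v. ?H k v) \<in> borel_measurable lborel" for k
    proof -
      have "continuous_on UNIV (\<lambda>v. ?H k v)"
        unfolding H_eq by (intro continuous_on_mult continuous_on_const continuous_on_compose2[OF uJ_cont] continuous_intros) auto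
      then show ?thesis by (simp add: borel_measurable_continuous_onI)
    qed
    show "AE v in lborel. norm (?H k v) \<le> D * (fact CARD('n) * (B + 1) ^ CARD('n)) * exp (- (norm v)\<^sup>2)" for k
    proof (rule AE_I2)
      fix v :: "complex^'n"
      have "norm (?M k v $ i $ j) \<le> B + 1" for i j
      proof -
        have "norm (of_real ((l k)\<^sup>2) * dbar (Q1 i (z + l k *\<^sub>R v)) j) \<le> 1 * B"
          unfolding norm_mult using l[of k] by (intro mult_mono dbarQ) (auto simp: norm_power power_le_one)
        then show ?thesis
          using norm_triangle_ineq[of "of_real ((l k)\<^sup>2) * dbar (Q1 i (z + l k *\<^sub>R v)) j" "if i = j then 1 else 0"] by (auto split: if_splits)
      qed
      then have d: "norm (det (?M k v)) \<le> fact CARD('n) * (B + 1) ^ CARD('n)"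
        using norm_det_le[of "?M k v" "\<lambda>_. B + 1"] B by simp
      have "norm (?H k v) = norm (u (z + l k *\<^sub>R v) * exp (- cdot (q (z + l k *\<^sub>R v)) (z + l k *\<^sub>R v - z))) * exp (- (norm v)\<^sup>2) * norm (det (?M k v))"
        by (simp add: norm_mult)
      also have "\<dots> \<le> D * exp (- (norm v)\<^sup>2) * (fact CARD('n) * (B + 1) ^ CARD('n))"
        using D(1) by (intro mult_mono[OF mult_right_mono[OF D(2)] d]) auto
      finally show "norm (?H k v) \<le> D * (fact CARD('n) * (B + 1) ^ CARD('n)) * exp (- (norm v)\<^sup>2)" by (simp add: mult_ac)
    qed
  qed (use H_lim in auto)
  then show ?thesis unfolding avg_eq by (simp only: gaussK_def mult.commute integral_mult_right_zero integral_complex_of_real)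
qed

text \<open>
  The function \<open>h\<close> corrects \<open>u\<close> to the solution \<open>u - h\<close> of
  the d-bar equation with right-hand side \<open>dbar u\<close> given by the kernel, and
  \<open>nn_integral_convolution_square_le\<close> bounds that solution operator on the weighted
  space.
\<close>

lemma weighted_L2_solution:
  defines "h \<equiv> \<lambda>z. avg z 0 / of_real (gaussK TYPE('n))"
  shows "h \<in> holo UNIV"
    and "(\<integral>\<^sup>+z. ennreal ((norm (u z - h z))\<^sup>2 * exp (- 2 * \<phi> z)) \<partial>lborel)
      \<le> (ennreal (1 / gaussK TYPE('n)) * (\<integral>\<^sup>+w. schur w \<partial>lborel))\<^sup>2 *
        (\<integral>\<^sup>+x. ennreal ((dbar_abs x)\<^sup>2 * exp (- 2 * \<phi> x)) \<partial>lborel)"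
proof -
  let ?K = "gaussK TYPE('n)"
  have K: "0 < ?K" by (rule gaussK_pos)
  have "(\<lambda>z. \<integral>x. (u x * det (jac 0 x) / of_real ?K) * exp (cdot (q x) (z - x)) \<partial>lborel) \<in> holo UNIV"
    by (rule holo_compact_exp_integral[where R = R])
       (use K in \<open>auto intro!: continuous_intros u_cont q_cont continuous_on_det simp: supp jac_def dbar_def intro!: Q1_cont\<close>)
  also have "(\<lambda>z. \<integral>x. (u x * det (jac 0 x) / of_real ?K) * exp (cdot (q x) (z - x)) \<partial>lborel) = h"
  proof
    fix z
    have "(\<lambda>x. (u x * det (jac 0 x) / of_real ?K) * exp (cdot (q x) (z - x))) = (\<lambda>x. (u x * form z 0 x) / of_real ?K)"
      by (simp add: form_def expker_def fun_eq_iff cdot_diff mult_ac)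
    then show "(\<integral>x. (u x * det (jac 0 x) / of_real ?K) * exp (cdot (q x) (z - x)) \<partial>lborel) = h z"
      by (simp add: h_def avg_def)
  qed
  finally show "h \<in> holo UNIV" .
  have [measurable]: "dbar_abs \<in> borel_measurable borel" "\<phi> \<in> borel_measurable borel"
    by (auto intro!: borel_measurable_continuous_onI dbar_abs_cont phi_cont)
  let ?f = "\<lambda>x. ennreal (dbar_abs x * exp (- \<phi> x))"
  let ?c = "\<lambda>z. \<integral>\<^sup>+x. schur (x - z) * ?f x \<partial>lborel"
  have pt: "ennreal ((norm (u z - h z))\<^sup>2 * exp (- 2 * \<phi> z)) \<le> (ennreal (1 / ?K))\<^sup>2 * (?c z)\<^sup>2" for z
  proof -
    have "(\<lambda>k. ennreal (norm (avg z ((real (Suc k))\<^sup>2) - avg z 0))) \<longlonglongrightarrow> ennreal (norm (of_real ?K * u z - avg z 0))"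
      by (intro tendsto_intros tendsto_ennrealI avg_limit)
    then have "ennreal (norm (of_real ?K * u z - avg z 0)) \<le> ennreal (exp (\<phi> z)) * ?c z"
      by (rule LIMSEQ_le_const2) (auto intro!: norm_avg_diff_le exI[of _ 0])
    moreover have "of_real ?K * u z - avg z 0 = of_real ?K * (u z - h z)"
      using K by (simp add: h_def field_simps)
    ultimately have le: "ennreal (?K * norm (u z - h z)) \<le> ennreal (exp (\<phi> z)) * ?c z"
      using K by (simp add: norm_mult)
    have "ennreal (norm (u z - h z) * exp (- \<phi> z)) = ennreal (exp (- \<phi> z) / ?K) * ennreal (?K * norm (u z - h z))"
      using K by (subst ennreal_mult[symmetric]) auto
    also have "\<dots> \<le> ennreal (exp (- \<phi> z) / ?K) * (ennreal (exp (\<phi> z)) * ?c z)"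
      by (intro mult_left_mono le) auto
    also have "\<dots> = ennreal (1 / ?K) * ?c z"
      unfolding mult.assoc[symmetric] using K by (subst ennreal_mult[symmetric]) (auto simp: exp_minus)
    finally have le2: "ennreal (norm (u z - h z) * exp (- \<phi> z)) \<le> ennreal (1 / ?K) * ?c z" .
    have "ennreal ((norm (u z - h z))\<^sup>2 * exp (- 2 * \<phi> z)) = (ennreal (norm (u z - h z) * exp (- \<phi> z)))\<^sup>2"
      by (simp add: ennreal_power power_mult_distrib exp_double[symmetric])
    also have "\<dots> \<le> (ennreal (1 / ?K) * ?c z)\<^sup>2" by (intro power_mono le2) auto
    finally show ?thesis by (simp add: power_mult_distrib)
  qed
  have "(\<integral>\<^sup>+z. ennreal ((norm (u z - h z))\<^sup>2 * exp (- 2 * \<phi> z)) \<partial>lborel) \<le> (\<integral>\<^sup>+z. (ennreal (1 / ?K))\<^sup>2 * (?c z)\<^sup>2 \<partial>lborel)"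
    by (intro nn_integral_mono pt)
  also have "\<dots> = (ennreal (1 / ?K))\<^sup>2 * (\<integral>\<^sup>+z. (?c z)\<^sup>2 \<partial>lborel)"
    by (rule nn_integral_cmult) measurable
  also have "\<dots> \<le> (ennreal (1 / ?K))\<^sup>2 * ((\<integral>\<^sup>+w. schur w \<partial>lborel)\<^sup>2 * (\<integral>\<^sup>+x. (?f x)\<^sup>2 \<partial>lborel))"
    by (intro mult_left_mono nn_integral_convolution_square_le) auto
  also have "(\<integral>\<^sup>+x. (?f x)\<^sup>2 \<partial>lborel) = (\<integral>\<^sup>+x. ennreal ((dbar_abs x)\<^sup>2 * exp (- 2 * \<phi> x)) \<partial>lborel)"
    using dbar_abs_nonneg by (simp add: ennreal_power power_mult_distrib exp_double[symmetric])
  finally show "(\<integral>\<^sup>+z. ennreal ((norm (u z - h z))\<^sup>2 * exp (- 2 * \<phi> z)) \<partial>lborel)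
      \<le> (ennreal (1 / gaussK TYPE('n)) * (\<integral>\<^sup>+w. schur w \<partial>lborel))\<^sup>2 *
        (\<integral>\<^sup>+x. ennreal ((dbar_abs x)\<^sup>2 * exp (- 2 * \<phi> x)) \<partial>lborel)"
    by (simp add: power_mult_distrib mult.assoc)
qed

end

end

section \<open>Polynomial bumps and first derivatives of holomorphic functions\<close>

text \<open>
  A power of \<open>1 - \<bar>w\<bar>\<^sup>2\<close> cut off at the unit sphere is radial,
  explicit and \<open>k - 1\<close> times continuously differentiable, and its derivatives are
  lower powers times polynomials.
\<close>

definition bump :: "nat \<Rightarrow> 'a::real_inner \<Rightarrow> real" where
  "bump k w = (max 0 (1 - (norm w)\<^sup>2)) ^ k"

lemma bump_nonneg: "0 \<le> bump k w" by (simp add: bump_def)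
lemma bump_le_1: "bump k w \<le> 1" by (auto simp: bump_def intro!: power_le_one)
lemma bump_outside: "0 < k \<Longrightarrow> 1 \<le> norm w \<Longrightarrow> bump k w = 0"
proof -
  assume "0 < k" "1 \<le> norm w"
  then have "1 - (norm w)\<^sup>2 \<le> 0" using one_le_power[of "norm w" 2] by simp
  then have "max 0 (1 - (norm w)\<^sup>2) = 0" by simp
  then show ?thesis using \<open>0 < k\<close> unfolding bump_def by (metis zero_power)
qed
lemma bump_minus: "bump k (- w) = bump k w" by (simp add: bump_def)
lemma bump_cont: "continuous_on S (bump k)"
  unfolding bump_def by (intro continuous_intros)

lemma has_real_derivative_pos_part_power:
  assumes "1 \<le> k"
  shows "((\<lambda>x::real. (max 0 x) ^ Suc k) has_real_derivative (real (Suc k) * (max 0 x) ^ k)) (at x)"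
proof (cases x "0::real" rule: linorder_cases)
  case greater
  have "((\<lambda>x::real. x ^ Suc k) has_real_derivative (real (Suc k) * x ^ k)) (at x)"
    by (auto intro!: derivative_eq_intros simp del: power_Suc)
  then show ?thesis using greater
    by (auto simp: max_def elim!: has_field_derivative_transform_within_open[where S = "{0<..}"])
next
  case less
  have "((\<lambda>x::real. (max 0 x) ^ Suc k) has_real_derivative 0) (at x)"
    by (rule has_field_derivative_transform_within_open[where S = "{..<0}" and f = "\<lambda>_. 0"]) (use less in auto)
  moreover have "max 0 x ^ k = 0" using less assms by (simp add: max_def)
  ultimately show ?thesis by (simp only: mult_zero_right)
next
  case equal
  have "((\<lambda>y. ((max 0 y) ^ Suc k - (max 0 0) ^ Suc k) / (y - 0)) \<longlongrightarrow> 0) (at (0::real))"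
  proof (rule Lim_null_comparison[where g = "\<lambda>y. \<bar>y\<bar> ^ k"])
    show "\<forall>\<^sub>F y in at (0::real). norm (((max 0 y) ^ Suc k - (max 0 0) ^ Suc k) / (y - 0)) \<le> \<bar>y\<bar> ^ k"
    proof (intro always_eventually allI)
      fix y :: real
      show "norm (((max 0 y) ^ Suc k - (max 0 0) ^ Suc k) / (y - 0)) \<le> \<bar>y\<bar> ^ k"
      proof (cases "0 < y")
        case False
        then have "max 0 y = 0" by simp
        then show ?thesis by (simp only:) simp
      qed (simp add: abs_mult)
    qed
    show "((\<lambda>y. \<bar>y\<bar> ^ k) \<longlongrightarrow> 0) (at (0::real))"
      using assms by (auto intro!: tendsto_eq_intros)
  qed
  moreover have "max 0 x ^ k = 0" using equal assms by simp
  ultimately show ?thesis using equal by (simp only: has_field_derivative_iff mult_zero_right)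
qed

lemma bump_has_derivative:
  assumes "1 \<le> k"
  shows "(bump (Suc k) has_derivative (\<lambda>v. - 2 * real (Suc k) * bump k w * (w \<bullet> v))) (at w)"
proof -
  have 1: "((\<lambda>w. 1 - (norm w)\<^sup>2) has_derivative (\<lambda>v. - 2 * (w \<bullet> v))) (at w)"
    unfolding power2_norm_eq_inner by (auto intro!: derivative_eq_intros simp: inner_commute)
  show ?thesis
    unfolding bump_def[abs_def]
    by (rule has_derivative_eq_rhs[OF has_derivative_compose[OF 1 has_real_derivative_pos_part_power[OF assms, unfolded has_field_derivative_def]]])
      (simp only: fun_eq_iff mult_ac, simp)
qed

lemma bounded_linear_smult_vec: "bounded_linear (\<lambda>c::complex. c *s (v :: complex^'n))"
  unfolding linear_conv_bounded_linear[symmetric]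
  by (intro linearI) (simp_all add: vec_eq_iff algebra_simps)

lemma norm_smult_vec: "norm (c *s (v :: complex^'n)) = norm c * norm v"
  by (simp add: norm_vec_def L2_set_def norm_mult power_mult_distrib sum_distrib_left[symmetric] real_sqrt_mult)

definition hder :: "(complex^'n \<Rightarrow> complex) \<Rightarrow> complex^'n \<Rightarrow> complex^'n \<Rightarrow> complex" where
  "hder h z = (SOME D. (h has_derivative D) (at z) \<and> (\<forall>c v. D (c *s v) = c * D v))"

lemma hder:
  assumes "h \<in> holo S" "z \<in> S"
  shows "(h has_derivative hder h z) (at z)" "hder h z (c *s v) = c * hder h z v"
proof -
  have ex: "\<exists>D. (h has_derivative D) (at z) \<and> (\<forall>c v. D (c *s v) = c * D v)"
    using assms by (simp add: holo_def)
  have "(h has_derivative hder h z) (at z) \<and> (\<forall>c v. hder h z (c *s v) = c * hder h z v)"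
    using someI_ex[OF ex] unfolding hder_def by blast
  then show "(h has_derivative hder h z) (at z)" "hder h z (c *s v) = c * hder h z v" by auto
qed

lemma holo_continuous_on: "h \<in> holo S \<Longrightarrow> continuous_on S h"
  by (intro continuous_at_imp_continuous_on ballI has_derivative_continuous) (rule hder)

lemma holo_subset: "h \<in> holo S \<Longrightarrow> T \<subseteq> S \<Longrightarrow> h \<in> holo T"
  by (auto simp: holo_def)

lemma holo_line_derivative:
  assumes "h \<in> holo S" "z + c *s v \<in> S"
  shows "((\<lambda>c. h (z + c *s v)) has_field_derivative hder h (z + c *s v) v) (at c)"
proof -
  have "((\<lambda>c. z + c *s v) has_derivative (\<lambda>c. c *s v)) (at c)"
    using has_derivative_add[OF has_derivative_const bounded_linear_imp_has_derivative[OF bounded_linear_smult_vec[of v]]] by simp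
  from has_derivative_compose[OF this hder(1)[OF assms]]
  show ?thesis unfolding has_field_derivative_def by (simp add: hder(2)[OF assms] mult.commute[of _ "hder h (z + c *s v) v"])
qed

text \<open>
  On a complex line through \<open>z\<close> in direction \<open>v\<close>, Cauchy's inequality
  bounds the derivative of the difference of the restrictions of \<open>h\<close> to two parallel
  lines by the supremum of that difference, which is small by uniform continuity.
\<close>

lemma hder_continuous_on:
  assumes h: "h \<in> holo S" and S: "open S"
  shows "continuous_on S (\<lambda>z. hder h z v)"
proof (rule continuous_at_imp_continuous_on, rule ballI)
  fix z0 assume z0: "z0 \<in> S"
  obtain r' where r': "0 < r'" "cball z0 r' \<subseteq> S"
    using S z0 open_contains_cball by blast
  define r where "r = r' / 2"
  have r: "0 < r" "cball z0 (2 * r) \<subseteq> S" using r' by (auto simp: r_def)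
  define \<rho> where "\<rho> = r / (norm v + 1)"
  have nv: "0 < norm v + 1" using norm_ge_zero[of v] by linarith
  have \<rho>: "0 < \<rho>" "\<rho> * norm v \<le> r"
    using r nv by (auto simp: \<rho>_def field_simps)
  have in_ball: "z + c *s v \<in> cball z0 (2 * r)" if "z \<in> ball z0 r" "norm c \<le> \<rho>" for z and c :: complex
  proof -
    have "norm (c *s v) \<le> r"
      using that mult_right_mono[of "norm c" \<rho> "norm v"] \<rho> by (simp add: norm_smult_vec)
    then show ?thesis using that norm_triangle_ineq4[of "z0 - z" "c *s v"] by (simp add: dist_norm algebra_simps)
  qed
  have uc: "uniformly_continuous_on (cball z0 (2 * r)) h"
    by (intro compact_uniformly_continuous continuous_on_subset[OF holo_continuous_on[OF h] r(2)]) auto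
  show "isCont (\<lambda>z. hder h z v) z0"
    unfolding continuous_at_eps_delta
  proof (intro allI impI)
    fix e :: real assume e: "0 < e"
    obtain d where d: "0 < d" "\<And>x y. x \<in> cball z0 (2 * r) \<Longrightarrow> y \<in> cball z0 (2 * r) \<Longrightarrow> dist y x < d \<Longrightarrow> dist (h y) (h x) < e * \<rho> / 2"
      using uc e \<rho> unfolding uniformly_continuous_on_def by (metis half_gt_zero mult_pos_pos)
    have "dist (hder h z v) (hder h z0 v) < e" if z: "dist z z0 < min d r" for z
    proof -
      let ?f = "\<lambda>c. h (z + c *s v) - h (z0 + c *s v)"
      have zb: "z \<in> ball z0 r" "z0 \<in> ball z0 r" using z r by (auto simp: dist_commute)
      have der: "(?f has_field_derivative (hder h (z + c *s v) v - hder h (z0 + c *s v) v)) (at c)" if "norm c \<le> \<rho>" for c :: complex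
        using in_ball[OF zb(1) that] in_ball[OF zb(2) that] r(2)
        by (intro DERIV_diff holo_line_derivative[OF h]) auto
      have "norm ((deriv ^^ 1) ?f 0) \<le> fact 1 * (e * \<rho> / 2) / \<rho> ^ 1"
      proof (rule Cauchy_inequality)
        show "?f holomorphic_on ball 0 \<rho>"
        proof (rule holomorphic_onI)
          fix c :: complex assume "c \<in> ball 0 \<rho>"
          then have "norm c \<le> \<rho>" by simp
          then show "?f field_differentiable at c within ball 0 \<rho>"
            using der field_differentiable_at_within unfolding field_differentiable_def by blast
        qed
        show "continuous_on (cball 0 \<rho>) ?f"
        proof (rule continuous_at_imp_continuous_on, rule ballI)
          fix c :: complex assume "c \<in> cball 0 \<rho>"
          then have "norm c \<le> \<rho>" by simp
          then show "isCont ?f c" by (rule DERIV_isCont[OF der])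
        qed
        fix c :: complex assume "norm (0 - c) = \<rho>"
        then have c: "norm c \<le> \<rho>" by simp
        have "dist (h (z + c *s v)) (h (z0 + c *s v)) < e * \<rho> / 2"
          using z by (intro d in_ball zb c) (auto simp: dist_norm)
        then show "norm (?f c) \<le> e * \<rho> / 2" by (simp add: dist_norm)
      qed (use \<rho> in auto)
      moreover have "deriv ?f 0 = hder h z v - hder h z0 v"
        using DERIV_imp_deriv[OF der[of 0]] \<rho> by simp
      ultimately show ?thesis using \<rho> e by (simp add: dist_norm)
    qed
    then show "\<exists>d>0. \<forall>z. dist z z0 < d \<longrightarrow> dist (hder h z v) (hder h z0 v) < e"
      using d r by (intro exI[of _ "min d r"]) auto
  qed
qed

section \<open>Convolution with a radial bump\<close>

definition bmass :: "'a::euclidean_space itself \<Rightarrow> real" where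
  "bmass _ = (\<integral>x. bump 4 (x :: 'a) \<partial>lborel)"

lemma bump_integrable: "0 < k \<Longrightarrow> integrable lborel (bump k :: 'a::euclidean_space \<Rightarrow> real)"
  by (rule integrable_continuous_bounded_support[where R = 1]) (auto simp: bump_cont bump_outside)

lemma bmass_pos: "0 < bmass TYPE('a::euclidean_space)"
proof -
  have "(1/2) * indicator (ball 0 (1/3)) x \<le> bump 4 (x::'a)" for x
  proof (cases "x \<in> ball 0 (1/3)")
    case True
    then have "(norm x)\<^sup>2 \<le> (1/3)\<^sup>2" by (intro power_mono) auto
    then have "8/9 \<le> 1 - (norm x)\<^sup>2" by (simp add: power_divide)
    then have "8/9 \<le> max 0 (1 - (norm x)\<^sup>2)" by linarith
    then have "(8/9)^4 \<le> bump 4 x" unfolding bump_def by (rule power_mono) simp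
    then show ?thesis using True by (simp add: power_divide)
  qed (simp add: bump_nonneg)
  then have le: "(\<integral>x. (1/2) * indicator (ball (0::'a) (1/3)) x \<partial>lborel) \<le> bmass TYPE('a)"
    unfolding bmass_def by (intro integral_mono bump_integrable integrable_mult_right integrable_real_indicator)
      (auto intro!: emeasure_bounded_finite[unfolded infinity_ennreal_def])
  have pos: "0 < measure lborel (ball (0::'a) (1/3))"
    using content_ball_pos[of "1/3" "0::'a"] by (simp add: measure_completion)
  have "(\<integral>x. (1/2) * indicator (ball (0::'a) (1/3)) x \<partial>lborel) = (1/2) * measure lborel (ball (0::'a) (1/3))"
    by simp
  then show ?thesis using le pos by linarith
qed

text \<open>
  The fourth power makes \<open>rho\<close> three times differentiable with bounded derivatives,
  so that a convolution with \<open>rho\<close> can be differentiated twice with a quadratic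
  control of the error.
\<close>

definition rho :: "'a::euclidean_space \<Rightarrow> real" where
  "rho w = bump 4 w / bmass TYPE('a)"
definition rho' :: "'a::euclidean_space \<Rightarrow> 'a \<Rightarrow> real" where
  "rho' w v = (- 4 * bump 3 w / bmass TYPE('a)) * (2 * (w \<bullet> v))"
definition rho'' :: "'a::euclidean_space \<Rightarrow> 'a \<Rightarrow> 'a \<Rightarrow> real" where
  "rho'' w v u = (48 * bump 2 w * (w \<bullet> u) * (w \<bullet> v) - 8 * bump 3 w * (u \<bullet> v)) / bmass TYPE('a)"
definition rho''' :: "'a::euclidean_space \<Rightarrow> 'a \<Rightarrow> 'a \<Rightarrow> 'a \<Rightarrow> real" where
  "rho''' w v u t = (48 * ((- 4 * bump 1 w * (w \<bullet> t)) * (w \<bullet> u) * (w \<bullet> v)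
      + bump 2 w * ((t \<bullet> u) * (w \<bullet> v) + (w \<bullet> u) * (t \<bullet> v)) + bump 2 w * (w \<bullet> t) * (u \<bullet> v))) / bmass TYPE('a)"

lemma bump_has_derivative': "(bump 4 has_derivative (\<lambda>v. - 8 * bump 3 w * (w \<bullet> v))) (at w)"
  "(bump 3 has_derivative (\<lambda>v. - 6 * bump 2 w * (w \<bullet> v))) (at w)"
  "(bump 2 has_derivative (\<lambda>v. - 4 * bump 1 w * (w \<bullet> v))) (at w)"
  using bump_has_derivative[of 3 w] bump_has_derivative[of 2 w] bump_has_derivative[of 1 w]
  by (simp_all add: eval_nat_numeral)

lemma rho_deriv: "(rho has_derivative rho' w) (at w)"
  unfolding rho_def[abs_def] rho'_def[abs_def]
  using bmass_pos[where 'a='a] by (auto intro!: derivative_eq_intros bump_has_derivative' simp: field_simps)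

lemma rho'_deriv: "((\<lambda>w. rho' w v) has_derivative rho'' w v) (at w)"
  unfolding rho'_def[abs_def] rho''_def[abs_def]
  using bmass_pos[where 'a='a] by (auto intro!: derivative_eq_intros bump_has_derivative' simp: fun_eq_iff field_simps)

lemma rho''_deriv: "((\<lambda>w. rho'' w v u) has_derivative rho''' w v u) (at w)"
  unfolding rho''_def[abs_def] rho'''_def[abs_def]
  using bmass_pos[where 'a='a] by (auto intro!: derivative_eq_intros bump_has_derivative' simp: fun_eq_iff field_simps)

lemma rho_nonneg: "0 \<le> rho w"
  using bmass_pos[where 'a='a] by (simp add: rho_def bump_nonneg)

lemma rho_le: "rho (w::'a::euclidean_space) \<le> 1 / bmass TYPE('a)"
  using bmass_pos[where 'a='a] bump_le_1[of 4 w] by (simp add: rho_def divide_right_mono)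

lemma abs_rho_le: "\<bar>rho (w::'a::euclidean_space)\<bar> \<le> 1 / bmass TYPE('a)"
  by (simp add: rho_nonneg rho_le)

lemma rho_minus: "rho (- w) = rho w" by (simp add: rho_def bump_minus)

lemma rho_outside: "1 \<le> norm w \<Longrightarrow> rho w = 0" "1 \<le> norm w \<Longrightarrow> rho' w v = 0" "1 \<le> norm w \<Longrightarrow> rho'' w v u = 0"
  "1 \<le> norm w \<Longrightarrow> rho''' w v u t = 0"
  by (simp_all add: rho_def rho'_def rho''_def rho'''_def bump_outside)

lemma rho_integral: "(\<integral>w. rho (w::'a::euclidean_space) \<partial>lborel) = 1"
  using bmass_pos[where 'a='a] by (simp add: rho_def bmass_def)

lemma rho_shift_continuous: "continuous_on UNIV (\<lambda>x. rho (z - x))"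
  by (rule continuous_on_compose2[OF has_derivative_imp_continuous_on[OF rho_deriv, of UNIV]])
     (auto intro: continuous_intros)

lemma rho_shift_outside: "norm x > norm z + 1 \<Longrightarrow> rho (z - x) = 0"
  using norm_triangle_ineq2[of x z] by (intro rho_outside) (simp add: norm_minus_commute)

lemma rho_shift_integrable: "integrable lborel (\<lambda>x. rho (z - x))"
  by (rule integrable_continuous_bounded_support[OF rho_shift_continuous rho_shift_outside])

lemma rho_borel: "rho \<in> borel_measurable borel" "(\<lambda>w. rho' w v) \<in> borel_measurable borel"
  by (intro borel_measurable_continuous_onI has_derivative_imp_continuous_on[OF rho_deriv]
     has_derivative_imp_continuous_on[OF rho'_deriv])+

lemma rho_shift_integral: "(\<integral>x. rho (z - x) \<partial>lborel) = 1"
  using lborel_integral_affine[OF rho_borel(1), of "-1" z] by (simp add: rho_integral)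

lemma norm_inner_unit: "norm w \<le> 1 \<Longrightarrow> \<bar>w \<bullet> v\<bar> \<le> norm v"
  by (rule order_trans[OF Cauchy_Schwarz_ineq2]) (simp add: mult_left_le_one_le)

lemma abs_bump: "\<bar>bump k w\<bar> \<le> 1" using bump_nonneg[of k w] bump_le_1[of k w] by simp

lemma rho'_bound: "\<bar>rho' (w::'a::euclidean_space) v\<bar> \<le> 8 / bmass TYPE('a) * norm v"
proof (cases "norm w \<le> 1")
  case True
  have "\<bar>bump 3 w * (w \<bullet> v)\<bar> \<le> 1 * norm v"
    unfolding abs_mult using norm_inner_unit[OF True] abs_bump[of 3 w] by (intro mult_mono) auto
  then have "8 * \<bar>bump 3 w * (w \<bullet> v)\<bar> / bmass TYPE('a) \<le> 8 * norm v / bmass TYPE('a)"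
    using bmass_pos[where 'a='a] by (intro divide_right_mono) auto
  moreover have "\<bar>rho' w v\<bar> = 8 * \<bar>bump 3 w * (w \<bullet> v)\<bar> / bmass TYPE('a)"
    using bmass_pos[where 'a='a] by (simp add: rho'_def abs_mult)
  ultimately show ?thesis by simp
next
  case False
  then show ?thesis using bmass_pos[where 'a='a] by (simp add: rho_outside)
qed

lemma rho''_bound: "\<bar>rho'' (w::'a::euclidean_space) v u\<bar> \<le> 56 / bmass TYPE('a) * norm v * norm u"
proof (cases "norm w \<le> 1")
  case True
  have 1: "\<bar>bump 2 w * (w \<bullet> u) * (w \<bullet> v)\<bar> \<le> 1 * norm u * norm v"
    unfolding abs_mult using norm_inner_unit[OF True] abs_bump[of 2 w] by (intro mult_mono) auto
  have 2: "\<bar>bump 3 w * (u \<bullet> v)\<bar> \<le> 1 * (norm u * norm v)"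
    unfolding abs_mult using Cauchy_Schwarz_ineq2[of u v] abs_bump[of 3 w] by (intro mult_mono) auto
  have "\<bar>48 * bump 2 w * (w \<bullet> u) * (w \<bullet> v) - 8 * bump 3 w * (u \<bullet> v)\<bar> \<le> 56 * norm v * norm u"
    using 1 2 by (simp add: abs_le_iff mult_ac)
  then show ?thesis using bmass_pos[where 'a='a] by (simp add: rho''_def divide_right_mono)
next
  case False
  then show ?thesis using bmass_pos[where 'a='a] by (simp add: rho_outside)
qed

lemma rho'''_bound: "\<bar>rho''' (w::'a::euclidean_space) v u t\<bar> \<le> 336 / bmass TYPE('a) * norm v * norm u * norm t"
proof (cases "norm w \<le> 1")
  case True
  note i = norm_inner_unit[OF True]
  have cs: "\<bar>a \<bullet> b\<bar> \<le> norm a * norm b" for a b :: 'a by (rule Cauchy_Schwarz_ineq2)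
  have 1: "\<bar>bump 1 w * (w \<bullet> t) * (w \<bullet> u) * (w \<bullet> v)\<bar> \<le> 1 * norm t * norm u * norm v"
    unfolding abs_mult using i abs_bump[of 1 w] by (intro mult_mono) auto
  have 2: "\<bar>bump 2 w * (t \<bullet> u) * (w \<bullet> v)\<bar> \<le> 1 * (norm t * norm u) * norm v"
    unfolding abs_mult using i cs abs_bump[of 2 w] by (intro mult_mono) auto
  have 3: "\<bar>bump 2 w * (w \<bullet> u) * (t \<bullet> v)\<bar> \<le> 1 * norm u * (norm t * norm v)"
    unfolding abs_mult using i cs abs_bump[of 2 w] by (intro mult_mono) auto
  have 4: "\<bar>bump 2 w * (w \<bullet> t) * (u \<bullet> v)\<bar> \<le> 1 * norm t * (norm u * norm v)"
    unfolding abs_mult using i cs abs_bump[of 2 w] by (intro mult_mono) auto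
  have "\<bar>48 * ((- 4 * bump 1 w * (w \<bullet> t)) * (w \<bullet> u) * (w \<bullet> v)
      + bump 2 w * ((t \<bullet> u) * (w \<bullet> v) + (w \<bullet> u) * (t \<bullet> v)) + bump 2 w * (w \<bullet> t) * (u \<bullet> v))\<bar> \<le> 336 * norm v * norm u * norm t"
    using 1 2 3 4 by (simp add: abs_le_iff algebra_simps)
  then show ?thesis using bmass_pos[where 'a='a] by (simp add: rho'''_def divide_right_mono)
next
  case False
  then show ?thesis using bmass_pos[where 'a='a] by (simp add: rho_outside)
qed

text \<open>
  The constant is not the optimal \<open>C / 2\<close>: the mean value inequality is applied
  twice, without integrating.
\<close>

lemma quadratic_remainder:
  fixes K :: "'a::euclidean_space \<Rightarrow> real"
  assumes K: "\<And>w. (K has_derivative K' w) (at w)"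
    and K': "\<And>w v. ((\<lambda>w. K' w v) has_derivative K'' w v) (at w)"
    and C: "\<And>w v u. \<bar>K'' w v u\<bar> \<le> C * norm v * norm u"
  shows "\<bar>K (w + v) - K w - K' w v\<bar> \<le> C * (norm v)\<^sup>2"
proof -
  have C0: "0 \<le> C * norm v * norm u" for u :: 'a using C[of w v u] by linarith
  have 1: "\<bar>K' (w + s *\<^sub>R v) v - K' w v\<bar> \<le> C * (norm v)\<^sup>2" if "s \<in> {0..1}" for s
  proof -
    have "norm (K' (w + s *\<^sub>R v) v - K' w v) \<le> (C * norm v) * norm (w + s *\<^sub>R v - w)"
    proof (rule differentiable_bound[where S = UNIV and f' = "\<lambda>w. K'' w v"])
      fix x :: 'a
      show "onorm (K'' x v) \<le> C * norm v" by (rule onorm_le) (use C in simp)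
    qed (use K' in auto)
    also have "\<dots> = (C * (norm v)\<^sup>2) * s" using that by (simp add: power2_eq_square)
    also have "\<dots> \<le> (C * (norm v)\<^sup>2) * 1" using that C0[of v] by (intro mult_left_mono) (auto simp: power2_eq_square mult.assoc)
    finally show ?thesis by simp
  qed
  let ?f = "\<lambda>s. K (w + s *\<^sub>R v) - s * K' w v"
  have "norm (?f 1 - ?f 0) \<le> (C * (norm v)\<^sup>2) * norm (1 - (0::real))"
  proof (rule differentiable_bound[where S = "{0..1}" and f' = "\<lambda>s r. K' (w + s *\<^sub>R v) (r *\<^sub>R v) - r * K' w v"])
    fix s :: real assume s: "s \<in> {0..1}"
    have "((\<lambda>s. w + s *\<^sub>R v) has_derivative (\<lambda>r. r *\<^sub>R v)) (at s)" by (auto intro!: derivative_eq_intros)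
    note d1 = has_derivative_compose[OF this K]
    have d2: "((\<lambda>s. s * K' w v) has_derivative (\<lambda>r. r * K' w v)) (at s)"
      by (intro has_derivative_mult_left has_derivative_ident)
    show "(?f has_derivative (\<lambda>r. K' (w + s *\<^sub>R v) (r *\<^sub>R v) - r * K' w v)) (at s within {0..1})"
      by (rule has_derivative_at_withinI[OF has_derivative_diff[OF d1 d2]])
    have l: "K' (w + s *\<^sub>R v) (r *\<^sub>R v) = r * K' (w + s *\<^sub>R v) v" for r
      using linear_scale[OF has_derivative_linear[OF K[of "w + s *\<^sub>R v"]], of r v] by simp
    show "onorm (\<lambda>r. K' (w + s *\<^sub>R v) (r *\<^sub>R v) - r * K' w v) \<le> C * (norm v)\<^sup>2"
    proof (rule onorm_le)
      fix r :: real
      have "K' (w + s *\<^sub>R v) (r *\<^sub>R v) - r * K' w v = (K' (w + s *\<^sub>R v) v - K' w v) * r" by (simp add: l algebra_simps)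
      then show "norm (K' (w + s *\<^sub>R v) (r *\<^sub>R v) - r * K' w v) \<le> C * (norm v)\<^sup>2 * norm r"
        using mult_right_mono[OF 1[OF s], of "\<bar>r\<bar>"] by (simp add: abs_mult)
    qed
  qed auto
  then show ?thesis by (simp add: algebra_simps)
qed

definition locint :: "('a::euclidean_space \<Rightarrow> complex) \<Rightarrow> bool" where
  "locint F \<longleftrightarrow> F \<in> borel_measurable borel \<and> (\<forall>R. integrable lborel (\<lambda>x. indicator (cball 0 R) x *\<^sub>R F x))"

lemma locint_bounded:
  assumes [measurable]: "F \<in> borel_measurable borel" and b: "\<And>R. \<exists>C. \<forall>x. norm x \<le> R \<longrightarrow> norm (F x) \<le> C"
  shows "locint F"
  unfolding locint_def
proof safe
  fix R
  obtain C where C: "\<And>x. norm x \<le> R \<Longrightarrow> norm (F x) \<le> C" using b by blast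
  show "integrable lborel (\<lambda>x. indicator (cball 0 R) x *\<^sub>R F x)"
    by (rule Bochner_Integration.integrable_bound[where f = "\<lambda>x. indicator (cball 0 R) x * C"])
       ((intro integrable_mult_left integrable_real_indicator emeasure_compact_finite; simp),
        measurable, auto simp: indicator_def dest!: C)
qed fact

lemma locint_continuous: "continuous_on UNIV F \<Longrightarrow> locint F"
  unfolding locint_def
  by (auto intro!: borel_measurable_continuous_onI borel_integrable_compact intro: continuous_on_subset)

lemma conv_integrable:
  assumes F: "locint F" and K: "K \<in> borel_measurable borel" "\<And>w. \<bar>K w\<bar> \<le> C" "\<And>w. norm w > 1 \<Longrightarrow> K w = 0"
  shows "integrable lborel (\<lambda>x. F x * complex_of_real (K (z - x)))"
proof (rule Bochner_Integration.integrable_bound[where f = "\<lambda>x. C *\<^sub>R (indicator (cball 0 (norm z + 1)) x *\<^sub>R F x)"])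
  have [measurable]: "F \<in> borel_measurable borel" using F by (simp add: locint_def)
  note [measurable] = K(1)
  show "(\<lambda>x. F x * complex_of_real (K (z - x))) \<in> borel_measurable lborel" by measurable
  show "integrable lborel (\<lambda>x. C *\<^sub>R (indicator (cball 0 (norm z + 1)) x *\<^sub>R F x))"
    using F by (intro integrable_scaleR_right) (auto simp: locint_def)
  have C: "0 \<le> C" using K(2)[of 0] by linarith
  show "AE x in lborel. norm (F x * complex_of_real (K (z - x))) \<le> norm (C *\<^sub>R (indicator (cball 0 (norm z + 1)) x *\<^sub>R F x))"
  proof (rule AE_I2)
    fix x
    show "norm (F x * complex_of_real (K (z - x))) \<le> norm (C *\<^sub>R (indicator (cball 0 (norm z + 1)) x *\<^sub>R F x))"
    proof (cases "norm (z - x) > 1")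
      case False
      then have "norm x \<le> norm z + 1" using norm_triangle_ineq4[of z "z - x"] by simp
      then show ?thesis using mult_left_mono[OF K(2)[of "z - x"], of "norm (F x)"] C by (simp add: norm_mult mult.commute)
    qed (simp add: K)
  qed
qed

text \<open>
  The kernel is linearised; the error is quadratic and supported in a fixed ball, where
  \<open>F\<close> is integrable.
\<close>

lemma conv_has_derivative:
  fixes F :: "'a::euclidean_space \<Rightarrow> complex"
  assumes F: "locint F"
    and K: "\<And>w. (K has_derivative K' w) (at w)"
    and K': "\<And>w v. ((\<lambda>w. K' w v) has_derivative K'' w v) (at w)"
    and C: "\<And>w v u. \<bar>K'' w v u\<bar> \<le> C * norm v * norm u"
    and C0: "\<And>w. \<bar>K w\<bar> \<le> C0" and C1: "\<And>w v. \<bar>K' w v\<bar> \<le> C1 * norm v"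
    and supp: "\<And>w. norm w > 1 \<Longrightarrow> K w = 0" "\<And>w v. norm w > 1 \<Longrightarrow> K' w v = 0"
  shows "((\<lambda>z. \<integral>x. F x * complex_of_real (K (z - x)) \<partial>lborel) has_derivative
     (\<lambda>v. \<integral>x. F x * complex_of_real (K' (z - x) v) \<partial>lborel)) (at z)"
proof (rule has_derivative_integral_quadratic[where \<delta> = 1 and G = "\<lambda>x. C * norm (indicator (cball 0 (norm z + 2)) x *\<^sub>R F x)"])
  have Km: "K \<in> borel_measurable borel"
    by (intro borel_measurable_continuous_onI has_derivative_imp_continuous_on[OF K])
  have K'm: "(\<lambda>w. K' w v) \<in> borel_measurable borel" for v
    by (intro borel_measurable_continuous_onI has_derivative_imp_continuous_on[OF K'])
  show "integrable lborel (\<lambda>x. F x * complex_of_real (K (y - x)))" for y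
    by (rule conv_integrable[OF F Km C0 supp(1)])
  show "integrable lborel (\<lambda>x. F x * complex_of_real (K' (z - x) v))" for v
    by (rule conv_integrable[OF F K'm C1 supp(2)])
  show "linear (\<lambda>v. F x * complex_of_real (K' (z - x) v))" for x
    using has_derivative_linear[OF K[of "z - x"]]
    by (intro linearI) (simp_all add: linear_add linear_scale algebra_simps scaleR_conv_of_real)
  show "integrable lborel (\<lambda>x. C * norm (indicator (cball 0 (norm z + 2)) x *\<^sub>R F x))"
    using F by (intro integrable_mult_right integrable_norm) (auto simp: locint_def)
  fix x v :: 'a assume v: "norm v \<le> 1"
  show "norm (F x * complex_of_real (K (z + v - x)) - F x * complex_of_real (K (z - x)) - F x * complex_of_real (K' (z - x) v))
     \<le> C * norm (indicator (cball 0 (norm z + 2)) x *\<^sub>R F x) * (norm v)\<^sup>2"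
  proof (cases "norm x \<le> norm z + 2")
    case True
    have "F x * complex_of_real (K (z + v - x)) - F x * complex_of_real (K (z - x)) - F x * complex_of_real (K' (z - x) v)
      = F x * complex_of_real (K ((z - x) + v) - K (z - x) - K' (z - x) v)" by (simp add: algebra_simps)
    also have "norm \<dots> \<le> norm (F x) * (C * (norm v)\<^sup>2)"
      unfolding norm_mult norm_of_real by (intro mult_left_mono quadratic_remainder[OF K K' C]) auto
    finally show ?thesis using True by (simp add: mult_ac)
  next
    case False
    then have "norm (z - x) > 2" using norm_triangle_ineq2[of x z] by (simp add: norm_minus_commute)
    moreover have "norm (z + v - x) > 1"
      using norm_triangle_ineq4[of "z + v - x" v] v calculation by (simp add: algebra_simps)
    ultimately show ?thesis using False by (simp add: supp)
  qed
qed simp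

lemma conv_rho_deriv:
  fixes F :: "'a::euclidean_space \<Rightarrow> complex"
  assumes F: "locint F"
  shows "((\<lambda>z. \<integral>x. F x * of_real (rho (z - x)) \<partial>lborel) has_derivative
     (\<lambda>v. \<integral>x. F x * of_real (rho' (z - x) v) \<partial>lborel)) (at z)"
  by (rule conv_has_derivative[OF F rho_deriv rho'_deriv rho''_bound abs_rho_le rho'_bound])
     (auto simp: rho_outside abs_of_nonneg rho_nonneg rho_le)

lemma conv_rho'_deriv:
  fixes F :: "'a::euclidean_space \<Rightarrow> complex"
  assumes F: "locint F"
  shows "((\<lambda>z. \<integral>x. F x * of_real (rho' (z - x) v) \<partial>lborel) has_derivative
     (\<lambda>u. \<integral>x. F x * of_real (rho'' (z - x) v u) \<partial>lborel)) (at z)"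
  by (rule conv_has_derivative[OF F rho'_deriv rho''_deriv rho'''_bound rho'_bound rho''_bound])
     (auto simp: rho_outside)

lemma conv_cont:
  fixes F :: "'a::euclidean_space \<Rightarrow> complex"
  assumes F: "locint F" and K: "continuous_on UNIV K" "\<And>w. \<bar>K w\<bar> \<le> C" "\<And>w. norm w > 1 \<Longrightarrow> K w = 0"
  shows "continuous_on UNIV (\<lambda>z. \<integral>x. F x * complex_of_real (K (z - x)) \<partial>lborel)"
  unfolding continuous_on_sequentially
proof (intro allI ballI impI)
  fix X and a :: 'a assume X: "(\<forall>n. X n \<in> UNIV) \<and> X \<longlonglongrightarrow> a"
  then obtain B where B: "\<And>n. norm (X n) \<le> B"
    by (meson Bseq_def convergent_def convergent_imp_Bseq)
  have Km[measurable]: "K \<in> borel_measurable borel" by (rule borel_measurable_continuous_onI[OF K(1)])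
  have [measurable]: "F \<in> borel_measurable borel" using F by (simp add: locint_def)
  have C: "0 \<le> C" using K(2)[of 0] by linarith
  show "((\<lambda>z. \<integral>x. F x * complex_of_real (K (z - x)) \<partial>lborel) \<circ> X) \<longlonglongrightarrow> (\<integral>x. F x * complex_of_real (K (a - x)) \<partial>lborel)"
    unfolding comp_def
  proof (rule integral_dominated_convergence[where w = "\<lambda>x. C * norm (indicator (cball 0 (B + 1)) x *\<^sub>R F x)"])
    show "integrable lborel (\<lambda>x. C * norm (indicator (cball 0 (B + 1)) x *\<^sub>R F x))"
      using F by (intro integrable_mult_right integrable_norm) (auto simp: locint_def)
    show "AE x in lborel. (\<lambda>n. F x * complex_of_real (K (X n - x))) \<longlonglongrightarrow> F x * complex_of_real (K (a - x))"
      using X by (intro AE_I2 tendsto_intros continuous_on_tendsto_compose[OF K(1)]) auto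
    show "AE x in lborel. norm (F x * complex_of_real (K (X n - x))) \<le> C * norm (indicator (cball 0 (B + 1)) x *\<^sub>R F x)" for n
    proof (rule AE_I2)
      fix x
      show "norm (F x * complex_of_real (K (X n - x))) \<le> C * norm (indicator (cball 0 (B + 1)) x *\<^sub>R F x)"
      proof (cases "norm (X n - x) > 1")
        case False
        then have "norm x \<le> B + 1" using norm_triangle_ineq4[of "X n" "X n - x"] B[of n] by simp
        then show ?thesis using mult_left_mono[OF K(2)[of "X n - x"], of "norm (F x)"] C by (simp add: norm_mult mult.commute)
      qed (use C in \<open>simp add: K\<close>)
    qed
  qed measurable
qed

section \<open>The mean value property with weight rho\<close>

text \<open>
  The function \<open>f\<close> is only differentiable on a neighbourhood of the unit ball; where
  it is not, the product with \<open>w\<close> vanishes.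
\<close>

lemma integral_derivative_product_zero:
  fixes f w :: "'a::euclidean_space \<Rightarrow> complex"
  assumes W: "open W" "cball 0 1 \<subseteq> W"
    and f: "\<And>y. y \<in> W \<Longrightarrow> (f has_derivative f' y) (at y)" "\<And>v. continuous_on W (\<lambda>y. f' y v)"
    and w: "\<And>y. (w has_derivative w' y) (at y)" "\<And>v. continuous_on UNIV (\<lambda>y. w' y v)"
    and supp: "\<And>y. norm y > 1 \<Longrightarrow> w y = 0" "\<And>y v. norm y > 1 \<Longrightarrow> w' y v = 0"
  shows "integrable lborel (\<lambda>y. f y * w' y v + f' y v * w y)" "(\<integral>y. f y * w' y v + f' y v * w y \<partial>lborel) = 0"
proof -
  let ?O = "{y::'a. norm y > 1}"
  have O: "open ?O" by (intro open_Collect_less continuous_intros)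
  have "y \<in> W" if "\<not> norm y > 1" for y using W(2) that by (auto simp: subset_iff)
  then have U: "W \<union> ?O = UNIV" by auto
  have wc: "continuous_on UNIV w"
    by (intro has_derivative_imp_continuous_on[OF w(1)])
  have fc: "continuous_on W f"
    by (intro has_derivative_imp_continuous_on[OF f(1)])
  have cont: "continuous_on UNIV (\<lambda>y. f y * w' y v + f' y v * w y)" for v
  proof -
    have "continuous_on W (\<lambda>y. f y * w' y v + f' y v * w y)"
      by (intro continuous_intros fc f(2) continuous_on_subset[OF wc] continuous_on_subset[OF w(2)]) auto
    moreover have "continuous_on ?O (\<lambda>y. f y * w' y v + f' y v * w y)"
      by (rule continuous_on_eq[where f = "\<lambda>_. 0"]) (auto simp: supp)
    ultimately show ?thesis using continuous_on_open_Un[OF W(1) O] U by simp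
  qed
  have der: "((\<lambda>y. f y * w y) has_derivative (\<lambda>v. f y * w' y v + f' y v * w y)) (at y)" for y
  proof (cases "y \<in> W")
    case True
    then show ?thesis by (intro has_derivative_mult f w)
  next
    case False
    then have y: "norm y > 1" using W(2) by force
    have "((\<lambda>y. f y * w y) has_derivative (\<lambda>_. 0)) (at y)"
      by (rule has_derivative_transform_within_open[where f = "\<lambda>_. 0" and s = ?O]) (use O y in \<open>auto simp: supp\<close>)
    then show ?thesis using y by (simp add: supp)
  qed
  show "integrable lborel (\<lambda>y. f y * w' y v + f' y v * w y)"
    by (rule integrable_continuous_bounded_support[OF cont, of 1]) (simp add: supp)
  show "(\<integral>y. f y * w' y v + f' y v * w y \<partial>lborel) = 0"
    by (rule integral_directional_derivative_zero[OF der cont, of 1]) (simp add: supp)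
qed

definition del :: "(complex^'n \<Rightarrow> complex) \<Rightarrow> 'n \<Rightarrow> complex" where
  "del D j = (D (axis j 1) - \<i> * D (axis j \<i>)) / 2"

lemma complex_linear_expand:
  fixes D :: "complex^'n \<Rightarrow> complex"
  assumes lin: "linear D" and D: "\<And>c v. D (c *s v) = c * D v"
  shows "D v = (\<Sum>j\<in>UNIV. v $ j * D (axis j 1))"
proof -
  have "D v = D (\<Sum>j\<in>UNIV. v $ j *s axis j 1)" by (simp add: basis_expansion)
  also have "\<dots> = (\<Sum>j\<in>UNIV. v $ j * D (axis j 1))"
    by (simp add: linear_sum[OF lin] D)
  finally show ?thesis .
qed

lemma del_complex_linear:
  assumes "\<And>c v. D (c *s v) = c * D v"
  shows "del D j = D (axis j 1)"
proof -
  have "D (axis j \<i>) = \<i> * D (axis j 1)"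
    using assms[of \<i> "axis j 1"] by (simp add: vector_scalar_mult_def axis_def if_distrib cong: if_cong)
  then show ?thesis by (simp add: del_def)
qed

text \<open>
  Radial symmetry of \<open>rho\<close> means that \<open>cnj (y\<^sub>j)\<close> times the
  \<open>dbar\<close>-derivative of \<open>rho\<close> equals \<open>y\<^sub>j\<close> times its
  \<open>del\<close>-derivative. Hence, after integration by parts, the integrals of
  \<open>y\<^sub>j (del\<^sub>j f) rho\<close> and of \<open>cnj (y\<^sub>j) (dbar\<^sub>j f)
  rho\<close> agree, and the latter vanishes since \<open>dbar f = 0\<close>.
\<close>

lemma radial_derivative_integral_zero:
  fixes f :: "complex^'n \<Rightarrow> complex"
  assumes W: "open W" "cball 0 1 \<subseteq> W"
    and f: "\<And>y. y \<in> W \<Longrightarrow> (f has_derivative f' y) (at y)" "\<And>v. continuous_on W (\<lambda>y. f' y v)"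
    and lin: "\<And>y c v. y \<in> W \<Longrightarrow> f' y (c *s v) = c * f' y v"
  shows "(\<integral>y. f' y y * of_real (rho y) \<partial>lborel) = 0"
proof -
  let ?b = "bmass TYPE(complex^'n)"
  let ?c = "\<lambda>y::complex^'n. complex_of_real (- 4 * bump 3 y / ?b)"
  let ?r = "\<lambda>y v::complex^'n. complex_of_real (rho' y v)"
  have rho_c: "((\<lambda>y::complex^'n. complex_of_real (rho y)) has_derivative ?r y) (at y)" for y
    by (rule has_derivative_of_real[OF rho_deriv])
  have rho_cc: "continuous_on UNIV (\<lambda>y::complex^'n. complex_of_real (rho y))"
    by (intro has_derivative_imp_continuous_on[OF rho_c])
  have rho'_cc: "continuous_on UNIV (\<lambda>y::complex^'n. complex_of_real (rho' y v))" for v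
    by (intro continuous_on_of_real has_derivative_imp_continuous_on[OF rho'_deriv])
  have dbar_r: "dbar (?r y) j = ?c y * y $ j" for y j
    unfolding rho'_def of_real_mult[of "- 4 * bump 3 y / ?b"] dbar_cmult dbar_inner ..
  have del_r: "del (?r y) j = ?c y * cnj (y $ j)" for y j
  proof -
    have "del (?r y) j = cnj (dbar (?r y) j)" by (simp add: del_def dbar_def)
    then show ?thesis by (simp add: dbar_r)
  qed
  \<comment> \<open>Two families of test functions: \<open>w1\<close> is paired with \<open>dbar\<close>, \<open>w2\<close> with \<open>del\<close>, and their own derivatives agree by radial symmetry.\<close>
  define w1 where "w1 j y = cnj (y $ j) * complex_of_real (rho y)" for j and y :: "complex^'n"
  define w1' where "w1' j y v = cnj (y $ j) * ?r y v + cnj (v $ j) * complex_of_real (rho y)" for j and y v :: "complex^'n"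
  define w2 where "w2 j y = y $ j * complex_of_real (rho y)" for j and y :: "complex^'n"
  define w2' where "w2' j y v = y $ j * ?r y v + v $ j * complex_of_real (rho y)" for j and y v :: "complex^'n"
  have w1: "(w1 j has_derivative w1' j y) (at y)" for j y
    unfolding w1_def[abs_def] w1'_def[abs_def]
    by (intro has_derivative_mult rho_c bounded_linear.has_derivative[OF bounded_linear_cnj]
      bounded_linear_imp_has_derivative[OF bounded_linear_vec_nth])
  have w2: "(w2 j has_derivative w2' j y) (at y)" for j y
    unfolding w2_def[abs_def] w2'_def[abs_def]
    by (intro has_derivative_mult rho_c bounded_linear_imp_has_derivative[OF bounded_linear_vec_nth])
  have cw: "continuous_on UNIV (\<lambda>y. w1' j y v)" "continuous_on UNIV (\<lambda>y. w2' j y v)" for j v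
    unfolding w1'_def w2'_def by (intro continuous_intros rho_cc rho'_cc)+
  have supp: "w1 j y = 0" "w1' j y v = 0" "w2 j y = 0" "w2' j y v = 0" if "norm y > 1" for j y v
    using that by (simp_all add: w1_def w1'_def w2_def w2'_def rho_outside)
  note z1 = integral_derivative_product_zero[OF W f w1 cw(1) supp(1,2)]
  note z2 = integral_derivative_product_zero[OF W f w2 cw(2) supp(3,4)]
  have "(\<integral>y. (\<Sum>j\<in>UNIV. del (\<lambda>v. f y * w2' j y v + f' y v * w2 j y) j
        - dbar (\<lambda>v. f y * w1' j y v + f' y v * w1 j y) j) \<partial>lborel) = 0"
    unfolding dbar_def del_def using z1 z2 by simp
  moreover have "(\<Sum>j\<in>UNIV. del (\<lambda>v. f y * w2' j y v + f' y v * w2 j y) j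
        - dbar (\<lambda>v. f y * w1' j y v + f' y v * w1 j y) j) = f' y y * of_real (rho y)" for y
  proof (cases "norm y > 1")
    case True
    then show ?thesis by (simp add: supp del_def dbar_def rho_outside)
  next
    case False
    then have y: "y \<in> W" using W(2) by auto
    have "dbar (w1' j y) j = cnj (y $ j) * (?c y * y $ j) + of_real (rho y)" for j
      unfolding w1'_def[abs_def] by (simp add: dbar_add dbar_cmult dbar_multc dbar_cnj_coord dbar_r)
    moreover have "del (w2' j y) j = y $ j * (?c y * cnj (y $ j)) + of_real (rho y)" for j
    proof -
      have "del (w2' j y) j = y $ j * del (?r y) j + of_real (rho y)"
        by (simp add: w2'_def del_def axis_def field_simps)
      then show ?thesis by (simp only: del_r)
    qed
    ultimately have eq: "del (w2' j y) j = dbar (w1' j y) j" for j by (simp only: mult_ac)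
    have "del (\<lambda>v. f y * w2' j y v + f' y v * w2 j y) j - dbar (\<lambda>v. f y * w1' j y v + f' y v * w1 j y) j
       = f y * (del (w2' j y) j - dbar (w1' j y) j) + del (f' y) j * w2 j y - dbar (f' y) j * w1 j y" for j
      by (simp add: del_def dbar_def field_simps)
    then have "(\<Sum>j\<in>UNIV. del (\<lambda>v. f y * w2' j y v + f' y v * w2 j y) j - dbar (\<lambda>v. f y * w1' j y v + f' y v * w1 j y) j)
       = (\<Sum>j\<in>UNIV. y $ j * f' y (axis j 1)) * of_real (rho y)"
      using lin[OF y] by (simp add: eq dbar_complex_linear del_complex_linear w2_def sum_distrib_right sum_distrib_left mult_ac)
    then show ?thesis using complex_linear_expand[OF has_derivative_linear[OF f(1)[OF y]] lin[OF y], of y] by simp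
  qed
  ultimately show ?thesis by simp
qed

text \<open>
  The averages of \<open>h (z + s y)\<close> with weight \<open>rho y\<close> do not depend on
  \<open>s\<close>, because their \<open>s\<close>-derivative is the integral of a radial
  derivative; at \<open>s = 0\<close> the average is \<open>h z\<close>.
\<close>

lemma holo_rho_mean:
  fixes h :: "complex^'n \<Rightarrow> complex"
  assumes h: "h \<in> holo S" and S: "open S" "cball z 1 \<subseteq> S"
  shows "(\<integral>x. h x * of_real (rho (z - x)) \<partial>lborel) = h z"
proof -
  let ?B = "cball (0::complex^'n) 1"
  obtain a b :: "complex^'n" where ab: "?B \<subseteq> cbox a b"
    using bounded_subset_cbox_symmetric[OF bounded_cball] by metis
  define f where "f s y = h (z + s *\<^sub>R y) * of_real (rho y)" for s and y :: "complex^'n"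
  define f' where "f' s y = (\<Sum>j\<in>UNIV. y $ j * hder h (z + s *\<^sub>R y) (axis j 1)) * of_real (rho y)" for s and y :: "complex^'n"
  define M where "M s = integral (cbox a b) (f s)" for s
  have in_S: "z + s *\<^sub>R y \<in> S" if "s \<in> {0..1}" "norm y \<le> 1" for s y
  proof -
    have "norm (s *\<^sub>R y) \<le> 1 * 1" unfolding norm_scaleR using that by (intro mult_mono) auto
    then show ?thesis using S(2) by (auto simp: dist_norm)
  qed
  have rho_cc: "continuous_on UNIV (\<lambda>y::complex^'n. complex_of_real (rho y))"
    by (intro continuous_on_of_real has_derivative_imp_continuous_on[OF rho_deriv])
  \<comment> \<open>Joint continuity in \<open>(s, y)\<close> is obtained by gluing: the integrands are continuous on the open set \<open>W\<close> and vanish on the open set where \<open>norm y > 1\<close>, and these sets cover everything needed.\<close>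
  define W where "W = {p. z + fst p *\<^sub>R snd p \<in> S}"
  have Wo: "open W" 
  proof -
    have "W = (\<lambda>p::real \<times> (complex^'n). z + fst p *\<^sub>R snd p) -` S" by (auto simp: W_def)
    also have "open \<dots>" by (intro open_vimage S continuous_intros)
    finally show ?thesis .
  qed
  let ?O = "{p::real \<times> (complex^'n). norm (snd p) > 1}"
  have O: "open ?O" by (intro open_Collect_less continuous_intros)
  have sub: "{0..1} \<times> X \<subseteq> W \<union> ?O" for X using in_S by (auto simp: W_def not_less)
  have jc: "continuous_on ({0..1} \<times> X) (\<lambda>(s, y). f s y)" "continuous_on ({0..1} \<times> X) (\<lambda>(s, y). f' s y)" for X
  proof -
    have Wm: "continuous_on W (\<lambda>p. z + fst p *\<^sub>R snd p)" "(\<lambda>p. z + fst p *\<^sub>R snd p) ` W \<subseteq> S"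
      by (auto intro!: continuous_intros simp: W_def)
    have r: "continuous_on W (\<lambda>p. complex_of_real (rho (snd p)))"
      by (rule continuous_on_compose2[OF rho_cc]) (auto intro: continuous_intros)
    have hc: "continuous_on W (\<lambda>p. h (z + fst p *\<^sub>R snd p))"
      by (rule continuous_on_compose2[OF holo_continuous_on[OF h] Wm])
    have hd: "continuous_on W (\<lambda>p. hder h (z + fst p *\<^sub>R snd p) v)" for v
      by (rule continuous_on_compose2[OF hder_continuous_on[OF h S(1)] Wm])
    have "continuous_on W (\<lambda>(s, y). f s y)" "continuous_on W (\<lambda>(s, y). f' s y)"
      unfolding split_beta f_def f'_def by (intro continuous_intros r hc hd)+
    moreover have "continuous_on ?O (\<lambda>(s, y). f s y)" "continuous_on ?O (\<lambda>(s, y). f' s y)"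
      by (rule continuous_on_eq[where f = "\<lambda>_. 0"]; auto simp: f_def f'_def rho_outside)+
    ultimately have "continuous_on (W \<union> ?O) (\<lambda>(s, y). f s y)" "continuous_on (W \<union> ?O) (\<lambda>(s, y). f' s y)"
      using continuous_on_open_Un[OF Wo O] by blast+
    then show "continuous_on ({0..1} \<times> X) (\<lambda>(s, y). f s y)" "continuous_on ({0..1} \<times> X) (\<lambda>(s, y). f' s y)"
      using continuous_on_subset sub by blast+
  qed
  have fs: "continuous_on X (f s)" "continuous_on X (f' s)" if "s \<in> {0..1}" for s X
    using continuous_on_compose2[OF jc(1)[of X], of X "\<lambda>y. (s, y)"] continuous_on_compose2[OF jc(2)[of X], of X "\<lambda>y. (s, y)"] that
      continuous_on_Pair[OF continuous_on_const[of X s] continuous_on_id]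
    by (auto simp: image_subset_iff)
  note eq = lborel_integral_eq_cbox[OF _ _ ab]
  have der: "(M has_vector_derivative integral (cbox a b) (f' s)) (at s within {0..1})" if s: "s \<in> {0..1}" for s
    unfolding M_def
  proof (rule leibniz_rule_vector_derivative)
    fix r :: real and y :: "complex^'n" assume r: "r \<in> {0..1}"
    show "((\<lambda>s. f s y) has_vector_derivative f' r y) (at r within {0..1})"
    proof (cases "norm y \<le> 1")
      case True
      then have zS: "z + r *\<^sub>R y \<in> S" using in_S r by auto
      have "((\<lambda>s. z + s *\<^sub>R y) has_derivative (\<lambda>s. s *\<^sub>R y)) (at r)" by (auto intro!: derivative_eq_intros)
      from has_derivative_compose[OF this hder(1)[OF h zS]]
      have "((\<lambda>s. h (z + s *\<^sub>R y)) has_derivative (\<lambda>s. hder h (z + r *\<^sub>R y) (s *\<^sub>R y))) (at r)" .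
      moreover have "hder h (z + r *\<^sub>R y) (s *\<^sub>R y) = s *\<^sub>R hder h (z + r *\<^sub>R y) y" for s
        using has_derivative_linear[OF hder(1)[OF h zS]] linear_scale by blast
      ultimately have d: "((\<lambda>s. h (z + s *\<^sub>R y)) has_vector_derivative hder h (z + r *\<^sub>R y) y) (at r)"
        by (simp only: has_vector_derivative_def)
      have e: "hder h (z + r *\<^sub>R y) y = (\<Sum>j\<in>UNIV. y $ j * hder h (z + r *\<^sub>R y) (axis j 1))"
        by (rule complex_linear_expand[OF has_derivative_linear[OF hder(1)[OF h zS]] hder(2)[OF h zS]])
      show ?thesis
        unfolding f_def f'_def e[symmetric]
        by (rule has_vector_derivative_at_within[OF has_vector_derivative_mult_left[OF d]])
    next
      case False
      then show ?thesis by (simp add: f_def f'_def rho_outside)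
    qed
    show "f r integrable_on cbox a b"
      using fs(1)[OF r] by (rule integrable_continuous)
  qed (use jc that in auto)
  \<comment> \<open>The derivative of the dilated function carries a factor \<open>s\<close>, which is divided out. The single point \<open>s = 0\<close> does not affect constancy of the continuous function \<open>M\<close>.\<close>
  have zero: "integral (cbox a b) (f' s) = 0" if s: "s \<in> {0<..1}" for s
  proof -
    let ?W = "{y. z + s *\<^sub>R y \<in> S}"
    have W: "open ?W" "cball 0 1 \<subseteq> ?W"
    proof -
      have "?W = (\<lambda>y. z + s *\<^sub>R y) -` S" by auto
      also have "open \<dots>" by (intro open_vimage S continuous_intros)
      finally show "open ?W" .
      show "cball 0 1 \<subseteq> ?W" using in_S s by auto
    qed
    have s0: "s \<noteq> 0" "s \<in> {0..1}" using s by auto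
    have "(\<integral>y. s *\<^sub>R hder h (z + s *\<^sub>R y) y * of_real (rho y) \<partial>lborel) = 0"
    proof (rule radial_derivative_integral_zero[OF W, where f = "\<lambda>y. h (z + s *\<^sub>R y)"
        and f' = "\<lambda>y v. s *\<^sub>R hder h (z + s *\<^sub>R y) v"])
      fix y c v assume "y \<in> ?W"
      then have zS: "z + s *\<^sub>R y \<in> S" by simp
      have lin: "hder h (z + s *\<^sub>R y) (r *\<^sub>R v) = r *\<^sub>R hder h (z + s *\<^sub>R y) v" for r v
        using has_derivative_linear[OF hder(1)[OF h zS]] linear_scale by blast
      have "((\<lambda>y. z + s *\<^sub>R y) has_derivative (\<lambda>v. s *\<^sub>R v)) (at y)" by (auto intro!: derivative_eq_intros)
      from has_derivative_compose[OF this hder(1)[OF h zS]]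
      show "((\<lambda>y. h (z + s *\<^sub>R y)) has_derivative (\<lambda>v. s *\<^sub>R hder h (z + s *\<^sub>R y) v)) (at y)"
        by (simp add: lin)
      show "s *\<^sub>R hder h (z + s *\<^sub>R y) (c *s v) = c * s *\<^sub>R hder h (z + s *\<^sub>R y) v"
        by (simp add: hder(2)[OF h zS])
    next
      fix v
      show "continuous_on ?W (\<lambda>y. s *\<^sub>R hder h (z + s *\<^sub>R y) v)"
        by (intro continuous_intros continuous_on_compose2[OF hder_continuous_on[OF h S(1)]]) auto
    qed
    then have z: "(\<integral>y. hder h (z + s *\<^sub>R y) y * of_real (rho y) \<partial>lborel) = 0"
      using s0 by (simp add: mult_scaleR_left)
    have "hder h (z + s *\<^sub>R y) y * of_real (rho y) = f' s y" for y
    proof (cases "norm y \<le> 1")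
      case True
      then have zS: "z + s *\<^sub>R y \<in> S" using in_S s by auto
      show ?thesis using complex_linear_expand[OF has_derivative_linear[OF hder(1)[OF h zS]] hder(2)[OF h zS], of y]
        by (simp add: f'_def)
    qed (simp add: f'_def rho_outside)
    then have "(\<integral>y. f' s y \<partial>lborel) = 0" using z by simp
    moreover have "(\<integral>y. f' s y \<partial>lborel) = integral (cbox a b) (f' s)"
      by (rule eq) (use fs[OF s0(2)] in \<open>auto simp: f'_def rho_outside\<close>)
    ultimately show ?thesis by simp
  qed
  have "M 0 = M 1"
  proof (rule has_derivative_zero_unique_strong_convex[where S = "{0..1}" and K = "{0}" and f = M and c = 1 and x = 0])
    show "continuous_on {0..1} M"
      using der has_vector_derivative_continuous continuous_on_eq_continuous_within by blast
    fix s assume "s \<in> {0..1} - {0::real}"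
    then have "s \<in> {0<..1}" "s \<in> {0..1}" by auto
    then show "(M has_derivative (\<lambda>h. 0)) (at s within {0..1})"
      using der[of s] zero[of s] by (simp add: has_vector_derivative_def)
  qed auto
  moreover have "M 0 = h z"
  proof -
    have "M 0 = (\<integral>y. f 0 y \<partial>lborel)"
      unfolding M_def by (rule eq[symmetric]) (use fs[of 0] in \<open>auto simp: f_def rho_outside\<close>)
    also have "\<dots> = h z" using rho_integral[where 'a="complex^'n"] by (simp add: f_def)
    finally show ?thesis .
  qed
  moreover have "M 1 = (\<integral>x. h x * of_real (rho (z - x)) \<partial>lborel)"
  proof -
    have "M 1 = (\<integral>y. f 1 y \<partial>lborel)"
      unfolding M_def by (rule eq[symmetric]) (use fs[of 1] in \<open>auto simp: f_def rho_outside\<close>)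
    also have "\<dots> = (\<integral>x. h x * of_real (rho (z - x)) \<partial>lborel)"
    proof -
      have c: "continuous_on UNIV (\<lambda>y. f 1 y)" using fs[of 1] by auto
      have "(\<integral>y. f 1 y \<partial>lborel) = (\<integral>y. f 1 (y - z) \<partial>lborel)"
        using lborel_integral_affine[OF borel_measurable_continuous_onI[OF c], of 1 "-z"] by simp
      also have "(\<lambda>y. f 1 (y - z)) = (\<lambda>x. h x * of_real (rho (z - x)))"
        using rho_minus[of "z - _"] by (simp add: f_def fun_eq_iff)
      finally show ?thesis .
    qed
    finally show ?thesis .
  qed
  ultimately show ?thesis by simp
qed

section \<open>Projections onto function Hilbert spaces and semicommutators\<close>

lemma ennsqrt_ennreal: "0 \<le> x \<Longrightarrow> ennsqrt (ennreal x) = ennreal (sqrt x)"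
  by (simp add: ennsqrt_def)

lemma ennsqrt_less_top_iff: "ennsqrt x < \<infinity> \<longleftrightarrow> x < \<infinity>"
  by (cases x) (auto simp: ennsqrt_def)

lemma ennsqrt_mono: "x \<le> y \<Longrightarrow> ennsqrt x \<le> ennsqrt y"
  by (cases x; cases y) (auto simp: ennsqrt_def top_unique)

definition sqn :: "'a measure \<Rightarrow> ('a \<Rightarrow> complex) \<Rightarrow> real" where
  "sqn M u = (\<integral>z. (norm (u z))\<^sup>2 \<partial>M)"

definition ip :: "'a measure \<Rightarrow> ('a \<Rightarrow> complex) \<Rightarrow> ('a \<Rightarrow> complex) \<Rightarrow> complex" where
  "ip M u v = (\<integral>z. u z * cnj (v z) \<partial>M)"

lemma L2_iff: "u \<in> L2 M \<longleftrightarrow> u \<in> borel_measurable M \<and> integrable M (\<lambda>z. (norm (u z))\<^sup>2)"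
  unfolding L2_def L2norm_def ennsqrt_less_top_iff
  by (auto simp: integrable_iff_bounded)

lemma L2_measurable: "u \<in> L2 M \<Longrightarrow> u \<in> borel_measurable M" by (simp add: L2_iff)

lemma nn_integral_sqn: "u \<in> L2 M \<Longrightarrow> (\<integral>\<^sup>+z. ennreal ((norm (u z))\<^sup>2) \<partial>M) = ennreal (sqn M u)"
  unfolding sqn_def by (rule nn_integral_eq_integral) (auto simp: L2_iff)

lemma L2norm_sqn: "u \<in> L2 M \<Longrightarrow> L2norm M u = ennreal (sqrt (sqn M u))"
  unfolding L2norm_def nn_integral_sqn by (rule ennsqrt_ennreal) (simp add: sqn_def)

lemma sqn_nonneg: "0 \<le> sqn M u" by (simp add: sqn_def)

lemma L2I:
  assumes "u \<in> borel_measurable M" "(\<integral>\<^sup>+z. ennreal ((norm (u z))\<^sup>2) \<partial>M) \<le> ennreal c"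
  shows "u \<in> L2 M" "0 \<le> c \<Longrightarrow> sqn M u \<le> c"
proof -
  have "(\<integral>\<^sup>+z. ennreal ((norm (u z))\<^sup>2) \<partial>M) < \<infinity>" using assms(2) by (metis ennreal_less_top infinity_ennreal_def order_le_less_trans)
  then show 1: "u \<in> L2 M" using assms(1) by (auto simp: L2_iff integrable_iff_bounded)
  show "0 \<le> c \<Longrightarrow> sqn M u \<le> c" using assms(2) unfolding nn_integral_sqn[OF 1] by (simp add: ennreal_le_iff)
qed

lemma norm_add_square_le: "(norm (a + b))\<^sup>2 \<le> 2 * (norm a)\<^sup>2 + 2 * (norm (b::complex))\<^sup>2"
proof -
  have "(norm (a + b))\<^sup>2 \<le> (norm a + norm b)\<^sup>2" by (intro power_mono norm_triangle_ineq) auto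
  also have "\<dots> \<le> 2 * (norm a)\<^sup>2 + 2 * (norm b)\<^sup>2"
    using zero_le_power2[of "norm a - norm b"] by (simp add: power2_eq_square algebra_simps)
  finally show ?thesis .
qed

lemma L2_cmult: "u \<in> L2 M \<Longrightarrow> (\<lambda>z. c * u z) \<in> L2 M"
  by (auto simp: L2_iff norm_mult power_mult_distrib)

lemma sqn_cmult: "sqn M (\<lambda>z. c * u z) = (norm c)\<^sup>2 * sqn M u"
  by (simp add: sqn_def norm_mult power_mult_distrib)

lemma L2_add: assumes "u \<in> L2 M" "v \<in> L2 M" shows "(\<lambda>z. u z + v z) \<in> L2 M"
  unfolding L2_iff
proof
  have [measurable]: "u \<in> borel_measurable M" "v \<in> borel_measurable M" using assms by (auto simp: L2_iff)
  show "(\<lambda>z. u z + v z) \<in> borel_measurable M" by measurable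
  show "integrable M (\<lambda>z. (norm (u z + v z))\<^sup>2)"
    by (rule Bochner_Integration.integrable_bound[where f = "\<lambda>z. 2 * (norm (u z))\<^sup>2 + 2 * (norm (v z))\<^sup>2"])
       (use assms norm_add_square_le in \<open>auto simp: L2_iff\<close>)
qed

lemma L2_diff: assumes "u \<in> L2 M" "v \<in> L2 M" shows "(\<lambda>z. u z - v z) \<in> L2 M"
  using L2_add[OF assms(1) L2_cmult[OF assms(2), of "-1"]] by simp

lemma L2_mult_bounded:
  assumes u: "u \<in> L2 M" and f: "f \<in> borel_measurable M" "AE z in M. norm (f z) \<le> C"
  shows "(\<lambda>z. f z * u z) \<in> L2 M" "sqn M (\<lambda>z. f z * u z) \<le> C\<^sup>2 * sqn M u"
proof -
  have [measurable]: "u \<in> borel_measurable M" "f \<in> borel_measurable M" using u f by (auto simp: L2_iff)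
  have b: "AE z in M. (norm (f z * u z))\<^sup>2 \<le> C\<^sup>2 * (norm (u z))\<^sup>2"
    using f(2) by eventually_elim (auto simp: norm_mult power_mult_distrib intro!: mult_right_mono power_mono)
  have i: "integrable M (\<lambda>z. C\<^sup>2 * (norm (u z))\<^sup>2)" using u by (auto simp: L2_iff)
  have i2: "integrable M (\<lambda>z. (norm (f z * u z))\<^sup>2)"
    by (rule Bochner_Integration.integrable_bound[OF i]) (use b in \<open>auto\<close>)
  then show "(\<lambda>z. f z * u z) \<in> L2 M" by (auto simp: L2_iff)
  show "sqn M (\<lambda>z. f z * u z) \<le> C\<^sup>2 * sqn M u"
    using integral_mono_AE[OF i2 i b] by (simp add: sqn_def)
qed

lemma borel_measurable_cnj [measurable (raw)]: "f \<in> borel_measurable M \<Longrightarrow> (\<lambda>z. cnj (f z)) \<in> borel_measurable M"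
  by (rule measurable_compose[OF _ borel_measurable_continuous_onI]) (auto intro: continuous_intros)

lemma ip_integrable: assumes "u \<in> L2 M" "v \<in> L2 M" shows "integrable M (\<lambda>z. u z * cnj (v z))"
proof -
  have [measurable]: "u \<in> borel_measurable M" "v \<in> borel_measurable M" using assms by (auto simp: L2_iff)
  have "norm (a * cnj b) \<le> (norm a)\<^sup>2 + (norm b)\<^sup>2" for a b :: complex
  proof -
    have "0 \<le> norm a * norm b" by simp
    moreover have "2 * (norm a * norm b) \<le> (norm a)\<^sup>2 + (norm b)\<^sup>2"
      using zero_le_power2[of "norm a - norm b"] by (simp add: power2_diff)
    ultimately have "norm a * norm b \<le> (norm a)\<^sup>2 + (norm b)\<^sup>2" by linarith
    then show ?thesis by (simp add: norm_mult)
  qed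
  then show ?thesis
    by (intro Bochner_Integration.integrable_bound[where f = "\<lambda>z. (norm (u z))\<^sup>2 + (norm (v z))\<^sup>2" and g = "\<lambda>z. u z * cnj (v z)"])
       (use assms in \<open>auto simp: L2_iff\<close>)
qed

lemma ip_diff_left: "u \<in> L2 M \<Longrightarrow> v \<in> L2 M \<Longrightarrow> k \<in> L2 M \<Longrightarrow> ip M (\<lambda>z. u z - v z) k = ip M u k - ip M v k"
  unfolding ip_def by (simp add: ip_integrable left_diff_distrib)
lemma ip_add_left: "u \<in> L2 M \<Longrightarrow> v \<in> L2 M \<Longrightarrow> k \<in> L2 M \<Longrightarrow> ip M (\<lambda>z. u z + v z) k = ip M u k + ip M v k"
  unfolding ip_def by (simp add: ip_integrable distrib_right)
lemma ip_cmult_left: "ip M (\<lambda>z. c * u z) k = c * ip M u k"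
  unfolding ip_def by (simp add: mult.assoc)
lemma ip_sym: "ip M u k = cnj (ip M k u)"
  unfolding ip_def Bochner_Integration.integral_cnj[symmetric] by (simp only: complex_cnj_mult complex_cnj_cnj mult.commute)
lemma ip_self: "ip M u u = of_real (sqn M u)"
  unfolding ip_def sqn_def by (simp add: complex_norm_square[symmetric] flip: integral_complex_of_real)

lemma ip_diff_right: "u \<in> L2 M \<Longrightarrow> v \<in> L2 M \<Longrightarrow> k \<in> L2 M \<Longrightarrow> ip M k (\<lambda>z. u z - v z) = ip M k u - ip M k v"
  by (subst (1 2 3) ip_sym) (simp add: ip_diff_left)
lemma ip_add_right: "u \<in> L2 M \<Longrightarrow> v \<in> L2 M \<Longrightarrow> k \<in> L2 M \<Longrightarrow> ip M k (\<lambda>z. u z + v z) = ip M k u + ip M k v"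
  by (subst (1 2 3) ip_sym) (simp add: ip_add_left)
lemma ip_cmult_right: "ip M k (\<lambda>z. c * u z) = cnj c * ip M k u"
  by (subst (1 2) ip_sym) (simp add: ip_cmult_left)

lemma sqn_add:
  assumes "u \<in> L2 M" "v \<in> L2 M"
  shows "sqn M (\<lambda>z. u z + v z) = sqn M u + sqn M v + 2 * Re (ip M u v)"
proof -
  have "complex_of_real (sqn M (\<lambda>z. u z + v z)) = ip M u u + ip M v v + (ip M u v + cnj (ip M u v))"
    unfolding ip_self[symmetric] using assms by (simp add: ip_add_left ip_add_right L2_add ip_sym[of M v u])
  also have "\<dots> = complex_of_real (sqn M u + sqn M v + 2 * Re (ip M u v))"
    by (simp add: ip_self complex_add_cnj)
  finally show ?thesis using of_real_eq_iff by blast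
qed

lemma sqn_diff:
  assumes "u \<in> L2 M" "v \<in> L2 M"
  shows "sqn M (\<lambda>z. u z - v z) = sqn M u + sqn M v - 2 * Re (ip M u v)"
  using sqn_add[OF assms(1) L2_cmult[OF assms(2), of "-1"]] sqn_cmult[of M "-1" v] ip_cmult_right[of M u "-1" v] by simp

lemma sqn_add_le: "u \<in> L2 M \<Longrightarrow> v \<in> L2 M \<Longrightarrow> sqn M (\<lambda>z. u z + v z) \<le> 2 * sqn M u + 2 * sqn M v"
  using sqn_add[of u M v] sqn_diff[of u M v] sqn_nonneg[of M "\<lambda>z. u z - v z"] by simp

lemma ip_Cauchy_Schwarz:
  assumes "u \<in> L2 M" "v \<in> L2 M"
  shows "(norm (ip M u v))\<^sup>2 \<le> sqn M u * sqn M v"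
proof (cases "sqn M v = 0")
  case True
  have "ip M u v = 0"
  proof (rule ccontr)
    assume a: "ip M u v \<noteq> 0"
    define s where "s = (sqn M u + 1) / (norm (ip M u v))\<^sup>2"
    let ?c = "of_real s * ip M u v"
    have "0 \<le> sqn M (\<lambda>z. u z - ?c * v z)" by (rule sqn_nonneg)
    also have "\<dots> = sqn M u - 2 * Re (cnj ?c * ip M u v)"
      using sqn_diff[OF assms(1) L2_cmult[OF assms(2)], of ?c] True by (simp add: sqn_cmult ip_cmult_right)
    also have "cnj ?c * ip M u v = of_real (s * (norm (ip M u v))\<^sup>2)"
      by (simp add: complex_norm_square[symmetric] mult.commute)
    also have "s * (norm (ip M u v))\<^sup>2 = sqn M u + 1" using a by (simp add: s_def)
    finally show False using sqn_nonneg[of M u] by simp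
  qed
  then show ?thesis using True by simp
next
  case False
  then have v: "0 < sqn M v" using sqn_nonneg[of M v] by linarith
  define c where "c = ip M u v / of_real (sqn M v)"
  have "0 \<le> sqn M (\<lambda>z. u z - c * v z)" by (rule sqn_nonneg)
  also have "\<dots> = sqn M u + (norm c)\<^sup>2 * sqn M v - 2 * Re (cnj c * ip M u v)"
    using sqn_diff[OF assms(1) L2_cmult[OF assms(2)], of c] by (simp add: sqn_cmult ip_cmult_right)
  also have "cnj c * ip M u v = of_real ((norm (ip M u v))\<^sup>2 / sqn M v)"
    by (simp add: c_def complex_norm_square[symmetric] mult.commute)
  also have "(norm c)\<^sup>2 * sqn M v = (norm (ip M u v))\<^sup>2 / sqn M v"
    using v by (simp add: c_def norm_divide power_divide power2_eq_square)
  finally show ?thesis using v by (simp add: field_simps)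
qed

text \<open>
  A space of actual functions in which square-mean convergence controls pointwise convergence.
  Closedness is asked for pointwise limits of norm bounded sequences because that is what a
  minimising sequence provides.
\<close>

locale function_hilbert =
  fixes M :: "'a measure" and F :: "('a \<Rightarrow> complex) set"
  assumes F_L2: "F \<subseteq> L2 M"
    and F_lin: "\<And>h k a b. h \<in> F \<Longrightarrow> k \<in> F \<Longrightarrow> (\<lambda>z. a * h z + b * k z) \<in> F"
    and F_zero: "(\<lambda>z. 0) \<in> F"
    and eval: "\<And>z. \<exists>C. \<forall>h\<in>F. (norm (h z))\<^sup>2 \<le> C * sqn M h"
    and closed: "\<And>H h B. (\<And>n::nat. H n \<in> F) \<Longrightarrow> (\<And>n. sqn M (H n) \<le> B) \<Longrightarrow> (\<And>z. (\<lambda>n. H n z) \<longlonglongrightarrow> h z) \<Longrightarrow> h \<in> L2 M \<Longrightarrow> h \<in> F"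
begin

lemma F_L2': "h \<in> F \<Longrightarrow> h \<in> L2 M" using F_L2 by blast
lemma F_add: "h \<in> F \<Longrightarrow> k \<in> F \<Longrightarrow> (\<lambda>z. h z + k z) \<in> F" using F_lin[of h k 1 1] by simp
lemma F_diff: "h \<in> F \<Longrightarrow> k \<in> F \<Longrightarrow> (\<lambda>z. h z - k z) \<in> F" using F_lin[of h k 1 "-1"] by simp
lemma F_cmult: "h \<in> F \<Longrightarrow> (\<lambda>z. c * h z) \<in> F" using F_lin[of h h c 0] by simp

lemma sqn_zero_imp: "h \<in> F \<Longrightarrow> sqn M h = 0 \<Longrightarrow> h = (\<lambda>z. 0)"
proof
  fix z assume "h \<in> F" "sqn M h = 0"
  moreover obtain C where "\<forall>h\<in>F. (norm (h z))\<^sup>2 \<le> C * sqn M h" using eval by blast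
  ultimately have "(norm (h z))\<^sup>2 \<le> 0" by fastforce
  then show "h z = 0" by simp
qed

text \<open>
  By the parallelogram law a minimising sequence is Cauchy in mean square, hence pointwise by
  bounded point evaluations. Fatou's lemma shows that the pointwise limit attains the infimum.
\<close>

lemma minimizer:
  assumes u: "u \<in> L2 M"
  obtains h where "h \<in> F" "\<And>k. k \<in> F \<Longrightarrow> sqn M (\<lambda>z. u z - h z) \<le> sqn M (\<lambda>z. u z - k z)"
proof -
  let ?D = "(\<lambda>k. sqn M (\<lambda>z. u z - k z)) ` F"
  define d where "d = Inf ?D"
  have bdd: "bdd_below ?D" using sqn_nonneg by (intro bdd_belowI[of _ 0]) auto
  have d_le: "d \<le> sqn M (\<lambda>z. u z - k z)" if "k \<in> F" for k
    unfolding d_def using bdd that by (intro cInf_lower) auto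
  have ex: "\<exists>k\<in>F. sqn M (\<lambda>z. u z - k z) < d + e" if "0 < e" for e
    using cInf_lessD[of ?D "d + e"] F_zero that by (auto simp: d_def)
  define e where "e n = 1 / real (Suc n)" for n
  have e: "0 < e n" "e n \<le> 1" for n by (auto simp: e_def)
  have e0: "e \<longlonglongrightarrow> 0" unfolding e_def using LIMSEQ_inverse_real_of_nat by (simp add: inverse_eq_divide)
  obtain H where H: "\<And>n. H n \<in> F" "\<And>n. sqn M (\<lambda>z. u z - H n z) < d + e n"
    using ex[OF e(1)] by metis
  have par: "sqn M (\<lambda>z. H n z - H m z) \<le> 2 * e n + 2 * e m" for n m
  proof -
    let ?a = "\<lambda>z. u z - H n z" and ?b = "\<lambda>z. u z - H m z"
    have L: "?a \<in> L2 M" "?b \<in> L2 M" by (auto intro: L2_diff u F_L2' H)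
    have mid: "(\<lambda>z. (1/2) * H n z + (1/2) * H m z) \<in> F" by (rule F_lin) (auto intro: H)
    have eq1: "(\<lambda>z. ?a z + ?b z) = (\<lambda>z. 2 * (u z - ((1/2) * H n z + (1/2) * H m z)))"
      by (simp add: fun_eq_iff algebra_simps)
    have "4 * d \<le> sqn M (\<lambda>z. ?a z + ?b z)"
      unfolding eq1 sqn_cmult using d_le[OF mid] by simp
    moreover have "sqn M (\<lambda>z. ?a z + ?b z) + sqn M (\<lambda>z. ?b z - ?a z) = 2 * sqn M ?a + 2 * sqn M ?b"
      using sqn_add[OF L] sqn_diff[OF L(2,1)] by (simp add: ip_sym[of M ?b ?a])
    moreover have "(\<lambda>z. ?b z - ?a z) = (\<lambda>z. H n z - H m z)" by auto
    ultimately show ?thesis using H(2)[of n] H(2)[of m] by simp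
  qed
  have "Cauchy (\<lambda>n. H n z)" for z
  proof -
    obtain C where C: "\<And>h. h \<in> F \<Longrightarrow> (norm (h z))\<^sup>2 \<le> C * sqn M h" using eval[of z] by blast
    \<comment> \<open>The constant from the point evaluation may be zero or negative.\<close>
    define C' where "C' = max C 1"
    have C': "(norm (h z))\<^sup>2 \<le> C' * sqn M h" if "h \<in> F" for h
      using C[OF that] mult_right_mono[of C C' "sqn M h"] sqn_nonneg[of M h] by (simp add: C'_def)
    have C'p: "0 < C'" by (simp add: C'_def)
    show ?thesis
    proof (rule metric_CauchyI)
      fix \<epsilon> :: real assume \<epsilon>: "0 < \<epsilon>"
      have "0 < \<epsilon>\<^sup>2 / (4 * C')" using \<epsilon> C'p by simp
      then obtain N where N: "\<And>n. n \<ge> N \<Longrightarrow> e n < \<epsilon>\<^sup>2 / (4 * C')"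
        using order_tendstoD(2)[OF e0] unfolding eventually_sequentially by blast
      show "\<exists>N. \<forall>m\<ge>N. \<forall>n\<ge>N. dist (H m z) (H n z) < \<epsilon>"
      proof (intro exI allI impI)
        fix m n assume mn: "N \<le> m" "N \<le> n"
        have "(dist (H m z) (H n z))\<^sup>2 \<le> C' * sqn M (\<lambda>z. H m z - H n z)"
          using C'[OF F_diff[OF H(1)[of m] H(1)[of n]]] by (simp add: dist_norm)
        also have "\<dots> \<le> C' * (2 * e m + 2 * e n)" using C'p par by (intro mult_left_mono) auto
        also have "\<dots> < \<epsilon>\<^sup>2" using N[OF mn(1)] N[OF mn(2)] C'p by (simp add: field_simps)
        finally show "dist (H m z) (H n z) < \<epsilon>" using \<epsilon> power_less_imp_less_base[of "dist (H m z) (H n z)" 2 \<epsilon>] by linarith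
      qed
    qed
  qed
  then have "\<exists>l. (\<lambda>n. H n z) \<longlonglongrightarrow> l" for z
    by (simp add: Cauchy_convergent_iff convergent_def)
  then obtain h where h: "\<And>z. (\<lambda>n. H n z) \<longlonglongrightarrow> h z" by metis
  have [measurable]: "u \<in> borel_measurable M" "H n \<in> borel_measurable M" for n
    by (auto intro: L2_measurable u F_L2' H)
  have hm[measurable]: "h \<in> borel_measurable M"
    by (rule borel_measurable_LIMSEQ_metric[where f = H]) (use h in auto)
  have d0: "0 \<le> d" unfolding d_def using F_zero sqn_nonneg by (intro cInf_greatest) auto
  have "(\<integral>\<^sup>+z. ennreal ((norm (u z - h z))\<^sup>2) \<partial>M) = (\<integral>\<^sup>+z. liminf (\<lambda>n. ennreal ((norm (u z - H n z))\<^sup>2)) \<partial>M)"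
  proof (rule nn_integral_cong)
    fix z
    have "(\<lambda>n. ennreal ((norm (u z - H n z))\<^sup>2)) \<longlonglongrightarrow> ennreal ((norm (u z - h z))\<^sup>2)"
      by (intro tendsto_ennrealI tendsto_intros h)
    then show "ennreal ((norm (u z - h z))\<^sup>2) = liminf (\<lambda>n. ennreal ((norm (u z - H n z))\<^sup>2))"
      by (rule lim_imp_Liminf[OF trivial_limit_sequentially, symmetric])
  qed
  also have "\<dots> \<le> liminf (\<lambda>n. (\<integral>\<^sup>+z. ennreal ((norm (u z - H n z))\<^sup>2) \<partial>M))"
    by (rule nn_integral_liminf) measurable
  also have "\<dots> = liminf (\<lambda>n. ennreal (sqn M (\<lambda>z. u z - H n z)))"
    by (intro arg_cong[where f = liminf] ext nn_integral_sqn L2_diff u F_L2' H)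
  also have "\<dots> \<le> liminf (\<lambda>n. ennreal (d + e n))"
    by (intro Liminf_mono always_eventually allI ennreal_leI less_imp_le H)
  also have "\<dots> = ennreal d"
  proof -
    have "(\<lambda>n. ennreal (d + e n)) \<longlonglongrightarrow> ennreal (d + 0)" by (intro tendsto_ennrealI tendsto_intros e0)
    then show ?thesis using lim_imp_Liminf[OF trivial_limit_sequentially] by fastforce
  qed
  finally have le: "(\<integral>\<^sup>+z. ennreal ((norm (u z - h z))\<^sup>2) \<partial>M) \<le> ennreal d" .
  have uh: "(\<lambda>z. u z - h z) \<in> L2 M" "sqn M (\<lambda>z. u z - h z) \<le> d"
    using L2I[OF _ le] d0 by auto
  have "h \<in> L2 M" using L2_diff[OF u uh(1)] by simp
  moreover have "sqn M (H n) \<le> 2 * sqn M u + 2 * (d + 1)" for n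
  proof -
    have "sqn M (\<lambda>z. u z + - 1 * (u z - H n z)) \<le> 2 * sqn M u + 2 * sqn M (\<lambda>z. - 1 * (u z - H n z))"
      by (intro sqn_add_le u L2_cmult L2_diff F_L2' H)
    then show ?thesis using H(2)[of n] e(2)[of n] unfolding sqn_cmult by simp
  qed
  ultimately have hF: "h \<in> F" by (intro closed[OF H(1) _ h])
  show ?thesis by (rule that[OF hF], rule order_trans[OF uh(2) d_le])
qed

text \<open>
  The minimiser of the distance is the projection; uniqueness as a function, not only almost
  everywhere, again comes from the point evaluations.
\<close>

lemma proj_exists1:
  assumes u: "u \<in> L2 M"
  shows "\<exists>!h. h \<in> F \<and> (\<forall>k\<in>F. (\<integral>z. (u z - h z) * cnj (k z) \<partial>M) = 0)"
proof -
  obtain h where h: "h \<in> F" "\<And>k. k \<in> F \<Longrightarrow> sqn M (\<lambda>z. u z - h z) \<le> sqn M (\<lambda>z. u z - k z)"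
    using minimizer[OF u] by blast
  let ?w = "\<lambda>z. u z - h z"
  have w: "?w \<in> L2 M" by (intro L2_diff u F_L2' h)
  have orth: "ip M ?w k = 0" if k: "k \<in> F" for k
  proof (rule ccontr)
    assume a: "ip M ?w k \<noteq> 0"
    have kL: "k \<in> L2 M" by (rule F_L2'[OF k])
    \<comment> \<open>Moving the minimiser \<open>h\<close> by \<open>c k\<close> would decrease the distance; the added \<open>1\<close> avoids a division by zero.\<close>
    define c where "c = ip M ?w k / of_real (sqn M k + 1)"
    have s: "0 < sqn M k + 1" using sqn_nonneg[of M k] by simp
    have "(\<lambda>z. h z + c * k z) \<in> F" using F_add[OF h(1) F_cmult[OF k]] .
    then have "sqn M ?w \<le> sqn M (\<lambda>z. u z - (h z + c * k z))" by (rule h)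
    also have "(\<lambda>z. u z - (h z + c * k z)) = (\<lambda>z. ?w z - c * k z)" by auto
    also have "sqn M \<dots> = sqn M ?w + (norm c)\<^sup>2 * sqn M k - 2 * Re (cnj c * ip M ?w k)"
      using sqn_diff[OF w L2_cmult[OF kL], of c] by (simp add: sqn_cmult ip_cmult_right)
    finally have "2 * Re (cnj c * ip M ?w k) \<le> (norm c)\<^sup>2 * sqn M k" by simp
    moreover have "cnj c * ip M ?w k = of_real ((norm (ip M ?w k))\<^sup>2 / (sqn M k + 1))"
      by (simp add: c_def complex_norm_square[symmetric] mult.commute)
    moreover have "norm c = norm (ip M ?w k) / (sqn M k + 1)"
      unfolding c_def norm_divide norm_of_real using s by simp
    ultimately have "2 * ((norm (ip M ?w k))\<^sup>2 / (sqn M k + 1)) \<le> (norm (ip M ?w k))\<^sup>2 / (sqn M k + 1) * (sqn M k / (sqn M k + 1))"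
      by (simp add: power_divide power2_eq_square)
    also have "\<dots> \<le> (norm (ip M ?w k))\<^sup>2 / (sqn M k + 1) * 1"
      using s by (intro mult_left_mono) (auto simp: divide_le_eq)
    finally have "(norm (ip M ?w k))\<^sup>2 / (sqn M k + 1) \<le> 0" by simp
    then show False using a s by (simp add: divide_le_0_iff)
  qed
  show ?thesis
  proof (rule ex1I[of _ h])
    show "h \<in> F \<and> (\<forall>k\<in>F. (\<integral>z. (u z - h z) * cnj (k z) \<partial>M) = 0)"
      using h(1) orth by (auto simp: ip_def)
    fix h' assume h': "h' \<in> F \<and> (\<forall>k\<in>F. (\<integral>z. (u z - h' z) * cnj (k z) \<partial>M) = 0)"
    let ?k = "\<lambda>z. h z - h' z"
    have k: "?k \<in> F" using h(1) h' by (intro F_diff) auto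
    have "ip M ?w ?k = 0" "ip M (\<lambda>z. u z - h' z) ?k = 0" using orth[OF k] h' k by (auto simp: ip_def)
    moreover have "ip M (\<lambda>z. (u z - h' z) - ?w z) ?k = ip M (\<lambda>z. u z - h' z) ?k - ip M ?w ?k"
      using h(1) h' k w by (intro ip_diff_left L2_diff u F_L2') auto
    ultimately have "ip M ?k ?k = 0" by simp
    then have "sqn M ?k = 0" by (simp add: ip_self)
    from sqn_zero_imp[OF k this] show "h' = h" by (simp add: fun_eq_iff)
  qed
qed

abbreviation P where "P \<equiv> orth_proj M F"

lemma P_in: "u \<in> L2 M \<Longrightarrow> P u \<in> F"
  using theI'[OF proj_exists1[of u]] unfolding orth_proj_def by (rule conjunct1)

lemma P_orth: assumes "u \<in> L2 M" "k \<in> F" shows "ip M (\<lambda>z. u z - P u z) k = 0"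
  using conjunct2[OF theI'[OF proj_exists1[OF assms(1)]]] assms(2) unfolding orth_proj_def ip_def by (rule bspec)

lemma P_unique:
  assumes "u \<in> L2 M" "h \<in> F" "\<And>k. k \<in> F \<Longrightarrow> ip M (\<lambda>z. u z - h z) k = 0"
  shows "P u = h"
  unfolding orth_proj_def
  by (rule the1_equality[OF proj_exists1[OF assms(1)]]) (use assms in \<open>simp add: ip_def\<close>)

lemma P_diff: assumes "u \<in> L2 M" "v \<in> L2 M" shows "P (\<lambda>z. u z - v z) = (\<lambda>z. P u z - P v z)"
proof (rule P_unique)
  note L = assms P_in[OF assms(1), THEN F_L2'] P_in[OF assms(2), THEN F_L2']
  fix k assume k: "k \<in> F"
  have "ip M (\<lambda>z. (u z - P u z) - (v z - P v z)) k = 0"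
    using P_orth[OF assms(1) k] P_orth[OF assms(2) k] ip_diff_left[OF L2_diff[OF L(1,3)] L2_diff[OF L(2,4)] F_L2'[OF k]] by simp
  then show "ip M (\<lambda>z. u z - v z - (P u z - P v z)) k = 0" by (simp add: algebra_simps)
qed (intro assms L2_diff F_diff P_in)+

lemma P_ip: "u \<in> L2 M \<Longrightarrow> k \<in> F \<Longrightarrow> ip M (P u) k = ip M u k"
  using P_orth[of u k] ip_diff_left[of u M "P u" k] F_L2'[OF P_in[of u]] F_L2'[of k] by simp

lemma P_best: assumes u: "u \<in> L2 M" and h: "h \<in> F" shows "sqn M (\<lambda>z. u z - P u z) \<le> sqn M (\<lambda>z. u z - h z)"
proof -
  let ?w = "\<lambda>z. u z - P u z" and ?k = "\<lambda>z. P u z - h z"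
  have k: "?k \<in> F" by (intro F_diff P_in u h)
  have w: "?w \<in> L2 M" by (intro L2_diff u F_L2' P_in)
  have "sqn M (\<lambda>z. ?w z + ?k z) = sqn M ?w + sqn M ?k"
    using sqn_add[OF w F_L2'[OF k]] P_orth[OF u k] by simp
  then show ?thesis using sqn_nonneg[of M ?k] by simp
qed

definition toep :: "('a \<Rightarrow> complex) \<Rightarrow> ('a \<Rightarrow> complex) \<Rightarrow> ('a \<Rightarrow> complex)" where
  "toep f u = P (\<lambda>z. f z * u z)"

text \<open>
  Since \<open>w = (I - P) (g u)\<close> is orthogonal to \<open>F\<close>, the function
  \<open>cnj f k\<close> in the last equation may be replaced by its component orthogonal to
  \<open>F\<close>, which is the Hankel operator with symbol \<open>cnj f\<close> applied to
  \<open>k\<close>.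
\<close>

lemma semicommutator:
  assumes f: "f \<in> borel_measurable M" "AE z in M. norm (f z) \<le> C"
    and g: "g \<in> borel_measurable M" "AE z in M. norm (g z) \<le> D" and u: "u \<in> F"
  defines "w \<equiv> \<lambda>z. g z * u z - toep g u z"
  shows "w \<in> L2 M" "sqn M w \<le> sqn M (\<lambda>z. g z * u z)"
    "(\<lambda>z. toep f (toep g u) z - toep (\<lambda>z. f z * g z) u z) = (\<lambda>z. - P (\<lambda>z. f z * w z) z)"
    "\<And>k. k \<in> F \<Longrightarrow> ip M (P (\<lambda>z. f z * w z)) k = ip M w (\<lambda>z. cnj (f z) * k z - P (\<lambda>z. cnj (f z) * k z) z)"
proof -
  have gu: "(\<lambda>z. g z * u z) \<in> L2 M" by (rule L2_mult_bounded[OF F_L2'[OF u] g])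
  have Tg: "toep g u \<in> F" unfolding toep_def by (rule P_in[OF gu])
  show w: "w \<in> L2 M" unfolding w_def by (intro L2_diff gu F_L2' Tg)
  show "sqn M w \<le> sqn M (\<lambda>z. g z * u z)"
    using P_best[OF gu F_zero] by (simp add: w_def toep_def)
  have fw: "(\<lambda>z. f z * w z) \<in> L2 M" by (rule L2_mult_bounded[OF w f])
  have fT: "(\<lambda>z. f z * toep g u z) \<in> L2 M" by (rule L2_mult_bounded[OF F_L2'[OF Tg] f])
  have fgu: "(\<lambda>z. f z * g z * u z) \<in> L2 M"
    using L2_mult_bounded(1)[OF gu f] by (simp add: mult.assoc)
  have "(\<lambda>z. f z * w z) = (\<lambda>z. f z * g z * u z - f z * toep g u z)"
    by (simp add: w_def algebra_simps)
  then have "P (\<lambda>z. f z * w z) = (\<lambda>z. toep (\<lambda>z. f z * g z) u z - toep f (toep g u) z)"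
    using P_diff[OF fgu fT] by (simp add: toep_def)
  then show "(\<lambda>z. toep f (toep g u) z - toep (\<lambda>z. f z * g z) u z) = (\<lambda>z. - P (\<lambda>z. f z * w z) z)" by simp
  fix k assume k: "k \<in> F"
  have cf: "(\<lambda>z. cnj (f z)) \<in> borel_measurable M" "AE z in M. norm (cnj (f z)) \<le> C"
    using f by (auto intro: borel_measurable_cnj)
  have cfk: "(\<lambda>z. cnj (f z) * k z) \<in> L2 M" by (rule L2_mult_bounded[OF F_L2'[OF k] cf])
  have "ip M (P (\<lambda>z. f z * w z)) k = ip M (\<lambda>z. f z * w z) k" by (rule P_ip[OF fw k])
  also have "\<dots> = ip M w (\<lambda>z. cnj (f z) * k z)" by (simp add: ip_def mult_ac)
  also have "\<dots> = ip M w (\<lambda>z. cnj (f z) * k z) - ip M w (P (\<lambda>z. cnj (f z) * k z))"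
    using P_orth[OF gu P_in[OF cfk]] by (simp add: w_def toep_def)
  also have "\<dots> = ip M w (\<lambda>z. cnj (f z) * k z - P (\<lambda>z. cnj (f z) * k z) z)"
    by (rule ip_diff_right[symmetric, OF cfk F_L2'[OF P_in[OF cfk]] w])
  finally show "ip M (P (\<lambda>z. f z * w z)) k = ip M w (\<lambda>z. cnj (f z) * k z - P (\<lambda>z. cnj (f z) * k z) z)" .
qed

text \<open>
  With \<open>k\<close> the semicommutator applied to \<open>u\<close>, the last part of
  \<open>semicommutator\<close> bounds \<open>\<parallel>k\<parallel>\<^sup>2\<close> by
  \<open>\<parallel>w\<parallel>\<close> times the Hankel operator applied to \<open>k\<close>.
\<close>

lemma semicommutator_bound:
  assumes f: "f \<in> borel_measurable M" "AE z in M. norm (f z) \<le> C"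
    and g: "g \<in> borel_measurable M" "AE z in M. norm (g z) \<le> D" and u: "u \<in> F"
    and e: "0 \<le> e" "\<And>k. k \<in> F \<Longrightarrow> sqn M (\<lambda>z. cnj (f z) * k z - P (\<lambda>z. cnj (f z) * k z) z) \<le> e * sqn M k"
  shows "(\<lambda>z. toep f (toep g u) z - toep (\<lambda>z. f z * g z) u z) \<in> F"
    "sqn M (\<lambda>z. toep f (toep g u) z - toep (\<lambda>z. f z * g z) u z) \<le> e * D\<^sup>2 * sqn M u"
proof -
  let ?w = "\<lambda>z. g z * u z - toep g u z"
  note s = semicommutator[OF f g u]
  have fw: "(\<lambda>z. f z * ?w z) \<in> L2 M" by (rule L2_mult_bounded[OF s(1) f])
  define k where "k = P (\<lambda>z. f z * ?w z)"
  have k: "k \<in> F" unfolding k_def by (rule P_in[OF fw])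
  show "(\<lambda>z. toep f (toep g u) z - toep (\<lambda>z. f z * g z) u z) \<in> F"
    unfolding s(3) using F_cmult[OF k, of "-1"] by (simp add: k_def)
  have cf: "(\<lambda>z. cnj (f z)) \<in> borel_measurable M" "AE z in M. norm (cnj (f z)) \<le> C"
    using f by (auto intro: borel_measurable_cnj)
  have cfk: "(\<lambda>z. cnj (f z) * k z) \<in> L2 M" by (rule L2_mult_bounded[OF F_L2'[OF k] cf])
  let ?v = "\<lambda>z. cnj (f z) * k z - P (\<lambda>z. cnj (f z) * k z) z"
  have v: "?v \<in> L2 M" by (intro L2_diff cfk F_L2' P_in)
  have "complex_of_real (sqn M k) = ip M ?w ?v"
    using s(4)[OF k] by (simp add: ip_self[symmetric] k_def)
  then have "norm (complex_of_real (sqn M k)) = norm (ip M ?w ?v)" by simp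
  then have "(sqn M k)\<^sup>2 = (norm (ip M ?w ?v))\<^sup>2" using sqn_nonneg[of M k] by simp
  also have "\<dots> \<le> sqn M ?w * sqn M ?v" by (rule ip_Cauchy_Schwarz[OF s(1) v])
  also have "\<dots> \<le> (D\<^sup>2 * sqn M u) * (e * sqn M k)"
    using L2_mult_bounded(2)[OF F_L2'[OF u] g] s(2) e(2)[OF k] sqn_nonneg by (intro mult_mono) (auto intro: order_trans)
  finally have le: "sqn M k * sqn M k \<le> (e * D\<^sup>2 * sqn M u) * sqn M k" by (simp add: power2_eq_square mult_ac)
  have "sqn M k \<le> e * D\<^sup>2 * sqn M u"
  proof (cases "sqn M k = 0")
    case False
    then have "0 < sqn M k" using sqn_nonneg[of M k] by linarith
    then show ?thesis using le by (simp add: mult_le_cancel_right)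
  qed (use e sqn_nonneg[of M u] in simp)
  then show "sqn M (\<lambda>z. toep f (toep g u) z - toep (\<lambda>z. f z * g z) u z) \<le> e * D\<^sup>2 * sqn M u"
    unfolding s(3) using sqn_cmult[of M "-1" k] by (simp add: k_def)
qed

text \<open>
  For \<open>g = cnj f\<close> the semicommutator is minus the Hankel operator followed by its
  adjoint, so its pairing with \<open>u\<close> is minus the squared norm of the Hankel operator
  applied to \<open>u\<close>.
\<close>

lemma hankel_bound:
  assumes f: "f \<in> borel_measurable M" "AE z in M. norm (f z) \<le> C" and u: "u \<in> F"
    and e: "0 \<le> e" "sqn M (\<lambda>z. toep f (toep (\<lambda>z. cnj (f z)) u) z - toep (\<lambda>z. f z * cnj (f z)) u z) \<le> e\<^sup>2"
  shows "sqn M (\<lambda>z. cnj (f z) * u z - P (\<lambda>z. cnj (f z) * u z) z) \<le> e * sqrt (sqn M u)"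
proof -
  have cf: "(\<lambda>z. cnj (f z)) \<in> borel_measurable M" "AE z in M. norm (cnj (f z)) \<le> C"
    using f by (auto intro: borel_measurable_cnj)
  let ?w = "\<lambda>z. cnj (f z) * u z - P (\<lambda>z. cnj (f z) * u z) z"
  note s = semicommutator[OF f cf u, unfolded toep_def]
  have fw: "(\<lambda>z. f z * ?w z) \<in> L2 M" by (rule L2_mult_bounded[OF s(1) f])
  let ?k = "P (\<lambda>z. f z * ?w z)"
  have "complex_of_real (sqn M ?w) = ip M ?k u"
    using s(4)[OF u] by (simp add: ip_self[symmetric])
  then have "norm (complex_of_real (sqn M ?w)) = norm (ip M ?k u)" by simp
  then have "(sqn M ?w)\<^sup>2 = (norm (ip M ?k u))\<^sup>2" using sqn_nonneg[of M ?w] by simp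
  also have "\<dots> \<le> sqn M ?k * sqn M u" by (intro ip_Cauchy_Schwarz F_L2' P_in fw u)
  also have "\<dots> \<le> e\<^sup>2 * sqn M u"
    using e(2) sqn_cmult[of M "-1" ?k] unfolding toep_def s(3) by (intro mult_right_mono sqn_nonneg) simp
  also have "\<dots> = (e * sqrt (sqn M u))\<^sup>2" using sqn_nonneg[of M u] by (simp add: power_mult_distrib)
  finally show ?thesis by (rule power2_le_imp_le) (use e sqn_nonneg[of M u] in simp)
qed

end

section \<open>Weighted spaces of entire functions\<close>

lemma holo_lin: assumes "h \<in> holo S" "k \<in> holo S" shows "(\<lambda>z. a * h z + b * k z) \<in> holo S"
  unfolding holo_def mem_Collect_eq
proof
  fix z assume z: "z \<in> S"
  have "((\<lambda>z. a * h z + b * k z) has_derivative (\<lambda>v. a * hder h z v + b * hder k z v)) (at z)"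
    by (intro has_derivative_add has_derivative_mult_right hder(1)[OF _ z] assms)
  then show "\<exists>D. ((\<lambda>z. a * h z + b * k z) has_derivative D) (at z) \<and> (\<forall>c v. D (c *s v) = c * D v)"
    by (intro exI conjI) (auto simp: hder(2)[OF assms(1) z] hder(2)[OF assms(2) z] algebra_simps)
qed

lemma holo_mult: assumes "h \<in> holo S" "k \<in> holo S" shows "(\<lambda>z. h z * k z) \<in> holo S"
  unfolding holo_def mem_Collect_eq
proof
  fix z assume z: "z \<in> S"
  have "((\<lambda>z. h z * k z) has_derivative (\<lambda>v. h z * hder k z v + hder h z v * k z)) (at z)"
    by (intro has_derivative_mult hder(1)[OF _ z] assms)
  then show "\<exists>D. ((\<lambda>z. h z * k z) has_derivative D) (at z) \<and> (\<forall>c v. D (c *s v) = c * D v)"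
    by (intro exI conjI) (auto simp: hder(2)[OF assms(1) z] hder(2)[OF assms(2) z] algebra_simps)
qed

lemma holo_const: "(\<lambda>z. c) \<in> holo S"
  unfolding holo_def by (auto intro!: exI[of _ "\<lambda>_. 0"])

lemma bounded_linear_cdot: "bounded_linear (cdot p)"
  unfolding linear_conv_bounded_linear[symmetric]
  by (intro linearI) (simp_all add: cdot_add cdot_scaleR)

lemma holo_exp_cdot: "(\<lambda>z. exp (a + cdot p (z - b))) \<in> holo S"
  unfolding holo_def mem_Collect_eq
proof
  fix z
  have "((\<lambda>z. a + cdot p (z - b)) has_derivative (\<lambda>v. cdot p v)) (at z)"
  proof -
    have "((\<lambda>z. z - b) has_derivative (\<lambda>v. v)) (at z)" by (auto intro!: derivative_eq_intros)
    from has_derivative_add[OF has_derivative_const[of a] bounded_linear.has_derivative[OF bounded_linear_cdot this]]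
    show ?thesis by simp
  qed
  from has_derivative_compose[OF this DERIV_exp[unfolded has_field_derivative_def]]
  show "\<exists>D. ((\<lambda>z. exp (a + cdot p (z - b))) has_derivative D) (at z) \<and> (\<forall>c v. D (c *s v) = c * D v)"
    by (intro exI conjI, assumption) (simp add: cdot_smult)
qed

lemma holo_scale: assumes h: "h \<in> holo S" shows "(\<lambda>z. h (c *\<^sub>R z)) \<in> holo {z. c *\<^sub>R z \<in> S}"
  unfolding holo_def mem_Collect_eq
proof
  fix z assume "z \<in> {z. c *\<^sub>R z \<in> S}"
  then have z: "c *\<^sub>R z \<in> S" by simp
  have "((\<lambda>z. c *\<^sub>R z) has_derivative (\<lambda>v. c *\<^sub>R v)) (at z)" by (auto intro!: derivative_eq_intros)
  from has_derivative_compose[OF this hder(1)[OF h z]]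
  have "((\<lambda>z. h (c *\<^sub>R z)) has_derivative (\<lambda>v. hder h (c *\<^sub>R z) (c *\<^sub>R v))) (at z)" .
  moreover have "hder h (c *\<^sub>R z) (c *\<^sub>R (a *s v)) = a * hder h (c *\<^sub>R z) (c *\<^sub>R v)" for a v
  proof -
    have "c *\<^sub>R (a *s v) = a *s (c *\<^sub>R v)" by (simp add: vec_eq_iff)
    then show ?thesis by (simp add: hder(2)[OF h z])
  qed
  ultimately show "\<exists>D. ((\<lambda>z. h (c *\<^sub>R z)) has_derivative D) (at z) \<and> (\<forall>c v. D (c *s v) = c * D v)" by blast
qed

text \<open>
  Cauchy-Schwarz in the mean value formula \<open>holo_rho_mean\<close>.
\<close>

lemma holo_sup_bound:
  fixes h :: "complex^'n \<Rightarrow> complex"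
  assumes h: "h \<in> holo S" and S: "open S" "cball z 1 \<subseteq> S"
  shows "ennreal ((norm (h z))\<^sup>2) \<le> ennreal (1 / bmass TYPE(complex^'n)) * (\<integral>\<^sup>+x\<in>cball z 1. ennreal ((norm (h x))\<^sup>2) \<partial>lborel)"
proof -
  let ?b = "bmass TYPE(complex^'n)"
  let ?hi = "\<lambda>x. indicator (cball z 1) x *\<^sub>R h x"
  have c: "continuous_on (cball z 1) h" by (rule continuous_on_subset[OF holo_continuous_on[OF h] S(2)])
  have [measurable]: "?hi \<in> borel_measurable borel"
    by (intro borel_measurable_continuous_on_indicator c) simp
  note rc = rho_shift_continuous[of z]
  have [measurable]: "(\<lambda>x. rho (z - x)) \<in> borel_measurable borel"
    by (rule borel_measurable_continuous_onI[OF rc])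
  have eq: "h x * of_real (rho (z - x)) = ?hi x * of_real (rho (z - x))" for x
    by (cases "norm (z - x) \<le> 1") (auto simp: rho_outside dist_norm)
  have int: "integrable lborel (\<lambda>x. ?hi x * of_real (rho (z - x)))"
  proof -
    have "continuous_on (cball z 1) (\<lambda>x. h x * of_real (rho (z - x)))"
      by (intro continuous_intros c continuous_on_subset[OF rc]) auto
    from borel_integrable_compact[OF compact_cball this] show ?thesis by simp
  qed
  have "(\<integral>\<^sup>+x. (ennreal (rho (z - x)))\<^sup>2 \<partial>lborel) \<le> (\<integral>\<^sup>+x. ennreal (1 / ?b) * ennreal (rho (z - x)) \<partial>lborel)"
  proof (rule nn_integral_mono)
    fix x
    have "(rho (z - x))\<^sup>2 \<le> 1 / ?b * rho (z - x)"
      unfolding power2_eq_square by (intro mult_right_mono rho_le rho_nonneg)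
    then show "(ennreal (rho (z - x)))\<^sup>2 \<le> ennreal (1 / ?b) * ennreal (rho (z - x))"
      using bmass_pos[where 'a="complex^'n"] by (simp add: ennreal_power rho_nonneg ennreal_mult[symmetric] ennreal_leI)
  qed
  also have "\<dots> = ennreal (1 / ?b) * (\<integral>\<^sup>+x. ennreal (rho (z - x)) \<partial>lborel)" by (rule nn_integral_cmult) auto
  also have "(\<integral>\<^sup>+x. ennreal (rho (z - x)) \<partial>lborel) = 1"
    using nn_integral_eq_integral[OF rho_shift_integrable] by (simp add: rho_nonneg rho_shift_integral)
  finally have R_le: "(\<integral>\<^sup>+x. (ennreal (rho (z - x)))\<^sup>2 \<partial>lborel) \<le> ennreal (1 / ?b)" by simp
  have "ennreal (norm (h z)) \<le> (\<integral>\<^sup>+x. ennreal (norm (?hi x * of_real (rho (z - x)))) \<partial>lborel)"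
    using integral_norm_bound_ennreal[OF int] holo_rho_mean[OF h S] unfolding eq by simp
  also have "\<dots> = (\<integral>\<^sup>+x. ennreal (norm (?hi x)) * ennreal (rho (z - x)) \<partial>lborel)"
    by (intro nn_integral_cong) (simp add: norm_mult ennreal_mult rho_nonneg mult.assoc)
  finally have "ennreal (norm (h z)) ^ 2 \<le> (\<integral>\<^sup>+x. ennreal (norm (?hi x)) * ennreal (rho (z - x)) \<partial>lborel)\<^sup>2"
    by (intro power_mono) auto
  also have "\<dots> \<le> (\<integral>\<^sup>+x. (ennreal (norm (?hi x)))\<^sup>2 \<partial>lborel) * (\<integral>\<^sup>+x. (ennreal (rho (z - x)))\<^sup>2 \<partial>lborel)"
    by (rule Cauchy_Schwarz_nn_integral) measurable
  also have "\<dots> \<le> (\<integral>\<^sup>+x. (ennreal (norm (?hi x)))\<^sup>2 \<partial>lborel) * ennreal (1 / ?b)"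
    by (intro mult_left_mono R_le) auto
  also have "(\<integral>\<^sup>+x. (ennreal (norm (?hi x)))\<^sup>2 \<partial>lborel) = (\<integral>\<^sup>+x\<in>cball z 1. ennreal ((norm (h x))\<^sup>2) \<partial>lborel)"
    by (intro nn_integral_cong) (auto simp: ennreal_power indicator_def)
  finally show ?thesis by (simp add: ennreal_power mult.commute)
qed

text \<open>
  By \<open>holo_rho_mean\<close> each \<open>H n\<close> equals its convolution with
  \<open>rho\<close>. The same then holds for the limit, which is therefore differentiable, and
  complex linearity of the derivative passes to the limit because the derivatives are convolutions
  with \<open>rho'\<close>.
\<close>

lemma holo_limit:
  fixes H :: "nat \<Rightarrow> complex^'n \<Rightarrow> complex"
  assumes H: "\<And>n. H n \<in> holo UNIV" and lim: "\<And>z. (\<lambda>n. H n z) \<longlonglongrightarrow> h z"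
    and bd: "\<And>R. \<exists>C. \<forall>n z. norm z \<le> R \<longrightarrow> norm (H n z) \<le> C"
  shows "h \<in> holo UNIV"
proof -
  have Hc: "continuous_on UNIV (H n)" for n by (rule holo_continuous_on[OF H])
  have Hm[measurable]: "H n \<in> borel_measurable borel" for n by (rule borel_measurable_continuous_onI[OF Hc])
  have hm[measurable]: "h \<in> borel_measurable borel"
    by (rule borel_measurable_LIMSEQ_metric[where f = H]) (use lim in auto)
  have hb: "\<exists>C. \<forall>z. norm z \<le> R \<longrightarrow> norm (h z) \<le> C" for R
  proof -
    obtain C where C: "\<And>n z. norm z \<le> R \<Longrightarrow> norm (H n z) \<le> C" using bd by blast
    have "norm (h z) \<le> C" if "norm z \<le> R" for z
      by (rule LIMSEQ_le_const2[OF tendsto_norm[OF lim]]) (use C that in auto)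
    then show ?thesis by blast
  qed
  have hl: "locint h" by (rule locint_bounded[OF hm hb])
  have Hl: "locint (H n)" for n by (rule locint_continuous[OF Hc])
  have dom: "(\<lambda>n. \<integral>x. H n x * complex_of_real (K (z - x)) \<partial>lborel) \<longlonglongrightarrow> (\<integral>x. h x * complex_of_real (K (z - x)) \<partial>lborel)"
    if K: "continuous_on UNIV K" "\<And>w. norm w > 1 \<Longrightarrow> K w = 0" for K z
  proof -
    obtain C where C: "\<And>n x. norm x \<le> norm z + 1 \<Longrightarrow> norm (H n x) \<le> C" using bd by blast
    have Kc: "continuous_on UNIV (\<lambda>x. K (z - x))"
      by (rule continuous_on_compose2[OF K(1)]) (auto intro: continuous_intros)
    have Ks: "K (z - x) = 0" if "norm x > norm z + 1" for x
      using norm_triangle_ineq2[of x z] that by (intro K(2)) (simp add: norm_minus_commute)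
    have [measurable]: "(\<lambda>x. K (z - x)) \<in> borel_measurable borel" by (rule borel_measurable_continuous_onI[OF Kc])
    have Ki: "integrable lborel (\<lambda>x. K (z - x))"
      by (rule integrable_continuous_bounded_support[OF Kc Ks])
    show ?thesis
    proof (rule integral_dominated_convergence[where w = "\<lambda>x. C * \<bar>K (z - x)\<bar>"])
      show "integrable lborel (\<lambda>x. C * \<bar>K (z - x)\<bar>)" using Ki by (intro integrable_mult_right integrable_abs)
      show "AE x in lborel. norm (H n x * complex_of_real (K (z - x))) \<le> C * \<bar>K (z - x)\<bar>" for n
      proof (rule AE_I2)
        fix x
        show "norm (H n x * complex_of_real (K (z - x))) \<le> C * \<bar>K (z - x)\<bar>"
          using C[of x n] Ks[of x] by (cases "norm x \<le> norm z + 1") (auto simp: norm_mult intro!: mult_right_mono)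
      qed
      show "AE x in lborel. (\<lambda>n. H n x * complex_of_real (K (z - x))) \<longlonglongrightarrow> h x * complex_of_real (K (z - x))"
        by (intro AE_I2 tendsto_intros lim)
    qed measurable
  qed
  have rho_c: "continuous_on UNIV (rho :: complex^'n \<Rightarrow> real)" "continuous_on UNIV (\<lambda>w::complex^'n. rho' w v)" for v
    by (intro has_derivative_imp_continuous_on[OF rho_deriv] has_derivative_imp_continuous_on[OF rho'_deriv])+
  have mean: "(\<integral>x. H n x * of_real (rho (z - x)) \<partial>lborel) = H n z" for n z
    by (rule holo_rho_mean[OF H]) auto
  have meanh: "(\<integral>x. h x * of_real (rho (z - x)) \<partial>lborel) = h z" for z
    using LIMSEQ_unique[OF dom[OF rho_c(1), of z]] lim[of z] unfolding mean by (simp add: rho_outside)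
  have dh: "(h has_derivative (\<lambda>v. \<integral>x. h x * of_real (rho' (z - x) v) \<partial>lborel)) (at z)" for z
    using conv_rho_deriv[OF hl, of z] unfolding meanh .
  have dH: "hder (H n) z v = (\<integral>x. H n x * of_real (rho' (z - x) v) \<partial>lborel)" for n z v
  proof -
    have "(H n has_derivative (\<lambda>v. \<integral>x. H n x * of_real (rho' (z - x) v) \<partial>lborel)) (at z)"
      using conv_rho_deriv[OF Hl, of n z] unfolding mean .
    from has_derivative_unique[OF hder(1)[OF H UNIV_I] this] show ?thesis by (rule fun_cong)
  qed
  have lim': "(\<lambda>n. hder (H n) z v) \<longlonglongrightarrow> (\<integral>x. h x * of_real (rho' (z - x) v) \<partial>lborel)" for z v
    unfolding dH by (rule dom[OF rho_c(2)]) (simp add: rho_outside)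
  have "(\<integral>x. h x * of_real (rho' (z - x) (c *s v)) \<partial>lborel) = c * (\<integral>x. h x * of_real (rho' (z - x) v) \<partial>lborel)" for z c v
  proof (rule LIMSEQ_unique[OF lim'])
    show "(\<lambda>n. hder (H n) z (c *s v)) \<longlonglongrightarrow> c * (\<integral>x. h x * of_real (rho' (z - x) v) \<partial>lborel)"
      unfolding hder(2)[OF H UNIV_I] by (intro tendsto_intros lim')
  qed
  then show ?thesis unfolding holo_def using dh by blast
qed

definition wmeas :: "real \<Rightarrow> (complex^'n \<Rightarrow> real) \<Rightarrow> (complex^'n) measure" where
  "wmeas c \<psi> = density lebesgue (\<lambda>z. ennreal (c * exp (- 2 * \<psi> z)))"

lemma wmeas_sets[simp, measurable_cong]: "sets (wmeas c \<psi>) = sets lebesgue" by (simp add: wmeas_def)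
lemma wmeas_space[simp]: "space (wmeas c \<psi>) = UNIV" by (simp add: wmeas_def)

lemma wmeas_measurable: "borel_measurable (wmeas c \<psi>) = borel_measurable lebesgue"
  by (rule measurable_cong_sets) auto

lemma lebesgue_measurable_continuous: "continuous_on UNIV f \<Longrightarrow> f \<in> borel_measurable lebesgue"
  by (intro measurable_completion) (simp add: borel_measurable_continuous_onI)

lemma nn_integral_wmeas:
  assumes \<psi>: "continuous_on UNIV \<psi>" and u: "u \<in> borel_measurable lebesgue" and c: "0 \<le> c"
  shows "(\<integral>\<^sup>+z. ennreal ((norm (u z :: complex))\<^sup>2) \<partial>wmeas c \<psi>) = ennreal c * (\<integral>\<^sup>+z. ennreal ((norm (u z))\<^sup>2 * exp (- 2 * \<psi> z)) \<partial>lborel)"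
proof -
  have [measurable]: "\<psi> \<in> borel_measurable lebesgue" by (rule lebesgue_measurable_continuous[OF \<psi>])
  note [measurable] = u
  have "(\<integral>\<^sup>+z. ennreal ((norm (u z))\<^sup>2) \<partial>wmeas c \<psi>) = (\<integral>\<^sup>+z. ennreal (c * exp (- 2 * \<psi> z)) * ennreal ((norm (u z))\<^sup>2) \<partial>lebesgue)"
    unfolding wmeas_def by (rule nn_integral_density) measurable
  also have "\<dots> = (\<integral>\<^sup>+z. ennreal c * ennreal ((norm (u z))\<^sup>2 * exp (- 2 * \<psi> z)) \<partial>lebesgue)"
    using c by (intro nn_integral_cong) (simp add: ennreal_mult[symmetric] mult_ac)
  also have "\<dots> = ennreal c * (\<integral>\<^sup>+z. ennreal ((norm (u z))\<^sup>2 * exp (- 2 * \<psi> z)) \<partial>lebesgue)"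
    by (rule nn_integral_cmult) measurable
  finally show ?thesis by (simp add: nn_integral_completion)
qed

lemma AE_wmeas: "(AE z in lebesgue. Q z) \<Longrightarrow> continuous_on UNIV \<psi> \<Longrightarrow> AE z in wmeas c \<psi>. Q z"
proof -
  assume Q: "AE z in lebesgue. Q z" and \<psi>: "continuous_on UNIV \<psi>"
  have [measurable]: "\<psi> \<in> borel_measurable lebesgue" by (rule lebesgue_measurable_continuous[OF \<psi>])
  have w: "(\<lambda>z. ennreal (c * exp (- 2 * \<psi> z))) \<in> borel_measurable lebesgue" by measurable
  show ?thesis unfolding wmeas_def AE_density[OF w] using Q by eventually_elim simp
qed

text \<open>
  On a bounded set the weight is bounded below, so \<open>holo_sup_bound\<close> bounds the
  functions there by their norms. This gives both the bounded point evaluations and the local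
  boundedness that \<open>holo_limit\<close> asks for.
\<close>

lemma function_hilbert_wmeas:
  fixes \<psi> :: "complex^'n \<Rightarrow> real"
  assumes \<psi>: "continuous_on UNIV \<psi>" and c: "0 < c"
  shows "function_hilbert (wmeas c \<psi>) (L2 (wmeas c \<psi>) \<inter> holo UNIV)"
proof -
  let ?M = "wmeas c \<psi>" and ?b = "bmass TYPE(complex^'n)"
  have local: "\<exists>C. \<forall>h\<in>L2 ?M \<inter> holo UNIV. \<forall>z. norm z \<le> R \<longrightarrow> (norm (h z))\<^sup>2 \<le> C * sqn ?M h" for R
  proof -
    obtain A where A: "\<And>z. norm z \<le> R + 1 \<Longrightarrow> norm (\<psi> z) \<le> A"
      using continuous_on_bounded_cball[OF \<psi>] by blast
    have "(norm (h z))\<^sup>2 \<le> (1 / ?b * exp (2 * A) / c) * sqn ?M h" if h: "h \<in> L2 ?M \<inter> holo UNIV" and z: "norm z \<le> R" for h z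
    proof -
      have hm: "h \<in> borel_measurable lebesgue" using h by (auto simp: L2_iff wmeas_measurable)
      have [measurable]: "h \<in> borel_measurable borel" using h holo_continuous_on borel_measurable_continuous_onI by blast
      have [measurable]: "\<psi> \<in> borel_measurable borel" by (rule borel_measurable_continuous_onI[OF \<psi>])
      have s: "ennreal c * (\<integral>\<^sup>+z. ennreal ((norm (h z))\<^sup>2 * exp (- 2 * \<psi> z)) \<partial>lborel) = ennreal (sqn ?M h)"
        using nn_integral_wmeas[OF \<psi> hm, of c] c nn_integral_sqn[of h ?M] h by simp
      have "ennreal ((norm (h z))\<^sup>2) \<le> ennreal (1 / ?b) * (\<integral>\<^sup>+x\<in>cball z 1. ennreal ((norm (h x))\<^sup>2) \<partial>lborel)"
        by (rule holo_sup_bound[where S = UNIV]) (use h in auto)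
      also have "(\<integral>\<^sup>+x\<in>cball z 1. ennreal ((norm (h x))\<^sup>2) \<partial>lborel) \<le> (\<integral>\<^sup>+x. ennreal (exp (2 * A) / c) * (ennreal c * ennreal ((norm (h x))\<^sup>2 * exp (- 2 * \<psi> x))) \<partial>lborel)"
      proof (rule nn_integral_mono)
        fix x
        show "ennreal ((norm (h x))\<^sup>2) * indicator (cball z 1) x \<le> ennreal (exp (2 * A) / c) * (ennreal c * ennreal ((norm (h x))\<^sup>2 * exp (- 2 * \<psi> x)))"
        proof (cases "x \<in> cball z 1")
          case True
          then have "norm x \<le> R + 1" using z norm_triangle_ineq4[of z "z - x"] by (simp add: dist_norm)
          from A[OF this] have "1 \<le> exp (2 * A) * exp (- 2 * \<psi> x)" by (simp add: exp_add[symmetric] del: exp_add)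
          then have "(norm (h x))\<^sup>2 * 1 \<le> (norm (h x))\<^sup>2 * (exp (2 * A) * exp (- 2 * \<psi> x))" by (intro mult_left_mono) auto
          also have "\<dots> = exp (2 * A) / c * (c * ((norm (h x))\<^sup>2 * exp (- 2 * \<psi> x)))" using c by simp
          finally show ?thesis using True c by (simp add: ennreal_mult[symmetric] ennreal_leI)
        qed simp
      qed
      also have "\<dots> = ennreal (exp (2 * A) / c) * ennreal (sqn ?M h)"
        unfolding s[symmetric] by (simp add: nn_integral_cmult)
      finally have "ennreal ((norm (h z))\<^sup>2) \<le> ennreal (1 / ?b) * (ennreal (exp (2 * A) / c) * ennreal (sqn ?M h))"
        by (simp add: mult_left_mono)
      also have "\<dots> = ennreal ((1 / ?b * exp (2 * A) / c) * sqn ?M h)"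
      proof -
        have "ennreal (exp (2 * A) / c) * ennreal (sqn ?M h) = ennreal (exp (2 * A) / c * sqn ?M h)"
          using c sqn_nonneg[of ?M h] by (intro ennreal_mult[symmetric]) auto
        moreover have "ennreal (1 / ?b) * ennreal (exp (2 * A) / c * sqn ?M h) = ennreal (1 / ?b * (exp (2 * A) / c * sqn ?M h))"
          using c bmass_pos[where 'a="complex^'n"] sqn_nonneg[of ?M h] by (intro ennreal_mult[symmetric]) auto
        ultimately show ?thesis by simp
      qed
      finally show ?thesis using c bmass_pos[where 'a="complex^'n"] sqn_nonneg[of ?M h] by (simp add: ennreal_le_iff)
    qed
    then show ?thesis by blast
  qed
  show ?thesis
  proof
    show "L2 ?M \<inter> holo UNIV \<subseteq> L2 ?M" by simp
    show "(\<lambda>z. a * h z + b * k z) \<in> L2 ?M \<inter> holo UNIV" if "h \<in> L2 ?M \<inter> holo UNIV" "k \<in> L2 ?M \<inter> holo UNIV" for h k a b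
      using that holo_lin L2_add[OF L2_cmult L2_cmult] by blast
    show "(\<lambda>z. 0) \<in> L2 ?M \<inter> holo UNIV" by (auto simp: L2_iff holo_const)
    show "\<exists>C. \<forall>h\<in>L2 ?M \<inter> holo UNIV. (norm (h z))\<^sup>2 \<le> C * sqn ?M h" for z
      using local[of "norm z"] by blast
    fix H h B assume H: "\<And>n::nat. H n \<in> L2 ?M \<inter> holo UNIV" "\<And>n. sqn ?M (H n) \<le> B" "\<And>z. (\<lambda>n. H n z) \<longlonglongrightarrow> h z" "h \<in> L2 ?M"
    have "h \<in> holo UNIV"
    proof (rule holo_limit[OF _ H(3)])
      fix R
      obtain C where C: "\<And>h z. h \<in> L2 ?M \<inter> holo UNIV \<Longrightarrow> norm z \<le> R \<Longrightarrow> (norm (h z))\<^sup>2 \<le> C * sqn ?M h"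
        using local[of R] by blast
      have "norm (H n z) \<le> sqrt (\<bar>C\<bar> * B)" if "norm z \<le> R" for n z
      proof -
        have "(norm (H n z))\<^sup>2 \<le> C * sqn ?M (H n)" by (rule C[OF H(1) that])
        also have "\<dots> \<le> \<bar>C\<bar> * sqn ?M (H n)" by (intro mult_right_mono sqn_nonneg) auto
        also have "\<dots> \<le> \<bar>C\<bar> * B" by (intro mult_left_mono H) auto
        finally show ?thesis by (rule real_le_rsqrt)
      qed
      then show "\<exists>C. \<forall>n z. norm z \<le> R \<longrightarrow> norm (H n z) \<le> C" by blast
    qed (use H in auto)
    then show "h \<in> L2 ?M \<inter> holo UNIV" using H(4) by simp
  qed
qed

section \<open>Uniformly convex weights\<close>

lemma norm_axis_complex: "norm (axis k (c::complex) :: complex^'n) = norm c"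
  by (simp add: norm_eq_sqrt_inner inner_axis_axis)

lemma emeasure_cball_translate:
  fixes x :: "'a::euclidean_space"
  shows "emeasure lborel (cball x r) = emeasure lborel (cball (0::'a::euclidean_space) r)"
proof -
  have "(\<integral>\<^sup>+y. indicator (cball x r) y \<partial>lborel) = (\<integral>\<^sup>+y. indicator (cball x r) (x + y) \<partial>(lborel :: 'a measure))"
    using nn_integral_lborel_affine[OF borel_measurable_indicator[OF borel_closed[OF closed_cball]], of 1 x r x] by simp
  also have "(\<lambda>y. indicator (cball x r) (x + y) :: ennreal) = indicator (cball 0 r)"
    by (auto simp: indicator_def dist_norm fun_eq_iff)
  finally show ?thesis by simp
qed

lemma measure_cball_translate:
  fixes x :: "'a::euclidean_space"
  shows "measure lborel (cball x r) = measure lborel (cball (0::'a::euclidean_space) r)"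
  unfolding measure_def by (subst emeasure_cball_translate) (rule refl)

text \<open>
  The map \<open>p\<close> is the gradient written in complex form, \<open>Re (cdot (p x)
  v)\<close> being the differential of \<open>\<phi>\<close> applied to \<open>v\<close>. The two
  inequalities are the integrated form of the bounds on the Hessian.
\<close>

locale convex_weight =
  fixes \<phi> :: "complex^'n \<Rightarrow> real" and p :: "complex^'n \<Rightarrow> complex^'n" and m M :: real
  assumes m: "0 < m" and M: "0 < M"
    and phi_c: "continuous_on UNIV \<phi>" and p_c: "continuous_on UNIV p"
    and lower: "\<And>x y. \<phi> x + Re (cdot (p x) (y - x)) + m * (norm (y - x))\<^sup>2 \<le> \<phi> y"
    and upper: "\<And>x y. \<phi> y \<le> \<phi> x + Re (cdot (p x) (y - x)) + M * (norm (y - x))\<^sup>2"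
begin

text \<open>
  The gradient has bounded oscillation: comparing \<open>\<phi>\<close> at \<open>x + v\<close>
  with the affine minorant at \<open>y\<close> and the quadratic majorants at \<open>x\<close> and
  \<open>y\<close> bounds \<open>Re (cdot (p y - p x) v)\<close> for every unit vector
  \<open>v\<close>.
\<close>

lemma norm_p_diff_le:
  assumes "norm (x - y) \<le> 1"
  shows "norm (p x $ k - p y $ k) \<le> 2 * M"
proof -
  define d where "d = p y $ k - p x $ k"
  \<comment> \<open>The unit vector \<open>v\<close> is chosen so that \<open>Re (cdot (p y - p x) v)\<close> is the norm of the \<open>k\<close>-th component \<open>d\<close>.\<close>
  define c where "c = (if d = 0 then 1 else cnj d / of_real (norm d))"
  have c: "norm c = 1" by (auto simp: c_def norm_divide)
  have cd: "c * d = of_real (norm d)"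
    by (auto simp: c_def complex_norm_square[symmetric] power2_eq_square mult.commute)
  define v where "v = axis k c"
  have v: "norm v = 1" using c by (simp add: v_def norm_axis_complex)
  have cdv: "cdot q v = q $ k * c" for q
    by (simp add: cdot_def v_def axis_def if_distrib cong: if_cong)
  have xy: "M * (norm (x - y))\<^sup>2 \<le> M * 1"
    using M assms by (intro mult_left_mono) (auto simp: power_le_one)
  have "\<phi> (x + v) \<ge> \<phi> y + Re (cdot (p y) (x + v - y)) + m * (norm (x + v - y))\<^sup>2" by (rule lower)
  moreover have "0 \<le> m * (norm (x + v - y))\<^sup>2" using m by simp
  moreover have "cdot (p y) (x + v - y) = cdot (p y) (x - y) + cdot (p y) v" by (simp add: cdot_add cdot_diff)
  moreover have "\<phi> x \<le> \<phi> y + Re (cdot (p y) (x - y)) + M * (norm (x - y))\<^sup>2" by (rule upper)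
  moreover have "\<phi> (x + v) \<le> \<phi> x + Re (cdot (p x) v) + M * (norm v)\<^sup>2" using upper[of "x + v" x] by simp
  ultimately have "Re (cdot (p y) v) - Re (cdot (p x) v) \<le> 2 * M" using xy v by simp
  moreover have "Re (cdot (p y) v) - Re (cdot (p x) v) = Re (c * d)" by (simp add: cdv d_def algebra_simps)
  ultimately have "norm d \<le> 2 * M" by (simp add: cd)
  then show ?thesis by (simp add: d_def norm_minus_commute)
qed

lemma p_comp_cont: "continuous_on UNIV (\<lambda>x. p x $ k)" by (intro continuous_intros p_c)

lemma p_locint: "locint (\<lambda>x. p x $ k)" by (rule locint_continuous[OF p_comp_cont])

text \<open>
  The gradient is only once differentiable for a weight with continuous second derivatives, while
  the kernel calculus needs two derivatives of \<open>q\<close>. Mollification costs only a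
  bounded error, which goes into the additive constant of \<open>growth\<close>.
\<close>

definition q :: "complex^'n \<Rightarrow> complex^'n" where
  "q x = (\<chi> k. \<integral>y. p y $ k * of_real (rho (x - y)) \<partial>lborel)"
definition Q1 :: "'n \<Rightarrow> complex^'n \<Rightarrow> complex^'n \<Rightarrow> complex" where
  "Q1 k x v = (\<integral>y. p y $ k * of_real (rho' (x - y) v) \<partial>lborel)"
definition Q2 :: "'n \<Rightarrow> complex^'n \<Rightarrow> complex^'n \<Rightarrow> complex^'n \<Rightarrow> complex" where
  "Q2 k x v u = (\<integral>y. p y $ k * of_real (rho'' (x - y) v u) \<partial>lborel)"

text \<open>
  The derivative of \<open>rho\<close> has integral zero, so \<open>p y\<close> may be replaced by
  \<open>p y - p x\<close>, which is bounded on the support.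
\<close>

lemma norm_Q1_le: "norm (Q1 k x v) \<le> 2 * M * (8 / bmass TYPE(complex^'n)) * norm v * measure lborel (cball (0::complex^'n) 1)"
proof -
  let ?b = "bmass TYPE(complex^'n)"
  have c: "continuous_on UNIV (\<lambda>w::complex^'n. rho' w v)"
    by (intro has_derivative_imp_continuous_on[OF rho'_deriv])
  have cc: "continuous_on UNIV (\<lambda>y. rho' (x - y) v)"
    by (rule continuous_on_compose2[OF c]) (auto intro: continuous_intros)
  have supp: "norm y > norm x + 1 \<Longrightarrow> rho' (x - y) v = 0" for y
    using norm_triangle_ineq2[of y x] by (intro rho_outside) (simp add: norm_minus_commute)
  have z: "(\<integral>w. rho' (w::complex^'n) v \<partial>lborel) = 0"
    by (rule integral_directional_derivative_zero[OF rho_deriv c, of 1]) (simp add: rho_outside)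
  have z2: "(\<integral>y. rho' (x - y) v \<partial>lborel) = 0"
    using lborel_integral_affine[OF borel_measurable_continuous_onI[OF c], of "-1" x] z by simp
  have i1: "integrable lborel (\<lambda>y. p y $ k * of_real (rho' (x - y) v))"
    by (rule integrable_continuous_bounded_support[where R = "norm x + 1"])
       (auto intro!: continuous_intros p_comp_cont cc simp: supp)
  have i2: "integrable lborel (\<lambda>y. p x $ k * of_real (rho' (x - y) v))"
    by (rule integrable_continuous_bounded_support[where R = "norm x + 1"])
       (auto intro!: continuous_intros cc simp: supp)
  have "Q1 k x v = (\<integral>y. (p y $ k - p x $ k) * of_real (rho' (x - y) v) \<partial>lborel)"
  proof -
    have "(\<integral>y. p x $ k * of_real (rho' (x - y) v) \<partial>lborel) = p x $ k * of_real (\<integral>y. rho' (x - y) v \<partial>lborel)" by simp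
    then show ?thesis using i1 i2 by (simp add: Q1_def left_diff_distrib z2)
  qed
  also have "norm \<dots> \<le> (\<integral>y. (2 * M * (8 / ?b) * norm v) * indicator (cball x 1) y \<partial>lborel)"
  proof (rule order_trans[OF integral_norm_bound], rule integral_mono)
    show "integrable lborel (\<lambda>y. norm ((p y $ k - p x $ k) * of_real (rho' (x - y) v)))"
      using i1 i2 by (intro integrable_norm) (simp add: left_diff_distrib)
    show "integrable lborel (\<lambda>y. (2 * M * (8 / ?b) * norm v) * indicator (cball x 1) y)"
      by (intro integrable_mult_right integrable_real_indicator emeasure_compact_finite) auto
    fix y
    show "norm ((p y $ k - p x $ k) * of_real (rho' (x - y) v)) \<le> (2 * M * (8 / ?b) * norm v) * indicator (cball x 1) y"
    proof (cases "norm (x - y) \<le> 1")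
      case True
      have "norm ((p y $ k - p x $ k) * of_real (rho' (x - y) v)) \<le> (2 * M) * (8 / ?b * norm v)"
        unfolding norm_mult norm_of_real using M norm_p_diff_le[of y x k] True
        by (intro mult_mono rho'_bound) (auto simp: norm_minus_commute)
      then show ?thesis using True by (simp add: dist_norm mult.assoc)
    qed (simp add: rho_outside dist_norm)
  qed
  also have "\<dots> = 2 * M * (8 / ?b) * norm v * measure lborel (cball x 1)" by simp
  also have "measure lborel (cball x 1) = measure lborel (cball (0::complex^'n) 1)"
    by (rule measure_cball_translate)
  finally show ?thesis .
qed

definition dbar_q_bound :: real where
  "dbar_q_bound = 2 * M * (8 / bmass TYPE(complex^'n)) * measure lborel (cball (0::complex^'n) 1)"

text \<open>
  For each \<open>y\<close> in the unit ball around \<open>x\<close> the estimate holds with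
  \<open>p y\<close> in place of \<open>q x\<close>, by subtracting the quadratic majorant at
  \<open>x\<close> from the minorant at \<open>z\<close>, both based at \<open>y\<close>; then it
  is averaged with weight \<open>rho (x - y)\<close>.
\<close>

lemma growth: "Re (cdot (q x) (x - z)) \<ge> \<phi> x - \<phi> z + (m / 2) * (norm (x - z))\<^sup>2 - (m + M)"
proof -
  let ?c = "\<phi> x - \<phi> z + (m / 2) * (norm (x - z))\<^sup>2 - (m + M)"
  note rc = rho_shift_continuous[of x] and supp = rho_shift_outside[of x]
  have ik: "integrable lborel (\<lambda>y. p y $ k * of_real (rho (x - y)))" for k
    by (rule integrable_continuous_bounded_support[where R = "norm x + 1"])
       (auto intro!: continuous_intros p_comp_cont rc simp: supp)
  have ir: "integrable lborel (\<lambda>y. rho (x - y))"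
    by (rule rho_shift_integrable)
  have ic: "integrable lborel (\<lambda>y. cdot (p y) (x - z) * of_real (rho (x - y)))"
    unfolding cdot_def by (rule integrable_continuous_bounded_support[where R = "norm x + 1"])
       (auto intro!: continuous_intros p_comp_cont rc simp: supp)
  have "cdot (q x) (x - z) = (\<integral>y. cdot (p y) (x - z) * of_real (rho (x - y)) \<partial>lborel)"
  proof -
    have "cdot (q x) (x - z) = (\<Sum>k\<in>UNIV. \<integral>y. p y $ k * of_real (rho (x - y)) * (x - z) $ k \<partial>lborel)"
      unfolding cdot_def q_def by (simp del: vector_minus_component)
    also have "\<dots> = (\<integral>y. (\<Sum>k\<in>UNIV. p y $ k * of_real (rho (x - y)) * (x - z) $ k) \<partial>lborel)"
      by (rule Bochner_Integration.integral_sum[symmetric]) (intro integrable_mult_left ik)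
    also have "(\<lambda>y. \<Sum>k\<in>UNIV. p y $ k * of_real (rho (x - y)) * (x - z) $ k) = (\<lambda>y. cdot (p y) (x - z) * of_real (rho (x - y)))"
      unfolding cdot_def sum_distrib_right by (simp only: mult_ac)
    finally show ?thesis .
  qed
  then have "Re (cdot (q x) (x - z)) = (\<integral>y. Re (cdot (p y) (x - z)) * rho (x - y) \<partial>lborel)"
    using ic by (simp flip: integral_Re)
  also have "\<dots> \<ge> (\<integral>y. ?c * rho (x - y) \<partial>lborel)"
  proof (rule integral_mono)
    show "integrable lborel (\<lambda>y. ?c * rho (x - y))" by (intro integrable_mult_right ir)
    show "integrable lborel (\<lambda>y. Re (cdot (p y) (x - z)) * rho (x - y))" using integrable_Re[OF ic] by simp
    fix y
    show "?c * rho (x - y) \<le> Re (cdot (p y) (x - z)) * rho (x - y)"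
    proof (cases "norm (x - y) \<le> 1")
      case True
      have "\<phi> z \<ge> \<phi> y + Re (cdot (p y) (z - y)) + m * (norm (z - y))\<^sup>2" by (rule lower)
      moreover have "\<phi> x \<le> \<phi> y + Re (cdot (p y) (x - y)) + M * (norm (x - y))\<^sup>2" by (rule upper)
      moreover have "M * (norm (x - y))\<^sup>2 \<le> M * 1"
        using M True by (intro mult_left_mono) (auto simp: power_le_one)
      moreover have "cdot (p y) (x - z) = cdot (p y) (x - y) - cdot (p y) (z - y)" by (simp add: cdot_diff)
      moreover have "(m / 2) * (norm (x - z))\<^sup>2 \<le> m * (norm (z - y))\<^sup>2 + m"
      proof -
        have "norm (x - z) \<le> norm (x - y) + norm (z - y)"
          using norm_triangle_ineq4[of "x - y" "z - y"] by simp
        then have "(norm (x - z))\<^sup>2 \<le> (1 + norm (z - y))\<^sup>2" using True by (intro power_mono) auto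
        also have "\<dots> \<le> 2 * (norm (z - y))\<^sup>2 + 2"
          using zero_le_power2[of "1 - norm (z - y)"] by (simp add: power2_eq_square algebra_simps)
        finally show ?thesis using mult_left_mono[of "(norm (x - z))\<^sup>2" "2 * (norm (z - y))\<^sup>2 + 2" "m / 2"] m
          by (simp add: algebra_simps)
      qed
      ultimately have "?c \<le> Re (cdot (p y) (x - z))" by simp
      then show ?thesis by (intro mult_right_mono rho_nonneg)
    qed (simp add: rho_outside)
  qed
  also have "(\<integral>y. ?c * rho (x - y) \<partial>lborel) = ?c * (\<integral>y. rho (x - y) \<partial>lborel)" by simp
  also have "(\<integral>y. rho (x - y) \<partial>lborel) = 1" by (rule rho_shift_integral)
  finally show ?thesis by simp
qed

sublocale koppelman_estimate q Q1 Q2 \<phi> "m / 2" dbar_q_bound "m + M"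
proof
  show "((\<lambda>x. q x $ k) has_derivative Q1 k x) (at x)" for k x
    unfolding q_def Q1_def[abs_def] by (simp add: conv_rho_deriv[OF p_locint])
  show "((\<lambda>x. Q1 k x v) has_derivative Q2 k x v) (at x)" for k v x
    unfolding Q1_def[abs_def] Q2_def[abs_def] by (rule conv_rho'_deriv[OF p_locint])
  show "Q2 k x u v = Q2 k x v u" for k x u v
    unfolding Q2_def rho''_def by (simp add: inner_commute mult_ac)
  show "continuous_on UNIV (\<lambda>x. Q2 k x u v)" for k u v
    unfolding Q2_def
    by (rule conv_cont[OF p_locint _ rho''_bound])
       (auto intro!: has_derivative_imp_continuous_on[OF rho''_deriv] simp: rho_outside)
  show "0 < m / 2" using m by simp
  show "0 \<le> dbar_q_bound" unfolding dbar_q_bound_def using M bmass_pos[where 'a="complex^'n"] by simp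
  show "continuous_on UNIV \<phi>" by (rule phi_c)
  show "\<phi> x - \<phi> z + m / 2 * (norm (x - z))\<^sup>2 - (m + M) \<le> Re (cdot (q x) (x - z))" for x z by (rule growth)
  show "norm (dbar (Q1 k x) j) \<le> dbar_q_bound" for k j x
  proof (rule norm_dbar_le)
    fix c :: complex assume "norm c = 1"
    then show "norm (Q1 k x (axis j c)) \<le> dbar_q_bound"
      using norm_Q1_le[of k x "axis j c"] by (simp add: dbar_q_bound_def norm_axis_complex)
  qed
qed

text \<open>
  The square of the norm in the weighted space at scale \<open>t = 1\<close>, as an extended
  number.
\<close>

definition wsq :: "(complex^'n \<Rightarrow> complex) \<Rightarrow> ennreal" where
  "wsq u = (\<integral>\<^sup>+z. ennreal ((norm (u z))\<^sup>2 * exp (- 2 * \<phi> z)) \<partial>lborel)"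

lemma dbar_solution:
  "\<exists>C\<ge>0. \<forall>u U' R. (\<forall>x. (u has_derivative U' x) (at x)) \<longrightarrow> (\<forall>v. continuous_on UNIV (\<lambda>x. U' x v)) \<longrightarrow>
     (\<forall>x. norm x > R \<longrightarrow> u x = 0) \<longrightarrow>
     (\<exists>h\<in>holo UNIV. wsq (\<lambda>z. u z - h z) \<le> ennreal C * (\<integral>\<^sup>+x. ennreal ((\<Sum>j\<in>UNIV. norm (dbar (U' x) j))\<^sup>2 * exp (- 2 * \<phi> x)) \<partial>lborel))"
proof -
  let ?C = "(ennreal (1 / gaussK TYPE('n)) * (\<integral>\<^sup>+w. schur w \<partial>lborel))\<^sup>2"
  have "?C < \<infinity>" using schur_finite by (simp add: ennreal_mult_less_top power_less_top_ennreal)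
  then obtain C where C: "0 \<le> C" "?C = ennreal C" by (metis ennreal_cases infinity_ennreal_def order_less_irrefl)
  show ?thesis
  proof (intro exI[of _ C] conjI allI impI C(1))
    fix u :: "complex^'n \<Rightarrow> complex" and U' and R :: real
    assume a: "\<forall>x. (u has_derivative U' x) (at x)" "\<forall>v. continuous_on UNIV (\<lambda>x. U' x v)" "\<forall>x. norm x > R \<longrightarrow> u x = 0"
    show "\<exists>h\<in>holo UNIV. wsq (\<lambda>z. u z - h z) \<le> ennreal C * (\<integral>\<^sup>+x. ennreal ((\<Sum>j\<in>UNIV. norm (dbar (U' x) j))\<^sup>2 * exp (- 2 * \<phi> x)) \<partial>lborel)"
    proof -
      have u: "\<And>x. (u has_derivative U' x) (at x)" "\<And>v. continuous_on UNIV (\<lambda>x. U' x v)" "\<And>x. norm x > R \<Longrightarrow> u x = 0"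
        using a by auto
      have gd: "dbar_abs U' x = (\<Sum>j\<in>UNIV. norm (dbar (U' x) j))" for x
        by (rule dbar_abs_def[of u U' R]) (use u in auto)
      have "wsq (\<lambda>z. u z - avg u z 0 / of_real (gaussK TYPE('n)))
          \<le> ?C * (\<integral>\<^sup>+x. ennreal ((dbar_abs U' x)\<^sup>2 * exp (- 2 * \<phi> x)) \<partial>lborel)"
        unfolding wsq_def by (rule weighted_L2_solution(2)[of u U' R]) (use u in auto)
      moreover have "(\<lambda>z. avg u z 0 / of_real (gaussK TYPE('n))) \<in> holo UNIV"
        by (rule weighted_L2_solution(1)[of u U' R]) (use u in auto)
      ultimately show ?thesis unfolding gd C(2)
        by (rule bexI[where x = "\<lambda>z. avg u z 0 / of_real (gaussK TYPE('n))"])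
    qed
  qed
qed

end

section \<open>Smoothing a symbol that is locally near holomorphic\<close>

lemma power2_le_imp_le_ennreal: "x\<^sup>2 \<le> y\<^sup>2 \<Longrightarrow> x \<le> (y::ennreal)"
proof (rule ccontr)
  assume le: "x\<^sup>2 \<le> y\<^sup>2" and "\<not> x \<le> y"
  then have yx: "y < x" by simp
  then obtain r where r: "y = ennreal r" "0 \<le> r" by (cases y) auto
  show False
  proof (cases x)
    case (real s)
    then have "r < s" using yx r by (simp add: ennreal_less_iff)
    then have "r\<^sup>2 < s\<^sup>2" using r by (intro power_strict_mono) auto
    moreover have "s\<^sup>2 \<le> r\<^sup>2" using le unfolding real(2) r(1) by (simp only: ennreal_power[OF real(1)] ennreal_power[OF r(2)] ennreal_le_iff zero_le_power2)
    ultimately show False by linarith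
  next
    case top
    then show False using le r by (simp add: ennreal_power top_unique)
  qed
qed

lemma ball_borel[measurable]: "ball (a::'a::metric_space) r \<in> sets borel" "cball a r \<in> sets borel"
  by (auto intro: borel_open borel_closed)

context convex_weight
begin

lemma phi_m[measurable]: "\<phi> \<in> borel_measurable borel"
  by (rule borel_measurable_continuous_onI[OF phi_c])

text \<open>
  Multiplying \<open>g\<close> by the exponential of minus the complex affine function with real
  part \<open>\<phi> z + Re (cdot (p z) (x - z))\<close> replaces the weight by one that is
  bounded on the unit ball, and then \<open>holo_sup_bound\<close> applies.
\<close>

lemma weighted_sup_bound:
  fixes g :: "complex^'n \<Rightarrow> complex"
  assumes g: "g \<in> holo UNIV"
  shows "ennreal ((norm (g z))\<^sup>2 * exp (- 2 * \<phi> z)) \<le> ennreal (exp (2 * M) / bmass TYPE(complex^'n)) *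
    (\<integral>\<^sup>+x\<in>cball z 1. ennreal ((norm (g x))\<^sup>2 * exp (- 2 * \<phi> x)) \<partial>lborel)"
proof -
  let ?b = "bmass TYPE(complex^'n)"
  define h where "h x = g x * exp (- of_real (\<phi> z) + cdot (- p z) (x - z))" for x
  have h: "h \<in> holo UNIV" unfolding h_def[abs_def] by (intro holo_mult g holo_exp_cdot)
  have cm: "cdot (- p z) w = - cdot (p z) w" for w by (simp add: cdot_def sum_negf)
  have nh: "(norm (h x))\<^sup>2 = (norm (g x))\<^sup>2 * exp (2 * (- \<phi> z - Re (cdot (p z) (x - z))))" for x
    by (simp add: h_def norm_mult power_mult_distrib norm_exp_eq_Re cm exp_double[symmetric] del: exp_diff)
  have [measurable]: "g \<in> borel_measurable borel" using g holo_continuous_on borel_measurable_continuous_onI by blast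
  have "ennreal ((norm (g z))\<^sup>2 * exp (- 2 * \<phi> z)) = ennreal ((norm (h z))\<^sup>2)" by (simp add: nh cdot_0)
  also have "\<dots> \<le> ennreal (1 / ?b) * (\<integral>\<^sup>+x\<in>cball z 1. ennreal ((norm (h x))\<^sup>2) \<partial>lborel)"
    by (rule holo_sup_bound[OF h]) auto
  also have "\<dots> \<le> ennreal (1 / ?b) * (\<integral>\<^sup>+x. ennreal (exp (2 * M)) * (ennreal ((norm (g x))\<^sup>2 * exp (- 2 * \<phi> x)) * indicator (cball z 1) x) \<partial>lborel)"
  proof (intro mult_left_mono nn_integral_mono)
    fix x
    show "ennreal ((norm (h x))\<^sup>2) * indicator (cball z 1) x \<le> ennreal (exp (2 * M)) * (ennreal ((norm (g x))\<^sup>2 * exp (- 2 * \<phi> x)) * indicator (cball z 1) x)"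
    proof (cases "x \<in> cball z 1")
      case True
      then have "M * (norm (x - z))\<^sup>2 \<le> M * 1"
        using M by (intro mult_left_mono) (auto simp: power_le_one dist_norm norm_minus_commute)
      then have "2 * (- \<phi> z - Re (cdot (p z) (x - z))) \<le> 2 * M + - 2 * \<phi> x" using upper[of x z] by simp
      then have "(norm (h x))\<^sup>2 \<le> (norm (g x))\<^sup>2 * exp (2 * M + - 2 * \<phi> x)"
        unfolding nh by (intro mult_left_mono) auto
      also have "\<dots> = exp (2 * M) * ((norm (g x))\<^sup>2 * exp (- 2 * \<phi> x))" unfolding exp_add by (simp only: mult_ac)
      finally show ?thesis using True by (simp add: ennreal_mult[symmetric] ennreal_leI)
    qed simp
  qed auto
  also have "\<dots> = ennreal (1 / ?b) * (ennreal (exp (2 * M)) * (\<integral>\<^sup>+x\<in>cball z 1. ennreal ((norm (g x))\<^sup>2 * exp (- 2 * \<phi> x)) \<partial>lborel))"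
    by (subst nn_integral_cmult) auto
  also have "\<dots> = ennreal (exp (2 * M) / ?b) * (\<integral>\<^sup>+x\<in>cball z 1. ennreal ((norm (g x))\<^sup>2 * exp (- 2 * \<phi> x)) \<partial>lborel)"
    unfolding mult.assoc[symmetric] using bmass_pos[where 'a="complex^'n"] by (subst ennreal_mult[symmetric]) auto
  finally show ?thesis .
qed

text \<open>
  By \<open>weighted_sup_bound\<close> the value of \<open>\<bar>g\<bar>\<^sup>2 exp (- 2
  \<phi>)\<close> at \<open>z\<close> is at most a multiple of its integral over a unit ball;
  exchanging the integrals leaves the local mean squares of \<open>F\<close>.
\<close>

lemma local_L2_mult_bound:
  fixes g F :: "complex^'n \<Rightarrow> complex"
  assumes g: "g \<in> holo UNIV" and F[measurable]: "F \<in> borel_measurable borel"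
    and loc: "\<And>a. (\<integral>\<^sup>+z\<in>cball a 1. ennreal ((norm (F z))\<^sup>2) \<partial>lborel) \<le> ennreal c"
  shows "wsq (\<lambda>z. F z * g z) \<le> ennreal (exp (2 * M) / bmass TYPE(complex^'n)) * ennreal c * wsq g"
proof -
  let ?K = "ennreal (exp (2 * M) / bmass TYPE(complex^'n))"
  let ?g = "\<lambda>x. ennreal ((norm (g x))\<^sup>2 * exp (- 2 * \<phi> x))"
  let ?F = "\<lambda>z. ennreal ((norm (F z))\<^sup>2)"
  have gm[measurable]: "g \<in> borel_measurable borel" using g holo_continuous_on borel_measurable_continuous_onI by blast
  have "wsq (\<lambda>z. F z * g z) \<le> (\<integral>\<^sup>+z. (\<integral>\<^sup>+x. ?K * (?F z * ?g x * indicator {y. dist (fst y) (snd y) \<le> 1} (z, x)) \<partial>lborel) \<partial>lborel)"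
    unfolding wsq_def
  proof (rule nn_integral_mono)
    fix z
    have "ennreal ((norm (F z * g z))\<^sup>2 * exp (- 2 * \<phi> z)) = ?F z * ?g z"
      by (simp add: norm_mult power_mult_distrib ennreal_mult[symmetric] mult.assoc)
    also have "\<dots> \<le> ?F z * (?K * (\<integral>\<^sup>+x\<in>cball z 1. ?g x \<partial>lborel))"
      by (intro mult_left_mono weighted_sup_bound[OF g]) auto
    also have "\<dots> = (?F z * ?K) * (\<integral>\<^sup>+x. ?g x * indicator (cball z 1) x \<partial>lborel)"
      by (simp only: mult.assoc)
    also have "\<dots> = (\<integral>\<^sup>+x. (?F z * ?K) * (?g x * indicator (cball z 1) x) \<partial>lborel)"
      by (rule nn_integral_cmult[symmetric]) measurable
    also have "\<dots> = (\<integral>\<^sup>+x. ?K * (?F z * ?g x * indicator {y. dist (fst y) (snd y) \<le> 1} (z, x)) \<partial>lborel)"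
      by (intro nn_integral_cong) (auto simp: indicator_def mult_ac)
    finally show "ennreal ((norm (F z * g z))\<^sup>2 * exp (- 2 * \<phi> z)) \<le> (\<integral>\<^sup>+x. ?K * (?F z * ?g x * indicator {y. dist (fst y) (snd y) \<le> 1} (z, x)) \<partial>lborel)" .
  qed
  also have "\<dots> = (\<integral>\<^sup>+x. (\<integral>\<^sup>+z. ?K * (?F z * ?g x * indicator {y. dist (fst y) (snd y) \<le> 1} (z, x)) \<partial>lborel) \<partial>lborel)"
  proof (rule lborel_pair.Fubini')
    have [measurable]: "{y::(complex^'n) \<times> (complex^'n). dist (fst y) (snd y) \<le> 1} \<in> sets borel"
      by (intro borel_closed closed_Collect_le continuous_intros)
    then have [measurable]: "{y::(complex^'n) \<times> (complex^'n). dist (fst y) (snd y) \<le> 1} \<in> sets (lborel \<Otimes>\<^sub>M lborel)"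
      by (simp add: borel_prod[symmetric] cong: sets_pair_measure_cong)
    show "case_prod (\<lambda>x z. ?K * (?F z * ?g x * indicator {y. dist (fst y) (snd y) \<le> 1} (z, x))) \<in> borel_measurable (lborel \<Otimes>\<^sub>M lborel)"
      by measurable
  qed
  also have "\<dots> \<le> (\<integral>\<^sup>+x. (?K * ennreal c) * ?g x \<partial>lborel)"
  proof (rule nn_integral_mono)
    fix x
    have "(\<integral>\<^sup>+z. ?K * (?F z * ?g x * indicator {y. dist (fst y) (snd y) \<le> 1} (z, x)) \<partial>lborel)
      = (\<integral>\<^sup>+z. (?K * ?g x) * (?F z * indicator (cball x 1) z) \<partial>lborel)"
      by (intro nn_integral_cong) (auto simp: indicator_def mult_ac dist_commute)
    also have "\<dots> = (?K * ?g x) * (\<integral>\<^sup>+z. ?F z * indicator (cball x 1) z \<partial>lborel)"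
      by (rule nn_integral_cmult) measurable
    also have "\<dots> \<le> (?K * ?g x) * ennreal c" by (intro mult_left_mono loc) auto
    finally show "(\<integral>\<^sup>+z. ?K * (?F z * ?g x * indicator {y. dist (fst y) (snd y) \<le> 1} (z, x)) \<partial>lborel) \<le> (?K * ennreal c) * ?g x"
      by (simp add: mult_ac)
  qed
  also have "\<dots> = (?K * ennreal c) * wsq g" unfolding wsq_def by (rule nn_integral_cmult) measurable
  finally show ?thesis .
qed

end

text \<open>
  The radius \<open>3\<close> leaves room for two unit steps: points of a unit ball around
  \<open>a\<close>, and their unit balls in which the convolution lives.
\<close>

locale local_holo_approx =
  fixes F :: "complex^'n \<Rightarrow> complex" and A \<epsilon> :: real
  assumes Fm[measurable]: "F \<in> borel_measurable borel" and FA: "\<And>z. norm (F z) \<le> A" and eps: "0 \<le> \<epsilon>"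
    and near: "\<And>a. \<exists>h\<in>holo (ball a 3). (\<integral>\<^sup>+z\<in>ball a 3. ennreal ((norm (F z - h z))\<^sup>2) \<partial>lborel) \<le> ennreal (\<epsilon>\<^sup>2)"
begin

definition F1 :: "complex^'n \<Rightarrow> complex" where
  "F1 z = (\<integral>x. F x * of_real (rho (z - x)) \<partial>lborel)"
definition F1' :: "complex^'n \<Rightarrow> complex^'n \<Rightarrow> complex" where
  "F1' z v = (\<integral>x. F x * of_real (rho' (z - x) v) \<partial>lborel)"

definition vol :: real where "vol = measure lborel (ball (0 :: complex^'n) 3)"

lemma A_nonneg: "0 \<le> A" using FA[of 0] norm_ge_zero order_trans by blast

lemma F_locint: "locint F"
  by (rule locint_bounded[OF Fm]) (use FA in blast)

lemma F1_deriv: "(F1 has_derivative F1' z) (at z)"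
  unfolding F1_def[abs_def] F1'_def[abs_def] by (rule conv_rho_deriv[OF F_locint])

lemma F1'_cont: "continuous_on UNIV (\<lambda>z. F1' z v)"
  unfolding F1'_def by (intro has_derivative_imp_continuous_on[OF conv_rho'_deriv[OF F_locint]])

lemma F1_bound: "norm (F1 z) \<le> A"
proof -
  have "norm (F1 z) \<le> (\<integral>x. A * rho (z - x) \<partial>lborel)"
    unfolding F1_def
  proof (rule order_trans[OF integral_norm_bound], rule integral_mono)
    show "integrable lborel (\<lambda>x. norm (F x * of_real (rho (z - x))))"
      by (intro integrable_norm conv_integrable[OF F_locint rho_borel(1) abs_rho_le]) (simp add: rho_outside)
    show "integrable lborel (\<lambda>x. A * rho (z - x))" by (intro integrable_mult_right rho_shift_integrable)
    show "norm (F x * of_real (rho (z - x))) \<le> A * rho (z - x)" for x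
      using FA[of x] rho_nonneg[of "z - x"] by (simp add: norm_mult mult_right_mono)
  qed
  then show ?thesis by (simp add: rho_shift_integral)
qed

text \<open>
  Near \<open>a\<close> write \<open>F = h + d\<close> with \<open>h\<close> holomorphic and
  \<open>d\<close> small. Convolution reproduces \<open>h\<close>, so \<open>F1 - h\<close> and
  \<open>dbar F1\<close> depend on \<open>d\<close> only.
\<close>

lemma local_split:
  shows "\<exists>h d. h \<in> holo (ball a 3) \<and> locint d \<and> d \<in> borel_measurable borel \<and>
    (\<forall>z\<in>ball a 3. d z = F z - h z) \<and>
    (\<integral>\<^sup>+z. ennreal ((norm (d z))\<^sup>2) \<partial>lborel) \<le> ennreal (\<epsilon>\<^sup>2) \<and>
    integrable lborel d \<and> (\<integral>x. norm (d x) \<partial>lborel) \<le> \<epsilon> * sqrt vol \<and>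
    (\<forall>z\<in>cball a 1. F1 z = h z + (\<integral>x. d x * of_real (rho (z - x)) \<partial>lborel)) \<and>
    (\<forall>j. dbar (F1' a) j = dbar (\<lambda>v. \<integral>x. d x * of_real (rho' (a - x) v) \<partial>lborel) j)"
proof -
  let ?U = "ball a 3"
  obtain h where h: "h \<in> holo ?U" "(\<integral>\<^sup>+z\<in>?U. ennreal ((norm (F z - h z))\<^sup>2) \<partial>lborel) \<le> ennreal (\<epsilon>\<^sup>2)"
    using near by blast
  \<comment> \<open>All functions are extended by zero outside the ball, so that they are defined and measurable everywhere.\<close>
  define hB where "hB z = indicator ?U z *\<^sub>R h z" for z
  define FB where "FB z = indicator ?U z *\<^sub>R F z" for z
  define d where "d z = FB z - hB z" for z
  have hBm[measurable]: "hB \<in> borel_measurable borel"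
    unfolding hB_def by (intro borel_measurable_continuous_on_indicator holo_continuous_on h) simp
  have FBm[measurable]: "FB \<in> borel_measurable borel"
    unfolding FB_def using Fm by measurable
  have dm[measurable]: "d \<in> borel_measurable borel" unfolding d_def by measurable
  have dU: "d z = F z - h z" if "z \<in> ?U" for z using that by (simp add: d_def hB_def FB_def)
  have dO: "d z = 0" if "z \<notin> ?U" for z using that by (simp add: d_def hB_def FB_def)
  have d2: "(\<integral>\<^sup>+z. ennreal ((norm (d z))\<^sup>2) \<partial>lborel) \<le> ennreal (\<epsilon>\<^sup>2)"
  proof -
    have "(\<integral>\<^sup>+z. ennreal ((norm (d z))\<^sup>2) \<partial>lborel) = (\<integral>\<^sup>+z\<in>?U. ennreal ((norm (F z - h z))\<^sup>2) \<partial>lborel)"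
      by (intro nn_integral_cong) (auto simp: indicator_def dU dO)
    then show ?thesis using h(2) by simp
  qed
  have ball_fin: "emeasure lborel ?U = ennreal vol"
  proof -
    have f: "emeasure lborel ?U < \<infinity>" by (rule emeasure_bounded_finite) simp
    have "emeasure lborel ?U = emeasure lborel (ball (0::complex^'n) 3)"
    proof -
      have "(\<integral>\<^sup>+y. indicator ?U y \<partial>lborel) = (\<integral>\<^sup>+y. indicator ?U (a + y) \<partial>lborel)"
        using nn_integral_lborel_affine[OF borel_measurable_indicator[OF borel_open[OF open_ball]], of 1 a 3 a] by simp
      also have "(\<lambda>y. indicator ?U (a + y) :: ennreal) = indicator (ball 0 3)"
        by (auto simp: indicator_def dist_norm fun_eq_iff)
      finally show ?thesis by simp
    qed
    then show ?thesis using f unfolding vol_def by (simp add: emeasure_eq_ennreal_measure less_top)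
  qed
  have d1: "(\<integral>\<^sup>+z. ennreal (norm (d z)) \<partial>lborel) \<le> ennreal (\<epsilon> * sqrt vol)"
  proof -
    have v0: "0 \<le> vol" by (simp add: vol_def)
    have "(\<integral>\<^sup>+z. ennreal (norm (d z)) * indicator ?U z \<partial>lborel)\<^sup>2 \<le> (\<integral>\<^sup>+z. (ennreal (norm (d z)))\<^sup>2 \<partial>lborel) * (\<integral>\<^sup>+z. (indicator ?U z)\<^sup>2 \<partial>lborel)"
      by (rule Cauchy_Schwarz_nn_integral) measurable
    also have "(\<lambda>z. (indicator ?U z)\<^sup>2 :: ennreal) = indicator ?U" by (auto simp: indicator_def)
    also have "(\<integral>\<^sup>+z. indicator ?U z \<partial>lborel) = ennreal vol" using ball_fin by simp
    also have "(\<integral>\<^sup>+z. (ennreal (norm (d z)))\<^sup>2 \<partial>lborel) * ennreal vol \<le> ennreal (\<epsilon>\<^sup>2) * ennreal vol"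
      using d2 by (intro mult_right_mono) (auto simp: ennreal_power)
    also have "\<dots> = (ennreal (\<epsilon> * sqrt vol))\<^sup>2"
      using v0 eps by (simp add: ennreal_mult[symmetric] ennreal_power power_mult_distrib)
    also have "(\<lambda>z. ennreal (norm (d z)) * indicator ?U z) = (\<lambda>z. ennreal (norm (d z)))"
      by (auto simp: fun_eq_iff indicator_def dO)
    finally show ?thesis by (rule power2_le_imp_le_ennreal)
  qed
  have di: "integrable lborel d"
    using d1 by (intro integrableI_bounded) (auto intro: order_le_less_trans)
  have d1r: "(\<integral>x. norm (d x) \<partial>lborel) \<le> \<epsilon> * sqrt vol"
    using d1 eps nn_integral_eq_integral[OF integrable_norm[OF di]] by (simp add: vol_def ennreal_le_iff)
  have dl: "locint d" unfolding locint_def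
    by (auto intro!: dm integrable_mult_indicator[of _ lborel d, unfolded scaleR_conv_of_real] di simp: scaleR_conv_of_real)
  have FBl: "locint FB"
    by (rule locint_bounded[OF FBm]) (use FA A_nonneg in \<open>auto simp: FB_def indicator_def intro!: exI[of _ A]\<close>)
  have hBl: "locint hB"
  proof -
    have "hB = (\<lambda>z. FB z - d z)" by (simp add: d_def fun_eq_iff)
    then show ?thesis using FBl dl unfolding locint_def by (auto simp: scaleR_diff_right)
  qed
  have split: "(\<integral>x. F x * complex_of_real (K (z - x)) \<partial>lborel) = (\<integral>x. d x * complex_of_real (K (z - x)) \<partial>lborel) + (\<integral>x. hB x * complex_of_real (K (z - x)) \<partial>lborel)"
    if K: "K \<in> borel_measurable borel" "\<And>w. \<bar>K w\<bar> \<le> C" "\<And>w. norm w > 1 \<Longrightarrow> K w = 0" and z: "z \<in> cball a 1" for K C z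
  proof -
    have "(\<integral>x. F x * complex_of_real (K (z - x)) \<partial>lborel) = (\<integral>x. d x * complex_of_real (K (z - x)) + hB x * complex_of_real (K (z - x)) \<partial>lborel)"
    proof (rule Bochner_Integration.integral_cong[OF refl])
      fix x
      show "F x * complex_of_real (K (z - x)) = d x * complex_of_real (K (z - x)) + hB x * complex_of_real (K (z - x))"
      proof (cases "norm (z - x) > 1")
        case False
        then have "x \<in> ?U" using z dist_triangle[of a x z] by (auto simp: dist_norm)
        then show ?thesis by (simp add: dU hB_def algebra_simps)
      qed (simp add: K)
    qed
    also have "\<dots> = (\<integral>x. d x * complex_of_real (K (z - x)) \<partial>lborel) + (\<integral>x. hB x * complex_of_real (K (z - x)) \<partial>lborel)"
      by (rule Bochner_Integration.integral_add[OF conv_integrable[OF dl K] conv_integrable[OF hBl K]])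
    finally show ?thesis .
  qed
  have mean: "(\<integral>x. hB x * of_real (rho (z - x)) \<partial>lborel) = h z" if z: "z \<in> ball a 2" for z
  proof -
    have sub: "cball z 1 \<subseteq> ?U"
    proof
      fix x assume "x \<in> cball z 1"
      then show "x \<in> ?U" using z dist_triangle[of a x z] by auto
    qed
    have "(\<integral>x. hB x * of_real (rho (z - x)) \<partial>lborel) = (\<integral>x. h x * of_real (rho (z - x)) \<partial>lborel)"
    proof (rule Bochner_Integration.integral_cong[OF refl])
      fix x
      show "hB x * complex_of_real (rho (z - x)) = h x * complex_of_real (rho (z - x))"
      proof (cases "norm (z - x) \<le> 1")
        case True
        then have "x \<in> ?U" using sub by (auto simp: dist_norm)
        then show ?thesis by (simp add: hB_def)
      qed (simp add: rho_outside)
    qed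
    then show ?thesis using holo_rho_mean[OF h(1) open_ball sub] by simp
  qed
  have F1: "F1 z = h z + (\<integral>x. d x * of_real (rho (z - x)) \<partial>lborel)" if z: "z \<in> cball a 1" for z
    unfolding F1_def using split[OF rho_borel(1) abs_rho_le _ z] mean[of z] z by (simp add: rho_outside)
  have dbarF1: "dbar (F1' a) j = dbar (\<lambda>v. \<integral>x. d x * of_real (rho' (a - x) v) \<partial>lborel) j" for j
  proof -
    have a: "a \<in> cball a 1" "a \<in> ball a 2" "a \<in> ?U" by auto
    have s: "F1' a v = (\<integral>x. d x * of_real (rho' (a - x) v) \<partial>lborel) + (\<integral>x. hB x * of_real (rho' (a - x) v) \<partial>lborel)" for v
      unfolding F1'_def by (rule split[OF rho_borel(2) rho'_bound _ a(1)]) (simp add: rho_outside)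
    have "(h has_derivative (\<lambda>v. \<integral>x. hB x * of_real (rho' (a - x) v) \<partial>lborel)) (at a)"
      by (rule has_derivative_transform_within_open[OF conv_rho_deriv[OF hBl] open_ball a(2) mean])
    then have e: "(\<lambda>v. \<integral>x. hB x * of_real (rho' (a - x) v) \<partial>lborel) = hder h a"
      using has_derivative_unique hder(1)[OF h(1) a(3)] by blast
    have "dbar (F1' a) j = dbar (\<lambda>v. \<integral>x. d x * of_real (rho' (a - x) v) \<partial>lborel) j + dbar (\<lambda>v. \<integral>x. hB x * of_real (rho' (a - x) v) \<partial>lborel) j"
      unfolding dbar_add[symmetric] s[symmetric] ..
    also have "dbar (\<lambda>v. \<integral>x. hB x * of_real (rho' (a - x) v) \<partial>lborel) j = 0"
      unfolding e by (rule dbar_complex_linear) (rule hder(2)[OF h(1) a(3)])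
    finally show ?thesis by simp
  qed
  show ?thesis
    by (intro exI[of _ h] exI[of _ d] conjI ballI allI h(1) dl dm dU d2 di d1r F1 dbarF1)
qed

lemma conv_d_bound:
  assumes d: "integrable lborel d" "(\<integral>x. norm (d x) \<partial>lborel) \<le> c" and K: "K \<in> borel_measurable borel" "\<And>w. \<bar>K w\<bar> \<le> C"
  shows "norm (\<integral>x. d x * complex_of_real (K (z - x :: complex^'n)) \<partial>lborel) \<le> C * c"
proof -
  have C: "0 \<le> C" using K(2)[of 0] by linarith
  note [measurable] = K(1) borel_measurable_integrable[OF d(1)]
  have i: "integrable lborel (\<lambda>x. norm (d x) * C)" using d by (intro integrable_mult_left integrable_norm)
  have le: "norm (d x * complex_of_real (K (z - x))) \<le> norm (d x) * C" for x
    using K(2)[of "z - x"] by (simp add: norm_mult mult_left_mono)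
  have "norm (\<integral>x. d x * complex_of_real (K (z - x)) \<partial>lborel) \<le> (\<integral>x. norm (d x) * C \<partial>lborel)"
  proof (rule order_trans[OF integral_norm_bound], rule integral_mono[OF _ i le])
    show "integrable lborel (\<lambda>x. norm (d x * complex_of_real (K (z - x))))"
      by (rule Bochner_Integration.integrable_bound[OF i]) (use le C in \<open>auto\<close>)
  qed
  also have "\<dots> = C * (\<integral>x. norm (d x) \<partial>lborel)" by simp
  also have "\<dots> \<le> C * c" by (intro mult_left_mono d C)
  finally show ?thesis .
qed

lemma dbar_F1_bound: "norm (dbar (F1' a) j) \<le> 8 / bmass TYPE(complex^'n) * sqrt vol * \<epsilon>"
proof -
  obtain d where d: "integrable lborel d" "(\<integral>x. norm (d x) \<partial>lborel) \<le> \<epsilon> * sqrt vol"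
    and d3: "\<forall>j. dbar (F1' a) j = dbar (\<lambda>v. \<integral>x. d x * of_real (rho' (a - x) v) \<partial>lborel) j"
    using local_split[of a] by (elim exE conjE)
  let ?D = "\<lambda>v. \<integral>x. d x * complex_of_real (rho' (a - x) v) \<partial>lborel"
  have D: "norm (?D v) \<le> (8 / bmass TYPE(complex^'n) * norm v) * (\<epsilon> * sqrt vol)" for v
    by (rule conv_d_bound[OF d(1,2) rho_borel(2) rho'_bound])
  have "norm (dbar ?D j) \<le> 8 / bmass TYPE(complex^'n) * sqrt vol * \<epsilon>"
  proof (rule norm_dbar_le)
    fix c :: complex assume "norm c = 1"
    then show "norm (?D (axis j c)) \<le> 8 / bmass TYPE(complex^'n) * sqrt vol * \<epsilon>"
      using D[of "axis j c"] by (simp add: norm_axis_complex mult_ac)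
  qed
  then show ?thesis using d3 by simp
qed

definition smooth_c :: real where
  "smooth_c = 2 + 2 * (sqrt vol / bmass TYPE(complex^'n))\<^sup>2 * measure lborel (cball (0::complex^'n) 1)"

lemma F_F1_local: "(\<integral>\<^sup>+z\<in>cball a 1. ennreal ((norm (F z - F1 z))\<^sup>2) \<partial>lborel) \<le> ennreal (smooth_c * \<epsilon>\<^sup>2)"
proof -
  let ?b = "bmass TYPE(complex^'n)"
  obtain h d where d2: "d \<in> borel_measurable borel"
    and d3: "\<forall>z\<in>ball a 3. d z = F z - h z"
    and d4: "(\<integral>\<^sup>+z. ennreal ((norm (d z))\<^sup>2) \<partial>lborel) \<le> ennreal (\<epsilon>\<^sup>2)"
    and d5: "integrable lborel d" "(\<integral>x. norm (d x) \<partial>lborel) \<le> \<epsilon> * sqrt vol"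
    and d7: "\<forall>z\<in>cball a 1. F1 z = h z + (\<integral>x. d x * of_real (rho (z - x)) \<partial>lborel)"
    using local_split[of a] by (elim exE conjE)
  note [measurable] = d2 
  let ?e = "1 / ?b * (\<epsilon> * sqrt vol)"
  have pt: "(norm (F z - F1 z))\<^sup>2 \<le> 2 * (norm (d z))\<^sup>2 + 2 * ?e\<^sup>2" if z: "z \<in> cball a 1" for z
  proof -
    have zU: "z \<in> ball a 3" using z by auto
    let ?I = "\<integral>x. d x * complex_of_real (rho (z - x)) \<partial>lborel"
    have I: "norm ?I \<le> ?e" by (rule conv_d_bound[OF d5 rho_borel(1) abs_rho_le])
    have "F z - F1 z = d z + - ?I" using d3 zU d7 z by simp
    then have "(norm (F z - F1 z))\<^sup>2 \<le> 2 * (norm (d z))\<^sup>2 + 2 * (norm (- ?I))\<^sup>2" using norm_add_square_le by metis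
    also have "(norm (- ?I))\<^sup>2 \<le> ?e\<^sup>2" unfolding norm_minus_cancel by (intro power_mono I) auto
    finally show ?thesis by simp
  qed
  have fin: "emeasure lborel (cball a 1) = ennreal (measure lborel (cball (0::complex^'n) 1))"
  proof -
    have "emeasure lborel (cball (0::complex^'n) 1) < \<infinity>" by (rule emeasure_bounded_finite) simp
    then show ?thesis by (simp add: emeasure_cball_translate[of a] emeasure_eq_ennreal_measure less_top)
  qed
  have "(\<integral>\<^sup>+z\<in>cball a 1. ennreal ((norm (F z - F1 z))\<^sup>2) \<partial>lborel) \<le> (\<integral>\<^sup>+z. ennreal 2 * ennreal ((norm (d z))\<^sup>2) + ennreal (2 * ?e\<^sup>2) * indicator (cball a 1) z \<partial>lborel)"
  proof (rule nn_integral_mono)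
    fix z
    show "ennreal ((norm (F z - F1 z))\<^sup>2) * indicator (cball a 1) z \<le> ennreal 2 * ennreal ((norm (d z))\<^sup>2) + ennreal (2 * ?e\<^sup>2) * indicator (cball a 1) z"
    proof (cases "z \<in> cball a 1")
      case True
      have "ennreal ((norm (F z - F1 z))\<^sup>2) \<le> ennreal (2 * (norm (d z))\<^sup>2 + 2 * ?e\<^sup>2)" by (intro ennreal_leI pt True)
      also have "\<dots> = ennreal 2 * ennreal ((norm (d z))\<^sup>2) + ennreal (2 * ?e\<^sup>2)"
        by (subst ennreal_plus) (auto simp: ennreal_mult)
      finally show ?thesis using True by simp
    qed simp
  qed
  also have "\<dots> = ennreal 2 * (\<integral>\<^sup>+z. ennreal ((norm (d z))\<^sup>2) \<partial>lborel) + ennreal (2 * ?e\<^sup>2) * emeasure lborel (cball a 1)"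
    by (subst nn_integral_add) (auto simp: nn_integral_cmult)
  also have "\<dots> \<le> ennreal 2 * ennreal (\<epsilon>\<^sup>2) + ennreal (2 * ?e\<^sup>2) * ennreal (measure lborel (cball (0::complex^'n) 1))"
    unfolding fin by (intro add_mono mult_left_mono d4) auto
  also have "\<dots> = ennreal (2 * \<epsilon>\<^sup>2 + (2 * ?e\<^sup>2) * measure lborel (cball (0::complex^'n) 1))"
    by (subst ennreal_mult[symmetric], simp, simp, subst ennreal_mult[symmetric], simp, simp, subst ennreal_plus) auto
  also have "2 * \<epsilon>\<^sup>2 + (2 * ?e\<^sup>2) * measure lborel (cball (0::complex^'n) 1) = smooth_c * \<epsilon>\<^sup>2"
    by (simp add: smooth_c_def power_mult_distrib power_divide algebra_simps)
  finally show ?thesis .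
qed

end

section \<open>Entire approximation of the symbol times an entire function\<close>

context convex_weight
begin

lemma norm_add3_square_le: "(norm (a + b + c))\<^sup>2 \<le> 3 * (norm a)\<^sup>2 + 3 * (norm b)\<^sup>2 + 3 * (norm (c::complex))\<^sup>2"
proof -
  have "(norm (a + b + c))\<^sup>2 \<le> (norm a + norm b + norm c)\<^sup>2"
    by (intro power_mono order_trans[OF norm_triangle_ineq add_right_mono[OF norm_triangle_ineq]]) auto
  also have "\<dots> \<le> 3 * (norm a)\<^sup>2 + 3 * (norm b)\<^sup>2 + 3 * (norm c)\<^sup>2"
    using zero_le_power2[of "norm a - norm b"] zero_le_power2[of "norm a - norm c"] zero_le_power2[of "norm b - norm c"]
    by (simp add: power2_eq_square algebra_simps)
  finally show ?thesis .
qed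

lemma wsq_add3_le:
  assumes [measurable]: "a \<in> borel_measurable borel" "b \<in> borel_measurable borel" "c \<in> borel_measurable borel"
  shows "wsq (\<lambda>z. a z + b z + c z) \<le> 3 * wsq a + 3 * wsq b + 3 * wsq c"
proof -
  have "wsq (\<lambda>z. a z + b z + c z) \<le> (\<integral>\<^sup>+z. 3 * ennreal ((norm (a z))\<^sup>2 * exp (- 2 * \<phi> z)) + 3 * ennreal ((norm (b z))\<^sup>2 * exp (- 2 * \<phi> z))
      + 3 * ennreal ((norm (c z))\<^sup>2 * exp (- 2 * \<phi> z)) \<partial>lborel)"
    unfolding wsq_def
  proof (rule nn_integral_mono)
    fix z
    let ?e = "exp (- 2 * \<phi> z)"
    have t: "3 * ennreal x = ennreal (3 * x)" for x by (subst ennreal_mult') auto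
    have "(norm (a z + b z + c z))\<^sup>2 * ?e \<le> (3 * (norm (a z))\<^sup>2 + 3 * (norm (b z))\<^sup>2 + 3 * (norm (c z))\<^sup>2) * ?e"
      by (intro mult_right_mono norm_add3_square_le) auto
    also have "\<dots> = 3 * ((norm (a z))\<^sup>2 * ?e) + 3 * ((norm (b z))\<^sup>2 * ?e) + 3 * ((norm (c z))\<^sup>2 * ?e)"
      by (simp add: algebra_simps)
    finally show "ennreal ((norm (a z + b z + c z))\<^sup>2 * ?e) \<le> 3 * ennreal ((norm (a z))\<^sup>2 * ?e) + 3 * ennreal ((norm (b z))\<^sup>2 * ?e) + 3 * ennreal ((norm (c z))\<^sup>2 * ?e)"
      unfolding t by (subst ennreal_plus[symmetric], simp, simp, subst ennreal_plus[symmetric], simp, simp, intro ennreal_leI)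
  qed
  also have "\<dots> = 3 * wsq a + 3 * wsq b + 3 * wsq c"
    unfolding wsq_def by (simp add: nn_integral_add nn_integral_cmult)
  finally show ?thesis .
qed

text \<open>
  A cutoff on the scale \<open>R\<close>, needed because the d-bar equation is solved for
  compactly supported functions; its gradient is of order \<open>1 / R\<close>.
\<close>

definition chi :: "real \<Rightarrow> complex^'n \<Rightarrow> real" where
  "chi R z = bump 2 ((1 / R) *\<^sub>R z)"
definition chi' :: "real \<Rightarrow> complex^'n \<Rightarrow> complex^'n \<Rightarrow> real" where
  "chi' R z v = (- 2 * bump 1 ((1 / R) *\<^sub>R z) / R\<^sup>2) * (2 * (z \<bullet> v))"

lemma chi_deriv: "(chi R has_derivative chi' R z) (at z)"
proof -
  have "((\<lambda>z::complex^'n. (1 / R) *\<^sub>R z) has_derivative (\<lambda>v. (1 / R) *\<^sub>R v)) (at z)" by (auto intro!: derivative_eq_intros)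
  from has_derivative_compose[OF this bump_has_derivative'(3)]
  show ?thesis unfolding chi_def[abs_def] by (rule has_derivative_eq_rhs) (simp add: fun_eq_iff chi'_def power2_eq_square)
qed

lemma dbar_chi'_le: "0 < R \<Longrightarrow> norm (dbar (\<lambda>v. of_real (chi' R z v)) j) \<le> 2 / R"
proof -
  assume R: "0 < R"
  have "dbar (\<lambda>v. of_real (chi' R z v)) j = of_real (- 2 * bump 1 ((1 / R) *\<^sub>R z) / R\<^sup>2) * z $ j"
    unfolding chi'_def of_real_mult[of "- 2 * bump 1 ((1 / R) *\<^sub>R z) / R\<^sup>2"] dbar_cmult dbar_inner ..
  then have eq: "norm (dbar (\<lambda>v. of_real (chi' R z v)) j) = 2 * bump 1 ((1 / R) *\<^sub>R z) / R\<^sup>2 * norm (z $ j)"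
    using R by (simp add: norm_mult bump_nonneg norm_divide norm_power)
  show ?thesis
  proof (cases "norm z < R")
    case True
    have "2 * bump 1 ((1 / R) *\<^sub>R z) / R\<^sup>2 * norm (z $ j) \<le> 2 * 1 / R\<^sup>2 * R"
      using True R by (intro mult_mono divide_right_mono mult_left_mono bump_le_1 order_trans[OF Finite_Cartesian_Product.norm_nth_le]) (auto simp: bump_nonneg)
    then show ?thesis unfolding eq using R by (simp add: power2_eq_square)
  next
    case False
    then have "bump 1 ((1 / R) *\<^sub>R z) = 0" using R by (intro bump_outside) (auto simp: field_simps)
    then show ?thesis unfolding eq using R by simp
  qed
qed

lemma chi_bounds: "0 \<le> chi R z" "chi R z \<le> 1"
  unfolding chi_def by (rule bump_nonneg bump_le_1)+

lemma chi_limit: "(\<lambda>k. chi (real (Suc k)) z) \<longlonglongrightarrow> 1"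
proof -
  have c: "continuous_on UNIV (bump 2 :: complex^'n \<Rightarrow> real)" by (rule bump_cont)
  have "(\<lambda>k. (1 / real (Suc k)) *\<^sub>R z) \<longlonglongrightarrow> 0 *\<^sub>R z"
    using LIMSEQ_inverse_real_of_nat by (intro tendsto_intros) (simp add: inverse_eq_divide)
  from continuous_on_tendsto_compose[OF c this] show ?thesis by (simp add: chi_def bump_def)
qed

text \<open>
  With \<open>u = chi R F1 G\<close> and \<open>h\<close> the holomorphic correction of
  \<open>u\<close>, the difference \<open>F G - h\<close> is the sum of \<open>(F - F1) G\<close>,
  of \<open>(1 - chi R) F1 G\<close> and of \<open>u - h\<close>. The first is small by
  \<open>local_L2_mult_bound\<close>, the second by dominated convergence for large
  \<open>R\<close>, and the third by \<open>dbar_solution\<close>, since \<open>dbar u\<close>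
  consists of \<open>(dbar F1) G\<close> and a term of order \<open>1 / R\<close>. The
  contributions of \<open>R\<close> are absorbed in \<open>\<delta>\<close>.
\<close>

lemma hankel_approximation:
  "\<exists>C\<ge>0. \<forall>F A \<epsilon> G \<delta>. local_holo_approx F A \<epsilon> \<longrightarrow> G \<in> holo UNIV \<longrightarrow> wsq G < \<infinity> \<longrightarrow> 0 < \<delta> \<longrightarrow>
     (\<exists>h\<in>holo UNIV. wsq (\<lambda>z. F z * G z - h z) \<le> ennreal (C * \<epsilon>\<^sup>2) * wsq G + ennreal \<delta>)"
proof -
  obtain Cs where Cs: "0 \<le> Cs" and sol: "\<And>u U' R. (\<And>x. (u has_derivative U' x) (at x)) \<Longrightarrow> (\<And>v. continuous_on UNIV (\<lambda>x. U' x v)) \<Longrightarrow>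
     (\<And>x. norm x > R \<Longrightarrow> u x = 0) \<Longrightarrow>
     (\<exists>h\<in>holo UNIV. wsq (\<lambda>z. u z - h z) \<le> ennreal Cs * (\<integral>\<^sup>+x. ennreal ((\<Sum>j\<in>UNIV. norm (dbar (U' x) j))\<^sup>2 * exp (- 2 * \<phi> x)) \<partial>lborel))"
    using dbar_solution by blast
  let ?n = "real CARD('n)"
  let ?b = "bmass TYPE(complex^'n)"
  let ?vol = "measure lborel (ball (0 :: complex^'n) 3)"
  define K where "K = exp (2 * M) / ?b"
  define c1 where "c1 = 8 / ?b * sqrt ?vol"
  define k3 where "k3 = 2 + 2 * (sqrt ?vol / ?b)\<^sup>2 * measure lborel (cball (0::complex^'n) 1)"
  \<comment> \<open>The factors \<open>3\<close> come from squaring a sum of three terms.\<close>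
  define C where "C = 3 * (K * k3) + 3 * (Cs * (2 * ?n\<^sup>2 * c1\<^sup>2))"
  have b: "0 < ?b" by (rule bmass_pos)
  have K0: "0 \<le> K" and k30: "0 \<le> k3" using b by (auto simp: K_def k3_def)
  have C0: "0 \<le> C" using K0 k30 Cs by (simp add: C_def)
  have "\<exists>h\<in>holo UNIV. wsq (\<lambda>z. F z * G z - h z) \<le> ennreal (C * \<epsilon>\<^sup>2) * wsq G + ennreal \<delta>"
    if F: "local_holo_approx F A \<epsilon>" and G: "G \<in> holo UNIV" and WG: "wsq G < \<infinity>" and \<delta>: "0 < \<delta>" for F A \<epsilon> G \<delta>
  proof -
    interpret L: local_holo_approx F A \<epsilon> by (rule F)
    define w where "w = enn2real (wsq G)"
    have w: "wsq G = ennreal w" "0 \<le> w" using WG by (auto simp: w_def)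
    have Gc: "continuous_on UNIV G" by (rule holo_continuous_on[OF G])
    have F1c: "continuous_on UNIV L.F1"
      by (intro has_derivative_imp_continuous_on[OF L.F1_deriv])
    have chic: "continuous_on UNIV (chi R)" for R
      by (intro has_derivative_imp_continuous_on[OF chi_deriv])
    have chi'c: "continuous_on UNIV (\<lambda>z. chi' R z v)" for R v
      unfolding chi'_def by (cases "R = 0") (auto intro!: continuous_intros continuous_on_compose2[OF bump_cont[of UNIV]])
    have [measurable]: "G \<in> borel_measurable borel" "L.F1 \<in> borel_measurable borel" "chi R \<in> borel_measurable borel" for R
      by (auto intro!: borel_measurable_continuous_onI Gc F1c chic)
    note [measurable] = L.Fm
    define u where "u R z = of_real (chi R z) * (L.F1 z * G z)" for R z
    define U' where "U' R z v = of_real (chi R z) * (L.F1 z * hder G z v + L.F1' z v * G z) + of_real (chi' R z v) * (L.F1 z * G z)" for R z v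
    have du: "(u R has_derivative U' R z) (at z)" for R z
      unfolding u_def[abs_def] U'_def[abs_def]
      by (intro has_derivative_mult has_derivative_of_real chi_deriv L.F1_deriv hder[OF G UNIV_I])
    have cU: "continuous_on UNIV (\<lambda>z. U' R z v)" for R v
      unfolding U'_def by (intro continuous_intros chic chi'c F1c Gc L.F1'_cont hder_continuous_on[OF G open_UNIV])
    have uc: "continuous_on UNIV (u R)" for R
      by (intro has_derivative_imp_continuous_on[OF du])
    have su: "u R z = 0" if "0 < R" "norm z > R" for R z
    proof -
      have "chi R z = 0" unfolding chi_def using that by (intro bump_outside) (auto simp: field_simps)
      then show ?thesis by (simp add: u_def)
    qed
    let ?e = "\<lambda>z. exp (- 2 * \<phi> z)"
    have dU: "(\<Sum>j\<in>UNIV. norm (dbar (U' R z) j))\<^sup>2 \<le> (2 * ?n\<^sup>2 * (c1\<^sup>2 * \<epsilon>\<^sup>2 + 4 * A\<^sup>2 / R\<^sup>2)) * (norm (G z))\<^sup>2" if R: "0 < R" for R z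
    proof -
      have "norm (dbar (U' R z) j) \<le> c1 * \<epsilon> * norm (G z) + 2 / R * (A * norm (G z))" for j
      proof -
        have "dbar (U' R z) j = of_real (chi R z) * (dbar (L.F1' z) j * G z) + dbar (\<lambda>v. of_real (chi' R z v)) j * (L.F1 z * G z)"
          unfolding U'_def[abs_def] dbar_add dbar_cmult dbar_multc
          using dbar_complex_linear[of "hder G z" j] hder(2)[OF G UNIV_I] by simp
        also have "norm \<dots> \<le> 1 * (c1 * \<epsilon> * norm (G z)) + 2 / R * (A * norm (G z))"
          unfolding c1_def using R
          by (intro order_trans[OF norm_triangle_ineq] add_mono; unfold norm_mult;
             intro mult_mono L.dbar_F1_bound[unfolded L.vol_def] dbar_chi'_le L.F1_bound) (use chi_bounds L.eps b L.A_nonneg in auto)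
        finally show ?thesis by simp
      qed
      then have "(\<Sum>j\<in>UNIV. norm (dbar (U' R z) j)) \<le> (\<Sum>j\<in>(UNIV::'n set). c1 * \<epsilon> * norm (G z) + 2 / R * (A * norm (G z)))"
        by (intro sum_mono)
      also have "\<dots> = ?n * norm (G z) * (c1 * \<epsilon> + 2 * A / R)" by (simp add: algebra_simps)
      finally have "(\<Sum>j\<in>UNIV. norm (dbar (U' R z) j))\<^sup>2 \<le> (?n * norm (G z) * (c1 * \<epsilon> + 2 * A / R))\<^sup>2"
        by (intro power_mono sum_nonneg) auto
      also have "\<dots> = (?n\<^sup>2 * (norm (G z))\<^sup>2) * (c1 * \<epsilon> + 2 * A / R)\<^sup>2" by (simp add: power_mult_distrib)
      also have "\<dots> \<le> (?n\<^sup>2 * (norm (G z))\<^sup>2) * (2 * (c1\<^sup>2 * \<epsilon>\<^sup>2 + 4 * A\<^sup>2 / R\<^sup>2))"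
      proof (intro mult_left_mono)
        have "(c1 * \<epsilon> + 2 * A / R)\<^sup>2 \<le> 2 * (c1 * \<epsilon>)\<^sup>2 + 2 * (2 * A / R)\<^sup>2"
          using zero_le_power2[of "c1 * \<epsilon> - 2 * A / R"] unfolding power2_sum power2_diff by linarith
        then show "(c1 * \<epsilon> + 2 * A / R)\<^sup>2 \<le> 2 * (c1\<^sup>2 * \<epsilon>\<^sup>2 + 4 * A\<^sup>2 / R\<^sup>2)"
          by (simp add: power_mult_distrib power_divide)
      qed simp
      finally show ?thesis by (simp only: mult_ac)
    qed
    have solR: "\<exists>h\<in>holo UNIV. wsq (\<lambda>z. u R z - h z) \<le> ennreal (Cs * (2 * ?n\<^sup>2 * (c1\<^sup>2 * \<epsilon>\<^sup>2 + 4 * A\<^sup>2 / R\<^sup>2)) * w)" if R: "0 < R" for R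
    proof -
      let ?q = "2 * ?n\<^sup>2 * (c1\<^sup>2 * \<epsilon>\<^sup>2 + 4 * A\<^sup>2 / R\<^sup>2)"
      have q0: "0 \<le> ?q" by simp
      obtain h where h: "h \<in> holo UNIV" "wsq (\<lambda>z. u R z - h z) \<le> ennreal Cs * (\<integral>\<^sup>+x. ennreal ((\<Sum>j\<in>UNIV. norm (dbar (U' R x) j))\<^sup>2 * ?e x) \<partial>lborel)"
        using sol[OF du cU su[OF R]] by blast
      have "(\<integral>\<^sup>+x. ennreal ((\<Sum>j\<in>UNIV. norm (dbar (U' R x) j))\<^sup>2 * ?e x) \<partial>lborel) \<le> (\<integral>\<^sup>+x. ennreal ?q * ennreal ((norm (G x))\<^sup>2 * ?e x) \<partial>lborel)"
      proof (rule nn_integral_mono)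
        fix x
        have "(\<Sum>j\<in>UNIV. norm (dbar (U' R x) j))\<^sup>2 * ?e x \<le> (?q * (norm (G x))\<^sup>2) * ?e x"
          by (intro mult_right_mono dU R) auto
        then have "ennreal ((\<Sum>j\<in>UNIV. norm (dbar (U' R x) j))\<^sup>2 * ?e x) \<le> ennreal (?q * ((norm (G x))\<^sup>2 * ?e x))"
          by (intro ennreal_leI) (simp only: mult.assoc)
        also have "\<dots> = ennreal ?q * ennreal ((norm (G x))\<^sup>2 * ?e x)" by (intro ennreal_mult q0) auto
        finally show "ennreal ((\<Sum>j\<in>UNIV. norm (dbar (U' R x) j))\<^sup>2 * ?e x) \<le> ennreal ?q * ennreal ((norm (G x))\<^sup>2 * ?e x)" .
      qed
      also have "\<dots> = ennreal ?q * wsq G" unfolding wsq_def by (rule nn_integral_cmult) measurable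
      finally have "wsq (\<lambda>z. u R z - h z) \<le> ennreal Cs * (ennreal ?q * ennreal w)"
        using h(2) mult_left_mono[OF _ zero_le, of _ _ "ennreal Cs"] unfolding w(1) by (meson order_trans)
      also have "\<dots> = ennreal (Cs * ?q * w)"
        using ennreal_mult[OF q0 w(2)] ennreal_mult[OF Cs mult_nonneg_nonneg[OF q0 w(2)]] by (simp only: mult.assoc)
      finally show ?thesis using h(1) by blast
    qed
    have lim1: "(\<lambda>k. wsq (\<lambda>z. (1 - of_real (chi (real (Suc k)) z)) * (L.F1 z * G z))) \<longlonglongrightarrow> 0"
    proof -
      have "(\<lambda>k. wsq (\<lambda>z. (1 - of_real (chi (real (Suc k)) z)) * (L.F1 z * G z))) \<longlonglongrightarrow> (\<integral>\<^sup>+z. 0 \<partial>(lborel :: (complex^'n) measure))"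
        unfolding wsq_def
      proof (rule nn_integral_dominated_convergence[where w = "\<lambda>z. ennreal (A\<^sup>2) * ennreal ((norm (G z))\<^sup>2 * ?e z)"])
        show "AE z in lborel. ennreal ((norm ((1 - of_real (chi (real (Suc k)) z)) * (L.F1 z * G z)))\<^sup>2 * ?e z) \<le> ennreal (A\<^sup>2) * ennreal ((norm (G z))\<^sup>2 * ?e z)" for k
        proof (rule AE_I2)
          fix z
          have "norm (1 - complex_of_real (chi (real (Suc k)) z)) = \<bar>1 - chi (real (Suc k)) z\<bar>"
            by (metis norm_of_real of_real_1 of_real_diff)
          then have "norm ((1 - complex_of_real (chi (real (Suc k)) z)) * (L.F1 z * G z)) \<le> 1 * (A * norm (G z))"
            unfolding norm_mult using chi_bounds[of "real (Suc k)" z] by (intro mult_mono L.F1_bound) (auto simp: L.A_nonneg)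
          then have "(norm ((1 - complex_of_real (chi (real (Suc k)) z)) * (L.F1 z * G z)))\<^sup>2 \<le> (A * norm (G z))\<^sup>2"
            by (intro power_mono) auto
          then have "(norm ((1 - complex_of_real (chi (real (Suc k)) z)) * (L.F1 z * G z)))\<^sup>2 * ?e z \<le> (A * norm (G z))\<^sup>2 * ?e z"
            by (rule mult_right_mono) simp
          also have "\<dots> = A\<^sup>2 * ((norm (G z))\<^sup>2 * ?e z)" by (simp only: power_mult_distrib mult.assoc)
          finally have "ennreal ((norm ((1 - complex_of_real (chi (real (Suc k)) z)) * (L.F1 z * G z)))\<^sup>2 * ?e z) \<le> ennreal (A\<^sup>2 * ((norm (G z))\<^sup>2 * ?e z))"
            by (rule ennreal_leI)
          also have "\<dots> = ennreal (A\<^sup>2) * ennreal ((norm (G z))\<^sup>2 * ?e z)" by (rule ennreal_mult) auto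
          finally show "ennreal ((norm ((1 - of_real (chi (real (Suc k)) z)) * (L.F1 z * G z)))\<^sup>2 * ?e z) \<le> ennreal (A\<^sup>2) * ennreal ((norm (G z))\<^sup>2 * ?e z)" .
        qed
        have "(\<integral>\<^sup>+z. ennreal (A\<^sup>2) * ennreal ((norm (G z))\<^sup>2 * ?e z) \<partial>lborel) = ennreal (A\<^sup>2) * wsq G"
          unfolding wsq_def by (rule nn_integral_cmult) measurable
        then show "(\<integral>\<^sup>+z. ennreal (A\<^sup>2) * ennreal ((norm (G z))\<^sup>2 * ?e z) \<partial>lborel) < \<infinity>"
          using WG by (simp add: ennreal_mult_less_top)
        show "AE z in lborel. (\<lambda>k. ennreal ((norm ((1 - of_real (chi (real (Suc k)) z)) * (L.F1 z * G z)))\<^sup>2 * ?e z)) \<longlonglongrightarrow> 0"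
        proof (rule AE_I2)
          fix z
          have "(\<lambda>k. ennreal ((norm ((1 - of_real (chi (real (Suc k)) z)) * (L.F1 z * G z)))\<^sup>2 * ?e z)) \<longlonglongrightarrow> ennreal ((norm ((1 - of_real 1) * (L.F1 z * G z)))\<^sup>2 * ?e z)"
            by (intro tendsto_ennrealI tendsto_intros chi_limit)
          then show "(\<lambda>k. ennreal ((norm ((1 - of_real (chi (real (Suc k)) z)) * (L.F1 z * G z)))\<^sup>2 * ?e z)) \<longlonglongrightarrow> 0" by simp
        qed
      qed measurable
      then show ?thesis by simp
    qed
    have lim2: "(\<lambda>k. 3 * (Cs * (2 * ?n\<^sup>2 * (4 * A\<^sup>2 / (real (Suc k))\<^sup>2)) * w)) \<longlonglongrightarrow> 0"
      by real_asymp
    have ev1: "\<forall>\<^sub>F k in sequentially. wsq (\<lambda>z. (1 - of_real (chi (real (Suc k)) z)) * (L.F1 z * G z)) < ennreal (\<delta> / 6)"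
      by (rule order_tendstoD(2)[OF lim1]) (use \<delta> in simp)
    have ev2: "\<forall>\<^sub>F k in sequentially. 3 * (Cs * (2 * ?n\<^sup>2 * (4 * A\<^sup>2 / (real (Suc k))\<^sup>2)) * w) < \<delta> / 2"
      by (rule order_tendstoD(2)[OF lim2]) (use \<delta> in simp)
    obtain k where k: "wsq (\<lambda>z. (1 - of_real (chi (real (Suc k)) z)) * (L.F1 z * G z)) < ennreal (\<delta> / 6)"
      "3 * (Cs * (2 * ?n\<^sup>2 * (4 * A\<^sup>2 / (real (Suc k))\<^sup>2)) * w) < \<delta> / 2"
      using eventually_conj[OF ev1 ev2] eventually_happens'[OF sequentially_bot] by (metis (no_types, lifting))
    let ?R = "real (Suc k)"
    obtain h where h: "h \<in> holo UNIV" "wsq (\<lambda>z. u ?R z - h z) \<le> ennreal (Cs * (2 * ?n\<^sup>2 * (c1\<^sup>2 * \<epsilon>\<^sup>2 + 4 * A\<^sup>2 / ?R\<^sup>2)) * w)"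
      using solR[of ?R] by auto
    have [measurable]: "h \<in> borel_measurable borel" "u ?R \<in> borel_measurable borel"
      by (auto intro!: borel_measurable_continuous_onI holo_continuous_on h uc)
    have t: "3 * ennreal x = ennreal (3 * x)" for x by (subst ennreal_mult') auto
    have F2: "wsq (\<lambda>z. (F z - L.F1 z) * G z) \<le> ennreal (K * (k3 * \<epsilon>\<^sup>2) * w)"
    proof -
      have "wsq (\<lambda>z. (F z - L.F1 z) * G z) \<le> ennreal K * ennreal (k3 * \<epsilon>\<^sup>2) * wsq G"
        unfolding K_def by (rule local_L2_mult_bound[OF G]) (measurable, use L.F_F1_local in \<open>simp add: L.smooth_c_def L.vol_def k3_def\<close>)
      also have "\<dots> = ennreal (K * (k3 * \<epsilon>\<^sup>2) * w)"
        unfolding w(1) using K0 k30 w(2) by (simp add: ennreal_mult)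
      finally show ?thesis .
    qed
    have eq: "(\<lambda>z. F z * G z - h z) = (\<lambda>z. (F z - L.F1 z) * G z + (1 - of_real (chi ?R z)) * (L.F1 z * G z) + (u ?R z - h z))"
      by (simp add: fun_eq_iff u_def algebra_simps)
    have "wsq (\<lambda>z. F z * G z - h z) \<le> 3 * wsq (\<lambda>z. (F z - L.F1 z) * G z) + 3 * wsq (\<lambda>z. (1 - of_real (chi ?R z)) * (L.F1 z * G z)) + 3 * wsq (\<lambda>z. u ?R z - h z)"
      unfolding eq by (rule wsq_add3_le) measurable
    also have "\<dots> \<le> 3 * ennreal (K * (k3 * \<epsilon>\<^sup>2) * w) + 3 * ennreal (\<delta> / 6) + 3 * ennreal (Cs * (2 * ?n\<^sup>2 * (c1\<^sup>2 * \<epsilon>\<^sup>2 + 4 * A\<^sup>2 / ?R\<^sup>2)) * w)"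
      using F2 k(1) h(2) by (intro add_mono mult_left_mono) auto
    also have "\<dots> = ennreal (3 * (K * (k3 * \<epsilon>\<^sup>2) * w) + 3 * (\<delta> / 6) + 3 * (Cs * (2 * ?n\<^sup>2 * (c1\<^sup>2 * \<epsilon>\<^sup>2 + 4 * A\<^sup>2 / ?R\<^sup>2)) * w))"
    proof -
      have "0 \<le> 3 * (K * (k3 * \<epsilon>\<^sup>2) * w)" "0 \<le> 3 * (\<delta> / 6)" "0 \<le> 3 * (Cs * (2 * ?n\<^sup>2 * (c1\<^sup>2 * \<epsilon>\<^sup>2 + 4 * A\<^sup>2 / ?R\<^sup>2)) * w)"
        using K0 k30 w(2) \<delta> Cs by auto
      then show ?thesis unfolding t by (simp only: ennreal_plus add_nonneg_nonneg)
    qed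
    also have "\<dots> \<le> ennreal (C * \<epsilon>\<^sup>2 * w + \<delta>)"
    proof (rule ennreal_leI)
      have "3 * (Cs * (2 * ?n\<^sup>2 * (c1\<^sup>2 * \<epsilon>\<^sup>2 + 4 * A\<^sup>2 / ?R\<^sup>2)) * w) = 3 * (Cs * (2 * ?n\<^sup>2 * c1\<^sup>2)) * \<epsilon>\<^sup>2 * w + 3 * (Cs * (2 * ?n\<^sup>2 * (4 * A\<^sup>2 / ?R\<^sup>2)) * w)"
        by (simp only: distrib_left distrib_right mult_ac)
      moreover have "C * \<epsilon>\<^sup>2 * w = 3 * (K * (k3 * \<epsilon>\<^sup>2) * w) + 3 * (Cs * (2 * ?n\<^sup>2 * c1\<^sup>2)) * \<epsilon>\<^sup>2 * w"
        by (simp only: C_def distrib_left distrib_right mult_ac)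
      ultimately show "3 * (K * (k3 * \<epsilon>\<^sup>2) * w) + 3 * (\<delta> / 6) + 3 * (Cs * (2 * ?n\<^sup>2 * (c1\<^sup>2 * \<epsilon>\<^sup>2 + 4 * A\<^sup>2 / ?R\<^sup>2)) * w) \<le> C * \<epsilon>\<^sup>2 * w + \<delta>"
        using k(2) by linarith
    qed
    also have "\<dots> = ennreal (C * \<epsilon>\<^sup>2) * wsq G + ennreal \<delta>"
      unfolding w(1) using C0 w(2) \<delta> by (simp add: ennreal_mult)
    finally show ?thesis using h(1) by blast
  qed
  then show ?thesis using C0 by blast
qed

end

section \<open>From the Hessian condition to uniform convexity\<close>

lemma has_partial_shift:
  assumes "has_partial b f"
  shows "((\<lambda>s. f (y + s *\<^sub>R b)) has_real_derivative partial b f (y + r *\<^sub>R b)) (at r)"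
proof -
  have "(\<lambda>s. f ((y + r *\<^sub>R b) + s *\<^sub>R b)) differentiable (at 0)"
    using assms by (simp add: has_partial_def)
  then have "((\<lambda>s. f ((y + r *\<^sub>R b) + s *\<^sub>R b)) has_real_derivative partial b f (y + r *\<^sub>R b)) (at 0)"
    unfolding partial_def by (simp add: DERIV_deriv_iff_real_differentiable)
  then have "((\<lambda>s. f ((y + r *\<^sub>R b) + (s - r) *\<^sub>R b)) has_real_derivative partial b f (y + r *\<^sub>R b)) (at r)"
    using DERIV_shift[of "\<lambda>s. f ((y + r *\<^sub>R b) + s *\<^sub>R b)" _ r "-r"] by simp
  then show ?thesis by (simp add: algebra_simps)
qed

text \<open>
  The coordinates are changed one at a time, the mean value inequality being used along each basis
  vector; the induction is over the set of coordinates already changed.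
\<close>

lemma continuous_partials_imp_has_derivative:
  fixes f :: "'a::euclidean_space \<Rightarrow> real"
  assumes p: "\<And>b. b \<in> Basis \<Longrightarrow> has_partial b f" and c: "\<And>b. b \<in> Basis \<Longrightarrow> continuous_on UNIV (partial b f)"
  shows "(f has_derivative (\<lambda>v. \<Sum>b\<in>Basis. (v \<bullet> b) * partial b f x)) (at x)"
proof -
  have main: "\<forall>e>0. \<exists>d>0. \<forall>h. norm h < d \<longrightarrow>
      \<bar>f (x + (\<Sum>b\<in>S. (h \<bullet> b) *\<^sub>R b)) - f x - (\<Sum>b\<in>S. (h \<bullet> b) * partial b f x)\<bar> \<le> e * norm h"
    if "finite S" "S \<subseteq> Basis" for S
    using that
  proof (induction S)
    case empty
    then show ?case by (auto intro!: exI[of _ 1])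
  next
    case (insert k S)
    have kB: "k \<in> Basis" "norm k = 1" using insert by auto
    show ?case
    proof (intro allI impI)
      fix e :: real assume e: "0 < e"
      obtain d1 where d1: "0 < d1" "\<And>h. norm h < d1 \<Longrightarrow>
        \<bar>f (x + (\<Sum>b\<in>S. (h \<bullet> b) *\<^sub>R b)) - f x - (\<Sum>b\<in>S. (h \<bullet> b) * partial b f x)\<bar> \<le> (e / 2) * norm h"
        using insert.IH[THEN spec, of "e / 2"] insert.prems e by auto
      have "isCont (partial k f) x" using c[OF kB(1)] by (simp add: continuous_on_eq_continuous_at)
      then obtain d2 where d2: "0 < d2" "\<And>y. norm (y - x) < d2 \<Longrightarrow> \<bar>partial k f y - partial k f x\<bar> < e / 2"
        using e unfolding continuous_at_eps_delta dist_norm by (metis half_gt_zero real_norm_def)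
      let ?N = "real (card S) + 1"
      let ?d = "min d1 (d2 / ?N)"
      have "\<bar>f (x + (\<Sum>b\<in>insert k S. (h \<bullet> b) *\<^sub>R b)) - f x - (\<Sum>b\<in>insert k S. (h \<bullet> b) * partial b f x)\<bar> \<le> e * norm h"
        if h: "norm h < ?d" for h
      proof -
        let ?y = "x + (\<Sum>b\<in>S. (h \<bullet> b) *\<^sub>R b)"
        have "norm (\<Sum>b\<in>S. (h \<bullet> b) *\<^sub>R b) \<le> (\<Sum>b\<in>S. norm h)"
          by (rule order_trans[OF norm_sum], rule sum_mono) (use insert.prems Basis_le_norm in \<open>auto simp: subset_iff\<close>)
        then have ny: "norm (\<Sum>b\<in>S. (h \<bullet> b) *\<^sub>R b) \<le> real (card S) * norm h" by simp
        have near: "norm (?y + r *\<^sub>R k - x) < d2" if "\<bar>r\<bar> \<le> norm h" for r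
        proof -
          have "norm (?y + r *\<^sub>R k - x) \<le> norm (\<Sum>b\<in>S. (h \<bullet> b) *\<^sub>R b) + norm (r *\<^sub>R k)"
            using norm_triangle_ineq[of "\<Sum>b\<in>S. (h \<bullet> b) *\<^sub>R b" "r *\<^sub>R k"] by simp
          also have "\<dots> \<le> ?N * norm h" using ny that kB by (simp add: algebra_simps)
          also have "\<dots> < d2" using h by (simp add: pos_less_divide_eq mult.commute)
          finally show ?thesis .
        qed
        let ?g = "\<lambda>r. f (?y + r *\<^sub>R k) - r * partial k f x"
        let ?I = "closed_segment 0 (h \<bullet> k)"
        have hk: "\<bar>h \<bullet> k\<bar> \<le> norm h" using Basis_le_norm[OF kB(1)] .
        have "norm (?g (h \<bullet> k) - ?g 0) \<le> (e / 2) * norm (h \<bullet> k - 0)"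
        proof (rule field_differentiable_bound[where S = ?I and f' = "\<lambda>r. partial k f (?y + r *\<^sub>R k) - partial k f x"])
          fix r assume r: "r \<in> ?I"
          show "(?g has_field_derivative partial k f (?y + r *\<^sub>R k) - partial k f x) (at r within ?I)"
            by (intro has_field_derivative_at_within[OF DERIV_diff[OF has_partial_shift[OF p[OF kB(1)]]]])
               (auto intro!: derivative_eq_intros)
          have "\<bar>r\<bar> \<le> norm h" using r hk by (auto simp: closed_segment_eq_real_ivl split: if_splits)
          from d2(2)[OF near[OF this]] show "norm (partial k f (?y + r *\<^sub>R k) - partial k f x) \<le> e / 2" by simp
        qed auto
        also have "\<dots> \<le> (e / 2) * norm h" using hk e by (intro mult_left_mono) auto
        finally have 1: "\<bar>f (?y + (h \<bullet> k) *\<^sub>R k) - f ?y - (h \<bullet> k) * partial k f x\<bar> \<le> (e / 2) * norm h"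
          by (simp add: algebra_simps)
        have 2: "\<bar>f ?y - f x - (\<Sum>b\<in>S. (h \<bullet> b) * partial b f x)\<bar> \<le> (e / 2) * norm h" using d1(2)[of h] h by simp
        have s: "x + (\<Sum>b\<in>insert k S. (h \<bullet> b) *\<^sub>R b) = ?y + (h \<bullet> k) *\<^sub>R k"
          using insert.hyps by (simp add: algebra_simps)
        have s2: "(\<Sum>b\<in>insert k S. (h \<bullet> b) * partial b f x) = (h \<bullet> k) * partial k f x + (\<Sum>b\<in>S. (h \<bullet> b) * partial b f x)"
          using insert.hyps by simp
        have "e * norm h = (e / 2) * norm h + (e / 2) * norm h" by simp
        then show ?thesis unfolding s s2 using 1 2 by linarith
      qed
      then show "\<exists>d>0. \<forall>h. norm h < d \<longrightarrow>
        \<bar>f (x + (\<Sum>b\<in>insert k S. (h \<bullet> b) *\<^sub>R b)) - f x - (\<Sum>b\<in>insert k S. (h \<bullet> b) * partial b f x)\<bar> \<le> e * norm h"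
        using d1(1) d2(1) by (intro exI[of _ ?d]) auto
    qed
  qed
  show ?thesis
    unfolding has_derivative_at_alt
  proof (intro conjI allI impI)
    show "bounded_linear (\<lambda>v. \<Sum>b\<in>Basis. (v \<bullet> b) * partial b f x)"
      by (intro bounded_linear_sum bounded_linear_mult_const bounded_linear_inner_left)
    fix e :: real assume "0 < e"
    then obtain d where d: "0 < d" "\<And>h. norm h < d \<Longrightarrow>
      \<bar>f (x + (\<Sum>b\<in>Basis. (h \<bullet> b) *\<^sub>R b)) - f x - (\<Sum>b\<in>Basis. (h \<bullet> b) * partial b f x)\<bar> \<le> e * norm h"
      using main[OF finite_Basis order_refl] by blast
    show "\<exists>d>0. \<forall>y. norm (y - x) < d \<longrightarrow> norm (f y - f x - (\<Sum>b\<in>Basis. ((y - x) \<bullet> b) * partial b f x)) \<le> e * norm (y - x)"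
      using d(1) d(2)[of "_ - x"] by (intro exI[of _ d]) (auto simp: euclidean_representation)
  qed
qed

text \<open>
  Taylor's formula with a one-sided bound on the second derivative; applied to \<open>- g\<close>
  it also gives the upper bound.
\<close>

lemma second_order_lower:
  fixes g :: "real \<Rightarrow> real"
  assumes g: "\<And>s. (g has_real_derivative g' s) (at s)" and g': "\<And>s. (g' has_real_derivative g'' s) (at s)"
    and k: "\<And>s. k \<le> g'' s"
  shows "g 0 + g' 0 + k / 2 \<le> g 1"
proof -
  have 1: "g' 0 + k * s \<le> g' s" if "0 \<le> s" for s
  proof -
    have "(\<lambda>s. g' s - k * s) 0 \<le> (\<lambda>s. g' s - k * s) s"
    proof (rule DERIV_nonneg_imp_nondecreasing[OF that])
      fix r
      show "\<exists>y. ((\<lambda>s. g' s - k * s) has_real_derivative y) (at r) \<and> 0 \<le> y"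
        using k[of r] by (intro exI[of _ "g'' r - k"]) (auto intro!: derivative_eq_intros g')
    qed
    then show ?thesis by simp
  qed
  have "(\<lambda>s. g s - g' 0 * s - k / 2 * s\<^sup>2) 0 \<le> (\<lambda>s. g s - g' 0 * s - k / 2 * s\<^sup>2) 1"
  proof (rule DERIV_nonneg_imp_nondecreasing[of 0 1 "\<lambda>s. g s - g' 0 * s - k / 2 * s\<^sup>2"])
    fix r :: real assume "0 \<le> r"
    then show "\<exists>y. ((\<lambda>s. g s - g' 0 * s - k / 2 * s\<^sup>2) has_real_derivative y) (at r) \<and> 0 \<le> y"
      using 1[of r] by (intro exI[of _ "g' r - g' 0 - k * r"]) (auto intro!: derivative_eq_intros g)
  qed simp
  then show ?thesis by simp
qed

lemma sum_Basis_complex_vec: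
  "(\<Sum>b\<in>(Basis :: (complex^'n) set). F b) = (\<Sum>j\<in>UNIV. F (axis j 1) + F (axis j \<i>))"
proof -
  have B: "(Basis :: (complex^'n) set) = (\<lambda>(j, u). axis j u) ` (UNIV \<times> Basis)"
    by (auto simp: Basis_vec_def)
  have inj: "inj_on (\<lambda>(j, u). axis j u :: complex^'n) (UNIV \<times> Basis)"
    by (auto simp: inj_on_def axis_eq_axis)
  have "(\<Sum>b\<in>(Basis :: (complex^'n) set). F b) = (\<Sum>(j, u)\<in>UNIV \<times> Basis. F (axis j u))"
    unfolding B by (subst sum.reindex[OF inj]) (simp add: split_beta comp_def)
  also have "\<dots> = (\<Sum>j\<in>UNIV. \<Sum>u\<in>Basis. F (axis j u))" by (rule sum.cartesian_product[symmetric])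
  finally show ?thesis by (simp add: Basis_complex_def)
qed

lemma sum_id_matrix:
  fixes w :: "'a::euclidean_space"
  shows "(\<Sum>b\<in>Basis. \<Sum>c\<in>Basis. id_matrix b c * (w \<bullet> b) * (w \<bullet> c)) = (norm w)\<^sup>2"
proof -
  have "(\<Sum>c\<in>Basis. id_matrix b c * (w \<bullet> b) * (w \<bullet> c)) = (w \<bullet> b) * (w \<bullet> b)" if "b \<in> Basis" for b
  proof -
    have "(\<Sum>c\<in>Basis. id_matrix b c * (w \<bullet> b) * (w \<bullet> c)) = (\<Sum>c\<in>Basis. if b = c then (w \<bullet> b) * (w \<bullet> c) else 0)"
      by (intro sum.cong) (auto simp: id_matrix_def)
    then show ?thesis using that by simp
  qed
  then show ?thesis unfolding power2_norm_eq_inner by (subst euclidean_inner) simp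
qed

text \<open>
  The second derivative of \<open>\<phi>\<close> along the segment from \<open>x\<close> to
  \<open>y\<close> is the Hessian form of \<open>y - x\<close>, which lies between
  \<open>m\<close> and \<open>M\<close> times its squared norm.
\<close>

lemma hessian_convex_weight:
  fixes \<phi> :: "complex^'n \<Rightarrow> real"
  assumes C2: "C2 \<phi>" and H: "hess_equiv_id \<phi>"
  shows "\<exists>p m M. convex_weight \<phi> p m M"
proof -
  obtain m M where m: "0 < m" and M: "0 < M"
    and lo: "\<And>x. matrix_le (\<lambda>b c. m * id_matrix b c) (hess \<phi> x)"
    and up: "\<And>x. matrix_le (hess \<phi> x) (\<lambda>b c. M * id_matrix b c)"
    using H unfolding hess_equiv_id_def by blast
  have d1: "(\<phi> has_derivative (\<lambda>v. \<Sum>b\<in>Basis. (v \<bullet> b) * partial b \<phi> x)) (at x)" for x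
    using C2 by (intro continuous_partials_imp_has_derivative) (auto simp: C2_def)
  have d2: "(partial b \<phi> has_derivative (\<lambda>v. \<Sum>c\<in>Basis. (v \<bullet> c) * partial c (partial b \<phi>) x)) (at x)" if "b \<in> Basis" for b x
    using C2 that by (intro continuous_partials_imp_has_derivative) (auto simp: C2_def)
  \<comment> \<open>Twice the holomorphic gradient; the sign of the imaginary part makes the differential of \<open>\<phi>\<close> the real part of the complex pairing with \<open>p\<close>.\<close>
  define p :: "complex^'n \<Rightarrow> complex^'n" where
    "p x = (\<chi> j. Complex (partial (axis j 1) \<phi> x) (- partial (axis j \<i>) \<phi> x))" for x
  have pd: "Re (cdot (p x) v) = (\<Sum>b\<in>Basis. (v \<bullet> b) * partial b \<phi> x)" for x v
    unfolding sum_Basis_complex_vec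
    by (simp add: cdot_def p_def inner_axis_complex inner_complex_def algebra_simps)
  have line: "((\<lambda>s. x + s *\<^sub>R v) has_derivative (\<lambda>s. s *\<^sub>R v)) (at s)" for x v :: "complex^'n" and s
    by (auto intro!: derivative_eq_intros)
  define g' where "g' x v s = (\<Sum>b\<in>Basis. (v \<bullet> b) * partial b \<phi> (x + s *\<^sub>R v))" for x v s
  define g'' where "g'' x v s = (\<Sum>b\<in>Basis. \<Sum>c\<in>Basis. hess \<phi> (x + s *\<^sub>R v) b c * (v \<bullet> b) * (v \<bullet> c))" for x v s
  have D1: "((\<lambda>s. \<phi> (x + s *\<^sub>R v)) has_real_derivative g' x v s) (at s)" for x v s
    unfolding has_field_derivative_def
    by (rule has_derivative_eq_rhs[OF has_derivative_compose[OF line d1]])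
       (simp add: fun_eq_iff g'_def sum_distrib_left sum_distrib_right mult_ac)
  have D2: "(g' x v has_real_derivative g'' x v s) (at s)" for x v s
  proof -
    have "((\<lambda>s. partial b \<phi> (x + s *\<^sub>R v)) has_real_derivative (\<Sum>c\<in>Basis. (v \<bullet> c) * partial c (partial b \<phi>) (x + s *\<^sub>R v))) (at s)" if "b \<in> Basis" for b
      unfolding has_field_derivative_def
      by (rule has_derivative_eq_rhs[OF has_derivative_compose[OF line d2[OF that]]])
         (simp add: fun_eq_iff sum_distrib_left sum_distrib_right mult_ac)
    then have "(g' x v has_real_derivative (\<Sum>b\<in>Basis. (v \<bullet> b) * (\<Sum>c\<in>Basis. (v \<bullet> c) * partial c (partial b \<phi>) (x + s *\<^sub>R v)))) (at s)"
      unfolding g'_def[abs_def] by (intro DERIV_sum DERIV_cmult)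
    also have "(\<Sum>b\<in>Basis. (v \<bullet> b) * (\<Sum>c\<in>Basis. (v \<bullet> c) * partial c (partial b \<phi>) (x + s *\<^sub>R v))) = g'' x v s"
      unfolding g''_def hess_def sum_distrib_left by (subst sum.swap) (simp only: mult_ac)
    finally show ?thesis .
  qed
  have g''_lo: "m * (norm v)\<^sup>2 \<le> g'' x v s" and g''_up: "g'' x v s \<le> M * (norm v)\<^sup>2" for x v s
  proof -
    have "0 \<le> (\<Sum>b\<in>Basis. \<Sum>c\<in>Basis. (hess \<phi> (x + s *\<^sub>R v) b c - m * id_matrix b c) * (v \<bullet> b) * (v \<bullet> c))"
      using lo[of "x + s *\<^sub>R v"] unfolding matrix_le_def psd_def by blast
    also have "\<dots> = g'' x v s - m * (norm v)\<^sup>2"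
      unfolding g''_def sum_id_matrix[symmetric] by (simp add: left_diff_distrib sum_subtractf sum_distrib_left mult.assoc)
    finally show "m * (norm v)\<^sup>2 \<le> g'' x v s" by simp
    have "0 \<le> (\<Sum>b\<in>Basis. \<Sum>c\<in>Basis. (M * id_matrix b c - hess \<phi> (x + s *\<^sub>R v) b c) * (v \<bullet> b) * (v \<bullet> c))"
      using up[of "x + s *\<^sub>R v"] unfolding matrix_le_def psd_def by blast
    also have "\<dots> = M * (norm v)\<^sup>2 - g'' x v s"
      unfolding g''_def sum_id_matrix[symmetric] by (simp add: left_diff_distrib sum_subtractf sum_distrib_left mult.assoc)
    finally show "g'' x v s \<le> M * (norm v)\<^sup>2" by simp
  qed
  have g'0: "g' x v 0 = Re (cdot (p x) v)" for x v by (simp add: pd g'_def)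
  \<comment> \<open>The factor \<open>1 / 2\<close> is that of the second order Taylor term.\<close>
  have "convex_weight \<phi> p (m / 2) (M / 2)"
  proof
    show "0 < m / 2" "0 < M / 2" using m M by auto
    show "continuous_on UNIV \<phi>" using C2 by (simp add: C2_def)
    show "continuous_on UNIV p"
    proof -
      have "axis j 1 \<in> (Basis :: (complex^'n) set)" "axis j \<i> \<in> (Basis :: (complex^'n) set)" for j
        by (auto simp: Basis_vec_def Basis_complex_def)
      then have "continuous_on UNIV (partial (axis j 1) \<phi>)" "continuous_on UNIV (partial (axis j \<i>) \<phi>)" for j
        using C2 by (auto simp: C2_def)
      then show ?thesis unfolding p_def by (intro continuous_on_vec_lambda continuous_on_Complex continuous_intros)
    qed
    fix x y
    have "(\<lambda>s. \<phi> (x + s *\<^sub>R (y - x))) 0 + g' x (y - x) 0 + m * (norm (y - x))\<^sup>2 / 2 \<le> (\<lambda>s. \<phi> (x + s *\<^sub>R (y - x))) 1"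
      by (rule second_order_lower[OF D1 D2 g''_lo])
    then show "\<phi> x + Re (cdot (p x) (y - x)) + m / 2 * (norm (y - x))\<^sup>2 \<le> \<phi> y" by (simp add: g'0)
    have "- (\<phi> (x + 0 *\<^sub>R (y - x))) + - g' x (y - x) 0 + - (M * (norm (y - x))\<^sup>2) / 2 \<le> - (\<phi> (x + 1 *\<^sub>R (y - x)))"
      by (rule second_order_lower[OF DERIV_minus[OF D1] DERIV_minus[OF D2]]) (use g''_up in simp)
    then show "\<phi> y \<le> \<phi> x + Re (cdot (p x) (y - x)) + M / 2 * (norm (y - x))\<^sup>2" by (simp add: g'0)
  qed
  then show ?thesis by blast
qed

section \<open>Passage between the scales and the equivalence\<close>

text \<open>
  Borel versions behave well under the dilation and under product measures; the version is
  truncated so that the bound holds everywhere.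
\<close>

lemma lebesgue_bounded_borel_version:
  fixes f :: "complex^'n \<Rightarrow> complex"
  assumes f: "f \<in> borel_measurable lebesgue" and b: "AE z in lebesgue. norm (f z) \<le> C"
  obtains F where "F \<in> borel_measurable borel" "AE z in lebesgue. f z = F z" "\<And>z. norm (F z) \<le> \<bar>C\<bar>"
proof -
  have "(\<lambda>z. Re (f z)) \<in> borel_measurable lebesgue" "(\<lambda>z. Im (f z)) \<in> borel_measurable lebesgue"
    using f by measurable
  then obtain r s where rs: "r \<in> borel_measurable lborel" "AE z in lborel. Re (f z) = r z"
    "s \<in> borel_measurable lborel" "AE z in lborel. Im (f z) = s z"
    using completion_ex_borel_measurable_real by metis
  define F0 where "F0 z = Complex (r z) (s z)" for z
  have F0: "F0 = (\<lambda>z. of_real (r z) + \<i> * of_real (s z))" by (simp add: F0_def fun_eq_iff Complex_eq)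
  have [measurable]: "F0 \<in> borel_measurable borel" unfolding F0 using rs by simp
  define F where "F z = (if norm (F0 z) \<le> \<bar>C\<bar> then F0 z else 0)" for z
  have "F \<in> borel_measurable borel" unfolding F_def by measurable
  moreover have "AE z in lebesgue. f z = F z"
  proof -
    have "AE z in lebesgue. Re (f z) = r z" "AE z in lebesgue. Im (f z) = s z"
      using rs by (auto intro: AE_completion)
    then show ?thesis using b
    proof eventually_elim
      case (elim z)
      then have "F0 z = f z" by (simp add: F0_def complex_eq_iff)
      then show ?case using elim by (simp add: F_def)
    qed
  qed
  moreover have "norm (F z) \<le> \<bar>C\<bar>" for z by (simp add: F_def)
  ultimately show ?thesis using that by blast
qed

lemma nn_integral_lborel_ball_scale:
  fixes u :: "complex^'n \<Rightarrow> ennreal"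
  assumes u: "(\<lambda>z. u z * indicator (ball (s *\<^sub>R a) (s * r)) z) \<in> borel_measurable borel" and s: "0 < s"
  shows "(\<integral>\<^sup>+z\<in>ball (s *\<^sub>R a) (s * r). u z \<partial>lborel) = ennreal (s ^ DIM(complex^'n)) * (\<integral>\<^sup>+z\<in>ball a r. u (s *\<^sub>R z) \<partial>lborel)"
proof -
  have "(indicator (ball (s *\<^sub>R a) (s * r)) (s *\<^sub>R z) :: ennreal) = indicator (ball a r) z" for z
  proof -
    have "dist (s *\<^sub>R a) (s *\<^sub>R z) = s * dist a z"
      using s by (simp add: dist_norm scaleR_diff_right[symmetric])
    then show ?thesis using s by (simp add: indicator_def)
  qed
  then show ?thesis using nn_integral_lborel_affine[OF u, of s 0] s by simp
qed

definition vol_ball :: "'n::finite itself \<Rightarrow> real \<Rightarrow> real" where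
  "vol_ball _ r = measure lborel (ball (0 :: complex^'n) r)"

lemma vol_ball: "0 < r \<Longrightarrow> 0 < vol_ball TYPE('n::finite) r"
  using content_ball_pos[of r "0::complex^'n"] by (simp add: vol_ball_def measure_completion)

lemma emeasure_vol_ball:
  fixes a :: "complex^'n"
  shows "emeasure lborel (ball a r) = ennreal (vol_ball TYPE('n) r)"
proof -
  have f: "emeasure lborel (ball (0 :: complex^'n) r) \<noteq> \<infinity>" using emeasure_bounded_finite[of "ball (0 :: complex^'n) r"] by simp
  have i: "(\<lambda>y. indicator (ball a r) (a + y) :: ennreal) = indicator (ball 0 r)"
    by (auto simp: indicator_def dist_norm fun_eq_iff)
  have "(\<integral>\<^sup>+y. indicator (ball a r) y \<partial>lborel) = (\<integral>\<^sup>+y. indicator (ball a r) (a + y) \<partial>lborel)"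
    using nn_integral_lborel_affine[OF borel_measurable_indicator[OF borel_open[OF open_ball]], of 1 a r a] by simp
  then have "emeasure lborel (ball a r) = emeasure lborel (ball (0 :: complex^'n) r)" unfolding i by simp
  also have "\<dots> = ennreal (vol_ball TYPE('n) r)"
    unfolding vol_ball_def using f by (intro emeasure_eq_ennreal_measure) simp
  finally show ?thesis .
qed

lemma ennreal_mult_divide_cancel:
  assumes "0 < d" "0 < v"
  shows "ennreal d * x / (ennreal d * ennreal v) = x / ennreal v"
proof (cases x)
  case (real r)
  then show ?thesis using assms by (simp add: ennreal_mult[symmetric] divide_ennreal)
next
  case top
  then show ?thesis using assms by (simp add: ennreal_mult[symmetric] ennreal_mult_top ennreal_top_divide)
qed

lemma G2_integral_scale:
  fixes F h :: "complex^'n \<Rightarrow> complex"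
  assumes F: "F \<in> borel_measurable borel" and h: "h \<in> holo (ball (s *\<^sub>R a) (s * r))" and s: "0 < s" and r: "0 < r"
  shows "(\<integral>\<^sup>+w\<in>ball (s *\<^sub>R a) (s * r). ennreal ((norm (F w - h w))\<^sup>2) \<partial>lebesgue) / emeasure lebesgue (ball (s *\<^sub>R a) (s * r))
     = (\<integral>\<^sup>+w\<in>ball a r. ennreal ((norm (F (s *\<^sub>R w) - h (s *\<^sub>R w)))\<^sup>2) \<partial>lborel) / ennreal (vol_ball TYPE('n) r)"
proof -
  let ?U = "ball (s *\<^sub>R a) (s * r)" and ?d = "s ^ DIM(complex^'n)"
  have d: "0 < ?d" using s by simp
  have hm: "(\<lambda>w. indicator ?U w *\<^sub>R h w) \<in> borel_measurable borel"
    by (intro borel_measurable_continuous_on_indicator holo_continuous_on h) simp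
  have "(\<lambda>w. ennreal ((norm (F w - h w))\<^sup>2) * indicator ?U w) = (\<lambda>w. ennreal ((norm (F w - indicator ?U w *\<^sub>R h w))\<^sup>2) * indicator ?U w)"
    by (auto simp: fun_eq_iff indicator_def)
  also have "\<dots> \<in> borel_measurable borel" using F hm by measurable
  finally have m: "(\<lambda>w. ennreal ((norm (F w - h w))\<^sup>2) * indicator ?U w) \<in> borel_measurable borel" .
  have 1: "(\<integral>\<^sup>+w\<in>?U. ennreal ((norm (F w - h w))\<^sup>2) \<partial>lebesgue) = ennreal ?d * (\<integral>\<^sup>+w\<in>ball a r. ennreal ((norm (F (s *\<^sub>R w) - h (s *\<^sub>R w)))\<^sup>2) \<partial>lborel)"
    unfolding nn_integral_completion by (rule nn_integral_lborel_ball_scale[OF m s])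
  have 2: "emeasure lebesgue ?U = ennreal ?d * ennreal (vol_ball TYPE('n) r)"
  proof -
    have "emeasure lebesgue ?U = emeasure lborel ?U" by simp
    also have "\<dots> = (\<integral>\<^sup>+w\<in>?U. 1 \<partial>lborel)" by simp
    also have "\<dots> = ennreal ?d * (\<integral>\<^sup>+w\<in>ball a r. 1 \<partial>lborel)" by (rule nn_integral_lborel_ball_scale[OF _ s]) simp
    finally show ?thesis by (simp add: emeasure_vol_ball)
  qed
  have v: "0 < vol_ball TYPE('n) r" by (rule vol_ball[OF r])
  show ?thesis unfolding 1 2
    using d v by (rule ennreal_mult_divide_cancel)
qed

lemma mu_wmeas: "mu \<phi> t = wmeas (1 / t ^ CARD('n)) (\<lambda>z :: complex^'n. \<phi> (z /\<^sub>R sqrt t))"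
  by (simp add: mu_def wmeas_def)

lemma ennsqrt_less_imp: "ennsqrt x < ennreal \<eta> \<Longrightarrow> x \<le> ennreal (\<eta>\<^sup>2)"
proof -
  assume a: "ennsqrt x < ennreal \<eta>"
  show ?thesis
  proof (cases x)
    case (real r)
    then have "sqrt r < \<eta>" using a by (simp add: ennsqrt_ennreal ennreal_less_iff)
    then have "(sqrt r)\<^sup>2 \<le> \<eta>\<^sup>2" using real by (intro power_mono) auto
    then show ?thesis using real by (simp add: ennreal_leI)
  qed (use a in \<open>simp add: ennsqrt_def\<close>)
qed

lemma ennreal_divide_le_imp: "x / ennreal v \<le> ennreal y \<Longrightarrow> 0 < v \<Longrightarrow> 0 \<le> y \<Longrightarrow> x \<le> ennreal (y * v)"
  by (cases x) (auto simp: divide_ennreal ennreal_le_iff divide_le_eq ennreal_top_divide top_unique intro!: ennreal_leI)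

lemma ennreal_divide_le: "x \<le> ennreal y \<Longrightarrow> 0 < v \<Longrightarrow> 0 \<le> y \<Longrightarrow> x / ennreal v \<le> ennreal (y / v)"
  by (cases x) (auto simp: divide_ennreal ennreal_le_iff divide_right_mono top_unique intro!: ennreal_leI)

lemma G2_le:
  assumes "h \<in> holo (ball z r)"
  shows "G2 r f z \<le> ennsqrt ((\<integral>\<^sup>+w\<in>ball z r. ennreal ((norm (f w - h w))\<^sup>2) \<partial>lebesgue) / emeasure lebesgue (ball z r))"
  unfolding G2_def by (rule INF_lower[OF assms])

lemma G2_integral_cong:
  assumes "AE z in lebesgue. f z = F z"
  shows "(\<integral>\<^sup>+w\<in>B. ennreal ((norm (f w - h w))\<^sup>2) \<partial>lebesgue) = (\<integral>\<^sup>+w\<in>B. ennreal ((norm (F w - h w))\<^sup>2) \<partial>lebesgue)"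
  by (rule nn_integral_cong_AE) (use assms in eventually_elim, simp)

context convex_weight
begin

lemma psi_cont: "continuous_on UNIV (\<lambda>z. \<phi> (z /\<^sub>R sqrt t))"
  by (rule continuous_on_compose2[OF phi_c]) (auto intro!: continuous_intros)

lemma mu_hilbert: "0 < t \<Longrightarrow> function_hilbert (mu \<phi> t) (F2 \<phi> t)"
  unfolding F2_def mu_wmeas by (rule function_hilbert_wmeas[OF psi_cont]) simp

lemma mu_measurable: "borel_measurable (mu \<phi> t) = borel_measurable lebesgue"
  unfolding mu_wmeas by (rule wmeas_measurable)

lemma mu_AE: "(AE z in lebesgue. Q z) \<Longrightarrow> AE z in mu \<phi> t. Q z"
  unfolding mu_wmeas by (rule AE_wmeas[OF _ psi_cont])

lemma borel_mu: "u \<in> borel_measurable borel \<Longrightarrow> u \<in> borel_measurable (mu \<phi> t)"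
  unfolding mu_measurable by (intro measurable_completion) simp

text \<open>
  The factor \<open>1 / t ^ CARD('n)\<close> in \<open>mu\<close> is the Jacobian of the dilation,
  so that dilation is an isometry onto the weighted space at scale \<open>1\<close>.
\<close>

lemma mu_scale:
  assumes t: "0 < t" and u: "u \<in> borel_measurable borel"
  shows "(\<integral>\<^sup>+z. ennreal ((norm (u z))\<^sup>2) \<partial>mu \<phi> t) = wsq (\<lambda>z. u (sqrt t *\<^sub>R z))"
proof -
  let ?n = "CARD('n)"
  have ul: "u \<in> borel_measurable lebesgue" using borel_mu[OF u] by (simp add: mu_measurable)
  have [measurable]: "(\<lambda>z. \<phi> (z /\<^sub>R sqrt t)) \<in> borel_measurable borel" by (rule borel_measurable_continuous_onI[OF psi_cont])
  note [measurable] = u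
  have "(\<integral>\<^sup>+z. ennreal ((norm (u z))\<^sup>2) \<partial>mu \<phi> t) = ennreal (1 / t ^ ?n) * (\<integral>\<^sup>+z. ennreal ((norm (u z))\<^sup>2 * exp (- 2 * \<phi> (z /\<^sub>R sqrt t))) \<partial>lborel)"
    unfolding mu_wmeas using t by (intro nn_integral_wmeas[OF psi_cont ul]) simp
  also have "(\<integral>\<^sup>+z. ennreal ((norm (u z))\<^sup>2 * exp (- 2 * \<phi> (z /\<^sub>R sqrt t))) \<partial>lborel)
     = ennreal (\<bar>sqrt t\<bar> ^ DIM(complex^'n)) * (\<integral>\<^sup>+z. ennreal ((norm (u (0 + sqrt t *\<^sub>R z)))\<^sup>2 * exp (- 2 * \<phi> ((0 + sqrt t *\<^sub>R z) /\<^sub>R sqrt t))) \<partial>lborel)"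
    using t by (intro nn_integral_lborel_affine) auto
  also have "(\<integral>\<^sup>+z. ennreal ((norm (u (0 + sqrt t *\<^sub>R z)))\<^sup>2 * exp (- 2 * \<phi> ((0 + sqrt t *\<^sub>R z) /\<^sub>R sqrt t))) \<partial>lborel) = wsq (\<lambda>z. u (sqrt t *\<^sub>R z))"
    using t by (simp add: wsq_def)
  also have "\<bar>sqrt t\<bar> ^ DIM(complex^'n) = t ^ ?n"
    using t by (simp add: power_mult mult.commute[of ?n 2])
  also have "ennreal (1 / t ^ ?n) * (ennreal (t ^ ?n) * wsq (\<lambda>z. u (sqrt t *\<^sub>R z))) = wsq (\<lambda>z. u (sqrt t *\<^sub>R z))"
    unfolding mult.assoc[symmetric] using t by (subst ennreal_mult[symmetric]) auto
  finally show ?thesis .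
qed

lemma F2_borel: "k \<in> F2 \<phi> t \<Longrightarrow> k \<in> borel_measurable borel"
  unfolding F2_def by (auto intro!: borel_measurable_continuous_onI holo_continuous_on)

lemma F2_I:
  assumes t: "0 < t" and h: "h \<in> holo UNIV" and wsq: "wsq (\<lambda>z. h (sqrt t *\<^sub>R z)) \<le> ennreal c"
  shows "h \<in> F2 \<phi> t" "0 \<le> c \<Longrightarrow> sqn (mu \<phi> t) h \<le> c"
proof -
  have hb: "h \<in> borel_measurable borel" using h by (auto intro!: borel_measurable_continuous_onI holo_continuous_on)
  note L = L2I[OF borel_mu[OF hb], of t c, unfolded mu_scale[OF t hb], OF wsq]
  show "h \<in> F2 \<phi> t" using L(1) h by (simp add: F2_def)
  show "0 \<le> c \<Longrightarrow> sqn (mu \<phi> t) h \<le> c" by (rule L(2))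
qed

lemma holo_scale_UNIV: "h \<in> holo UNIV \<Longrightarrow> (\<lambda>z. h (c *\<^sub>R z)) \<in> holo UNIV"
  using holo_scale[of h UNIV c] by simp

text \<open>
  The symbol \<open>z \<mapsto> f (sqrt t z)\<close> is near holomorphic functions on balls of
  radius \<open>3\<close>, so \<open>hankel_approximation\<close> provides, after undoing the
  dilation, an element of the space near \<open>f k\<close>, and the projection is at least as
  near.
\<close>

lemma hankel_small:
  "\<exists>C\<ge>0. \<forall>f A t \<eta> k. f \<in> borel_measurable lebesgue \<longrightarrow> (AE z in lebesgue. norm (f z) \<le> A) \<longrightarrow> 0 < t \<longrightarrow>
     (\<forall>z. G2 (3 * sqrt t) f z < ennreal \<eta>) \<longrightarrow> k \<in> F2 \<phi> t \<longrightarrow>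
     sqn (mu \<phi> t) (\<lambda>z. f z * k z - orth_proj (mu \<phi> t) (F2 \<phi> t) (\<lambda>z. f z * k z) z) \<le> C * \<eta>\<^sup>2 * sqn (mu \<phi> t) k"
proof -
  obtain C where C: "0 \<le> C" and app: "\<And>F A \<epsilon> G \<delta>. local_holo_approx F A \<epsilon> \<Longrightarrow> G \<in> holo UNIV \<Longrightarrow> wsq G < \<infinity> \<Longrightarrow> 0 < \<delta> \<Longrightarrow>
     (\<exists>h\<in>holo UNIV. wsq (\<lambda>z. F z * G z - h z) \<le> ennreal (C * \<epsilon>\<^sup>2) * wsq G + ennreal \<delta>)"
    using hankel_approximation by blast
  let ?v = "vol_ball TYPE('n) 3"
  have v: "0 < ?v" by (rule vol_ball) simp
  have "sqn (mu \<phi> t) (\<lambda>z. f z * k z - orth_proj (mu \<phi> t) (F2 \<phi> t) (\<lambda>z. f z * k z) z) \<le> (C * ?v) * \<eta>\<^sup>2 * sqn (mu \<phi> t) k"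
    if f: "f \<in> borel_measurable lebesgue" and fA: "AE z in lebesgue. norm (f z) \<le> A" and t: "0 < t"
      and G: "\<And>z. G2 (3 * sqrt t) f z < ennreal \<eta>" and k: "k \<in> F2 \<phi> t" for f A t \<eta> k
  proof -
    let ?M = "mu \<phi> t" and ?s = "sqrt t"
    have s: "0 < ?s" using t by simp
    interpret H: function_hilbert ?M "F2 \<phi> t" by (rule mu_hilbert[OF t])
    obtain F where F: "F \<in> borel_measurable borel" "AE z in lebesgue. f z = F z" "\<And>z. norm (F z) \<le> \<bar>A\<bar>"
      using lebesgue_bounded_borel_version[OF f fA] by blast
    define Fs where "Fs z = F (?s *\<^sub>R z)" for z
    have Fsm: "Fs \<in> borel_measurable borel" unfolding Fs_def using F(1) by measurable
    have \<eta>: "0 < \<eta>" using G[of 0] by (metis ennreal_neg le_zero_eq not_gr_zero not_le zero_less_iff_neq_zero order_less_imp_le)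
    define \<epsilon> where "\<epsilon> = \<eta> * sqrt ?v"
    have near: "\<exists>h\<in>holo (ball a 3). (\<integral>\<^sup>+z\<in>ball a 3. ennreal ((norm (Fs z - h z))\<^sup>2) \<partial>lborel) \<le> ennreal (\<epsilon>\<^sup>2)" for a
    proof -
      obtain h where h: "h \<in> holo (ball (?s *\<^sub>R a) (?s * 3))"
        and le: "ennsqrt ((\<integral>\<^sup>+w\<in>ball (?s *\<^sub>R a) (?s * 3). ennreal ((norm (f w - h w))\<^sup>2) \<partial>lebesgue) / emeasure lebesgue (ball (?s *\<^sub>R a) (?s * 3))) < ennreal \<eta>"
        using G[of "?s *\<^sub>R a"] unfolding G2_def INF_less_iff by (auto simp: mult.commute)
      have "(\<integral>\<^sup>+w\<in>ball a 3. ennreal ((norm (F (?s *\<^sub>R w) - h (?s *\<^sub>R w)))\<^sup>2) \<partial>lborel) / ennreal ?v \<le> ennreal (\<eta>\<^sup>2)"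
        using ennsqrt_less_imp[OF le] unfolding G2_integral_cong[OF F(2)] G2_integral_scale[OF F(1) h s zero_less_numeral] .
      then have "(\<integral>\<^sup>+w\<in>ball a 3. ennreal ((norm (F (?s *\<^sub>R w) - h (?s *\<^sub>R w)))\<^sup>2) \<partial>lborel) \<le> ennreal (\<epsilon>\<^sup>2)"
        using ennreal_divide_le_imp[OF _ v] v by (simp add: \<epsilon>_def power_mult_distrib)
      moreover have "{z. ?s *\<^sub>R z \<in> ball (?s *\<^sub>R a) (?s * 3)} = ball a 3"
      proof -
        have "dist (?s *\<^sub>R a) (?s *\<^sub>R z) = ?s * dist a z" for z
          using s by (simp add: dist_norm scaleR_diff_right[symmetric])
        then show ?thesis using s by auto
      qed
      ultimately show ?thesis using holo_scale[OF h, of ?s] unfolding Fs_def by auto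
    qed
    have L: "local_holo_approx Fs \<bar>A\<bar> \<epsilon>"
      by unfold_locales (use Fsm F(3) \<eta> v near in \<open>auto simp: Fs_def \<epsilon>_def\<close>)
    define K where "K z = k (?s *\<^sub>R z)" for z
    have kh: "k \<in> holo UNIV" and kL: "k \<in> L2 ?M" using k by (auto simp: F2_def)
    have K: "K \<in> holo UNIV" unfolding K_def[abs_def] by (rule holo_scale_UNIV[OF kh])
    have WK: "wsq K = ennreal (sqn ?M k)"
      using mu_scale[OF t F2_borel[OF k]] nn_integral_sqn[OF kL] by (simp add: K_def[abs_def])
    have fm: "f \<in> borel_measurable ?M" "AE z in ?M. norm (f z) \<le> A"
      using f fA by (auto simp: mu_measurable intro: mu_AE)
    have fk: "(\<lambda>z. f z * k z) \<in> L2 ?M" by (rule L2_mult_bounded[OF kL fm])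
    show ?thesis
    proof (rule field_le_epsilon)
      fix \<delta> :: real assume \<delta>: "0 < \<delta>"
      obtain h where h: "h \<in> holo UNIV" "wsq (\<lambda>z. Fs z * K z - h z) \<le> ennreal (C * \<epsilon>\<^sup>2) * wsq K + ennreal \<delta>"
        using app[OF L K _ \<delta>] WK by auto
      let ?b = "C * \<epsilon>\<^sup>2 * sqn ?M k + \<delta>"
      have b0: "0 \<le> ?b" using C \<delta> sqn_nonneg[of ?M k] by simp
      have Wle: "wsq (\<lambda>z. Fs z * K z - h z) \<le> ennreal ?b"
        using h(2) C \<delta> sqn_nonneg[of ?M k] unfolding WK by (simp add: ennreal_mult ennreal_plus)
      define g where "g z = h ((1 / ?s) *\<^sub>R z)" for z
      have g: "g \<in> holo UNIV" unfolding g_def[abs_def] by (rule holo_scale_UNIV[OF h(1)])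
      have gb: "g \<in> borel_measurable borel" using g by (auto intro!: borel_measurable_continuous_onI holo_continuous_on)
      have ub: "(\<lambda>z. F z * k z - g z) \<in> borel_measurable borel" using F(1) F2_borel[OF k] gb by measurable
      have "(\<integral>\<^sup>+z. ennreal ((norm (F z * k z - g z))\<^sup>2) \<partial>?M) = wsq (\<lambda>z. Fs z * K z - h z)"
        using mu_scale[OF t ub] s by (simp add: Fs_def K_def g_def)
      moreover have "(\<integral>\<^sup>+z. ennreal ((norm (f z * k z - g z))\<^sup>2) \<partial>?M) = (\<integral>\<^sup>+z. ennreal ((norm (F z * k z - g z))\<^sup>2) \<partial>?M)"
        by (rule nn_integral_cong_AE) (use mu_AE[OF F(2), of t] in eventually_elim, simp)
      ultimately have le: "(\<integral>\<^sup>+z. ennreal ((norm (f z * k z - g z))\<^sup>2) \<partial>?M) \<le> ennreal ?b" using Wle by simp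
      have dm: "(\<lambda>z. f z * k z - g z) \<in> borel_measurable ?M"
        using L2_measurable[OF fk] borel_mu[OF gb] by measurable
      note D = L2I[OF dm le]
      have "g \<in> L2 ?M" using L2_diff[OF fk D(1)] by simp
      then have gF: "g \<in> F2 \<phi> t" using g by (simp add: F2_def)
      have "sqn ?M (\<lambda>z. f z * k z - H.P (\<lambda>z. f z * k z) z) \<le> sqn ?M (\<lambda>z. f z * k z - g z)"
        by (rule H.P_best[OF fk gF])
      also have "\<dots> \<le> ?b" by (rule D(2)[OF b0])
      also have "\<dots> = C * ?v * \<eta>\<^sup>2 * sqn ?M k + \<delta>" using v by (simp add: \<epsilon>_def power_mult_distrib)
      finally show "sqn ?M (\<lambda>z. f z * k z - H.P (\<lambda>z. f z * k z) z) \<le> C * ?v * \<eta>\<^sup>2 * sqn ?M k + \<delta>" .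
    qed
  qed
  then show ?thesis using C v by (intro exI[of _ "C * ?v"]) auto
qed

text \<open>
  The Hankel operator is tested on a normalised exponential \<open>\<kappa>\<close>, the dilate of
  which is concentrated near \<open>a\<close>. It has no zeros and its weighted size is bounded
  below on the unit ball, so the error may be divided by it, and the projection divided by
  \<open>\<kappa>\<close> competes in the infimum \<open>G2\<close>.
\<close>

lemma G2_from_hankel:
  "\<exists>C\<ge>0. \<forall>f A t e a. f \<in> borel_measurable lebesgue \<longrightarrow> (AE z in lebesgue. norm (f z) \<le> A) \<longrightarrow> 0 < t \<longrightarrow> 0 \<le> e \<longrightarrow>
     (\<forall>k\<in>F2 \<phi> t. sqn (mu \<phi> t) k \<le> 1 \<longrightarrow>
       sqn (mu \<phi> t) (\<lambda>z. f z * k z - orth_proj (mu \<phi> t) (F2 \<phi> t) (\<lambda>z. f z * k z) z) \<le> e) \<longrightarrow>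
     G2 (sqrt t) f a \<le> ennreal (sqrt (C * e))"
proof -
  \<comment> \<open>A bound for the Gaussian integral; the added \<open>1\<close> makes it positive without computing it.\<close>
  define \<Gamma> where "\<Gamma> = enn2real (\<integral>\<^sup>+x. ennreal (exp (- (2 * m) * (norm x)\<^sup>2)) \<partial>(lborel :: (complex^'n) measure)) + 1"
  have \<Gamma>: "0 < \<Gamma>" by (simp add: \<Gamma>_def add_nonneg_pos)
  have gi: "(\<integral>\<^sup>+x. ennreal (exp (- (2 * m) * (norm (x - b))\<^sup>2)) \<partial>lborel) \<le> ennreal \<Gamma>" for b :: "complex^'n"
  proof -
    let ?G = "\<integral>\<^sup>+x. ennreal (exp (- (2 * m) * (norm x)\<^sup>2)) \<partial>(lborel :: (complex^'n) measure)"
    have [measurable]: "(\<lambda>x::complex^'n. ennreal (exp (- (2 * m) * (norm (x - b))\<^sup>2))) \<in> borel_measurable borel" by measurable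
    have "(\<integral>\<^sup>+x. ennreal (exp (- (2 * m) * (norm (x - b))\<^sup>2)) \<partial>lborel) = ?G"
      using nn_integral_lborel_affine[of "\<lambda>x::complex^'n. ennreal (exp (- (2 * m) * (norm (x - b))\<^sup>2))" 1 b] by simp
    moreover have "?G < \<infinity>" by (rule nn_integral_gauss_finite) (use m in simp)
    ultimately show ?thesis unfolding \<Gamma>_def by (simp add: ennreal_plus less_top)
  qed
  let ?v = "vol_ball TYPE('n) 1"
  have v: "0 < ?v" by (rule vol_ball) simp
  define C where "C = \<Gamma> * exp (2 * M) / ?v"
  have C: "0 \<le> C" using \<Gamma> v by (simp add: C_def)
  have "G2 (sqrt t) f a \<le> ennreal (sqrt (C * e))"
    if f: "f \<in> borel_measurable lebesgue" and fA: "AE z in lebesgue. norm (f z) \<le> A" and t: "0 < t" and e: "0 \<le> e"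
      and hk: "\<And>k. k \<in> F2 \<phi> t \<Longrightarrow> sqn (mu \<phi> t) k \<le> 1 \<Longrightarrow>
       sqn (mu \<phi> t) (\<lambda>z. f z * k z - orth_proj (mu \<phi> t) (F2 \<phi> t) (\<lambda>z. f z * k z) z) \<le> e" for f A t e a
  proof -
    let ?M = "mu \<phi> t" and ?s = "sqrt t"
    have s: "0 < ?s" using t by simp
    interpret H: function_hilbert ?M "F2 \<phi> t" by (rule mu_hilbert[OF t])
    obtain F where F: "F \<in> borel_measurable borel" "AE z in lebesgue. f z = F z" "\<And>z. norm (F z) \<le> \<bar>A\<bar>"
      using lebesgue_bounded_borel_version[OF f fA] by blast
    define b where "b = (1 / ?s) *\<^sub>R a"
    have sb: "?s *\<^sub>R b = a" using s by (simp add: b_def)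
    define \<kappa> where "\<kappa> x = of_real (1 / sqrt \<Gamma>) * exp (of_real (\<phi> b) + cdot (p b) (x - b))" for x
    \<comment> \<open>The reciprocal of \<open>\<kappa>\<close>, again an exponential and therefore entire.\<close>
    define \<kappa>' where "\<kappa>' x = of_real (sqrt \<Gamma>) * exp (- of_real (\<phi> b) + cdot (- p b) (x - b))" for x
    have cm: "cdot (- p b) w = - cdot (p b) w" for w by (simp add: cdot_def sum_negf)
    have kk: "\<kappa> x * \<kappa>' x = 1" for x
    proof -
      have "exp (of_real (\<phi> b) + cdot (p b) (x - b)) * exp (- of_real (\<phi> b) + cdot (- p b) (x - b)) = 1"
        unfolding exp_add[symmetric] cm by simp
      then show ?thesis unfolding \<kappa>_def \<kappa>'_def using \<Gamma> by (simp add: mult_ac)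
    qed
    have \<kappa>h: "\<kappa> \<in> holo UNIV" "\<kappa>' \<in> holo UNIV"
      unfolding \<kappa>_def[abs_def] \<kappa>'_def[abs_def] by (intro holo_mult holo_const holo_exp_cdot)+
    have n\<kappa>: "(norm (\<kappa> x))\<^sup>2 = exp (2 * (\<phi> b + Re (cdot (p b) (x - b)))) / \<Gamma>" for x
      using \<Gamma> by (simp add: \<kappa>_def norm_mult norm_divide power_mult_distrib power_divide norm_exp_eq_Re exp_double[symmetric])
    have wsq\<kappa>: "wsq \<kappa> \<le> ennreal 1"
    proof -
      have "wsq \<kappa> \<le> (\<integral>\<^sup>+x. ennreal (1 / \<Gamma>) * ennreal (exp (- (2 * m) * (norm (x - b))\<^sup>2)) \<partial>lborel)"
        unfolding wsq_def
      proof (rule nn_integral_mono)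
        fix x
        have "2 * (\<phi> b + Re (cdot (p b) (x - b))) + - 2 * \<phi> x \<le> - (2 * m) * (norm (x - b))\<^sup>2" using lower[of b x] by simp
        then have "exp (2 * (\<phi> b + Re (cdot (p b) (x - b))) + - 2 * \<phi> x) \<le> exp (- (2 * m) * (norm (x - b))\<^sup>2)" by simp
        then have "(norm (\<kappa> x))\<^sup>2 * exp (- 2 * \<phi> x) \<le> 1 / \<Gamma> * exp (- (2 * m) * (norm (x - b))\<^sup>2)"
          unfolding n\<kappa> exp_add using \<Gamma> by (simp add: divide_right_mono)
        then show "ennreal ((norm (\<kappa> x))\<^sup>2 * exp (- 2 * \<phi> x)) \<le> ennreal (1 / \<Gamma>) * ennreal (exp (- (2 * m) * (norm (x - b))\<^sup>2))"
          using \<Gamma> by (subst ennreal_mult[symmetric]) (auto intro: ennreal_leI)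
      qed
      also have "\<dots> = ennreal (1 / \<Gamma>) * (\<integral>\<^sup>+x. ennreal (exp (- (2 * m) * (norm (x - b))\<^sup>2)) \<partial>lborel)"
        by (rule nn_integral_cmult) measurable
      also have "\<dots> \<le> ennreal (1 / \<Gamma>) * ennreal \<Gamma>" by (intro mult_left_mono gi) auto
      also have "\<dots> = ennreal 1" using \<Gamma> by (subst ennreal_mult[symmetric]) auto
      finally show ?thesis .
    qed
    define k where "k z = \<kappa> ((1 / ?s) *\<^sub>R z)" for z
    have kh: "k \<in> holo UNIV" unfolding k_def[abs_def] by (rule holo_scale_UNIV[OF \<kappa>h(1)])
    have ks: "(\<lambda>z. k (?s *\<^sub>R z)) = \<kappa>" using s by (simp add: k_def fun_eq_iff)
    have k: "k \<in> F2 \<phi> t" "sqn ?M k \<le> 1" using F2_I[OF t kh, of 1] wsq\<kappa> unfolding ks by auto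
    have kL: "k \<in> L2 ?M" using k by (auto simp: F2_def)
    have fm: "f \<in> borel_measurable ?M" "AE z in ?M. norm (f z) \<le> A"
      using f fA by (auto simp: mu_measurable intro: mu_AE)
    have fk: "(\<lambda>z. f z * k z) \<in> L2 ?M" by (rule L2_mult_bounded[OF kL fm])
    define h where "h = H.P (\<lambda>z. f z * k z)"
    have hF: "h \<in> F2 \<phi> t" unfolding h_def by (rule H.P_in[OF fk])
    have dL: "(\<lambda>z. f z * k z - h z) \<in> L2 ?M" by (intro L2_diff fk H.F_L2' hF)
    have ub: "(\<lambda>z. F z * k z - h z) \<in> borel_measurable borel"
      using F(1) F2_borel[OF k(1)] F2_borel[OF hF] by measurable
    have "wsq (\<lambda>z. F (?s *\<^sub>R z) * \<kappa> z - h (?s *\<^sub>R z)) = (\<integral>\<^sup>+z. ennreal ((norm (F z * k z - h z))\<^sup>2) \<partial>?M)"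
      using mu_scale[OF t ub] fun_cong[OF ks] by simp
    also have "\<dots> = (\<integral>\<^sup>+z. ennreal ((norm (f z * k z - h z))\<^sup>2) \<partial>?M)"
      by (rule nn_integral_cong_AE) (use mu_AE[OF F(2), of t] in eventually_elim, simp)
    also have "\<dots> = ennreal (sqn ?M (\<lambda>z. f z * k z - h z))" by (rule nn_integral_sqn[OF dL])
    also have "\<dots> \<le> ennreal e" using hk[OF k] by (intro ennreal_leI) (simp add: h_def)
    finally have We: "wsq (\<lambda>z. F (?s *\<^sub>R z) * \<kappa> z - h (?s *\<^sub>R z)) \<le> ennreal e" .
    define Hh where "Hh w = h w * \<kappa>' ((1 / ?s) *\<^sub>R w)" for w
    have Hh: "Hh \<in> holo UNIV" unfolding Hh_def[abs_def]
      using hF by (intro holo_mult holo_scale_UNIV[OF \<kappa>h(2)]) (simp add: F2_def)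
    have loc: "(\<integral>\<^sup>+w\<in>ball b 1. ennreal ((norm (F (?s *\<^sub>R w) - Hh (?s *\<^sub>R w)))\<^sup>2) \<partial>lborel) \<le> ennreal (\<Gamma> * exp (2 * M) * e)"
    proof -
      have [measurable]: "(\<lambda>w. F (?s *\<^sub>R w) * \<kappa> w - h (?s *\<^sub>R w)) \<in> borel_measurable borel"
      proof -
        have [measurable]: "\<kappa> \<in> borel_measurable borel" using \<kappa>h(1) by (auto intro!: borel_measurable_continuous_onI holo_continuous_on)
        show ?thesis using F(1) F2_borel[OF hF] by measurable
      qed
      have "(\<integral>\<^sup>+w\<in>ball b 1. ennreal ((norm (F (?s *\<^sub>R w) - Hh (?s *\<^sub>R w)))\<^sup>2) \<partial>lborel)
        \<le> (\<integral>\<^sup>+w. ennreal (\<Gamma> * exp (2 * M)) * ennreal ((norm (F (?s *\<^sub>R w) * \<kappa> w - h (?s *\<^sub>R w)))\<^sup>2 * exp (- 2 * \<phi> w)) \<partial>lborel)"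
      proof (rule nn_integral_mono)
        fix w
        show "ennreal ((norm (F (?s *\<^sub>R w) - Hh (?s *\<^sub>R w)))\<^sup>2) * indicator (ball b 1) w
          \<le> ennreal (\<Gamma> * exp (2 * M)) * ennreal ((norm (F (?s *\<^sub>R w) * \<kappa> w - h (?s *\<^sub>R w)))\<^sup>2 * exp (- 2 * \<phi> w))"
        proof (cases "w \<in> ball b 1")
          case True
          then have "M * (norm (w - b))\<^sup>2 \<le> M * 1"
            using M by (intro mult_left_mono) (auto simp: power_le_one dist_norm norm_minus_commute)
          then have "0 \<le> 2 * M + (2 * (\<phi> b + Re (cdot (p b) (w - b))) + - 2 * \<phi> w)" using upper[of w b] by simp
          then have "1 \<le> exp (2 * M + (2 * (\<phi> b + Re (cdot (p b) (w - b))) + - 2 * \<phi> w))" by simp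
          also have "\<dots> = \<Gamma> * exp (2 * M) * ((norm (\<kappa> w))\<^sup>2 * exp (- 2 * \<phi> w))"
            unfolding n\<kappa> exp_add using \<Gamma> by simp
          finally have one: "1 \<le> \<Gamma> * exp (2 * M) * ((norm (\<kappa> w))\<^sup>2 * exp (- 2 * \<phi> w))" .
          have "Hh (?s *\<^sub>R w) = h (?s *\<^sub>R w) * \<kappa>' w" using s by (simp add: Hh_def)
          then have "F (?s *\<^sub>R w) * \<kappa> w - h (?s *\<^sub>R w) = \<kappa> w * (F (?s *\<^sub>R w) - Hh (?s *\<^sub>R w))"
            using kk[of w] by (simp add: algebra_simps)
          then have eq: "(norm (F (?s *\<^sub>R w) * \<kappa> w - h (?s *\<^sub>R w)))\<^sup>2 = (norm (\<kappa> w))\<^sup>2 * (norm (F (?s *\<^sub>R w) - Hh (?s *\<^sub>R w)))\<^sup>2"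
            by (simp add: norm_mult power_mult_distrib)
          have "(norm (F (?s *\<^sub>R w) - Hh (?s *\<^sub>R w)))\<^sup>2 * 1 \<le> (norm (F (?s *\<^sub>R w) - Hh (?s *\<^sub>R w)))\<^sup>2 * (\<Gamma> * exp (2 * M) * ((norm (\<kappa> w))\<^sup>2 * exp (- 2 * \<phi> w)))"
            by (intro mult_left_mono one) auto
          also have "\<dots> = \<Gamma> * exp (2 * M) * ((norm (F (?s *\<^sub>R w) * \<kappa> w - h (?s *\<^sub>R w)))\<^sup>2 * exp (- 2 * \<phi> w))"
            unfolding eq by (simp only: mult_ac)
          finally have "ennreal ((norm (F (?s *\<^sub>R w) - Hh (?s *\<^sub>R w)))\<^sup>2) \<le> ennreal (\<Gamma> * exp (2 * M) * ((norm (F (?s *\<^sub>R w) * \<kappa> w - h (?s *\<^sub>R w)))\<^sup>2 * exp (- 2 * \<phi> w)))"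
            by (intro ennreal_leI) simp
          also have "\<dots> = ennreal (\<Gamma> * exp (2 * M)) * ennreal ((norm (F (?s *\<^sub>R w) * \<kappa> w - h (?s *\<^sub>R w)))\<^sup>2 * exp (- 2 * \<phi> w))"
            using \<Gamma> by (intro ennreal_mult) auto
          finally show ?thesis using True by simp
        qed simp
      qed
      also have "\<dots> = ennreal (\<Gamma> * exp (2 * M)) * wsq (\<lambda>z. F (?s *\<^sub>R z) * \<kappa> z - h (?s *\<^sub>R z))"
        unfolding wsq_def by (rule nn_integral_cmult) measurable
      also have "\<dots> \<le> ennreal (\<Gamma> * exp (2 * M)) * ennreal e" by (intro mult_left_mono We) auto
      also have "\<dots> = ennreal (\<Gamma> * exp (2 * M) * e)" using \<Gamma> e by (intro ennreal_mult[symmetric]) auto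
      finally show ?thesis .
    qed
    have Hb: "Hh \<in> holo (ball (?s *\<^sub>R b) (?s * 1))" by (rule holo_subset[OF Hh]) simp
    have "G2 ?s f a \<le> ennsqrt ((\<integral>\<^sup>+w\<in>ball (?s *\<^sub>R b) (?s * 1). ennreal ((norm (f w - Hh w))\<^sup>2) \<partial>lebesgue) / emeasure lebesgue (ball (?s *\<^sub>R b) (?s * 1)))"
      using G2_le[of Hh a ?s f] Hb by (simp add: sb)
    also have "\<dots> = ennsqrt ((\<integral>\<^sup>+w\<in>ball b 1. ennreal ((norm (F (?s *\<^sub>R w) - Hh (?s *\<^sub>R w)))\<^sup>2) \<partial>lborel) / ennreal ?v)"
      unfolding G2_integral_cong[OF F(2)] G2_integral_scale[OF F(1) Hb s zero_less_one] ..
    also have "\<dots> \<le> ennsqrt (ennreal (\<Gamma> * exp (2 * M) * e / ?v))"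
      using \<Gamma> e by (intro ennsqrt_mono ennreal_divide_le loc v) auto
    also have "\<dots> = ennreal (sqrt (C * e))"
      using \<Gamma> e v by (subst ennsqrt_ennreal) (auto simp: C_def)
    finally show ?thesis .
  qed
  then show ?thesis using C by blast
qed

end

lemma conj_family_iff: "f \<in> conj_family X \<longleftrightarrow> (\<lambda>z. cnj (f z)) \<in> X"
proof
  assume "f \<in> conj_family X"
  then obtain h where "h \<in> X" "f = (\<lambda>z. cnj (h z))" unfolding conj_family_def by auto
  then show "(\<lambda>z. cnj (f z)) \<in> X" by simp
next
  assume "(\<lambda>z. cnj (f z)) \<in> X"
  from imageI[OF this, of "\<lambda>f z. cnj (f z)"] have "(\<lambda>z. cnj (cnj (f z))) \<in> conj_family X" unfolding conj_family_def .
  then show "f \<in> conj_family X" by simp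
qed

lemma Linf_imp_BDA:
  fixes f :: "complex^'n \<Rightarrow> complex"
  assumes f: "f \<in> borel_measurable lebesgue" and A: "AE z in lebesgue. norm (f z) \<le> A"
  shows "f \<in> BDA_star"
proof -
  have I: "(\<integral>\<^sup>+z\<in>B. ennreal ((norm (f z))\<^sup>2) \<partial>lebesgue) \<le> ennreal (A\<^sup>2) * emeasure lebesgue B" if B: "B \<in> sets lebesgue" for B
  proof -
    have "(\<integral>\<^sup>+z\<in>B. ennreal ((norm (f z))\<^sup>2) \<partial>lebesgue) \<le> (\<integral>\<^sup>+z. ennreal (A\<^sup>2) * indicator B z \<partial>lebesgue)"
    proof (rule nn_integral_mono_AE, use A in eventually_elim)
      fix z assume "norm (f z) \<le> A"
      then show "ennreal ((norm (f z))\<^sup>2) * indicator B z \<le> ennreal (A\<^sup>2) * indicator B z"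
        by (intro mult_right_mono ennreal_leI power_mono) auto
    qed
    also have "\<dots> = ennreal (A\<^sup>2) * emeasure lebesgue B" using B by (simp add: nn_integral_cmult_indicator)
    finally show ?thesis .
  qed
  have "f \<in> L2loc" unfolding L2loc_def
  proof (intro CollectI conjI f allI impI)
    fix K :: "(complex^'n) set" assume K: "compact K"
    then have "emeasure lebesgue K < \<infinity>" using emeasure_compact_finite[OF K] by (simp add: borel_compact)
    then show "(\<integral>\<^sup>+z\<in>K. ennreal ((norm (f z))\<^sup>2) \<partial>lebesgue) < \<infinity>"
      using I[of K] K by (intro order_le_less_trans[OF I]) (auto simp: borel_compact ennreal_mult_less_top)
  qed
  moreover have "(SUP z. SUP r\<in>{0<..}. G2 r f z) < \<infinity>"
  proof -
    have "G2 r f z \<le> ennreal \<bar>A\<bar>" if r: "0 < r" for r and z :: "complex^'n"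
    proof -
      have v: "0 < vol_ball TYPE('n) r" by (rule vol_ball[OF r])
      have e: "emeasure lebesgue (ball z r) = ennreal (vol_ball TYPE('n) r)" using emeasure_vol_ball[of z r] by simp
      have "G2 r f z \<le> ennsqrt ((\<integral>\<^sup>+w\<in>ball z r. ennreal ((norm (f w - 0))\<^sup>2) \<partial>lebesgue) / emeasure lebesgue (ball z r))"
        by (rule G2_le[OF holo_const])
      also have "\<dots> \<le> ennsqrt (ennreal (A\<^sup>2 * vol_ball TYPE('n) r / vol_ball TYPE('n) r))"
        unfolding e using I[of "ball z r"] v by (intro ennsqrt_mono ennreal_divide_le) (auto simp: e ennreal_mult)
      also have "\<dots> = ennreal \<bar>A\<bar>" using v by (simp add: ennsqrt_ennreal)
      finally show ?thesis .
    qed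
    then have "(SUP z. SUP r\<in>{0<..}. G2 r f z) \<le> ennreal \<bar>A\<bar>" by (intro SUP_least) auto
    then show ?thesis by (rule order_le_less_trans) simp
  qed
  ultimately show ?thesis by (simp add: BDA_star_def)
qed

lemma tendsto_zero_ennrealI:
  fixes f :: "'a \<Rightarrow> ennreal"
  assumes "\<And>a. 0 < a \<Longrightarrow> eventually (\<lambda>x. f x \<le> ennreal a) F"
  shows "(f \<longlongrightarrow> 0) F"
proof (rule order_tendstoI)
  fix a :: ennreal assume "0 < a"
  then obtain b where b: "0 < b" "ennreal b < a"
    by (metis ennreal_0 ennreal_less_zero_iff dense ennreal_cases not_less_iff_gr_or_eq order_less_imp_le top.not_eq_extremum zero_less_iff_neq_zero)
  show "eventually (\<lambda>x. f x < a) F"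
    using assms[OF b(1)] by eventually_elim (use b in auto)
qed auto

theorem theorem6p4:
  fixes \<phi> :: "complex ^ 'n \<Rightarrow> real" and f :: "complex ^ 'n \<Rightarrow> complex"
  assumes "C2 \<phi>" and "hess_equiv_id \<phi>" and "f \<in> Linf"
  shows "(\<forall>g\<in>Linf.
            ((\<lambda>t. F2_opnorm \<phi> t
                (\<lambda>u z. toeplitz \<phi> t f (toeplitz \<phi> t g u) z - toeplitz \<phi> t (\<lambda>w. f w * g w) u z))
              \<longlongrightarrow> 0) (at_right 0))
         \<longleftrightarrow> f \<in> conj_family VDA_star"
proof -
  obtain p m M where cw: "convex_weight \<phi> p m M" using hessian_convex_weight[OF assms(1,2)] by blast
  interpret convex_weight \<phi> p m M by (rule cw)
  obtain A where f: "f \<in> borel_measurable lebesgue" and fA: "AE z in lebesgue. norm (f z) \<le> A"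
    using assms(3) by (auto simp: Linf_def)
  let ?c = "\<lambda>z. cnj (f z)"
  have c: "?c \<in> borel_measurable lebesgue" "AE z in lebesgue. norm (?c z) \<le> A"
    using f fA by (auto intro: borel_measurable_cnj)
  have fm: "f \<in> borel_measurable (mu \<phi> t)" "AE z in mu \<phi> t. norm (f z) \<le> A" for t
    using f fA by (auto simp: mu_measurable intro: mu_AE)
  define S where "S g t = (\<lambda>u z. toeplitz \<phi> t f (toeplitz \<phi> t g u) z - toeplitz \<phi> t (\<lambda>w. f w * g w) u z)" for g t
  have S_T: "S g t u = (\<lambda>z. function_hilbert.toep (mu \<phi> t) (F2 \<phi> t) f (function_hilbert.toep (mu \<phi> t) (F2 \<phi> t) g u) z
       - function_hilbert.toep (mu \<phi> t) (F2 \<phi> t) (\<lambda>z. f z * g z) u z)" if "0 < t" for g t u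
    unfolding S_def toeplitz_def function_hilbert.toep_def[OF mu_hilbert[OF that]] ..
  show ?thesis
    unfolding conj_family_iff S_def[symmetric]
  proof
    assume lim: "\<forall>g\<in>Linf. ((\<lambda>t. F2_opnorm \<phi> t (S g t)) \<longlongrightarrow> 0) (at_right 0)"
    have "?c \<in> Linf" using c by (auto simp: Linf_def)
    with lim have lim: "((\<lambda>t. F2_opnorm \<phi> t (S ?c t)) \<longlongrightarrow> 0) (at_right 0)" by blast
    \<comment> \<open>Radius \<open>r\<close> corresponds to scale \<open>t = r\<^sup>2\<close>.\<close>
    have "filterlim (\<lambda>r::real. r\<^sup>2) (at_right 0) (at_right 0)"
      by (rule filterlim_at_withinI) (auto intro!: tendsto_eq_intros simp: eventually_at_filter)
    from filterlim_compose[OF lim this] have lim2: "((\<lambda>r. F2_opnorm \<phi> (r\<^sup>2) (S ?c (r\<^sup>2))) \<longlongrightarrow> 0) (at_right 0)" .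
    obtain C where C: "0 \<le> C" and G: "\<And>f A t e a. f \<in> borel_measurable lebesgue \<Longrightarrow> (AE z in lebesgue. norm (f z) \<le> A) \<Longrightarrow> 0 < t \<Longrightarrow> 0 \<le> e \<Longrightarrow>
     (\<forall>k\<in>F2 \<phi> t. sqn (mu \<phi> t) k \<le> 1 \<longrightarrow>
       sqn (mu \<phi> t) (\<lambda>z. f z * k z - orth_proj (mu \<phi> t) (F2 \<phi> t) (\<lambda>z. f z * k z) z) \<le> e) \<Longrightarrow>
     G2 (sqrt t) f a \<le> ennreal (sqrt (C * e))"
      using G2_from_hankel by blast
    have "((\<lambda>r. SUP z. G2 r ?c z) \<longlongrightarrow> 0) (at_right 0)"
    proof (rule tendsto_zero_ennrealI)
      fix a :: real assume a: "0 < a"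
      define e where "e = a\<^sup>2 / (C + 1)"
      have e: "0 < e" using a C by (simp add: e_def add_nonneg_pos)
      have Ce: "sqrt (C * e) \<le> a"
      proof -
        have "C * e \<le> a\<^sup>2" unfolding e_def using C by (simp add: divide_le_eq algebra_simps)
        then show ?thesis using a real_sqrt_le_mono[of "C * e" "a\<^sup>2"] by simp
      qed
      have "eventually (\<lambda>r. F2_opnorm \<phi> (r\<^sup>2) (S ?c (r\<^sup>2)) < ennreal e) (at_right 0)"
        by (rule order_tendstoD(2)[OF lim2]) (use e in simp)
      then show "eventually (\<lambda>r. (SUP z. G2 r ?c z) \<le> ennreal a) (at_right 0)"
        using eventually_at_right_less[of 0]
      proof eventually_elim
        case (elim r)
        let ?t = "r\<^sup>2"
        have t: "0 < ?t" and rt: "sqrt ?t = r" using elim by auto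
        interpret H: function_hilbert "mu \<phi> ?t" "F2 \<phi> ?t" by (rule mu_hilbert[OF t])
        have hk: "sqn (mu \<phi> ?t) (\<lambda>z. ?c z * k z - H.P (\<lambda>z. ?c z * k z) z) \<le> e"
          if k: "k \<in> F2 \<phi> ?t" "sqn (mu \<phi> ?t) k \<le> 1" for k
        proof -
          have kL: "k \<in> L2 (mu \<phi> ?t)" by (rule H.F_L2'[OF k(1)])
          have "L2norm (mu \<phi> ?t) k \<le> 1" using L2norm_sqn[OF kL] k(2) by (simp add: ennreal_le_1)
          then have "L2norm (mu \<phi> ?t) (S ?c ?t k) \<le> F2_opnorm \<phi> ?t (S ?c ?t)"
            unfolding F2_opnorm_def by (intro SUP_upper) (use k in auto)
          also have "\<dots> \<le> ennreal e" using elim by simp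
          finally have "L2norm (mu \<phi> ?t) (S ?c ?t k) \<le> ennreal e" .
          moreover have "S ?c ?t k \<in> L2 (mu \<phi> ?t)"
          proof -
            have cm: "?c \<in> borel_measurable (mu \<phi> ?t)" "AE z in mu \<phi> ?t. norm (?c z) \<le> A"
              using fm by (auto intro: borel_measurable_cnj)
            have i: "(\<lambda>z. ?c z * k z) \<in> L2 (mu \<phi> ?t)" by (rule L2_mult_bounded[OF kL cm])
            have Tk: "H.toep ?c k \<in> F2 \<phi> ?t" unfolding H.toep_def by (rule H.P_in[OF i])
            have "H.toep f (H.toep ?c k) \<in> F2 \<phi> ?t" unfolding H.toep_def[of f]
              by (rule H.P_in[OF L2_mult_bounded(1)[OF H.F_L2'[OF Tk] fm]])
            moreover have "H.toep (\<lambda>z. f z * ?c z) k \<in> F2 \<phi> ?t"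
              unfolding H.toep_def using H.P_in[OF L2_mult_bounded(1)[OF i fm]] by (simp add: mult.assoc)
            ultimately show ?thesis unfolding S_T[OF t] by (intro L2_diff H.F_L2')
          qed
          ultimately have "sqrt (sqn (mu \<phi> ?t) (S ?c ?t k)) \<le> e" using e by (simp add: L2norm_sqn ennreal_le_iff)
          then have "sqn (mu \<phi> ?t) (S ?c ?t k) \<le> e\<^sup>2" by (rule sqrt_le_D)
          from H.hankel_bound[OF fm k(1) less_imp_le[OF e] this[unfolded S_T[OF t]]]
          have "sqn (mu \<phi> ?t) (\<lambda>z. ?c z * k z - H.P (\<lambda>z. ?c z * k z) z) \<le> e * sqrt (sqn (mu \<phi> ?t) k)" .
          also have "\<dots> \<le> e * 1" using k(2) e by (intro mult_left_mono) auto
          finally show ?thesis by simp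
        qed
        have "G2 r ?c z \<le> ennreal a" for z
        proof -
          have "G2 (sqrt ?t) ?c z \<le> ennreal (sqrt (C * e))" using e hk by (intro G[OF c t]) auto
          also have "\<dots> \<le> ennreal a" by (rule ennreal_leI[OF Ce])
          finally show ?thesis unfolding rt .
        qed
        then show ?case by (intro SUP_least)
      qed
    qed
    then show "?c \<in> VDA_star" using Linf_imp_BDA[OF c] by (simp add: VDA_star_def)
  next
    assume "?c \<in> VDA_star"
    then have lim: "((\<lambda>r. SUP z. G2 r ?c z) \<longlongrightarrow> 0) (at_right 0)" by (simp add: VDA_star_def)
    \<comment> \<open>Scale \<open>t\<close> corresponds to radius \<open>3 sqrt t\<close>.\<close>
    have "filterlim (\<lambda>t::real. 3 * sqrt t) (at_right 0) (at_right 0)"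
      by (rule filterlim_at_withinI) (auto intro!: tendsto_eq_intros simp: eventually_at_filter)
    from filterlim_compose[OF lim this] have lim2: "((\<lambda>t. SUP z. G2 (3 * sqrt t) ?c z) \<longlongrightarrow> 0) (at_right 0)" .
    obtain C where C: "0 \<le> C" and HS: "\<And>f A t \<eta> k. f \<in> borel_measurable lebesgue \<Longrightarrow> (AE z in lebesgue. norm (f z) \<le> A) \<Longrightarrow> 0 < t \<Longrightarrow>
     (\<forall>z. G2 (3 * sqrt t) f z < ennreal \<eta>) \<Longrightarrow> k \<in> F2 \<phi> t \<Longrightarrow>
     sqn (mu \<phi> t) (\<lambda>z. f z * k z - orth_proj (mu \<phi> t) (F2 \<phi> t) (\<lambda>z. f z * k z) z) \<le> C * \<eta>\<^sup>2 * sqn (mu \<phi> t) k"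
      using hankel_small by blast
    show "\<forall>g\<in>Linf. ((\<lambda>t. F2_opnorm \<phi> t (S g t)) \<longlongrightarrow> 0) (at_right 0)"
    proof
      fix g :: "complex^'n \<Rightarrow> complex" assume "g \<in> Linf"
      then obtain D where g: "g \<in> borel_measurable lebesgue" "AE z in lebesgue. norm (g z) \<le> D" by (auto simp: Linf_def)
      have gm: "g \<in> borel_measurable (mu \<phi> t)" "AE z in mu \<phi> t. norm (g z) \<le> D" for t
        using g by (auto simp: mu_measurable intro: mu_AE)
      show "((\<lambda>t. F2_opnorm \<phi> t (S g t)) \<longlongrightarrow> 0) (at_right 0)"
      proof (rule tendsto_zero_ennrealI)
        fix a :: real assume a: "0 < a"
        define \<eta> where "\<eta> = a / (sqrt C * \<bar>D\<bar> + 1)"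
        have d: "0 < sqrt C * \<bar>D\<bar> + 1" using C by (intro add_nonneg_pos) auto
        have \<eta>: "0 < \<eta>" using a d by (simp add: \<eta>_def)
        have le: "sqrt (C * \<eta>\<^sup>2 * D\<^sup>2) \<le> a"
        proof -
          have "sqrt (C * \<eta>\<^sup>2 * D\<^sup>2) = (sqrt C * \<bar>D\<bar>) * \<eta>" using \<eta> by (simp add: real_sqrt_mult mult_ac)
          also have "\<dots> \<le> a" unfolding \<eta>_def using a d by (simp add: divide_le_eq algebra_simps)
          finally show ?thesis .
        qed
        have "eventually (\<lambda>t. (SUP z. G2 (3 * sqrt t) ?c z) < ennreal \<eta>) (at_right 0)"
          by (rule order_tendstoD(2)[OF lim2]) (use \<eta> in simp)
        then show "eventually (\<lambda>t. F2_opnorm \<phi> t (S g t) \<le> ennreal a) (at_right 0)"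
          using eventually_at_right_less[of 0]
        proof eventually_elim
          case (elim t)
          then have t: "0 < t" by simp
          interpret H: function_hilbert "mu \<phi> t" "F2 \<phi> t" by (rule mu_hilbert[OF t])
          have G: "\<forall>z. G2 (3 * sqrt t) ?c z < ennreal \<eta>"
            using elim(1) by (metis SUP_upper UNIV_I order_le_less_trans)
          have "L2norm (mu \<phi> t) (S g t u) \<le> ennreal a" if u: "u \<in> F2 \<phi> t" "L2norm (mu \<phi> t) u \<le> 1" for u
          proof -
            have s1: "sqn (mu \<phi> t) u \<le> 1"
              using u(2) L2norm_sqn[OF H.F_L2'[OF u(1)]] by (simp add: ennreal_le_1)
            note B = H.semicommutator_bound[OF fm gm u(1) _ HS[OF c t G], folded S_T[OF t]]
            have e0: "0 \<le> C * \<eta>\<^sup>2" using C by simp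
            have L: "S g t u \<in> L2 (mu \<phi> t)" using B(1)[OF e0] by (rule H.F_L2')
            have "sqn (mu \<phi> t) (S g t u) \<le> C * \<eta>\<^sup>2 * D\<^sup>2 * sqn (mu \<phi> t) u" using B(2)[OF e0] .
            also have "\<dots> \<le> C * \<eta>\<^sup>2 * D\<^sup>2 * 1" using s1 C by (intro mult_left_mono) auto
            finally have "sqrt (sqn (mu \<phi> t) (S g t u)) \<le> a"
              using real_sqrt_le_mono le by (metis mult.right_neutral order_trans)
            then show ?thesis unfolding L2norm_sqn[OF L] by (rule ennreal_leI)
          qed
          then show ?case unfolding F2_opnorm_def by (intro SUP_least) auto
        qed
      qed
    qed
  qed
qed

end
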